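(* All the independent nonlinear two-dimensional dynamical systems on $\mathbb{Z}^2$, not of type $Q$ or rhombic $H^4$, which are consistent on the 3D lattice (i.e. the lattice equations $\widehat Q=0$ obtained by non-autonomous lifting, as in the context, of consistent quad equations $Q=0$ neither of type $Q$ nor of rhombic $H^4$ type) are given, up to $\widehat{(\mathrm{M\ddot{o}b})}^4$ transformations of the field $u$ and rotations, translations and inversions of the discrete indices $n,m$, by nine non-autonomous representatives, three of trapezoidal $H^4$-type and six of $H^6$-type; the linear equation $D_1$ is listed in addition. With $F^{(\pm)}_k=\frac{1\pm(-1)^k}{2}$ and $u=u_{n,m}$, $u_1=u_{n+1,m}$, $u_2=u_{n,m+1}$, $u_{12}=u_{n+1,m+1}$, they are (with complex parameters): Trapezoidal $H^4$-type: ${}_tH_1$: $(u-u_1)(u_2-u_{12})-\alpha_2\epsilon^2\left(F_m^{(+)}u_2u_{12}+F_m^{(-)}u\,u_1\right)-\alpha_2=0$; ${}_tH_2$: $(u-u_1)(u_2-u_{12})+\alpha_2(u+u_1+u_2+u_{12})+\frac{\epsilon\alpha_2}{2}\left(2F_m^{(+)}u_2+2\alpha_3+\alpha_2\right)\left(2F_m^{(+)}u_{12}+2\alpha_3+\alpha_2\right)+\frac{\epsilon\alpha_2}{2}\left(2F_m^{(-)}u+2\alpha_3+\alpha_2\right)\left(2F_m^{(-)}u_1+2\alpha_3+\alpha_2\right)+(\alpha_3+\alpha_2)^2-\alpha_3^2-2\epsilon\alpha_2\alpha_3(\alpha_3+\alpha_2)=0$; ${}_tH_3$: $\alpha_2(u\,u_{12}+u_1u_2)-(u\,u_2+u_1u_{12})-\alpha_3(\alpha_2^2-1)\delta^2-\frac{\epsilon^2(\alpha_2^2-1)}{\alpha_3\alpha_2}\left(F_m^{(+)}u_2u_{12}+F_m^{(-)}u\,u_1\right)=0$.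 $H^6$-type: $D_1$: $u+u_1+u_2+u_{12}=0$; ${}_1D_2$: $\left(F_{n+m}^{(-)}-\delta_1F_n^{(+)}F_m^{(-)}+\delta_2F_n^{(+)}F_m^{(+)}\right)u+\left(F_{n+m}^{(+)}-\delta_1F_n^{(-)}F_m^{(-)}+\delta_2F_n^{(-)}F_m^{(+)}\right)u_1+\left(F_{n+m}^{(+)}-\delta_1F_n^{(+)}F_m^{(+)}+\delta_2F_n^{(+)}F_m^{(-)}\right)u_2+\left(F_{n+m}^{(-)}-\delta_1F_n^{(-)}F_m^{(+)}+\delta_2F_n^{(-)}F_m^{(-)}\right)u_{12}+\delta_1\left(F_m^{(-)}u\,u_1+F_m^{(+)}u_2u_{12}\right)+F_{n+m}^{(+)}u\,u_{12}+F_{n+m}^{(-)}u_1u_2=0$; ${}_2D_2$: $\left(F_m^{(-)}-\delta_1F_n^{(+)}F_m^{(-)}+\delta_2F_n^{(+)}F_m^{(+)}-\delta_1\lambda F_n^{(-)}F_m^{(+)}\right)u+\left(F_m^{(-)}-\delta_1F_n^{(-)}F_m^{(-)}+\delta_2F_n^{(-)}F_m^{(+)}-\delta_1\lambda F_n^{(+)}F_m^{(+)}\right)u_1+\left(F_m^{(+)}-\delta_1F_n^{(+)}F_m^{(+)}+\delta_2F_n^{(+)}F_m^{(-)}-\delta_1\lambda F_n^{(-)}F_m^{(-)}\right)u_2+\left(F_m^{(+)}-\delta_1F_n^{(-)}F_m^{(+)}+\delta_2F_n^{(-)}F_m^{(-)}-\delta_1\lambda F_n^{(+)}F_m^{(-)}\right)u_{12}+\delta_1\left(F_{n+m}^{(-)}u\,u_{12}+F_{n+m}^{(+)}u_1u_2\right)+F_m^{(+)}u\,u_1+F_m^{(-)}u_2u_{12}-\delta_1\delta_2\lambda=0$;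 ${}_3D_2$: $\left(F_m^{(-)}-\delta_1F_n^{(-)}F_m^{(-)}+\delta_2F_n^{(+)}F_m^{(+)}-\delta_1\lambda F_n^{(-)}F_m^{(+)}\right)u+\left(F_m^{(-)}-\delta_1F_n^{(+)}F_m^{(-)}+\delta_2F_n^{(-)}F_m^{(+)}-\delta_1\lambda F_n^{(+)}F_m^{(+)}\right)u_1+\left(F_m^{(+)}-\delta_1F_n^{(-)}F_m^{(+)}+\delta_2F_n^{(+)}F_m^{(-)}-\delta_1\lambda F_n^{(-)}F_m^{(-)}\right)u_2+\left(F_m^{(+)}-\delta_1F_n^{(+)}F_m^{(+)}+\delta_2F_n^{(-)}F_m^{(-)}-\delta_1\lambda F_n^{(+)}F_m^{(-)}\right)u_{12}+\delta_1\left(F_n^{(-)}u\,u_2+F_n^{(+)}u_1u_{12}\right)+F_m^{(-)}u_2u_{12}+F_m^{(+)}u\,u_1-\delta_1\delta_2\lambda=0$; $D_3$: $F_n^{(+)}F_m^{(+)}u+F_n^{(-)}F_m^{(+)}u_1+F_n^{(+)}F_m^{(-)}u_2+F_n^{(-)}F_m^{(-)}u_{12}+F_m^{(-)}u\,u_1+F_n^{(-)}u\,u_2+F_{n+m}^{(-)}u\,u_{12}+F_{n+m}^{(+)}u_1u_2+F_n^{(+)}u_1u_{12}+F_m^{(+)}u_2u_{12}=0$; ${}_1D_4$: $\delta_1\left(F_n^{(-)}u\,u_2+F_n^{(+)}u_1u_{12}\right)+\delta_2\left(F_m^{(-)}u\,u_1+F_m^{(+)}u_2u_{12}\right)+u\,u_{12}+u_1u_2+\delta_3=0$;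 ${}_2D_4$: $\delta_1\left(F_n^{(-)}u\,u_2+F_n^{(+)}u_1u_{12}\right)+\delta_2\left(F_{n+m}^{(-)}u\,u_{12}+F_{n+m}^{(+)}u_1u_2\right)+u\,u_1+u_2u_{12}+\delta_3=0$.
   Context: A quad equation is $Q(x,x_1,x_2,x_{12})=0$, where $Q$ is an irreducible complex polynomial, affine linear in each of its four variables and depending effectively on each of them; the variables sit at the vertices of a square with origin $x$, neighbours $x_1,x_2$ of $x$, and opposite vertex $x_{12}$ (diagonals $\{x,x_{12}\}$ and $\{x_1,x_2\}$). Consistency. Label the vertices of a cube $x,x_1,x_2,x_3,x_{12},x_{13},x_{23},x_{123}$. A six-tuple of quad equations on the faces, $A(x,x_1,x_2,x_{12})=0$, $\bar A(x_3,x_{13},x_{23},x_{123})=0$, $B(x,x_2,x_3,x_{23})=0$, $\bar B(x_1,x_{12},x_{13},x_{123})=0$, $C(x,x_1,x_3,x_{13})=0$, $\bar C(x_2,x_{12},x_{23},x_{123})=0$ (possibly six different polynomials), is 3D consistent if for arbitrary (generic) initial data $x,x_1,x_2,x_3$ the three values of $x_{123}$ computed from $\bar A=0$, $\bar B=0$, $\bar C=0$ coincide. It has the tetrahedron property if the resulting $x_{123}(x,x_1,x_2,x_3)$ does not depend on $x$. A quad equation is called consistent if, possibly after relabelling vertices, it occurs on a face of a 3D consistent six-tuple with the tetrahedron property. Types. Denote the four variables by $y_1,\dots,y_4$. The six accompanying biquadratics of $Q$ are $Q^{i,j}(y_i,y_j)=Q_{,y_m}Q_{,y_n}-Q\,Q_{,y_my_n}$,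 $\{m,n\}$ being the complement of $\{i,j\}$ in $\{1,2,3,4\}$. A biquadratic is degenerate if, viewed as a form of bidegree $(2,2)$ on $\mathbb{P}^1\times\mathbb{P}^1$, it is divisible by a nonconstant factor depending on only one of its two variables (a factor at infinity is allowed). $Q$ is of type $Q$ if no biquadratic is degenerate, of type $H^4$ if exactly four are degenerate, of type $H^6$ if all six are. An $H^4$-type equation is rhombic if its two nondegenerate biquadratics are those attached to the diagonals of the square, trapezoidal if they are attached to two opposite edges. Lifting to the lattice. Put ${|Q}(x,x_1,x_2,x_{12})=Q(x_1,x,x_{12},x_2)$, $\underline Q(x,x_1,x_2,x_{12})=Q(x_2,x_{12},x,x_1)$, ${|\underline Q}(x,x_1,x_2,x_{12})=Q(x_{12},x_2,x_1,x)$. The lattice equation associated with $Q$, for a field $u\colon\mathbb{Z}^2\to\mathbb{C}$, is $\widehat Q=0$ with $$\widehat Q=F_n^{(+)}F_m^{(+)}\,Q+F_n^{(-)}F_m^{(+)}\,{|Q}+F_n^{(+)}F_m^{(-)}\,\underline Q+F_n^{(-)}F_m^{(-)}\,{|\underline Q},$$ all polynomials evaluated at $(u_{n,m},u_{n+1,m},u_{n,m+1},u_{n+1,m+1})$, where $F_k^{(\pm)}=\frac{1\pm(-1)^k}{2}$. This construction extends to the third direction so as to preserve consistency, which is the meaning of consistency on the 3D lattice. Equivalence. $\widehat{(\mathrm{M\ddot{o}b})}^4$ is the group of transformations of the field $u_{n,m}\mapsto F_n^{(+)}F_m^{(+)}m_0(u_{n,m})+F_n^{(-)}F_m^{(+)}m_1(u_{n,m})+F_n^{(+)}F_m^{(-)}m_2(u_{n,m})+F_n^{(-)}F_m^{(-)}m_{12}(u_{n,m})$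 with $m_0,m_1,m_2,m_{12}$ arbitrary M\"obius transformations with complex coefficients, acting on equations by substitution and clearing denominators. Rotations, translations and inversions of the discrete indices are the maps of $(n,m)\in\mathbb{Z}^2$ generated by unit translations, rotations by multiples of $90^\circ$, and the inversions $n\mapsto-n$, $m\mapsto-m$. Lattice equations are identified when at each site the defining polynomials agree up to a nonzero constant. The parameters $\alpha_2,\alpha_3,\epsilon,\delta,\delta_1,\delta_2,\delta_3,\lambda$ are complex constants (for ${}_tH_3$, $\alpha_2,\alpha_3\neq0$), taken such that the corresponding single-cell polynomials are irreducible.
   Formalization: "Independent" is shown only between tH1, tH2, tH3, D1, D3, the three D2 families taken together and the two D4 families taken together: u→1/u at odd n turns 1D4(δ1,δ2,δ3) into 2D4(δ3,δ2,δ1), and 2D2 = 3D2 when δ1 = 0, so the nine are not mutually independent. *)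

theory Defs
  imports
    Complex_Main
    "HOL-Computational_Algebra.Polynomial_Factorial"
begin

section \<open>Polynomials in the four vertex variables\<close>

text \<open>
  A vertex of the square with origin \<open>X\<close>, edges \<open>X X1\<close>, \<open>X X2\<close>, \<open>X1 X12\<close>, \<open>X2 X12\<close> and
  diagonals \<open>X X12\<close>, \<open>X1 X2\<close>.
\<close>

datatype vertex = X | X1 | X2 | X12

text \<open>
  The ring of polynomials in \<open>x, x1, x2, x12\<close> as an iterated polynomial ring; \<open>x\<close> is the
  outermost and \<open>x12\<close> the innermost variable.
\<close>

type_synonym poly4 = "complex poly poly poly poly"

definition ev :: "poly4 \<Rightarrow> complex \<Rightarrow> complex \<Rightarrow> complex \<Rightarrow> complex \<Rightarrow> complex" where
  "ev Q x x1 x2 x12 = poly (poly (poly (poly Q [:[:[:x:]:]:]) [:[:x1:]:]) [:x2:]) x12"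

fun var :: "vertex \<Rightarrow> poly4" where
  "var X = [:0, 1:]"
| "var X1 = [:[:0, 1:]:]"
| "var X2 = [:[:[:0, 1:]:]:]"
| "var X12 = [:[:[:[:0, 1:]:]:]:]"

text \<open>The univariate polynomial \<open>p\<close> in the variable of \<open>v\<close>.\<close>

definition poly_in :: "vertex \<Rightarrow> complex poly \<Rightarrow> poly4" where
  "poly_in v p = poly (map_poly (\<lambda>a. [:[:[:[:a:]:]:]:]) p) (var v)"

fun pd :: "vertex \<Rightarrow> poly4 \<Rightarrow> poly4" where
  "pd X Q = pderiv Q"
| "pd X1 Q = map_poly pderiv Q"
| "pd X2 Q = map_poly (map_poly pderiv) Q"
| "pd X12 Q = map_poly (map_poly (map_poly pderiv)) Q"

text \<open>The degree of \<open>Q\<close> in the variable of \<open>v\<close> is at most \<open>d\<close>.\<close>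

fun degree_le :: "vertex \<Rightarrow> nat \<Rightarrow> poly4 \<Rightarrow> bool" where
  "degree_le X d Q \<longleftrightarrow> degree Q \<le> d"
| "degree_le X1 d Q \<longleftrightarrow> (\<forall>i. degree (coeff Q i) \<le> d)"
| "degree_le X2 d Q \<longleftrightarrow> (\<forall>i j. degree (coeff (coeff Q i) j) \<le> d)"
| "degree_le X12 d Q \<longleftrightarrow> (\<forall>i j k. degree (coeff (coeff (coeff Q i) j) k) \<le> d)"

definition quad_equation :: "poly4 \<Rightarrow> bool" where
  "quad_equation Q \<longleftrightarrow> irreducible Q \<and> (\<forall>v. degree_le v 1 Q \<and> \<not> degree_le v 0 Q)"


section \<open>Types of quad equations\<close>

text \<open>
  The accompanying biquadratic obtained by eliminating the variables of \<open>m\<close> and \<open>n\<close>; it is the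
  biquadratic attached to the pair of the two remaining vertices.
\<close>

definition biquadratic :: "vertex \<Rightarrow> vertex \<Rightarrow> poly4 \<Rightarrow> poly4" where
  "biquadratic m n Q = pd m Q * pd n Q - Q * pd m (pd n Q)"

text \<open>
  Degeneracy of a polynomial \<open>h\<close> of degree at most 2 in each of the variables of \<open>i\<close> and \<open>j\<close>.
  Homogenised to a form of bidegree (2,2), \<open>h\<close> is divisible by the factor at infinity of the
  variable of \<open>k\<close> iff its degree in that variable is less than 2.
\<close>

definition degenerate :: "vertex \<Rightarrow> vertex \<Rightarrow> poly4 \<Rightarrow> bool" where
  "degenerate i j h \<longleftrightarrow>
     (\<exists>k\<in>{i, j}. (\<exists>p. degree p > 0 \<and> poly_in k p dvd h) \<or> degree_le k 1 h)"

definition degenerate_pairs :: "poly4 \<Rightarrow> vertex set set" where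
  "degenerate_pairs Q =
     {{i, j} | i j m n. {i, j, m, n} = UNIV \<and> degenerate i j (biquadratic m n Q)}"

definition nondegenerate_pairs :: "poly4 \<Rightarrow> vertex set set" where
  "nondegenerate_pairs Q = {e. card e = 2} - degenerate_pairs Q"

definition type_Q :: "poly4 \<Rightarrow> bool" where
  "type_Q Q \<longleftrightarrow> degenerate_pairs Q = {}"

definition type_H4 :: "poly4 \<Rightarrow> bool" where
  "type_H4 Q \<longleftrightarrow> card (degenerate_pairs Q) = 4"

definition type_H6 :: "poly4 \<Rightarrow> bool" where
  "type_H6 Q \<longleftrightarrow> card (degenerate_pairs Q) = 6"

definition rhombic_H4 :: "poly4 \<Rightarrow> bool" where
  "rhombic_H4 Q \<longleftrightarrow> type_H4 Q \<and> nondegenerate_pairs Q = {{X, X12}, {X1, X2}}"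

definition trapezoidal_H4 :: "poly4 \<Rightarrow> bool" where
  "trapezoidal_H4 Q \<longleftrightarrow> type_H4 Q \<and>
     (nondegenerate_pairs Q = {{X, X1}, {X2, X12}} \<or>
      nondegenerate_pairs Q = {{X, X2}, {X1, X12}})"


section \<open>Consistency around the cube\<close>

text \<open>
  For the initial data \<open>x, x1, x2, x3\<close> the values at the other vertices are uniquely determined by
  the faces, and the three faces \<open>A'\<close>, \<open>B'\<close>, \<open>C'\<close> at \<open>x123\<close> yield the same value.
\<close>

definition cube_values ::
  "poly4 \<Rightarrow> poly4 \<Rightarrow> poly4 \<Rightarrow> poly4 \<Rightarrow> poly4 \<Rightarrow> poly4 \<Rightarrow>
   complex \<Rightarrow> complex \<Rightarrow> complex \<Rightarrow> complex \<Rightarrow>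
   complex \<Rightarrow> complex \<Rightarrow> complex \<Rightarrow> complex \<Rightarrow> bool" where
  "cube_values A A' B B' C C' x x1 x2 x3 x12 x13 x23 x123 \<longleftrightarrow>
     (\<forall>z. ev A x x1 x2 z = 0 \<longleftrightarrow> z = x12) \<and>
     (\<forall>z. ev B x x2 x3 z = 0 \<longleftrightarrow> z = x23) \<and>
     (\<forall>z. ev C x x1 x3 z = 0 \<longleftrightarrow> z = x13) \<and>
     (\<forall>z. ev A' x3 x13 x23 z = 0 \<longleftrightarrow> z = x123) \<and>
     (\<forall>z. ev B' x1 x12 x13 z = 0 \<longleftrightarrow> z = x123) \<and>
     (\<forall>z. ev C' x2 x12 x23 z = 0 \<longleftrightarrow> z = x123)"

text \<open>
  Generic means: outside the zero set of some nonzero polynomial \<open>P\<close> in \<open>x, x1, x2, x3\<close>.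
\<close>

definition consistent_3D ::
  "poly4 \<Rightarrow> poly4 \<Rightarrow> poly4 \<Rightarrow> poly4 \<Rightarrow> poly4 \<Rightarrow> poly4 \<Rightarrow> bool" where
  "consistent_3D A A' B B' C C' \<longleftrightarrow>
     (\<exists>P::poly4. P \<noteq> 0 \<and> (\<forall>x x1 x2 x3. ev P x x1 x2 x3 \<noteq> 0 \<longrightarrow>
        (\<exists>x12 x13 x23 x123. cube_values A A' B B' C C' x x1 x2 x3 x12 x13 x23 x123)))"

definition tetrahedron_property ::
  "poly4 \<Rightarrow> poly4 \<Rightarrow> poly4 \<Rightarrow> poly4 \<Rightarrow> poly4 \<Rightarrow> poly4 \<Rightarrow> bool" where
  "tetrahedron_property A A' B B' C C' \<longleftrightarrow>
     (\<exists>P::poly4. P \<noteq> 0 \<and>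
       (\<forall>x y x1 x2 x3 x12 x13 x23 x123 y12 y13 y23 y123.
          ev P x x1 x2 x3 \<noteq> 0 \<and> ev P y x1 x2 x3 \<noteq> 0 \<and>
          cube_values A A' B B' C C' x x1 x2 x3 x12 x13 x23 x123 \<and>
          cube_values A A' B B' C C' y x1 x2 x3 y12 y13 y23 y123 \<longrightarrow>
          x123 = y123))"

text \<open>Relabellings of the vertices that respect the square: they permute its two diagonals.\<close>

definition square_relabelling :: "(vertex \<Rightarrow> vertex) \<Rightarrow> bool" where
  "square_relabelling \<sigma> \<longleftrightarrow> bij \<sigma> \<and> \<sigma> ` {X, X12} \<in> {{X, X12}, {X1, X2}}"

definition relabelled :: "(vertex \<Rightarrow> vertex) \<Rightarrow> poly4 \<Rightarrow> poly4 \<Rightarrow> bool" where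
  "relabelled \<sigma> Q R \<longleftrightarrow>
     (\<forall>y. ev R (y X) (y X1) (y X2) (y X12) = ev Q (y (\<sigma> X)) (y (\<sigma> X1)) (y (\<sigma> X2)) (y (\<sigma> X12)))"

definition consistent :: "poly4 \<Rightarrow> bool" where
  "consistent Q \<longleftrightarrow>
     (\<exists>\<sigma> R A A' B B' C C'. square_relabelling \<sigma> \<and> relabelled \<sigma> Q R \<and>
        R \<in> {A, A', B, B', C, C'} \<and> (\<forall>G\<in>{A, A', B, B', C, C'}. quad_equation G) \<and>
        consistent_3D A A' B B' C C' \<and> tetrahedron_property A A' B B' C C')"


section \<open>Lattice equations\<close>

text \<open>
  A lattice equation assigns to each site \<open>(n, m)\<close> the defining polynomial function of
  \<open>u\<^sub>n\<^sub>,\<^sub>m\<close>, \<open>u\<^sub>n\<^sub>+\<^sub>1\<^sub>,\<^sub>m\<close>, \<open>u\<^sub>n\<^sub>,\<^sub>m\<^sub>+\<^sub>1\<close>, \<open>u\<^sub>n\<^sub>+\<^sub>1\<^sub>,\<^sub>m\<^sub>+\<^sub>1\<close>.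
\<close>

type_synonym site = "int \<times> int"

type_synonym lattice_equation =
  "site \<Rightarrow> complex \<Rightarrow> complex \<Rightarrow> complex \<Rightarrow> complex \<Rightarrow> complex"

definition Fplus :: "int \<Rightarrow> complex" where
  "Fplus k = (1 + (-1) powi k) / 2"

definition Fminus :: "int \<Rightarrow> complex" where
  "Fminus k = (1 - (-1) powi k) / 2"

definition lift :: "poly4 \<Rightarrow> lattice_equation" where
  "lift Q = (\<lambda>(n, m) u u1 u2 u12.
       Fplus n * Fplus m * ev Q u u1 u2 u12
     + Fminus n * Fplus m * ev Q u1 u u12 u2
     + Fplus n * Fminus m * ev Q u2 u12 u u1
     + Fminus n * Fminus m * ev Q u12 u2 u1 u)"

definition same_equation :: "lattice_equation \<Rightarrow> lattice_equation \<Rightarrow> bool" where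
  "same_equation E E' \<longleftrightarrow>
     (\<forall>s. \<exists>c. c \<noteq> 0 \<and> (\<forall>u u1 u2 u12. E' s u u1 u2 u12 = c * E s u u1 u2 u12))"

fun cell :: "site \<Rightarrow> site set" where
  "cell (n, m) = {(n, m), (n + 1, m), (n, m + 1), (n + 1, m + 1)}"

fun at_field :: "lattice_equation \<Rightarrow> (site \<Rightarrow> complex) \<Rightarrow> site \<Rightarrow> complex" where
  "at_field E u (n, m) = E (n, m) (u (n, m)) (u (n + 1, m)) (u (n, m + 1)) (u (n + 1, m + 1))"

text \<open>The Moebius transformation \<open>z \<mapsto> (a z + b) / (c z + d)\<close> is given by \<open>(a, b, c, d)\<close>.\<close>

type_synonym moebius = "complex \<times> complex \<times> complex \<times> complex"

fun is_moebius :: "moebius \<Rightarrow> bool" where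
  "is_moebius (a, b, c, d) \<longleftrightarrow> a * d - b * c \<noteq> 0"

fun moebius_den :: "moebius \<Rightarrow> complex \<Rightarrow> complex" where
  "moebius_den (a, b, c, d) z = c * z + d"

fun moebius :: "moebius \<Rightarrow> complex \<Rightarrow> complex" where
  "moebius (a, b, c, d) z = (a * z + b) / (c * z + d)"

fun by_parity :: "'a \<Rightarrow> 'a \<Rightarrow> 'a \<Rightarrow> 'a \<Rightarrow> site \<Rightarrow> 'a" where
  "by_parity m0 m1 m2 m12 (n, m) =
     (if even m then (if even n then m0 else m1) else (if even n then m2 else m12))"

inductive_set index_maps :: "(site \<Rightarrow> site) set" where
  "id \<in> index_maps"
| "(\<lambda>(n, m). (n + 1, m)) \<in> index_maps"
| "(\<lambda>(n, m). (n - 1, m)) \<in> index_maps"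
| "(\<lambda>(n, m). (n, m + 1)) \<in> index_maps"
| "(\<lambda>(n, m). (n, m - 1)) \<in> index_maps"
| "(\<lambda>(n, m). (- m, n)) \<in> index_maps"
| "(\<lambda>(n, m). (- n, m)) \<in> index_maps"
| "(\<lambda>(n, m). (n, - m)) \<in> index_maps"
| "\<phi> \<in> index_maps \<Longrightarrow> \<psi> \<in> index_maps \<Longrightarrow> \<phi> \<circ> \<psi> \<in> index_maps"

text \<open>
  \<open>E'\<close> arises from \<open>E\<close> by a field transformation \<open>v \<mapsto> (p \<mapsto> moebius (M p) (v p))\<close> with \<open>M\<close>
  depending on the parities only, followed by an index transformation \<open>\<phi>\<close>, clearing of
  denominators, and multiplication by a nonzero constant at each site. Index transformations
  permute the parity classes, so that these compositions already form the group generated by both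
  kinds of transformations.
\<close>

definition lattice_equivalent :: "lattice_equation \<Rightarrow> lattice_equation \<Rightarrow> bool" where
  "lattice_equivalent E E' \<longleftrightarrow>
     (\<exists>\<phi>\<in>index_maps. \<exists>m0 m1 m2 m12.
        is_moebius m0 \<and> is_moebius m1 \<and> is_moebius m2 \<and> is_moebius m12 \<and>
        (let M = by_parity m0 m1 m2 m12 in
          \<forall>s s'. \<phi> ` cell s = cell s' \<longrightarrow>
            (\<exists>c. c \<noteq> 0 \<and>
              (\<forall>u v. (\<forall>p\<in>cell s. moebius_den (M p) (v p) \<noteq> 0 \<and> u (\<phi> p) = moebius (M p) (v p)) \<longrightarrow>
                 at_field E' v s
                   = c * (\<Prod>p\<in>cell s. moebius_den (M p) (v p)) * at_field E u s'))))"


section \<open>The representatives\<close>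

definition tH1 :: "complex \<Rightarrow> complex \<Rightarrow> lattice_equation" where
  "tH1 \<alpha>2 \<epsilon> = (\<lambda>(n, m) u u1 u2 u12.
     (u - u1) * (u2 - u12) - \<alpha>2 * \<epsilon>^2 * (Fplus m * u2 * u12 + Fminus m * u * u1) - \<alpha>2)"

definition tH2 :: "complex \<Rightarrow> complex \<Rightarrow> complex \<Rightarrow> lattice_equation" where
  "tH2 \<alpha>2 \<alpha>3 \<epsilon> = (\<lambda>(n, m) u u1 u2 u12.
     (u - u1) * (u2 - u12) + \<alpha>2 * (u + u1 + u2 + u12)
     + \<epsilon> * \<alpha>2 / 2 * (2 * Fplus m * u2 + 2 * \<alpha>3 + \<alpha>2) * (2 * Fplus m * u12 + 2 * \<alpha>3 + \<alpha>2)
     + \<epsilon> * \<alpha>2 / 2 * (2 * Fminus m * u + 2 * \<alpha>3 + \<alpha>2) * (2 * Fminus m * u1 + 2 * \<alpha>3 + \<alpha>2)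
     + (\<alpha>3 + \<alpha>2)^2 - \<alpha>3^2 - 2 * \<epsilon> * \<alpha>2 * \<alpha>3 * (\<alpha>3 + \<alpha>2))"

definition tH3 :: "complex \<Rightarrow> complex \<Rightarrow> complex \<Rightarrow> complex \<Rightarrow> lattice_equation" where
  "tH3 \<alpha>2 \<alpha>3 \<delta> \<epsilon> = (\<lambda>(n, m) u u1 u2 u12.
     \<alpha>2 * (u * u12 + u1 * u2) - (u * u2 + u1 * u12) - \<alpha>3 * (\<alpha>2^2 - 1) * \<delta>^2
     - \<epsilon>^2 * (\<alpha>2^2 - 1) / (\<alpha>3 * \<alpha>2) * (Fplus m * u2 * u12 + Fminus m * u * u1))"

definition D1 :: lattice_equation where
  "D1 = (\<lambda>(n, m) u u1 u2 u12. u + u1 + u2 + u12)"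

definition D2_1 :: "complex \<Rightarrow> complex \<Rightarrow> lattice_equation" where
  "D2_1 \<delta>1 \<delta>2 = (\<lambda>(n, m) u u1 u2 u12.
     (Fminus (n + m) - \<delta>1 * Fplus n * Fminus m + \<delta>2 * Fplus n * Fplus m) * u
     + (Fplus (n + m) - \<delta>1 * Fminus n * Fminus m + \<delta>2 * Fminus n * Fplus m) * u1
     + (Fplus (n + m) - \<delta>1 * Fplus n * Fplus m + \<delta>2 * Fplus n * Fminus m) * u2
     + (Fminus (n + m) - \<delta>1 * Fminus n * Fplus m + \<delta>2 * Fminus n * Fminus m) * u12
     + \<delta>1 * (Fminus m * u * u1 + Fplus m * u2 * u12)
     + Fplus (n + m) * u * u12 + Fminus (n + m) * u1 * u2)"

definition D2_2 :: "complex \<Rightarrow> complex \<Rightarrow> complex \<Rightarrow> lattice_equation" where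
  "D2_2 \<delta>1 \<delta>2 lam = (\<lambda>(n, m) u u1 u2 u12.
     (Fminus m - \<delta>1 * Fplus n * Fminus m + \<delta>2 * Fplus n * Fplus m - \<delta>1 * lam * Fminus n * Fplus m) * u
     + (Fminus m - \<delta>1 * Fminus n * Fminus m + \<delta>2 * Fminus n * Fplus m - \<delta>1 * lam * Fplus n * Fplus m) * u1
     + (Fplus m - \<delta>1 * Fplus n * Fplus m + \<delta>2 * Fplus n * Fminus m - \<delta>1 * lam * Fminus n * Fminus m) * u2
     + (Fplus m - \<delta>1 * Fminus n * Fplus m + \<delta>2 * Fminus n * Fminus m - \<delta>1 * lam * Fplus n * Fminus m) * u12
     + \<delta>1 * (Fminus (n + m) * u * u12 + Fplus (n + m) * u1 * u2)
     + Fplus m * u * u1 + Fminus m * u2 * u12 - \<delta>1 * \<delta>2 * lam)"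

definition D2_3 :: "complex \<Rightarrow> complex \<Rightarrow> complex \<Rightarrow> lattice_equation" where
  "D2_3 \<delta>1 \<delta>2 lam = (\<lambda>(n, m) u u1 u2 u12.
     (Fminus m - \<delta>1 * Fminus n * Fminus m + \<delta>2 * Fplus n * Fplus m - \<delta>1 * lam * Fminus n * Fplus m) * u
     + (Fminus m - \<delta>1 * Fplus n * Fminus m + \<delta>2 * Fminus n * Fplus m - \<delta>1 * lam * Fplus n * Fplus m) * u1
     + (Fplus m - \<delta>1 * Fminus n * Fplus m + \<delta>2 * Fplus n * Fminus m - \<delta>1 * lam * Fminus n * Fminus m) * u2
     + (Fplus m - \<delta>1 * Fplus n * Fplus m + \<delta>2 * Fminus n * Fminus m - \<delta>1 * lam * Fplus n * Fminus m) * u12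
     + \<delta>1 * (Fminus n * u * u2 + Fplus n * u1 * u12)
     + Fminus m * u2 * u12 + Fplus m * u * u1 - \<delta>1 * \<delta>2 * lam)"

definition D3 :: lattice_equation where
  "D3 = (\<lambda>(n, m) u u1 u2 u12.
     Fplus n * Fplus m * u + Fminus n * Fplus m * u1
     + Fplus n * Fminus m * u2 + Fminus n * Fminus m * u12
     + Fminus m * u * u1 + Fminus n * u * u2 + Fminus (n + m) * u * u12
     + Fplus (n + m) * u1 * u2 + Fplus n * u1 * u12 + Fplus m * u2 * u12)"

definition D4_1 :: "complex \<Rightarrow> complex \<Rightarrow> complex \<Rightarrow> lattice_equation" where
  "D4_1 \<delta>1 \<delta>2 \<delta>3 = (\<lambda>(n, m) u u1 u2 u12.
     \<delta>1 * (Fminus n * u * u2 + Fplus n * u1 * u12)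
     + \<delta>2 * (Fminus m * u * u1 + Fplus m * u2 * u12)
     + u * u12 + u1 * u2 + \<delta>3)"

definition D4_2 :: "complex \<Rightarrow> complex \<Rightarrow> complex \<Rightarrow> lattice_equation" where
  "D4_2 \<delta>1 \<delta>2 \<delta>3 = (\<lambda>(n, m) u u1 u2 u12.
     \<delta>1 * (Fminus n * u * u2 + Fplus n * u1 * u12)
     + \<delta>2 * (Fminus (n + m) * u * u12 + Fplus (n + m) * u1 * u2)
     + u * u1 + u2 * u12 + \<delta>3)"

text \<open>
  Irreducibility of the single-cell polynomial, that is, of the polynomial at the site \<open>(0, 0)\<close>,
  where \<open>lift Q\<close> reduces to \<open>Q\<close>.
\<close>

definition cell_irreducible :: "lattice_equation \<Rightarrow> bool" where
  "cell_irreducible E \<longleftrightarrow>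
     (\<exists>Q::poly4. irreducible Q \<and> (\<forall>x x1 x2 x12. ev Q x x1 x2 x12 = E (0, 0) x x1 x2 x12))"

definition tH1_family :: "lattice_equation set" where
  "tH1_family = {E. (\<exists>\<alpha>2 \<epsilon>. E = tH1 \<alpha>2 \<epsilon>) \<and> cell_irreducible E}"

definition tH2_family :: "lattice_equation set" where
  "tH2_family = {E. (\<exists>\<alpha>2 \<alpha>3 \<epsilon>. E = tH2 \<alpha>2 \<alpha>3 \<epsilon>) \<and> cell_irreducible E}"

definition tH3_family :: "lattice_equation set" where
  "tH3_family = {E. (\<exists>\<alpha>2 \<alpha>3 \<delta> \<epsilon>. \<alpha>2 \<noteq> 0 \<and> \<alpha>3 \<noteq> 0 \<and> E = tH3 \<alpha>2 \<alpha>3 \<delta> \<epsilon>) \<and> cell_irreducible E}"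

definition D2_1_family :: "lattice_equation set" where
  "D2_1_family = {E. (\<exists>\<delta>1 \<delta>2. E = D2_1 \<delta>1 \<delta>2) \<and> cell_irreducible E}"

definition D2_2_family :: "lattice_equation set" where
  "D2_2_family = {E. (\<exists>\<delta>1 \<delta>2 lam. E = D2_2 \<delta>1 \<delta>2 lam) \<and> cell_irreducible E}"

definition D2_3_family :: "lattice_equation set" where
  "D2_3_family = {E. (\<exists>\<delta>1 \<delta>2 lam. E = D2_3 \<delta>1 \<delta>2 lam) \<and> cell_irreducible E}"

definition D4_1_family :: "lattice_equation set" where
  "D4_1_family = {E. (\<exists>\<delta>1 \<delta>2 \<delta>3. E = D4_1 \<delta>1 \<delta>2 \<delta>3) \<and> cell_irreducible E}"

definition D4_2_family :: "lattice_equation set" where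
  "D4_2_family = {E. (\<exists>\<delta>1 \<delta>2 \<delta>3. E = D4_2 \<delta>1 \<delta>2 \<delta>3) \<and> cell_irreducible E}"

definition trapezoidal_list :: "lattice_equation set" where
  "trapezoidal_list = tH1_family \<union> tH2_family \<union> tH3_family"

definition H6_list :: "lattice_equation set" where
  "H6_list = D2_1_family \<union> D2_2_family \<union> D2_3_family \<union> {D3} \<union> D4_1_family \<union> D4_2_family"

text \<open>
  The members of \<open>D2_1\<close>, \<open>D2_2\<close>, \<open>D2_3\<close> are grouped together, and so are those of \<open>D4_1\<close>,
  \<open>D4_2\<close>, since these families overlap up to equivalence: \<open>D2_2 0 \<delta>2 lam = D2_3 0 \<delta>2 lam\<close>, and
  the inversion \<open>u \<mapsto> 1 / u\<close> at the sites with odd \<open>n\<close> turns \<open>D4_1 \<delta>1 \<delta>2 \<delta>3\<close> into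
  \<open>D4_2 \<delta>3 \<delta>2 \<delta>1\<close>.
\<close>

definition equation_classes :: "lattice_equation set list" where
  "equation_classes =
     [tH1_family, tH2_family, tH3_family, {D1},
      D2_1_family \<union> D2_2_family \<union> D2_3_family, {D3}, D4_1_family \<union> D4_2_family]"

definition inequivalent :: "lattice_equation set \<Rightarrow> lattice_equation set \<Rightarrow> bool" where
  "inequivalent \<F> \<G> \<longleftrightarrow> (\<forall>E\<in>\<F>. \<forall>E'\<in>\<G>. \<not> lattice_equivalent E E')"

end

theory Submission
  imports Defs "HOL-Computational_Algebra.Field_as_Ring" "HOL-Computational_Algebra.Fundamental_Theorem_Algebra"
begin

text \<open>
  A multiaffine polynomial is homogenised to a quadrilinear form on \<open>\<complex>\<^sup>2\<close>, on which Moebius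
  transformations act linearly. If one accompanying biquadratic is degenerate, the form vanishes
  identically after fixing suitable values at two vertices \<open>k\<close>, \<open>m\<close>; moving both values to infinity
  leaves \<open>x\<^sub>k d(x\<^sub>l, x\<^sub>n) + x\<^sub>m b(x\<^sub>l, x\<^sub>n) + c(x\<^sub>l, x\<^sub>n)\<close> with bilinear \<open>d\<close>, \<open>b\<close>, \<open>c\<close>. If \<open>d\<close> and \<open>b\<close>
  are nondegenerate, the Jordan form of the pencil they span yields the three trapezoidal equations;
  otherwise all six biquadratics are degenerate, the form becomes \<open>x + P(x\<^sub>1, x\<^sub>2, x\<^sub>1\<^sub>2)\<close>, and \<open>P\<close> is
  normalised by its coefficients of top degree. The consistency of each representative is witnessed
  by an explicit six-tuple in which \<open>x\<^sub>1\<^sub>2\<^sub>3\<close> is a rational function of \<open>x\<^sub>1, x\<^sub>2, x\<^sub>3\<close>. Inequivalent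
  representatives are separated by the zeros of Cayley's hyperdeterminants of the four trilinear
  forms obtained by fixing one variable.
\<close>

section \<open>Polynomials as functions of the vertex values\<close>

text \<open>Passing to forms puts infinity on the same footing as finite values: the degree drop in
  \<open>degenerate\<close> becomes the root \<open>(1, 0)\<close>, and every normalisation is a
  change of basis. The null pair comes from a fact on pencils: with a root of a biquadratic inserted
  at \<open>k\<close>, the remaining trilinear form is a pencil of singular 2 x 2 matrices, and such
  a pencil has a common left or right kernel vector, which is the value at the second vertex. A null
  pair on \<open>{k, m}\<close> leaves open only whether \<open>{k, m}\<close> and
  \<open>{l, n}\<close> are degenerate, and these are so together; hence the dichotomy between H4
  and H6. Two relations of forms are kept apart: \<open>eqv\<close> admits the eight symmetries of
  the square, which index maps realise, so that normal forms transfer to the lattice;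
  \<open>geqv\<close> admits all bijections of the vertices and is what a lattice equivalence
  yields, so the invariants must not refer to the square. With one argument left free, the
  hyperdeterminant is a binary quartic at each vertex; whether it vanishes or has two distinct
  roots, at some vertex or at all of them, tells the classes apart.\<close>

definition pack :: "'a \<Rightarrow> 'a \<Rightarrow> 'a \<Rightarrow> 'a \<Rightarrow> vertex \<Rightarrow> 'a" where
  "pack a b c d v = (case v of X \<Rightarrow> a | X1 \<Rightarrow> b | X2 \<Rightarrow> c | X12 \<Rightarrow> d)"

lemma pack_simps [simp]:
  "pack a b c d X = a" "pack a b c d X1 = b" "pack a b c d X2 = c" "pack a b c d X12 = d"
  by (simp_all add: pack_def)

lemma pack_eta [simp]: "pack (z X) (z X1) (z X2) (z X12) = z"
proof
  fix v show "pack (z X) (z X1) (z X2) (z X12) v = z v" by (cases v) simp_all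
qed

lemma pack_upd [simp]:
  "(pack a b c d)(X := t) = pack t b c d" "(pack a b c d)(X1 := t) = pack a t c d"
  "(pack a b c d)(X2 := t) = pack a b t d" "(pack a b c d)(X12 := t) = pack a b c t"
  by (auto simp: pack_def fun_eq_iff split: vertex.splits)

lemma ex_vertex: "(\<exists>v. P v) \<longleftrightarrow> P X \<or> P X1 \<or> P X2 \<or> P X12"
  by (metis vertex.exhaust)

lemma UNIV_vertex: "(UNIV :: vertex set) = {X, X1, X2, X12}"
  by (auto intro: vertex.exhaust)

definition evv :: "poly4 \<Rightarrow> (vertex \<Rightarrow> complex) \<Rightarrow> complex" where
  "evv Q z = ev Q (z X) (z X1) (z X2) (z X12)"

lemma evv_simps [simp]:
  "evv 0 z = 0" "evv 1 z = 1" "evv (P + Q) z = evv P z + evv Q z"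
  "evv (P - Q) z = evv P z - evv Q z" "evv (P * Q) z = evv P z * evv Q z"
  "evv (- Q) z = - evv Q z" "evv (Q ^ n) z = evv Q z ^ n"
  by (simp_all add: evv_def ev_def)

lemma evv_const [simp]: "evv [:[:[:[:a:]:]:]:] z = a"
  by (simp add: evv_def ev_def)

lemma evv_var [simp]: "evv (var v) z = z v"
  by (cases v) (simp_all add: evv_def ev_def)

lemma ev_eq_evv: "ev Q a b c d = evv Q (pack a b c d)"
  by (simp add: evv_def)

text \<open>A nonzero polynomial over an integral domain has finitely many roots, whereas
  \<open>h\<close> supplies infinitely many. The map \<open>h\<close> is there because the
  coefficients are themselves polynomials, in which the complex numbers sit as nested
  constants.\<close>

lemma poly_eq_0_on_infinite:
  fixes p :: "'a::idom poly" and h :: "complex \<Rightarrow> 'a"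
  assumes "inj h" "\<And>c. poly p (h c) = 0"
  shows "p = 0"
proof (rule ccontr)
  assume "p \<noteq> 0"
  then have "finite {x. poly p x = 0}" by (rule poly_roots_finite)
  moreover have "range h \<subseteq> {x. poly p x = 0}" using assms(2) by auto
  ultimately have "finite (range h)" by (rule finite_subset[rotated])
  then show False
    using assms(1) infinite_UNIV_char_0[where 'a = complex] by (simp add: finite_image_iff)
qed

text \<open>The variables are freed one at a time, starting with the innermost: at each stage a
  polynomial that vanishes at all complex constants is zero.\<close>

lemma evv_eq_0D:
  assumes "\<And>z. evv P z = 0"
  shows "P = 0"
proof -
  have *: "poly (poly (poly (poly P [:[:[:x:]:]:]) [:[:x1:]:]) [:x2:]) x12 = 0" for x x1 x2 x12
    using assms[of "pack x x1 x2 x12"] by (simp add: evv_def ev_def)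
  have "poly (poly (poly P [:[:[:x:]:]:]) [:[:x1:]:]) [:x2:] = 0" for x x1 x2
    by (rule poly_eq_0_on_infinite[of id]) (use * in auto)
  then have "poly (poly P [:[:[:x:]:]:]) [:[:x1:]:] = 0" for x x1
    by (rule poly_eq_0_on_infinite[of "\<lambda>c. [:c:]", rotated]) (auto simp: inj_def)
  then have "poly P [:[:[:x:]:]:] = 0" for x
    by (rule poly_eq_0_on_infinite[of "\<lambda>c. [:[:c:]:]", rotated]) (auto simp: inj_def)
  then show ?thesis
    by (rule poly_eq_0_on_infinite[of "\<lambda>c. [:[:[:c:]:]:]", rotated]) (auto simp: inj_def)
qed

lemma evv_inject: "(\<And>z. evv P z = evv Q z) \<Longrightarrow> P = Q"
  using evv_eq_0D[of "P - Q"] by simp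

lemma evv_nonzero: "P \<noteq> 0 \<Longrightarrow> \<exists>z. evv P z \<noteq> 0"
  using evv_eq_0D by blast

text \<open>Once evaluation is a nested sum of monomials, \<open>polyfun_subst\<close> and
  \<open>evv_line\<close> reduce to closure under sums, products and powers.\<close>

lemma evv_altdef:
  "evv Q z = (\<Sum>i\<le>degree Q. (\<Sum>j\<le>degree (coeff Q i). (\<Sum>k\<le>degree (coeff (coeff Q i) j).
     (\<Sum>l\<le>degree (coeff (coeff (coeff Q i) j) k).
       coeff (coeff (coeff (coeff Q i) j) k) l * z X12 ^ l) * z X2 ^ k) * z X1 ^ j) * z X ^ i)"
proof -
  have c1: "[:[:[:x:]:]:] ^ i = [:[:[:x ^ i:]:]:]" for x :: complex and i
    by (induction i) (auto simp: one_pCons)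
  have c2: "[:[:x:]:] ^ i = [:[:x ^ i:]:]" for x :: complex and i
    by (induction i) (auto simp: one_pCons)
  have c3: "[:x:] ^ i = [:x ^ i:]" for x :: complex and i
    by (induction i) (auto simp: one_pCons)
  have 1: "poly (poly q [:b:]) c = (\<Sum>i\<le>degree q. poly (coeff q i) c * b ^ i)"
    for q :: "complex poly poly" and b c
    by (simp add: poly_altdef[of q] c3 poly_sum mult.commute)
  have 2: "poly (poly (poly q [:[:a:]:]) [:b:]) c =
      (\<Sum>i\<le>degree q. poly (poly (coeff q i) [:b:]) c * a ^ i)"
    for q :: "complex poly poly poly" and a b c
    by (simp add: poly_altdef[of q] c2 poly_sum mult.commute)
  have 3: "poly (poly (poly (poly q [:[:[:d:]:]:]) [:[:a:]:]) [:b:]) c =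
      (\<Sum>i\<le>degree q. poly (poly (poly (coeff q i) [:[:a:]:]) [:b:]) c * d ^ i)"
    for q :: poly4 and a b c d
    by (simp add: poly_altdef[of q] c1 poly_sum mult.commute)
  show ?thesis
    unfolding evv_def ev_def 3 unfolding 2 unfolding 1
    unfolding poly_altdef[of "_ :: complex poly"] ..
qed

text \<open>Genericity conditions and factors are most easily written as functions of the vertex
  values; this predicate recovers the polynomial behind them.\<close>

definition polyfun :: "((vertex \<Rightarrow> complex) \<Rightarrow> complex) \<Rightarrow> bool" where
  "polyfun g \<longleftrightarrow> (\<exists>P. \<forall>z. evv P z = g z)"

lemma polyfun_evv [intro, simp]: "polyfun (evv P)"
  by (auto simp: polyfun_def)

lemma polyfun_const [intro, simp]: "polyfun (\<lambda>z. c)"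
  unfolding polyfun_def by (rule exI[of _ "[:[:[:[:c:]:]:]:]"]) simp

lemma polyfun_var [intro, simp]: "polyfun (\<lambda>z. z v)"
  unfolding polyfun_def by (rule exI[of _ "var v"]) simp

lemma polyfun_arith:
  assumes "polyfun f" "polyfun g"
  shows polyfun_add [intro]: "polyfun (\<lambda>z. f z + g z)"
    and polyfun_diff [intro]: "polyfun (\<lambda>z. f z - g z)"
    and polyfun_mult [intro]: "polyfun (\<lambda>z. f z * g z)"
proof -
  obtain F G where "\<And>z. evv F z = f z" "\<And>z. evv G z = g z"
    using assms by (auto simp: polyfun_def)
  then show "polyfun (\<lambda>z. f z + g z)" "polyfun (\<lambda>z. f z - g z)" "polyfun (\<lambda>z. f z * g z)"
    unfolding polyfun_def
    by (auto intro: exI[of _ "F + G"] exI[of _ "F - G"] exI[of _ "F * G"])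
qed

lemma polyfun_minus [intro]: "polyfun f \<Longrightarrow> polyfun (\<lambda>z. - f z)"
  using polyfun_diff[OF polyfun_const[of 0], of f] by simp

lemma polyfun_power [intro]: "polyfun f \<Longrightarrow> polyfun (\<lambda>z. f z ^ n)"
  by (induction n) auto

lemma polyfun_sum: "(\<And>i. i \<in> A \<Longrightarrow> polyfun (f i)) \<Longrightarrow> polyfun (\<lambda>z. \<Sum>i\<in>A. f i z)"
  by (induction A rule: infinite_finite_induct) auto

lemma polyfun_subst:
  assumes "\<And>v. polyfun (s v)"
  shows "polyfun (\<lambda>z. evv P (\<lambda>v. s v z))"
  unfolding evv_altdef by (intro polyfun_sum polyfun_mult polyfun_power assms polyfun_const)

lemma polyfun_upd: "polyfun (\<lambda>z. evv P (z(v := t)))"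
proof -
  have "polyfun (\<lambda>z. evv P (\<lambda>w. (if w = v then t else z w)))"
  proof (rule polyfun_subst)
    show "polyfun (\<lambda>z. if w = v then t else z w)" for w by (cases "w = v") auto
  qed
  moreover have "(\<lambda>w. if w = v then t else z w) = z(v := t)" for z :: "vertex \<Rightarrow> complex"
    by auto
  ultimately show ?thesis by simp
qed

text \<open>The polynomial ring has no zero divisors, so the product of the two polynomials is
  nonzero and there is a point where it does not vanish.\<close>

lemma polyfun_mult_nonzero:
  assumes "polyfun f" "polyfun g" "f a \<noteq> 0" "g b \<noteq> 0"
  shows "\<exists>z. f z \<noteq> 0 \<and> g z \<noteq> 0"
proof -
  obtain F G where F: "\<And>z. evv F z = f z" and G: "\<And>z. evv G z = g z"
    using assms by (auto simp: polyfun_def)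
  have "F \<noteq> 0" "G \<noteq> 0" using F[of a] G[of b] assms by auto
  then have "F * G \<noteq> 0" by simp
  then obtain z where "evv (F * G) z \<noteq> 0" using evv_nonzero by blast
  then show ?thesis using F G by auto
qed

lemma evv_line: "\<exists>p. \<forall>t. evv P (z(v := t)) = poly p t"
proof -
  have "\<exists>p. \<forall>t. evv P (\<lambda>w. if w = v then t else z w) = poly p t"
  proof -
    have *: "\<exists>p. \<forall>t. (\<Sum>i\<in>A. f i t) = poly p t"
      if "\<And>i. i \<in> A \<Longrightarrow> \<exists>p. \<forall>t. f i t = poly p t" for A :: "nat set" and f :: "nat \<Rightarrow> complex \<Rightarrow> complex"
    proof -
      have "\<forall>i\<in>A. \<exists>p. \<forall>t. f i t = poly p t" using that by blast
      from bchoice[OF this] obtain q where "\<forall>i\<in>A. \<forall>t. f i t = poly (q i) t" by blast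
      then have "\<forall>t. (\<Sum>i\<in>A. f i t) = poly (\<Sum>i\<in>A. q i) t" by (simp add: poly_sum)
      then show ?thesis by blast
    qed
    have m: "\<exists>p. \<forall>t. f t * g t = poly p t"
      if "\<exists>p. \<forall>t. f t = poly p t" "\<exists>p. \<forall>t. g t = poly p t" for f g :: "complex \<Rightarrow> complex"
      using that by (metis poly_mult)
    have w: "\<exists>p. \<forall>t. (if w = v then t else z w) ^ n = poly p t" for w n
    proof (cases "w = v")
      case True
      then show ?thesis by (intro exI[of _ "monom 1 n"]) (simp add: poly_monom)
    next
      case False
      then show ?thesis by (intro exI[of _ "[:z w ^ n:]"]) simp
    qed
    have c: "\<exists>p. \<forall>t. (a::complex) = poly p t" for a by (intro exI[of _ "[:a:]"]) simp
    show ?thesis unfolding evv_altdef by (intro * m w c)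
  qed
  moreover have "(\<lambda>w. if w = v then t else z w) = z(v := t)" for t
    by auto
  ultimately show ?thesis by simp
qed

section \<open>Multiaffine functions\<close>

text \<open>Interpolation between 0 and 1 along each coordinate line expresses degree at most 1
  without mentioning coefficients, so that it applies to functions.\<close>

definition multiaffine :: "((vertex \<Rightarrow> complex) \<Rightarrow> complex) \<Rightarrow> bool" where
  "multiaffine f \<longleftrightarrow> (\<forall>v z t. f (z(v := t)) = f (z(v := 0)) + t * (f (z(v := 1)) - f (z(v := 0))))"

lemma multiaffineD:
  "multiaffine f \<Longrightarrow> f (z(v := t)) = f (z(v := 0)) + t * (f (z(v := 1)) - f (z(v := 0)))"
  unfolding multiaffine_def by blast

lemma multiaffine_pack:
  assumes "\<And>x x1 x2 x12. f (pack x x1 x2 x12) = g x x1 x2 x12"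
    "\<And>x x1 x2 x12. g x x1 x2 x12 = g 0 x1 x2 x12 + x * (g 1 x1 x2 x12 - g 0 x1 x2 x12)"
    "\<And>x x1 x2 x12. g x x1 x2 x12 = g x 0 x2 x12 + x1 * (g x 1 x2 x12 - g x 0 x2 x12)"
    "\<And>x x1 x2 x12. g x x1 x2 x12 = g x x1 0 x12 + x2 * (g x x1 1 x12 - g x x1 0 x12)"
    "\<And>x x1 x2 x12. g x x1 x2 x12 = g x x1 x2 0 + x12 * (g x x1 x2 1 - g x x1 x2 0)"
  shows "multiaffine f"
proof -
  have "f ((pack a b c d)(v := t)) =
      f ((pack a b c d)(v := 0)) + t * (f ((pack a b c d)(v := 1)) - f ((pack a b c d)(v := 0)))" for a b c d v t
    using assms(2)[of t b c d] assms(3)[of a t c d] assms(4)[of a b t d] assms(5)[of a b c t]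
    by (cases v) (simp_all only: pack_upd assms(1))
  then show ?thesis unfolding multiaffine_def by (metis pack_eta)
qed

definition interp :: "(complex \<Rightarrow> 'a::comm_ring_1) \<Rightarrow> 'a poly" where
  "interp g = [:g 0, g 1 - g 0:]"

lemma poly_interp: "poly (interp g) c = g 0 + c * (g 1 - g 0)"
  by (simp add: interp_def)

lemma interp_diff: "interp g - interp h = interp (\<lambda>x. g x - h x)"
  by (simp add: interp_def)

lemma interp_const: "interp (\<lambda>x. c) = [:c:]"
  by (simp add: interp_def)

lemma map_poly_interp:
  assumes "h 0 = 0" "\<And>a b. h (a - b) = h a - h b"
  shows "map_poly h (interp g) = interp (\<lambda>x. h (g x))"
  by (simp add: interp_def map_poly_pCons assms)

lemma pderiv_interp: "pderiv (interp g) = [:g 1 - g 0:]"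
  by (simp add: interp_def pderiv_pCons)

lemma degree_interp: "degree (interp g) \<le> 1"
  by (simp add: interp_def)

lemma coeff_interp: "coeff (interp g) i = (if i = 0 then g 0 else if i = 1 then g 1 - g 0 else 0)"
  by (auto simp: interp_def coeff_pCons split: nat.splits)

text \<open>Inverse of \<open>evv\<close> between functions affine in each variable and polynomials
  of degree at most 1 in each variable, by \<open>evv_pol\<close> and
  \<open>pol_evv\<close>.\<close>

definition pol :: "((vertex \<Rightarrow> complex) \<Rightarrow> complex) \<Rightarrow> poly4" where
  "pol f = interp (\<lambda>x. interp (\<lambda>x1. interp (\<lambda>x2. interp (\<lambda>x12. f (pack x x1 x2 x12)))))"

lemma evv_pol:
  assumes "multiaffine f"
  shows "evv (pol f) z = f z"
proof -
  have m: "f (pack x x1 x2 x12) = f (pack x x1 x2 0) + x12 * (f (pack x x1 x2 1) - f (pack x x1 x2 0))"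
    "f (pack x x1 x2 x12) = f (pack x x1 0 x12) + x2 * (f (pack x x1 1 x12) - f (pack x x1 0 x12))"
    "f (pack x x1 x2 x12) = f (pack x 0 x2 x12) + x1 * (f (pack x 1 x2 x12) - f (pack x 0 x2 x12))"
    "f (pack x x1 x2 x12) = f (pack 0 x1 x2 x12) + x * (f (pack 1 x1 x2 x12) - f (pack 0 x1 x2 x12))"
    for x x1 x2 x12
    using multiaffineD[OF assms, of "pack x x1 x2 x12" X12 x12]
      multiaffineD[OF assms, of "pack x x1 x2 x12" X2 x2]
      multiaffineD[OF assms, of "pack x x1 x2 x12" X1 x1]
      multiaffineD[OF assms, of "pack x x1 x2 x12" X x] by simp_all
  have i1: "poly (interp (\<lambda>x12. f (pack x x1 x2 x12))) x12 = f (pack x x1 x2 x12)" for x x1 x2 x12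
    using m(1)[of x x1 x2 x12] by (simp add: poly_interp)
  have i2: "poly (poly (interp (\<lambda>x2. interp (\<lambda>x12. f (pack x x1 x2 x12)))) [:x2:]) x12 = f (pack x x1 x2 x12)"
    for x x1 x2 x12
    using m(2)[of x x1 x2 x12] by (simp add: poly_interp[of _ "[:_:]"] i1)
  have i3: "poly (poly (poly (interp (\<lambda>x1. interp (\<lambda>x2. interp (\<lambda>x12. f (pack x x1 x2 x12))))) [:[:x1:]:]) [:x2:]) x12
      = f (pack x x1 x2 x12)"
    for x x1 x2 x12
    using m(3)[of x x1 x2 x12] by (simp add: poly_interp[of _ "[:[:_:]:]"] i2)
  have i4: "ev (pol f) x x1 x2 x12 = f (pack x x1 x2 x12)"
    for x x1 x2 x12
    unfolding ev_def pol_def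
    using m(4)[of x x1 x2 x12] by (simp add: poly_interp[of _ "[:[:[:_:]:]:]"] i3)
  show ?thesis by (simp add: evv_def i4)
qed

lemma degree_le_pol: "degree_le v 1 (pol f)"
proof -
  have i: "degree (interp g) \<le> Suc 0" for g :: "complex \<Rightarrow> 'a::comm_ring_1"
    using degree_interp[of g] by simp
  show ?thesis
    by (cases v) (auto simp: pol_def coeff_interp interp_diff i)
qed

lemma multiaffine_evv:
  assumes d: "\<And>v. degree_le v 1 Q"
  shows "multiaffine (evv Q)"
proof -
  have lin: "poly q y = coeff q 0 + y * coeff q 1" if "degree q \<le> Suc 0"
    for q :: "'a::comm_ring_1 poly" and y
  proof -
    have "degree q = 0 \<or> degree q = Suc 0" using that by auto
    then show ?thesis by (auto simp: poly_altdef coeff_eq_0)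
  qed
  have d1: "degree Q \<le> Suc 0" "\<And>i. degree (coeff Q i) \<le> Suc 0"
    "\<And>i j. degree (coeff (coeff Q i) j) \<le> Suc 0"
    "\<And>i j k. degree (coeff (coeff (coeff Q i) j) k) \<le> Suc 0"
    using d[of X] d[of X1] d[of X2] d[of X12] by simp_all
  show ?thesis
    by (rule multiaffine_pack[OF refl])
      (simp_all add: evv_def ev_def lin d1 algebra_simps)
qed

lemma pol_evv:
  assumes "\<And>v. degree_le v 1 Q"
  shows "pol (evv Q) = Q"
  by (rule evv_inject) (rule evv_pol[OF multiaffine_evv[OF assms]])

text \<open>For a multiaffine function this is the partial derivative; \<open>pd_pol\<close> states
  the correspondence.\<close>

definition diff_at :: "vertex \<Rightarrow> ((vertex \<Rightarrow> complex) \<Rightarrow> complex) \<Rightarrow> (vertex \<Rightarrow> complex) \<Rightarrow> complex" where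
  "diff_at v f z = f (z(v := 1)) - f (z(v := 0))"

lemma pd_pol: "pd v (pol f) = pol (diff_at v f)"
proof -
  have i: "map_poly h (interp g) = interp (\<lambda>x. h (g x))"
    if "h 0 = 0" "\<And>a b. h (a - b) = h a - h b" for h :: "'a::comm_ring_1 \<Rightarrow> 'b::comm_ring_1" and g
    by (rule map_poly_interp) (use that in auto)
  have m: "map_poly h (p - q) = map_poly h p - map_poly h q"
    if "h 0 = 0" "\<And>a b. h (a - b) = h a - h b" for h :: "'a::comm_ring_1 \<Rightarrow> 'b::comm_ring_1" and p q
    by (intro poly_eqI) (simp add: coeff_map_poly that)
  show ?thesis
    by (cases v) (simp_all add: pol_def diff_at_def i m pderiv_diff pderiv_interp interp_diff[symmetric]
        interp_const flip: interp_diff)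
qed

lemma multiaffine_diff_at:
  assumes f: "multiaffine f"
  shows "multiaffine (diff_at v f)"
  unfolding multiaffine_def
proof (intro allI)
  fix w z t
  show "diff_at v f (z(w := t)) =
      diff_at v f (z(w := 0)) + t * (diff_at v f (z(w := 1)) - diff_at v f (z(w := 0)))"
  proof (cases "w = v")
    case False
    have 1: "z(w := s, v := r) = z(v := r, w := s)" for s r using False by (simp add: fun_upd_twist)
    note e = multiaffineD[OF f, of "z(v := 1)" w t] multiaffineD[OF f, of "z(v := 0)" w t]
    show ?thesis
      unfolding diff_at_def 1 e by (simp add: algebra_simps)
  qed (simp add: diff_at_def)
qed

lemma diff_at_upd [simp]: "diff_at v f (z(v := t)) = diff_at v f z"
  by (simp add: diff_at_def)

lemma multiaffine_split: "multiaffine f \<Longrightarrow> f z = f (z(v := 0)) + z v * diff_at v f z"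
  using multiaffineD[of f z v "z v"] by (simp add: diff_at_def)

section \<open>Dependence on a variable, and irreducibility\<close>

definition indep :: "vertex \<Rightarrow> ((vertex \<Rightarrow> complex) \<Rightarrow> complex) \<Rightarrow> bool" where
  "indep v f \<longleftrightarrow> (\<forall>z t. f (z(v := t)) = f z)"

lemma indepD: "indep v f \<Longrightarrow> f (z(v := t)) = f z"
  by (simp add: indep_def)

lemma indep_pol_degree: "degree_le v 0 (pol f)" if "indep v f"
proof -
  have "pol f = pol (\<lambda>z. f (z(v := 0)))" using that by (simp add: indep_def)
  also have "degree_le v 0 \<dots>"
    by (cases v) (auto simp: pol_def coeff_interp interp_diff interp_const)
  finally show ?thesis .
qed

lemma degree_le_0_indep:
  assumes "\<And>v. degree_le v 1 Q" "degree_le v 0 Q"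
  shows "indep v (evv Q)"
proof -
  have "pd v Q = 0"
    using assms(2) by (cases v) (auto intro!: poly_eqI simp: coeff_map_poly pderiv_eq_0_iff coeff_pderiv coeff_eq_0)
  then have "evv (pol (diff_at v (evv Q))) z = 0" for z
    using pd_pol[of v "evv Q"] pol_evv[of Q] assms(1) by simp
  then have 0: "diff_at v (evv Q) z = 0" for z
    using evv_pol multiaffine_diff_at multiaffine_evv assms(1) by metis
  have "evv Q (z(v := t)) = evv Q (z(v := 0))" for z t
    using multiaffineD[OF multiaffine_evv[OF assms(1)], of z v t] 0[of z] by (simp add: diff_at_def)
  then show ?thesis unfolding indep_def by (metis fun_upd_triv)
qed

text \<open>Degrees in \<open>v\<close> add in a product, so if the product is affine along every
  \<open>v\<close>-line, at most one factor can vary with \<open>v\<close>.\<close>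

lemma indep_factor:
  assumes "\<And>z t. evv A (z(v := t)) * evv B (z(v := t)) =
      evv A (z(v := 0)) * evv B (z(v := 0)) +
      t * (evv A (z(v := 1)) * evv B (z(v := 1)) - evv A (z(v := 0)) * evv B (z(v := 0)))"
  shows "indep v (evv A) \<or> indep v (evv B)"
proof (rule ccontr)
  assume "\<not> ?thesis"
  then obtain a s b t where "evv A (a(v := s)) - evv A a \<noteq> 0" "evv B (b(v := t)) - evv B b \<noteq> 0"
    by (auto simp: indep_def)
  \<comment> \<open>Both differences are nonzero polynomial functions, hence there is a single line
    on which both factors vary.\<close>
  then obtain z where z: "evv A (z(v := s)) - evv A z \<noteq> 0" "evv B (z(v := t)) - evv B z \<noteq> 0"
    using polyfun_mult_nonzero[of "\<lambda>z. evv A (z(v := s)) - evv A z" "\<lambda>z. evv B (z(v := t)) - evv B z"]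
      polyfun_upd polyfun_diff polyfun_evv by meson
  obtain p q where p: "\<And>t. evv A (z(v := t)) = poly p t" and q: "\<And>t. evv B (z(v := t)) = poly q t"
    using evv_line by metis
  have "poly p s \<noteq> poly p (z v)" "poly q t \<noteq> poly q (z v)"
    using z p[of s] p[of "z v"] q[of t] q[of "z v"] by auto
  moreover have "degree r \<noteq> 0" if "poly r x \<noteq> poly r y" for r and x y :: complex
    using that degree_eq_zeroE[of r] by (metis poly_pCons poly_0 mult_zero_right)
  ultimately have "degree p \<noteq> 0" "degree q \<noteq> 0" by blast+
  then have d: "degree (p * q) \<ge> 2" by (subst degree_mult_eq) auto
  have "poly (p * q) x = poly [:poly p 0 * poly q 0, poly p 1 * poly q 1 - poly p 0 * poly q 0:] x" for x
    using assms[of z x] unfolding p q by simp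
  then have "p * q = [:poly p 0 * poly q 0, poly p 1 * poly q 1 - poly p 0 * poly q 0:]"
    using poly_eq_poly_eq_iff by blast
  then have "degree (p * q) \<le> 1" by simp
  then show False using d by simp
qed

text \<open>Minus the determinant of the 2 x 2 matrix of values of \<open>f\<close> at 0 and 1 in
  the variables of \<open>m\<close> and \<open>n\<close>.\<close>

definition fdet :: "vertex \<Rightarrow> vertex \<Rightarrow> ((vertex \<Rightarrow> complex) \<Rightarrow> complex) \<Rightarrow> (vertex \<Rightarrow> complex) \<Rightarrow> complex" where
  "fdet m n f z = f (z(m := 1, n := 0)) * f (z(m := 0, n := 1)) - f (z(m := 1, n := 1)) * f (z(m := 0, n := 0))"

text \<open>The biquadratic is constant in the variables of \<open>m\<close> and \<open>n\<close>.
  With \<open>a\<close>, \<open>b\<close>, \<open>c\<close>, \<open>d\<close> the values at the four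
  corners, it equals \<open>(b - a) (c - a) - a (d - b - c + a) = b c - a d\<close> at the corner
  where both are 0.\<close>

lemma evv_biquadratic:
  assumes "multiaffine f" "m \<noteq> n"
  shows "evv (biquadratic m n (pol f)) z = fdet m n f z"
proof -
  note M = assms(1) multiaffine_diff_at
  have u: "z(n := s, m := t) = z(m := t, n := s)" for s t using assms(2) by (simp add: fun_upd_twist)
  define a b c d where abcd: "a = f (z(m := 0, n := 0))" "b = f (z(m := 1, n := 0))"
    "c = f (z(m := 0, n := 1))" "d = f (z(m := 1, n := 1))"
  define s t where st: "s = z m" "t = z n"
  have s: "f w = f (w(m := 0)) + w m * (f (w(m := 1)) - f (w(m := 0)))" for w
    using multiaffine_split[OF M(1), of w m] by (simp add: diff_at_def)
  have t: "f w = f (w(n := 0)) + w n * (f (w(n := 1)) - f (w(n := 0)))" for w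
    using multiaffine_split[OF M(1), of w n] by (simp add: diff_at_def)
  have 1: "f (z(m := i)) = f (z(m := i, n := 0)) + t * (f (z(m := i, n := 1)) - f (z(m := i, n := 0)))" for i
    using t[of "z(m := i)"] assms(2) st by simp
  have 2: "f (z(n := i)) = f (z(m := 0, n := i)) + s * (f (z(m := 1, n := i)) - f (z(m := 0, n := i)))" for i
    using s[of "z(n := i)"] assms(2) st by (simp add: u)
  have m: "f (z(m := 0)) = a + t * (c - a)" "f (z(m := 1)) = b + t * (d - b)"
    unfolding abcd by (rule 1)+
  have n: "f (z(n := 0)) = a + s * (b - a)" "f (z(n := 1)) = c + s * (d - c)"
    unfolding abcd by (rule 2)+
  have f: "f z = f (z(m := 0)) + s * (f (z(m := 1)) - f (z(m := 0)))"
    using s[of z] st by simp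
  have e: "evv (pol f) z = f z" "evv (pol (diff_at m f)) z = b + t * (d - b) - (a + t * (c - a))"
    "evv (pol (diff_at n f)) z = c + s * (d - c) - (a + s * (b - a))"
    "evv (pol (diff_at m (diff_at n f))) z = d - b - (c - a)"
    by (simp_all only: evv_pol M) (simp_all only: diff_at_def m n u abcd)
  show ?thesis
    unfolding biquadratic_def evv_simps pd_pol e f m fdet_def abcd[symmetric]
    by (simp add: algebra_simps)
qed

text \<open>In a factorisation every variable occurs in only one factor, by
  \<open>indep_factor\<close>. If \<open>v\<close> and \<open>w\<close> occurred in different
  factors, \<open>fdet v w f\<close> would vanish; so the factor without \<open>v\<close> contains
  no variable at all and is a unit.\<close>

theorem quad_equation_polI:
  assumes f: "multiaffine f" and d: "\<And>w. w \<noteq> v \<Longrightarrow> \<exists>z. fdet v w f z \<noteq> 0"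
  shows "quad_equation (pol f)"
proof -
  have dep: "\<not> indep u f" for u
  proof
    assume i: "indep u f"
    have "\<exists>w. w \<noteq> v" by (rule exI[of _ "if v = X then X1 else X"]) auto
    then obtain w where w: "w \<noteq> v" "w = u \<or> v = u" by metis
    have "f (z(u := t)) = f z" for z t using i by (rule indepD)
    note u = this
    have "fdet v w f z = 0" for z
    proof (cases "w = u")
      case True
      then show ?thesis unfolding fdet_def by (simp add: u)
    next
      case False
      then have "z(v := a, w := b) = z(w := b, u := a)" for a b using w by (auto simp: fun_upd_twist)
      then show ?thesis unfolding fdet_def by (simp add: u)
    qed
    then show False using d[OF w(1)] by simp
  qed
  have ef: "evv (pol f) = f" using evv_pol[OF f] by auto
  have "irreducible (pol f)"
  proof (rule irreducibleI)
    show "pol f \<noteq> 0"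
    proof
      assume "pol f = 0"
      then have "f z = 0" for z using fun_cong[OF ef, of z] by simp
      then show False using dep by (simp add: indep_def)
    qed
    have unit: "B dvd 1" if B: "\<And>u. indep u (evv B)" and B0: "B \<noteq> 0" for B
    proof -
      define k where "k = evv B (pack 0 0 0 0)"
      have "evv B (pack a b c d) = k" for a b c d
        using indepD[OF B[of X], of "pack 0 b c d" a] indepD[OF B[of X1], of "pack 0 0 c d" b]
          indepD[OF B[of X2], of "pack 0 0 0 d" c] indepD[OF B[of X12], of "pack 0 0 0 0" d]
        by (simp add: k_def)
      from this[of "z X" "z X1" "z X2" "z X12" for z] have c: "evv B z = k" for z by simp
      have eq: "B = [:[:[:[:k:]:]:]:]" by (rule evv_inject) (simp only: evv_const c)
      then have "k \<noteq> 0" using B0 by auto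
      then have "B * [:[:[:[:1 / k:]:]:]:] = 1"
        by (simp add: eq one_pCons)
      then show ?thesis by (rule dvdI[OF sym])
    qed
    show "\<not> pol f dvd 1"
    proof
      assume "pol f dvd 1"
      then obtain G where G: "pol f * G = 1" by (metis dvdE)
      have g1: "evv (pol f) z * evv G z = 1" for z using arg_cong[OF G, of "\<lambda>p. evv p z"] by simp
      have "indep v (evv (pol f)) \<or> indep v (evv G)" by (rule indep_factor) (simp only: g1, simp)
      then have "indep v (evv G)" using dep ef by simp
      moreover have "evv (pol f) z = 1 / evv G z" for z
      proof -
        have "evv G z \<noteq> 0" using g1[of z] by auto
        then show ?thesis using g1[of z] by (simp add: eq_divide_eq)
      qed
      ultimately have "indep v (evv (pol f))" by (simp add: indep_def)
      then show False using dep ef by simp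
    qed
    have step: "B dvd 1" if AB: "pol f = A * B" and iB: "indep v (evv B)" for A B
    proof -
      have prod: "f z = evv A z * evv B z" for z using fun_cong[OF ef, of z] unfolding AB by simp
      have ii: "indep w (evv A) \<or> indep w (evv B)" for w
      proof (rule indep_factor)
        show "evv A (z(w := t)) * evv B (z(w := t)) = evv A (z(w := 0)) * evv B (z(w := 0)) +
          t * (evv A (z(w := 1)) * evv B (z(w := 1)) - evv A (z(w := 0)) * evv B (z(w := 0)))" for z t
          using multiaffineD[OF f, of z w t] by (simp only: prod)
      qed
      \<comment> \<open>If \<open>A\<close> were free of \<open>w\<close>, the variable
        \<open>v\<close> would occur only in \<open>A\<close> and \<open>w\<close> only in
        \<open>B\<close>, and the matrix of values in \<open>v\<close>, \<open>w\<close> would have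
        rank one.\<close>
      have "indep w (evv B)" for w
      proof (cases "w = v")
        case True then show ?thesis using iB by simp
      next
        case False
        then obtain z where z: "fdet v w f z \<noteq> 0" using d by blast
        { assume A: "indep w (evv A)"
          have sw: "evv A (z(v := s, w := t)) = evv A (z(v := s))" for s t
            using indepD[OF A] by blast
          have "evv B (z(v := s, w := t)) = evv B (z(w := t))" for s t
            using indepD[OF iB] False by (simp add: fun_upd_twist[of v w])
          then have "fdet v w f z = 0" unfolding fdet_def prod sw by simp
          then have False using z by simp }
        then show ?thesis using ii by blast
      qed
      moreover have "B \<noteq> 0" using AB \<open>pol f \<noteq> 0\<close> by auto
      ultimately show ?thesis by (rule unit)
    qed
    fix A B assume AB: "pol f = A * B"
    have prod: "f z = evv A z * evv B z" for z using fun_cong[OF ef, of z] unfolding AB by simp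
    have "indep v (evv A) \<or> indep v (evv B)"
    proof (rule indep_factor)
      show "evv A (z(v := t)) * evv B (z(v := t)) = evv A (z(v := 0)) * evv B (z(v := 0)) +
        t * (evv A (z(v := 1)) * evv B (z(v := 1)) - evv A (z(v := 0)) * evv B (z(v := 0)))" for z t
        using multiaffineD[OF f, of z v t] by (simp only: prod)
    qed
    then show "A dvd 1 \<or> B dvd 1"
      using step[of A B] step[of B A] AB by (auto simp only: mult.commute)
  qed
  moreover have "\<not> degree_le u 0 (pol f)" for u
    using degree_le_0_indep[of "pol f" u] degree_le_pol dep[of u] ef by auto
  ultimately show ?thesis unfolding quad_equation_def using degree_le_pol by blast
qed

text \<open>If the biquadratic vanished, \<open>Q\<close> would divide the product of two of its
  partial derivatives and hence, being prime, one of them. The derivative in \<open>v\<close> is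
  free of \<open>v\<close> while \<open>Q\<close> is not, so the quotient would be zero and
  \<open>Q\<close> would not depend on \<open>v\<close>.\<close>

theorem quad_equation_fdet:
  assumes "quad_equation Q" "m \<noteq> n"
  shows "\<exists>z. fdet m n (evv Q) z \<noteq> 0"
proof (rule ccontr)
  assume "\<not> ?thesis"
  then have 0: "fdet m n (evv Q) z = 0" for z by blast
  have deg: "\<And>v. degree_le v 1 Q" and irr: "irreducible Q" and nd: "\<And>v. \<not> degree_le v 0 Q"
    using assms(1) by (auto simp: quad_equation_def)
  note ma = multiaffine_evv[OF deg] and pe = pol_evv[OF deg]
  have "evv (biquadratic m n Q) z = 0" for z
    using evv_biquadratic[OF ma assms(2)] 0 pe by simp
  then have "biquadratic m n Q = 0" by (rule evv_eq_0D)
  then have "Q dvd pd m Q * pd n Q" unfolding biquadratic_def by (simp add: dvd_def)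
  with irreducible_imp_prime_elem_gcd[OF irr] have "Q dvd pd m Q \<or> Q dvd pd n Q"
    by (rule prime_elem_dvd_multD)
  moreover have False if "Q dvd pd v Q" for v
  proof -
    obtain G where G: "pd v Q = Q * G" using \<open>Q dvd pd v Q\<close> by (elim dvdE)
    have pd: "evv (pd v Q) z = diff_at v (evv Q) z" for z
      using pd_pol[of v "evv Q"] pe evv_pol multiaffine_diff_at[OF ma] by metis
    have pr: "diff_at v (evv Q) z = evv Q z * evv G z" for z
      using pd[of z] G by simp
    have ind: "\<not> indep v (evv Q)"
      using nd[of v] indep_pol_degree[of v "evv Q"] pe by auto
    have "indep v (evv Q) \<or> indep v (evv G)"
      using pr by (intro indep_factor) (simp flip: pr)
    then have iG: "indep v (evv G)" using ind by simp
    have "evv G z = 0" for z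
    proof (rule ccontr)
      assume "evv G z \<noteq> 0"
      moreover obtain a where "diff_at v (evv Q) a \<noteq> 0"
      proof (rule ccontr)
        assume "\<not> thesis"
        then have *: "diff_at v (evv Q) z = 0" for z using that by blast
        have "evv Q (z(v := t)) = evv Q (z(v := 0))" for z t
          using multiaffineD[OF ma, of z v t] *[of z] by (simp add: diff_at_def)
        then show False using ind unfolding indep_def by (metis fun_upd_triv)
      qed
      moreover have "polyfun (diff_at v (evv Q))"
        unfolding polyfun_def using pd by blast
      ultimately obtain z where z: "diff_at v (evv Q) z \<noteq> 0" "evv G z \<noteq> 0"
        using polyfun_mult_nonzero polyfun_evv by blast
      have "evv Q (z(v := t)) * evv G z = diff_at v (evv Q) z" for t
        using pr[of "z(v := t)"] indepD[OF iG] by simp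
      then have "evv Q (z(v := 1)) = evv Q (z(v := 0))"
        using z(2) by (metis mult_cancel_right)
      then show False using z(1) by (simp add: diff_at_def)
    qed
    then have "G = 0" by (rule evv_eq_0D)
    then have "pd v Q = 0" using G by simp
    then have "diff_at v (evv Q) z = 0" for z using pd[of z] by simp
    then have "evv Q (z(v := t)) = evv Q (z(v := 0))" for z t
      using multiaffineD[OF ma, of z v t] by (simp add: diff_at_def)
    then show False using ind unfolding indep_def by (metis fun_upd_triv)
  qed
  ultimately show False by blast
qed

section \<open>Quadrilinear forms and degenerate biquadratics\<close>

type_synonym hpoint = "complex \<times> complex"
type_synonym form = "(vertex \<Rightarrow> hpoint) \<Rightarrow> complex"

definition multilin :: "form \<Rightarrow> bool" where
  "multilin T \<longleftrightarrow> (\<forall>v y s t. T (y(v := (s, t))) = s * T (y(v := (1, 0))) + t * T (y(v := (0, 1))))"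

lemma multilinD: "multilin T \<Longrightarrow> T (y(v := (s, t))) = s * T (y(v := (1, 0))) + t * T (y(v := (0, 1)))"
  unfolding multilin_def by blast

lemma multilin_comb:
  assumes "multilin T"
  shows "T (y(v := (a * fst p + b * fst q, a * snd p + b * snd q))) = a * T (y(v := p)) + b * T (y(v := q))"
  using multilinD[OF assms, of y v "fst p" "snd p"] multilinD[OF assms, of y v "fst q" "snd q"]
    multilinD[OF assms, of y v "a * fst p + b * fst q" "a * snd p + b * snd q"]
  by (simp add: algebra_simps)

lemma multilin_scale:
  assumes "multilin T"
  shows "T (y(v := (a * fst p, a * snd p))) = a * T (y(v := p))"
  using multilin_comb[OF assms, of y v a p 0 p] by simp

definition aff :: "(vertex \<Rightarrow> complex) \<Rightarrow> vertex \<Rightarrow> hpoint" where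
  "aff z v = (z v, 1)"

lemma aff_upd [simp]: "aff (z(v := t)) = (aff z)(v := (t, 1))"
  by (auto simp: aff_def)

lemma aff_pack [simp]: "aff (pack a b c d) = pack (a, 1) (b, 1) (c, 1) (d, 1)"
proof
  fix v show "aff (pack a b c d) v = pack (a, 1) (b, 1) (c, 1) (d, 1) v"
    by (cases v) (simp_all add: aff_def)
qed

text \<open>A linear form on the plane is determined by its values at two independent vectors; the
  vertices are treated one after the other. The two test points are left free so that they can be
  chosen away from the poles of Moebius transformations.\<close>

lemma multilin_eqI:
  assumes T: "multilin T" and S: "multilin S" and ne: "\<And>v. a v \<noteq> b v"
    and eq: "\<And>z. (\<And>v. z v \<in> {a v, b v}) \<Longrightarrow> T (aff z) = S (aff z)"
  shows "T = S"
proof -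
  \<comment> \<open>\<open>A\<close> is the set of vertices where the argument is already arbitrary;
    this step adds \<open>w\<close> to it.\<close>
  have step: "T y = S y"
    if IH: "\<And>y. (\<And>v. v \<notin> A \<Longrightarrow> y v \<in> {(a v, 1), (b v, 1)}) \<Longrightarrow> T y = S y"
      and y: "\<And>v. v \<notin> insert w A \<Longrightarrow> y v \<in> {(a v, 1), (b v, 1)}" for A w y
  proof -
    obtain s t where st: "y w = (s, t)" by force
    \<comment> \<open>Coordinates of \<open>(s, t)\<close> in the basis \<open>(a w, 1)\<close>,
      \<open>(b w, 1)\<close>, by Cramer's rule.\<close>
    define c d where "c = (s - t * b w) / (a w - b w)" and "d = (t * a w - s) / (a w - b w)"
    have "a w - b w \<noteq> 0" using ne[of w] by simp
    then have "c * a w + d * b w = s" "c + d = t"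
      by (simp_all add: c_def d_def flip: add_divide_distrib) (simp_all add: field_simps)
    then have *: "y = y(w := (c * fst (a w, 1) + d * fst (b w, 1), c * snd (a w, 1::complex) + d * snd (b w, 1::complex)))"
      using st by auto
    have 1: "T (y(w := (a w, 1))) = S (y(w := (a w, 1)))"
      by (rule IH) (use y in auto)
    have 2: "T (y(w := (b w, 1))) = S (y(w := (b w, 1)))"
      by (rule IH) (use y in auto)
    have 3: "R y = c * R (y(w := (a w, 1))) + d * R (y(w := (b w, 1)))" if "multilin R" for R
      using multilin_comb[OF that, of y w c "(a w, 1)" d "(b w, 1)"] unfolding *[symmetric] .
    show ?thesis by (simp add: 3[OF T] 3[OF S] 1 2)
  qed
  have 0: "T y = S y" if y: "\<And>v. v \<notin> {} \<Longrightarrow> y v \<in> {(a v, 1), (b v, 1)}" for y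
  proof -
    have "snd (y v) = 1" "fst (y v) \<in> {a v, b v}" for v using y[of v] by auto
    moreover from this have "y = aff (\<lambda>v. fst (y v))" by (auto simp: aff_def prod_eq_iff)
    ultimately show ?thesis using eq[of "\<lambda>v. fst (y v)"] by metis
  qed
  note 1 = step[where A = "{}" and w = X, OF 0]
  note 2 = step[where A = "{X}" and w = X1, OF 1]
  note 3 = step[where A = "{X1, X}" and w = X2, OF 2]
  note 4 = step[where A = "{X2, X1, X}" and w = X12, OF 3]
  show ?thesis
  proof
    fix y show "T y = S y"
    proof (rule 4)
      fix v assume "v \<notin> {X12, X2, X1, X}"
      then show "y v \<in> {(a v, 1), (b v, 1)}" by (cases v) auto
    qed auto
  qed
qed

lemma multilin_eqI':
  assumes "multilin T" "multilin S" "\<And>z. T (aff z) = S (aff z)"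
  shows "T = S"
  by (rule multilin_eqI[OF assms(1,2), of "\<lambda>_. 0" "\<lambda>_. 1"]) (simp_all add: assms(3))

text \<open>For affine \<open>g\<close> this is the linear form with value \<open>g x\<close> at
  \<open>(x, 1)\<close>; at the point at infinity \<open>(1, 0)\<close> it takes the leading
  coefficient.\<close>

definition hlin :: "(complex \<Rightarrow> complex) \<Rightarrow> hpoint \<Rightarrow> complex" where
  "hlin g p = fst p * (g 1 - g 0) + snd p * g 0"

text \<open>The homogenization of a multiaffine function.\<close>

definition hom :: "((vertex \<Rightarrow> complex) \<Rightarrow> complex) \<Rightarrow> form" where
  "hom f y = hlin (\<lambda>x. hlin (\<lambda>x1. hlin (\<lambda>x2. hlin (\<lambda>x12. f (pack x x1 x2 x12)) (y X12)) (y X2)) (y X1)) (y X)"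

lemma multilin_hom: "multilin (hom f)"
  unfolding multilin_def
proof (intro allI)
  fix v y s t
  show "hom f (y(v := (s, t))) = s * hom f (y(v := (1, 0))) + t * hom f (y(v := (0, 1)))"
    by (cases v) (simp_all add: hom_def hlin_def algebra_simps)
qed

lemma hom_aff:
  assumes "multiaffine f"
  shows "hom f (aff z) = f z"
proof -
  have "hlin g (c, 1) = g c" if "\<And>t. g t = g 0 + t * (g 1 - g 0)" for g c
    using that[of c] by (simp add: hlin_def)
  note h = this
  have m: "f (pack x x1 x2 x12) = f (pack x x1 x2 0) + x12 * (f (pack x x1 x2 1) - f (pack x x1 x2 0))"
    "f (pack x x1 x2 x12) = f (pack x x1 0 x12) + x2 * (f (pack x x1 1 x12) - f (pack x x1 0 x12))"
    "f (pack x x1 x2 x12) = f (pack x 0 x2 x12) + x1 * (f (pack x 1 x2 x12) - f (pack x 0 x2 x12))"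
    "f (pack x x1 x2 x12) = f (pack 0 x1 x2 x12) + x * (f (pack 1 x1 x2 x12) - f (pack 0 x1 x2 x12))"
    for x x1 x2 x12
    using multiaffineD[OF assms, of "pack x x1 x2 x12" X12 x12]
      multiaffineD[OF assms, of "pack x x1 x2 x12" X2 x2]
      multiaffineD[OF assms, of "pack x x1 x2 x12" X1 x1]
      multiaffineD[OF assms, of "pack x x1 x2 x12" X x] by simp_all
  have "hlin (\<lambda>x12. f (pack x x1 x2 x12)) (c, 1) = f (pack x x1 x2 c)" for x x1 x2 c by (rule h) (rule m)
  moreover have "hlin (\<lambda>x2. f (pack x x1 x2 x12)) (c, 1) = f (pack x x1 c x12)" for x x1 x12 c by (rule h) (rule m)
  moreover have "hlin (\<lambda>x1. f (pack x x1 x2 x12)) (c, 1) = f (pack x c x2 x12)" for x x2 x12 c by (rule h) (rule m)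
  moreover have "hlin (\<lambda>x. f (pack x x1 x2 x12)) (c, 1) = f (pack c x1 x2 x12)" for x1 x2 x12 c by (rule h) (rule m)
  ultimately show ?thesis by (simp add: hom_def aff_def)
qed

text \<open>Minus the determinant of the bilinear form left in \<open>m\<close> and
  \<open>n\<close>; as a function of the other two arguments it is the homogenised
  biquadratic.\<close>

definition tdet :: "vertex \<Rightarrow> vertex \<Rightarrow> form \<Rightarrow> form" where
  "tdet m n T y = T (y(m := (1, 0), n := (0, 1))) * T (y(m := (0, 1), n := (1, 0)))
     - T (y(m := (1, 0), n := (1, 0))) * T (y(m := (0, 1), n := (0, 1)))"

text \<open>\<open>(1, 1)\<close> is the sum of the basis vectors, so passing from the points
  \<open>(1, 1)\<close>, \<open>(0, 1)\<close> to \<open>(1, 0)\<close>, \<open>(0, 1)\<close> is a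
  row and a column operation, which leaves the determinant unchanged.\<close>

lemma fdet_tdet:
  assumes f: "multiaffine f" and "m \<noteq> n"
  shows "fdet m n f z = tdet m n (hom f) (aff z)"
proof -
  have u: "y(n := s, m := t) = y(m := t, n := s)" for y :: "vertex \<Rightarrow> hpoint" and s t
    using assms(2) by (simp add: fun_upd_twist)
  have 1: "T (y(m := p, n := (1, 1))) = T (y(m := p, n := (1, 0))) + T (y(m := p, n := (0, 1)))"
    "T (y(m := (1, 1), n := p)) = T (y(m := (1, 0), n := p)) + T (y(m := (0, 1), n := p))"
    if "multilin T" for T y p
    using multilinD[OF that, of "y(m := p)" n 1 1] multilinD[OF that, of "y(n := p)" m 1 1] by (simp_all add: u)
  have "f z = hom f (aff z)" for z using hom_aff[OF f] by simp
  then show ?thesis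
    unfolding fdet_def tdet_def by (simp add: 1[OF multilin_hom] algebra_simps)
qed

lemma tdet_commute:
  assumes "m \<noteq> n" shows "tdet m n T y = tdet n m T y"
  unfolding tdet_def using assms by (simp add: fun_upd_twist algebra_simps)

text \<open>A factor in one variable is represented by its root \<open>p\<close>; the root
  \<open>(1, 0)\<close> is the factor at infinity.\<close>

definition hdeg :: "vertex \<Rightarrow> vertex \<Rightarrow> form \<Rightarrow> bool" where
  "hdeg i j T \<longleftrightarrow> (\<exists>k\<in>{i, j}. \<exists>p. p \<noteq> (0, 0) \<and>
     (\<forall>m n y. {i, j, m, n} = UNIV \<longrightarrow> y k = p \<longrightarrow> tdet m n T y = 0))"

lemma UNIV_distinct: "{i, j, m, n} = (UNIV :: vertex set) \<longleftrightarrow> distinct [i, j, m, n]"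
proof
  assume "{i, j, m, n} = (UNIV :: vertex set)"
  moreover have "card (UNIV :: vertex set) = 4" by (simp add: UNIV_vertex)
  ultimately have "card (set [i, j, m, n]) = 4" by simp
  then show "distinct [i, j, m, n]" by (intro card_distinct) simp
next
  assume "distinct [i, j, m, n]"
  then have "card (set [i, j, m, n]) = 4" by (subst distinct_card) auto
  moreover have "card (UNIV :: vertex set) = 4" "finite (UNIV :: vertex set)" by (simp_all add: UNIV_vertex)
  ultimately show "{i, j, m, n} = (UNIV :: vertex set)" by (intro card_subset_eq) auto
qed

text \<open>Each of the four matrix entries is linear in \<open>y k\<close>, so the determinant is a
  quadratic form there; its mixed coefficient is recovered from the value at
  \<open>(1, 1)\<close>.\<close>

lemma tdet_quadratic:
  assumes T: "multilin T" and k: "k \<noteq> m" "k \<noteq> n"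
  shows "tdet m n T (y(k := (s, t))) = s\<^sup>2 * tdet m n T (y(k := (1, 0)))
    + s * t * (tdet m n T (y(k := (1, 1))) - tdet m n T (y(k := (1, 0))) - tdet m n T (y(k := (0, 1))))
    + t\<^sup>2 * tdet m n T (y(k := (0, 1)))"
proof -
  have u: "y(k := r, m := p, n := q) = y(m := p, n := q, k := r)" for p q r
    using k by (simp add: fun_upd_twist)
  have 1: "T (y(m := p, n := q, k := (s, t))) = s * T (y(m := p, n := q, k := (1, 0))) + t * T (y(m := p, n := q, k := (0, 1)))"
    for p q s t by (rule multilinD[OF T])
  show ?thesis
    unfolding tdet_def u 1[of _ _ s t] 1[of _ _ 1 1] by (simp add: power2_eq_square algebra_simps)
qed

text \<open>Sorting a biquadratic by powers of the variable of \<open>k\<close> makes both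
  alternatives in \<open>degenerate\<close> visible: a drop of the degree means
  \<open>c = 0\<close>, and a factor means a root common to all values of the variable of
  \<open>l\<close>.\<close>

definition bi :: "vertex \<Rightarrow> vertex \<Rightarrow> complex poly \<Rightarrow> complex poly \<Rightarrow> complex poly \<Rightarrow> poly4" where
  "bi k l a b c = poly_in l a + poly_in l b * var k + poly_in l c * var k ^ 2"

lemma evv_poly_in: "evv (poly_in v p) z = poly p (z v)"
proof (induction p)
  case 0
  then show ?case by (simp add: poly_in_def)
next
  case (pCons a p)
  then show ?case by (simp add: poly_in_def map_poly_pCons)
qed

lemma evv_bi: "evv (bi k l a b c) z = poly a (z l) + poly b (z l) * z k + poly c (z l) * (z k)\<^sup>2"
  by (simp add: bi_def evv_poly_in)

lemma degree_le_bi: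
  assumes "k \<noteq> l" "degree a \<le> 2" "degree b \<le> 2" "degree c \<le> 2"
  shows "degree_le k 1 (bi k l a b c) \<longleftrightarrow> c = 0"
proof -
  have q: "\<exists>a0 a1 a2. p = [:a0, a1, a2:]" if "degree p \<le> 2" for p :: "complex poly"
    by (rule exI[of _ "coeff p 0"], rule exI[of _ "coeff p 1"], rule exI[of _ "coeff p 2"], rule poly_eqI)
      (use that in \<open>auto simp: coeff_pCons coeff_eq_0 numeral_2_eq_2 split: nat.splits\<close>)
  obtain a0 a1 a2 b0 b1 b2 c0 c1 c2 where *: "a = [:a0, a1, a2:]" "b = [:b0, b1, b2:]" "c = [:c0, c1, c2:]"
    using q assms by metis
  have m: "map_poly (\<lambda>a. [:[:[:[:a:]:]:]:]) [:a0, a1, a2:] =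
    [:[:[:[:[:a0:]:]:]:], [:[:[:[:a1:]:]:]:], [:[:[:[:a2:]:]:]:]:]" for a0 a1 a2 :: complex
    by (simp add: map_poly_pCons)
  show ?thesis
    using assms(1)
    apply (cases k; cases l)
    apply (simp_all add: bi_def * poly_in_def m power2_eq_square)
    apply (auto simp: coeff_pCons split: nat.splits)
    done
qed

text \<open>Over the complex numbers a nonconstant factor has a root \<open>r\<close>. Conversely,
  if the quadratic vanishes at \<open>r\<close>, division by the linear factor leaves
  \<open>b + c (x_k + r)\<close>.\<close>

lemma dvd_bi:
  assumes "k \<noteq> l"
  shows "(\<exists>p. degree p > 0 \<and> poly_in k p dvd bi k l a b c) \<longleftrightarrow>
    (\<exists>r. \<forall>z. evv (bi k l a b c) (z(k := r)) = 0)" (is "?L \<longleftrightarrow> ?R")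
proof
  assume ?L
  then obtain p G where p: "degree p > 0" "bi k l a b c = poly_in k p * G" by (auto simp: dvd_def)
  obtain r where "poly p r = 0"
    using p(1) fundamental_theorem_of_algebra[of p] by (auto simp: constant_degree)
  then have "evv (bi k l a b c) (z(k := r)) = 0" for z by (simp add: p(2) evv_poly_in)
  then show ?R by blast
next
  assume ?R
  then obtain r where r: "\<And>z. evv (bi k l a b c) (z(k := r)) = 0" by blast
  have r': "poly a x + poly b x * r + poly c x * r\<^sup>2 = 0" for x
    using r[of "\<lambda>_. x"] assms by (simp add: evv_bi)
  define R :: poly4 where "R = [:[:[:[:r:]:]:]:]"
  have R: "evv R z = r" for z by (simp only: R_def evv_const)
  have "bi k l a b c = poly_in k [:- r, 1:] * (poly_in l b + poly_in l c * (var k + R))"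
  proof (rule evv_inject)
    fix z
    have p: "poly [:- r, 1:] x = x - r" for x by simp
    show "evv (bi k l a b c) z = evv (poly_in k [:- r, 1:] * (poly_in l b + poly_in l c * (var k + R))) z"
      unfolding evv_bi evv_simps evv_poly_in evv_var R p using r'[of "z l"] by algebra
  qed
  then have "poly_in k [:- r, 1:] dvd bi k l a b c" by simp
  then show ?L by (intro exI[of _ "[:- r, 1:]"]) simp
qed

lemma tdet_cong:
  assumes "distinct [k, l, m, n]" "y k = y' k" "y l = y' l"
  shows "tdet m n T y = tdet m n T y'"
proof -
  have U: "{k, l, m, n} = (UNIV :: vertex set)" using assms(1) UNIV_distinct by blast
  have "y(m := p, n := q) = y'(m := p, n := q)" for p q
  proof
    fix v
    have "v \<in> {k, l, m, n}" using U by simp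
    then show "(y(m := p, n := q)) v = (y'(m := p, n := q)) v" using assms(2,3) by auto
  qed
  then show ?thesis by (simp add: tdet_def)
qed

text \<open>A finite root \<open>(r, 1)\<close> of the form corresponds to the factor
  \<open>x_k - r\<close>, and the root \<open>(1, 0)\<close> to a drop of the degree below
  2.\<close>

lemma degenerate_root_iff:
  assumes f: "multiaffine f" and d: "distinct [k, l, m, n]"
  shows "(\<exists>p. degree p > 0 \<and> poly_in k p dvd biquadratic m n (pol f)) \<or>
      degree_le k 1 (biquadratic m n (pol f)) \<longleftrightarrow>
    (\<exists>p. p \<noteq> (0, 0) \<and> (\<forall>y. y k = p \<longrightarrow> tdet m n (hom f) y = 0))"
proof -
  define T where "T = hom f"
  have T: "multilin T" by (simp add: T_def multilin_hom)
  define D where "D p q = tdet m n T ((\<lambda>_. (0, 0))(k := p, l := q))" for p q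
  have D: "tdet m n T y = D (y k) (y l)" for y
    unfolding D_def by (rule tdet_cong[OF d]) (use d in auto)
  have c1: "D (s, t) q = s\<^sup>2 * D (1, 0) q + s * t * (D (1, 1) q - D (1, 0) q - D (0, 1) q) + t\<^sup>2 * D (0, 1) q" for s t q
    using tdet_quadratic[OF T, of k m n "(\<lambda>_. (0, 0))(l := q)" s t] d unfolding D_def by (simp add: fun_upd_twist)
  have c2: "D p (s, t) = s\<^sup>2 * D p (1, 0) + s * t * (D p (1, 1) - D p (1, 0) - D p (0, 1)) + t\<^sup>2 * D p (0, 1)" for s t p
    using tdet_quadratic[OF T, of l m n "(\<lambda>_. (0, 0))(k := p)" s t] d unfolding D_def by simp
  \<comment> \<open>The quadratic in the variable of \<open>l\<close> that remains when
    \<open>p\<close> is inserted at \<open>k\<close>.\<close>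
  define P where "P p = [:D p (0, 1), D p (1, 1) - D p (1, 0) - D p (0, 1), D p (1, 0):]" for p
  have P: "poly (P p) x = D p (x, 1)" for p x
    unfolding P_def c2[of p x 1] by (simp add: algebra_simps power2_eq_square)
  have dP: "degree (P p) \<le> 2" for p by (simp add: P_def)
  \<comment> \<open>The coefficients of 1, \<open>x_k\<close> and \<open>x_k^2\<close>, the middle
    one by polarisation.\<close>
  define A B C where "A = P (0, 1)" and "B = P (1, 1) - P (1, 0) - P (0, 1)" and "C = P (1, 0)"
  have dB: "degree B \<le> 2" unfolding B_def by (intro degree_diff_le dP)
  have h: "biquadratic m n (pol f) = bi k l A B C"
  proof (rule evv_inject)
    fix z
    have "evv (biquadratic m n (pol f)) z = D (z k, 1) (z l, 1)"
      using evv_biquadratic[OF f, of m n z] fdet_tdet[OF f, of m n z] d D[of "aff z"]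
      by (simp add: T_def aff_def)
    then show "evv (biquadratic m n (pol f)) z = evv (bi k l A B C) z"
      unfolding c1[of "z k" 1] by (simp add: evv_bi A_def B_def C_def P)
  qed
  define Z where "Z p \<longleftrightarrow> (\<forall>y. y k = p \<longrightarrow> tdet m n T y = 0)" for p
  have Z_D: "Z p \<longleftrightarrow> (\<forall>q. D p q = 0)" for p
  proof
    assume z: "Z p"
    show "\<forall>q. D p q = 0"
    proof
      fix q
      have "((\<lambda>_. (0::complex, 0::complex))(k := p, l := q)) k = p" using d by simp
      then show "D p q = 0" using z unfolding Z_def D_def by blast
    qed
  next
    assume "\<forall>q. D p q = 0"
    then show "Z p" unfolding Z_def D by (simp del: split_paired_All)
  qed
  have Z_P: "Z p \<longleftrightarrow> P p = 0" for p
  proof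
    assume "Z p" then show "P p = 0" unfolding Z_D P_def by simp
  next
    assume "P p = 0"
    then have "D p (0, 1) = 0 \<and> D p (1, 1) - D p (1, 0) - D p (0, 1) = 0 \<and> D p (1, 0) = 0"
      unfolding P_def pCons_eq_0_iff by blast
    then have "D p (0, 1) = 0 \<and> D p (1, 1) = 0 \<and> D p (1, 0) = 0" by auto
    then have "D p (s, t) = 0" for s t unfolding c2[of p s t] by simp
    then show "Z p" unfolding Z_D by auto
  qed
  have "degree_le k 1 (bi k l A B C) \<longleftrightarrow> Z (1, 0)"
    using degree_le_bi[of k l A B C] d dP dB by (simp add: A_def C_def Z_P)
  moreover have "(\<exists>p. degree p > 0 \<and> poly_in k p dvd bi k l A B C) \<longleftrightarrow> (\<exists>r. Z (r, 1))"
  proof -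
    have "(\<forall>z. evv (bi k l A B C) (z(k := r)) = 0) \<longleftrightarrow> Z (r, 1)" for r
    proof -
      have e: "evv (bi k l A B C) (z(k := r)) = poly (P (r, 1)) (z l)" for z
      proof -
        have "l \<noteq> k" using d by auto
        then show ?thesis
          unfolding P c1[of r 1] by (simp add: evv_bi A_def B_def C_def P)
      qed
      have "(\<forall>z. poly (P (r, 1)) (z l) = 0) \<longleftrightarrow> P (r, 1) = 0"
      proof
        assume a: "\<forall>z. poly (P (r, 1)) (z l) = 0"
        have "poly (P (r, 1)) x = 0" for x using a by (auto dest: spec[of _ "\<lambda>_. x"])
        then show "P (r, 1) = 0" using poly_all_0_iff_0 by blast
      qed simp
      then show ?thesis by (simp add: e Z_P)
    qed
    then show ?thesis using dvd_bi[of k l A B C] d by simp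
  qed
  moreover have "(\<exists>p. p \<noteq> (0, 0) \<and> Z p) \<longleftrightarrow> (\<exists>r. Z (r, 1)) \<or> Z (1, 0)"
  proof
    assume "\<exists>p. p \<noteq> (0, 0) \<and> Z p"
    then obtain s t where st: "(s, t) \<noteq> (0, 0)" "Z (s, t)" by auto
    show "(\<exists>r. Z (r, 1)) \<or> Z (1, 0)"
    proof (cases "t = 0")
      case True
      then have "s\<^sup>2 * D (1, 0) q = 0" for q using st(2) c1[of s t q] by (cases q) (simp add: Z_D)
      then show ?thesis using st(1) True by (simp add: Z_D)
    next
      case False
      have "t\<^sup>2 * D (s / t, 1) q = D (s, t) q" for q
        unfolding c1[of s t] c1[of "s / t" 1] using False by (simp add: field_simps power2_eq_square)
      then have "t\<^sup>2 * D (s / t, 1) q = 0" for q using st(2) by (cases q) (simp add: Z_D)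
      then have "D (s / t, 1) q = 0" for q using False by simp
      then show ?thesis by (auto simp: Z_D)
    qed
  next
    assume "(\<exists>r. Z (r, 1)) \<or> Z (1, 0)"
    moreover have "(r, 1) \<noteq> (0, 0 :: complex)" "(1 :: complex, 0 :: complex) \<noteq> (0, 0)" for r :: complex by simp_all
    ultimately show "\<exists>p. p \<noteq> (0, 0) \<and> Z p" by blast
  qed
  ultimately show ?thesis unfolding h Z_def T_def by blast
qed

lemma hdeg_iff:
  assumes d: "distinct [i, j, m, n]"
  shows "hdeg i j T \<longleftrightarrow> (\<exists>k\<in>{i, j}. \<exists>p. p \<noteq> (0, 0) \<and> (\<forall>y. y k = p \<longrightarrow> tdet m n T y = 0))"
proof -
  have "{i, j, m, n} = UNIV" using d UNIV_distinct by blast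
  moreover have "tdet m' n' T y = tdet m n T y" if "{i, j, m', n'} = UNIV" for m' n' y
  proof -
    have "distinct [i, j, m', n']" using that UNIV_distinct by blast
    moreover have "{m', n'} \<subseteq> {i, j, m, n}" "{m, n} \<subseteq> {i, j, m', n'}"
      unfolding that \<open>{i, j, m, n} = UNIV\<close> by auto
    ultimately have "m' = m \<and> n' = n \<or> m' = n \<and> n' = m" using d by auto
    then show ?thesis using tdet_commute d by auto
  qed
  ultimately show ?thesis unfolding hdeg_def by metis
qed

lemma degenerate_iff_hdeg:
  assumes f: "multiaffine f" and d: "distinct [i, j, m, n]"
  shows "degenerate i j (biquadratic m n (pol f)) \<longleftrightarrow> hdeg i j (hom f)"
proof -
  have "distinct [j, i, m, n]" using d by auto
  then show ?thesis
    unfolding degenerate_def hdeg_iff[OF d]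
    using degenerate_root_iff[OF f d] degenerate_root_iff[OF f, of j i m n] by simp
qed

lemma hdeg_commute: "hdeg i j T = hdeg j i T"
  unfolding hdeg_def by (simp add: insert_commute)

lemma complement_pair: "(i :: vertex) \<noteq> j \<Longrightarrow> \<exists>m n. distinct [i, j, m, n]"
  by (cases i; cases j) (auto simp: ex_vertex)

lemma degenerate_pairs_pol:
  assumes f: "multiaffine f"
  shows "degenerate_pairs (pol f) = {{i, j} |i j. i \<noteq> j \<and> hdeg i j (hom f)}"
proof (intro subset_antisym subsetI)
  fix e assume "e \<in> degenerate_pairs (pol f)"
  then obtain i j m n where "e = {i, j}" and d: "distinct [i, j, m, n]"
    and "degenerate i j (biquadratic m n (pol f))"
    unfolding degenerate_pairs_def UNIV_distinct by blast
  then have "i \<noteq> j" "hdeg i j (hom f)" using degenerate_iff_hdeg[OF f d] by simp_all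
  with \<open>e = {i, j}\<close> show "e \<in> {{i, j} |i j. i \<noteq> j \<and> hdeg i j (hom f)}" by blast
next
  fix e assume "e \<in> {{i, j} |i j. i \<noteq> j \<and> hdeg i j (hom f)}"
  then obtain i j where e: "e = {i, j}" "i \<noteq> j" "hdeg i j (hom f)" by blast
  obtain m n where d: "distinct [i, j, m, n]" using complement_pair[OF e(2)] by blast
  then have "degenerate i j (biquadratic m n (pol f))" using degenerate_iff_hdeg[OF f d] e(3) by simp
  then show "e \<in> degenerate_pairs (pol f)"
    unfolding degenerate_pairs_def UNIV_distinct using e(1) d by blast
qed

section \<open>Null pairs\<close>

definition null_pair :: "form \<Rightarrow> vertex \<Rightarrow> hpoint \<Rightarrow> vertex \<Rightarrow> hpoint \<Rightarrow> bool" where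
  "null_pair T k p m a \<longleftrightarrow> k \<noteq> m \<and> p \<noteq> (0, 0) \<and> a \<noteq> (0, 0) \<and> (\<forall>y. y k = p \<longrightarrow> y m = a \<longrightarrow> T y = 0)"

text \<open>The hypotheses are the coefficients of the determinant of \<open>M + t M'\<close>, for
  the matrices with rows \<open>(a, b)\<close>, \<open>(c, d)\<close> and \<open>(a', b')\<close>,
  \<open>(c', d')\<close>: the whole pencil is singular. The two alternatives are a common left and
  a common right kernel vector. If \<open>a\<close> is nonzero, the product of
  \<open>a c' - a' c\<close> (first columns) and \<open>a b' - a' b\<close> (first rows) vanishes,
  and the factor that is zero decides the side.\<close>

lemma singular_pencil:
  fixes a b c d a' b' c' d' :: complex
  assumes "a * d = b * c" "a' * d' = b' * c'" "a * d' + a' * d = b * c' + b' * c"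
  shows "\<exists>u v. (u, v) \<noteq> (0, 0) \<and>
    (u * a + v * c = 0 \<and> u * b + v * d = 0 \<and> u * a' + v * c' = 0 \<and> u * b' + v * d' = 0 \<or>
     u * a + v * b = 0 \<and> u * c + v * d = 0 \<and> u * a' + v * b' = 0 \<and> u * c' + v * d' = 0)"
    (is "?P a b c d a' b' c' d'")
proof -
  have main: "?P a b c d a' b' c' d'"
    if e: "a * d = b * c" "a' * d' = b' * c'" "a * d' + a' * d = b * c' + b' * c" and a: "a \<noteq> 0"
    for a b c d a' b' c' d' :: complex
  proof -
    have e3: "a * (a * d') + a' * (b * c) = a * (b * c' + b' * c)"
      using e(1,3) by (metis distrib_left mult.left_commute)
    have "(a * c' - a' * c) * (a * b' - a' * b) = a * a * (b' * c') - a' * (a * (b * c' + b' * c)) + a' * a' * (b * c)"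
      by (simp add: algebra_simps)
    also have "\<dots> = 0" unfolding e(2)[symmetric] e3[symmetric] by (simp add: algebra_simps)
    finally consider "a * c' = a' * c" | "a * b' = a' * b" by auto
    then show ?thesis
    proof cases
      case 1
      have "a * (a * d') = a * (b * c') + a * (b' * c) - a' * (b * c)" using e3 by (simp add: algebra_simps)
      moreover have "a * (b * c') = a' * (b * c)" using 1 by (simp add: ac_simps)
      ultimately have "a * (a * d') = a * (b' * c)" by simp
      then have "a * d' = b' * c" using a by simp
      then show ?thesis using 1 a e(1)
        by (intro exI[of _ c] exI[of _ "- a"]) (auto simp: algebra_simps)
    next
      case 2
      have "a * (a * d') = a * (b * c') + a * (b' * c) - a' * (b * c)" using e3 by (simp add: algebra_simps)
      moreover have "a * (b' * c) = a' * (b * c)" using 2 by (simp add: ac_simps)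
      ultimately have "a * (a * d') = a * (b * c')" by simp
      then have "a * d' = b * c'" using a by simp
      then show ?thesis using 2 a e(1)
        by (intro exI[of _ b] exI[of _ "- a"]) (auto simp: algebra_simps)
    qed
  qed
  \<comment> \<open>Swapping the rows or the columns of both matrices moves any nonzero entry to the
    upper left corner.\<close>
  have rows: "?P a b c d a' b' c' d'" if P: "?P c d a b c' d' a' b'" for a b c d a' b' c' d' :: complex
  proof -
    obtain u v where "(u, v) \<noteq> (0, 0)"
      "u * c + v * a = 0 \<and> u * d + v * b = 0 \<and> u * c' + v * a' = 0 \<and> u * d' + v * b' = 0 \<or>
       u * c + v * d = 0 \<and> u * a + v * b = 0 \<and> u * c' + v * d' = 0 \<and> u * a' + v * b' = 0"
      using P by blast
    then show ?thesis
    proof (elim disjE)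
      assume "u * c + v * a = 0 \<and> u * d + v * b = 0 \<and> u * c' + v * a' = 0 \<and> u * d' + v * b' = 0"
      with \<open>(u, v) \<noteq> (0, 0)\<close> show ?thesis
        by (intro exI[of _ v] exI[of _ u]) (auto simp: add.commute)
    next
      assume "u * c + v * d = 0 \<and> u * a + v * b = 0 \<and> u * c' + v * d' = 0 \<and> u * a' + v * b' = 0"
      with \<open>(u, v) \<noteq> (0, 0)\<close> show ?thesis
        by (intro exI[of _ u] exI[of _ v]) auto
    qed
  qed
  have columns: "?P a b c d a' b' c' d'" if P: "?P b a d c b' a' d' c'" for a b c d a' b' c' d' :: complex
  proof -
    obtain u v where "(u, v) \<noteq> (0, 0)"
      "u * b + v * d = 0 \<and> u * a + v * c = 0 \<and> u * b' + v * d' = 0 \<and> u * a' + v * c' = 0 \<or>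
       u * b + v * a = 0 \<and> u * d + v * c = 0 \<and> u * b' + v * a' = 0 \<and> u * d' + v * c' = 0"
      using P by blast
    then show ?thesis
    proof (elim disjE)
      assume "u * b + v * d = 0 \<and> u * a + v * c = 0 \<and> u * b' + v * d' = 0 \<and> u * a' + v * c' = 0"
      with \<open>(u, v) \<noteq> (0, 0)\<close> show ?thesis
        by (intro exI[of _ u] exI[of _ v]) auto
    next
      assume "u * b + v * a = 0 \<and> u * d + v * c = 0 \<and> u * b' + v * a' = 0 \<and> u * d' + v * c' = 0"
      with \<open>(u, v) \<noteq> (0, 0)\<close> show ?thesis
        by (intro exI[of _ v] exI[of _ u]) (auto simp: add.commute)
    qed
  qed
  have entry: "?P a b c d a' b' c' d'"
    if e: "a * d = b * c" "a' * d' = b' * c'" "a * d' + a' * d = b * c' + b' * c"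
      and nz: "a \<noteq> 0 \<or> b \<noteq> 0 \<or> c \<noteq> 0 \<or> d \<noteq> 0" for a b c d a' b' c' d' :: complex
  proof -
    from nz consider "a \<noteq> 0" | "b \<noteq> 0" | "c \<noteq> 0" | "d \<noteq> 0" by blast
    then show ?thesis
    proof cases
      case 1
      then show ?thesis by (rule main[OF e])
    next
      case 2
      show ?thesis
        by (rule columns, rule main) (use 2 e in \<open>simp_all add: ac_simps\<close>)
    next
      case 3
      show ?thesis
        by (rule rows, rule main) (use 3 e in \<open>simp_all add: ac_simps\<close>)
    next
      case 4
      show ?thesis
        by (rule rows, rule columns, rule main) (use 4 e in \<open>simp_all add: ac_simps\<close>)
    qed
  qed
  show ?thesis
  proof (cases "a = 0 \<and> b = 0 \<and> c = 0 \<and> d = 0")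
    case False
    then show ?thesis by (intro entry assms) blast
  next
    case z: True
    show ?thesis
    proof (cases "a' = 0 \<and> b' = 0 \<and> c' = 0 \<and> d' = 0")
      case True
      then show ?thesis using z by (intro exI[of _ 1] exI[of _ 0]) simp
    next
      case False
      have "?P a' b' c' d' a b c d"
        by (rule entry) (use False z assms(2) in auto)
      then show ?thesis using z by blast
    qed
  qed
qed

lemma multilin_expand:
  assumes T: "multilin T"
  shows "T (y(v := p)) = fst p * T (y(v := (1, 0))) + snd p * T (y(v := (0, 1)))"
  using multilinD[OF T, of y v "fst p" "snd p"] by simp

text \<open>With \<open>p\<close> inserted at \<open>k\<close>, the matrices in \<open>m\<close>,
  \<open>n\<close> depend linearly on the value at \<open>l\<close> and are all singular. The two
  basis vectors and their sum give the hypotheses of \<open>singular_pencil\<close>; the kernel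
  vector does not depend on the value at \<open>l\<close>, so it is the second value of a null
  pair.\<close>

lemma tdet_zero_null_pair:
  assumes T: "multilin T" and d: "distinct [k, l, m, n]" and p: "p \<noteq> (0, 0)"
    and z: "\<And>y. y k = p \<Longrightarrow> tdet m n T y = 0"
  shows "\<exists>a. null_pair T k p m a \<or> null_pair T k p n a"
proof -
  define t where "t q r s = T ((\<lambda>_. (0, 0))(k := p, l := q, m := r, n := s))" for q r s
  have t: "T y = t (y l) (y m) (y n)" if "y k = p" for y
  proof -
    have "y = (\<lambda>_. (0, 0))(k := p, l := y l, m := y m, n := y n)"
    proof
      fix v
      have "v \<in> {k, l, m, n}" using d UNIV_distinct by blast
      then show "y v = ((\<lambda>_. (0, 0))(k := p, l := y l, m := y m, n := y n)) v" using that d by auto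
    qed
    then show ?thesis unfolding t_def by simp
  qed
  have ln: "t q r (a, b) = a * t q r (1, 0) + b * t q r (0, 1)" for q r a b
    unfolding t_def by (rule multilinD[OF T])
  have um: "(\<lambda>_. (0::complex, 0::complex))(k := p, l := q, m := r, n := s) = (\<lambda>_. (0, 0))(k := p, l := q, n := s, m := r)" for q r s
    using d by (auto simp: fun_eq_iff)
  have ul: "(\<lambda>_. (0::complex, 0::complex))(k := p, l := q, m := r, n := s) = (\<lambda>_. (0, 0))(k := p, m := r, n := s, l := q)" for q r s
    using d by (auto simp: fun_eq_iff)
  have lm: "t q (a, b) s = a * t q (1, 0) s + b * t q (0, 1) s" for q s a b
    unfolding t_def um by (rule multilinD[OF T])
  have ll: "t (a, b) r s = a * t (1, 0) r s + b * t (0, 1) r s" for r s a b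
    unfolding t_def ul by (rule multilinD[OF T])
  define e f :: hpoint where "e = (1, 0)" and "f = (0, 1)"
  have det: "t q e f * t q f e = t q e e * t q f f" for q
  proof -
    define y where "y = (\<lambda>_. (0::complex, 0::complex))(k := p, l := q)"
    have y: "y k = p" "y l = q" using d by (auto simp: y_def)
    have "tdet m n T y = 0" using z y by blast
    then show ?thesis unfolding tdet_def using d y by (simp add: t e_def f_def)
  qed
  note 1 = det[of e] det[of f] det[of "(1, 1)"]
  have 2: "t (1, 1) r s = t e r s + t f r s" for r s using ll[of 1 1 r s] by (simp add: e_def f_def)
  have "\<exists>u v. (u, v) \<noteq> (0, 0) \<and>
    (u * t e e e + v * t e f e = 0 \<and> u * t e e f + v * t e f f = 0 \<and>
     u * t f e e + v * t f f e = 0 \<and> u * t f e f + v * t f f f = 0 \<or>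
     u * t e e e + v * t e e f = 0 \<and> u * t e f e + v * t e f f = 0 \<and>
     u * t f e e + v * t f e f = 0 \<and> u * t f f e + v * t f f f = 0)"
    by (rule singular_pencil) (use 1 in \<open>simp_all add: 2 algebra_simps\<close>)
  then obtain u v where uv: "(u, v) \<noteq> (0, 0)" and
    "u * t e e e + v * t e f e = 0 \<and> u * t e e f + v * t e f f = 0 \<and>
     u * t f e e + v * t f f e = 0 \<and> u * t f e f + v * t f f f = 0 \<or>
     u * t e e e + v * t e e f = 0 \<and> u * t e f e + v * t e f f = 0 \<and>
     u * t f e e + v * t f e f = 0 \<and> u * t f f e + v * t f f f = 0" by blast
  then show ?thesis
  proof (elim disjE)
    assume a: "u * t e e e + v * t e f e = 0 \<and> u * t e e f + v * t e f f = 0 \<and>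
     u * t f e e + v * t f f e = 0 \<and> u * t f e f + v * t f f f = 0"
    then have "t q (u, v) s = 0" if "q \<in> {e, f}" "s \<in> {e, f}" for q s
      using that unfolding lm[of q u v s] by (auto simp: e_def f_def)
    then have "t q (u, v) (b, c) = 0" if "q \<in> {e, f}" for q b c
      using that unfolding ln[of q "(u, v)" b c] by (auto simp: e_def f_def)
    then have "t (g, h) (u, v) (b, c) = 0" for g h b c
      unfolding ll[of g h] by (auto simp: e_def f_def)
    then have "null_pair T k p m (u, v)"
      unfolding null_pair_def using d p uv t by (metis distinct_length_2_or_more prod.exhaust)
    then show ?thesis by blast
  next
    assume a: "u * t e e e + v * t e e f = 0 \<and> u * t e f e + v * t e f f = 0 \<and>
     u * t f e e + v * t f e f = 0 \<and> u * t f f e + v * t f f f = 0"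
    then have "t q s (u, v) = 0" if "q \<in> {e, f}" "s \<in> {e, f}" for q s
      using that unfolding ln[of q s u v] by (auto simp: e_def f_def)
    then have "t q (b, c) (u, v) = 0" if "q \<in> {e, f}" for q b c
      using that unfolding lm[of q b c "(u, v)"] by (auto simp: e_def f_def)
    then have "t (g, h) (b, c) (u, v) = 0" for g h b c
      unfolding ll[of g h] by (auto simp: e_def f_def)
    then have "null_pair T k p n (u, v)"
      unfolding null_pair_def using d p uv t by (metis distinct_length_2_or_more prod.exhaust)
    then show ?thesis by blast
  qed
qed

text \<open>The root of the biquadratic on \<open>{i, j}\<close> supplies the first value; the
  kernel vector of \<open>tdet_zero_null_pair\<close> sits at a vertex of the complementary
  pair.\<close>

lemma hdeg_imp_null_pair:
  assumes T: "multilin T" and h: "hdeg i j T" "i \<noteq> j"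
  shows "\<exists>k\<in>{i, j}. \<exists>m. m \<notin> {i, j} \<and> (\<exists>p a. null_pair T k p m a)"
proof -
  obtain m n where d: "distinct [i, j, m, n]" using complement_pair[OF h(2)] by blast
  obtain k p where k: "k \<in> {i, j}" "p \<noteq> (0, 0)" "\<And>y. y k = p \<Longrightarrow> tdet m n T y = 0"
    using h(1) unfolding hdeg_iff[OF d] by blast
  define l where "l = (if k = i then j else i)"
  have dk: "distinct [k, l, m, n]" using d k(1) by (auto simp: l_def)
  obtain a where a: "null_pair T k p m a \<or> null_pair T k p n a"
    using tdet_zero_null_pair[OF T dk k(2,3)] by blast
  have "m \<notin> {i, j}" "n \<notin> {i, j}" using d by auto
  with a k(1) show ?thesis by blast
qed

lemma null_pair_commute: "null_pair T k p m a \<Longrightarrow> null_pair T m a k p"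
  by (auto simp: null_pair_def)

text \<open>Once \<open>p\<close> is inserted at \<open>k\<close>, the value \<open>a\<close> is a
  kernel vector of the matrix in \<open>m\<close> and the fourth vertex, so its determinant vanishes
  for every value at \<open>l\<close>. Applied to both ends and both remaining vertices, this makes
  four of the six pairs degenerate.\<close>

lemma null_pair_hdeg:
  assumes T: "multilin T" and n: "null_pair T k p m a" and l: "l \<notin> {k, m}"
  shows "hdeg k l T" "hdeg m l T"
proof -
  have main: "hdeg k l T" if n: "null_pair T k p m a" and l: "l \<notin> {k, m}" for k p m a
  proof -
    have km: "k \<noteq> m" using n by (simp add: null_pair_def)
    obtain n' where d: "distinct [k, l, m, n']"
    proof -
      have "\<exists>n'. distinct [k, l, m, n']" using km l by (cases k; cases l; cases m) (auto simp: ex_vertex)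
      then show thesis using that by blast
    qed
    have "tdet m n' T y = 0" if "y k = p" for y
    proof -
      have "T (y(m := a, n' := q)) = 0" for q
        using n that d by (auto simp: null_pair_def)
      moreover have "y(m := r, n' := q) = y(n' := q, m := r)" for r q using d by (auto simp: fun_eq_iff)
      then have "T (y(m := a, n' := q)) = fst a * T (y(m := (1, 0), n' := q)) + snd a * T (y(m := (0, 1), n' := q))" for q
        using multilin_expand[OF T, of "y(n' := q)" m a] by simp
      ultimately have z: "fst a * T (y(m := (1, 0), n' := q)) + snd a * T (y(m := (0, 1), n' := q)) = 0" for q by simp
      have "a \<noteq> (0, 0)" using n by (simp add: null_pair_def)
      then consider "fst a \<noteq> 0" | "snd a \<noteq> 0" by (metis prod.collapse)
      then show ?thesis
      proof cases
        case 1
        then have "T (y(m := (1, 0), n' := q)) = - snd a / fst a * T (y(m := (0, 1), n' := q))" for q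
          using z[of q] by (simp add: field_simps eq_neg_iff_add_eq_0)
        then show ?thesis by (simp add: tdet_def)
      next
        case 2
        then have "T (y(m := (0, 1), n' := q)) = - fst a / snd a * T (y(m := (1, 0), n' := q))" for q
          using z[of q] by (simp add: field_simps eq_neg_iff_add_eq_0)
        then show ?thesis by (simp add: tdet_def)
      qed
    qed
    moreover have "p \<noteq> (0, 0)" using n by (simp add: null_pair_def)
    ultimately show ?thesis unfolding hdeg_iff[OF d] by blast
  qed
  show "hdeg k l T" by (rule main[OF n l])
  show "hdeg m l T" using main[OF null_pair_commute[OF n]] l by auto
qed

text \<open>Degeneracy of \<open>{k, m}\<close> or of \<open>{l, n}\<close> produces a second null
  pair, which has one vertex in each of them. By \<open>null_pair_hdeg\<close> it makes both
  \<open>{k, m}\<close> and \<open>{l, n}\<close> degenerate, in addition to the four pairs coming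
  from the first null pair.\<close>

lemma null_pair_all_hdeg:
  assumes T: "multilin T" and n: "null_pair T k p m a" and d: "distinct [k, l, m, n]"
    and h: "hdeg k m T \<or> hdeg l n T" and ij: "i \<noteq> j"
  shows "hdeg i j T"
proof -
  have cross: "hdeg k l T" "hdeg m l T" "hdeg k n T" "hdeg m n T"
    using null_pair_hdeg[OF T n] d by auto
  have "hdeg k m T \<and> hdeg l n T"
    using h
  proof
    assume "hdeg k m T"
    then obtain k' m' p' a' where "k' \<in> {k, m}" "m' \<notin> {k, m}" "null_pair T k' p' m' a'"
      using hdeg_imp_null_pair[OF T, of k m] d by (metis distinct_length_2_or_more)
    moreover have "m' \<in> {k, l, m, n}" using d UNIV_distinct by blast
    ultimately show ?thesis
      using d
        null_pair_hdeg[OF T, of k' p' m' a' k] null_pair_hdeg[OF T, of k' p' m' a' l]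
        null_pair_hdeg[OF T, of k' p' m' a' m] null_pair_hdeg[OF T, of k' p' m' a' n]
      by (elim insertE emptyE; auto simp: hdeg_commute[of m k] hdeg_commute[of n l])
  next
    assume "hdeg l n T"
    then obtain k' m' p' a' where "k' \<in> {l, n}" "m' \<notin> {l, n}" "null_pair T k' p' m' a'"
      using hdeg_imp_null_pair[OF T, of l n] d by (metis distinct_length_2_or_more)
    moreover have "m' \<in> {k, l, m, n}" using d UNIV_distinct by blast
    ultimately show ?thesis
      using d
        null_pair_hdeg[OF T, of k' p' m' a' k] null_pair_hdeg[OF T, of k' p' m' a' l]
        null_pair_hdeg[OF T, of k' p' m' a' m] null_pair_hdeg[OF T, of k' p' m' a' n]
      by (elim insertE emptyE; auto simp: hdeg_commute[of m k] hdeg_commute[of n l])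
  qed
  moreover have "i \<in> {k, l, m, n}" "j \<in> {k, l, m, n}" using d UNIV_distinct by blast+
  ultimately show ?thesis using cross ij by (elim insertE emptyE; simp add: hdeg_commute)
qed

lemma card_2_pairs: "{e :: vertex set. card e = 2} = {{X, X1}, {X, X2}, {X, X12}, {X1, X2}, {X1, X12}, {X2, X12}}"
proof -
  have "e \<in> {{X, X1}, {X, X2}, {X, X12}, {X1, X2}, {X1, X12}, {X2, X12}}" if c: "card e = 2" for e
  proof -
    obtain a b where "e = {a, b}" "a \<noteq> b" using c unfolding card_2_iff by blast
    then show ?thesis by (cases a; cases b) auto
  qed
  moreover have "card e = 2" if "e \<in> {{X, X1}, {X, X2}, {X, X12}, {X1, X2}, {X1, X12}, {X2, X12}}" for e
    using that by (elim insertE emptyE) simp_all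
  ultimately show ?thesis by blast
qed

lemma type_H6_pol:
  assumes f: "multiaffine f" and h: "\<And>i j. i \<noteq> j \<Longrightarrow> hdeg i j (hom f)"
  shows "type_H6 (pol f)"
proof -
  have "degenerate_pairs (pol f) = {e. card e = 2}"
    unfolding degenerate_pairs_pol[OF f] using h by (auto simp: card_2_iff)
  then show ?thesis unfolding type_H6_def card_2_pairs
    by (simp add: doubleton_eq_iff card_insert_if)
qed

lemma type_H4_pol:
  assumes f: "multiaffine f" and n: "null_pair (hom f) k p m a" and d: "distinct [k, l, m, n]"
    and h: "\<not> hdeg k m (hom f)" "\<not> hdeg l n (hom f)"
  shows "type_H4 (pol f) \<and> nondegenerate_pairs (pol f) = {{k, m}, {l, n}}"
proof -
  have cross: "hdeg k l (hom f)" "hdeg m l (hom f)" "hdeg k n (hom f)" "hdeg m n (hom f)"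
    using null_pair_hdeg[OF multilin_hom n] d by auto
  have U: "v \<in> {k, l, m, n}" for v using d UNIV_distinct by blast
  have dp: "degenerate_pairs (pol f) = {{k, l}, {m, l}, {k, n}, {m, n}}"
    unfolding degenerate_pairs_pol[OF f]
  proof (intro subset_antisym subsetI)
    fix e assume "e \<in> {{i, j} |i j. i \<noteq> j \<and> hdeg i j (hom f)}"
    then obtain i j where "e = {i, j}" "i \<noteq> j" "hdeg i j (hom f)" by blast
    then show "e \<in> {{k, l}, {m, l}, {k, n}, {m, n}}"
      using U[of i] U[of j] h by (elim insertE emptyE; simp add: insert_commute hdeg_commute)
  next
    fix e assume "e \<in> {{k, l}, {m, l}, {k, n}, {m, n}}"
    then show "e \<in> {{i, j} |i j. i \<noteq> j \<and> hdeg i j (hom f)}"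
      using cross d by auto
  qed
  moreover have "{e. card e = 2} - {{k, l}, {m, l}, {k, n}, {m, n}} = {{k, m}, {l, n}}"
    using d unfolding card_2_pairs
    by (cases k; cases l; cases m; cases n) (auto simp: doubleton_eq_iff)
  moreover have "card {{k, l}, {m, l}, {k, n}, {m, n}} = 4"
    using d by (auto simp: doubleton_eq_iff card_insert_if)
  ultimately show ?thesis by (simp add: type_H4_def nondegenerate_pairs_def)
qed

text \<open>A degenerate biquadratic gives a null pair on some \<open>{k, m}\<close>, hence four
  degenerate pairs. The remaining \<open>{k, m}\<close> and \<open>{l, n}\<close> are both
  degenerate or both not; in the latter case the type is H4, and excluding the rhombic one leaves
  opposite edges.\<close>

theorem degenerate_type_cases:
  assumes f: "multiaffine f" and Q: "\<not> type_Q (pol f)" and R: "\<not> rhombic_H4 (pol f)"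
  obtains (H4) k p m a l n where "trapezoidal_H4 (pol f)" "null_pair (hom f) k p m a" "distinct [k, l, m, n]"
      "{k, m} \<in> {{X, X1}, {X2, X12}, {X, X2}, {X1, X12}}" "\<not> hdeg k m (hom f)" "\<not> hdeg l n (hom f)"
  | (H6) k p m a l n where "type_H6 (pol f)" "null_pair (hom f) k p m a" "distinct [k, l, m, n]"
      "hdeg l n (hom f)"
proof -
  obtain i j where "i \<noteq> j" "hdeg i j (hom f)"
    using Q unfolding type_Q_def degenerate_pairs_pol[OF f] by blast
  then obtain k m p a where n: "null_pair (hom f) k p m a"
    using hdeg_imp_null_pair[OF multilin_hom] by blast
  then have "k \<noteq> m" by (simp add: null_pair_def)
  then obtain l n where "distinct [k, m, l, n]"
    using complement_pair[of k m] by blast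
  then have d: "distinct [k, l, m, n]" by auto
  show thesis
  proof (cases "hdeg k m (hom f) \<or> hdeg l n (hom f)")
    case True
    then have "hdeg i j (hom f)" if "i \<noteq> j" for i j
      using null_pair_all_hdeg[OF multilin_hom n d] that by blast
    then show thesis
      using H6[OF type_H6_pol[OF f] n d] d by auto
  next
    case False
    have t: "type_H4 (pol f)" "nondegenerate_pairs (pol f) = {{k, m}, {l, n}}"
      using type_H4_pol[OF f n d] False by auto
    have "{k, m} \<notin> {{X, X12}, {X1, X2}}"
    proof
      assume "{k, m} \<in> {{X, X12}, {X1, X2}}"
      then have "{{k, m}, {l, n}} = {{X, X12}, {X1, X2}}"
        using d by (cases k; cases l; cases m; cases n) (auto simp: doubleton_eq_iff)
      then show False using R t by (simp add: rhombic_H4_def)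
    qed
    then have *: "{k, m} \<in> {{X, X1}, {X2, X12}, {X, X2}, {X1, X12}}"
      using \<open>k \<noteq> m\<close> by (cases k; cases m) (auto simp: doubleton_eq_iff)
    then have "{{k, m}, {l, n}} = {{X, X1}, {X2, X12}} \<or> {{k, m}, {l, n}} = {{X, X2}, {X1, X12}}"
      using d by (cases k; cases l; cases m; cases n) (auto simp: doubleton_eq_iff)
    then have "trapezoidal_H4 (pol f)" unfolding trapezoidal_H4_def using t by simp
    then show thesis using H4[OF _ n d *] False by blast
  qed
qed

section \<open>Equivalence of quadrilinear forms\<close>

fun act :: "moebius \<Rightarrow> hpoint \<Rightarrow> hpoint" where
  "act (a, b, c, d) p = (a * fst p + b * snd p, c * fst p + d * snd p)"

fun minv :: "moebius \<Rightarrow> moebius" where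
  "minv (a, b, c, d) = (d / (a * d - b * c), - b / (a * d - b * c), - c / (a * d - b * c), a / (a * d - b * c))"

fun mmul :: "moebius \<Rightarrow> moebius \<Rightarrow> moebius" where
  "mmul (a, b, c, d) (a', b', c', d') = (a * a' + b * c', a * b' + b * d', c * a' + d * c', c * b' + d * d')"

fun mdet :: "moebius \<Rightarrow> complex" where
  "mdet (a, b, c, d) = a * d - b * c"

lemma is_moebius_mdet: "is_moebius m \<longleftrightarrow> mdet m \<noteq> 0"
  by (cases m) simp

lemma mdet_mmul: "mdet (mmul m m') = mdet m * mdet m'"
  by (cases m; cases m') (simp add: algebra_simps)

lemma act_mmul: "act (mmul m m') p = act m (act m' p)"
  by (cases m; cases m') (simp add: algebra_simps)

lemma act_minv_both:
  assumes "is_moebius m"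
  shows act_minv: "act m (act (minv m) p) = p" and act_minv': "act (minv m) (act m p) = p"
proof -
  obtain a b c d where m: "m = (a, b, c, d)" by (cases m)
  obtain s t where p: "p = (s, t)" by (cases p)
  define i where "i = inverse (a * d - b * c)"
  have i: "(a * d - b * c) * i = 1" using assms by (simp add: m i_def)
  have "act m (act (minv m) p) = ((a * d - b * c) * i * s, (a * d - b * c) * i * t)"
    by (simp add: m p divide_inverse i_def[symmetric] algebra_simps)
  then show "act m (act (minv m) p) = p" by (simp add: i p)
  have "act (minv m) (act m p) = ((a * d - b * c) * i * s, (a * d - b * c) * i * t)"
    by (simp add: m p divide_inverse i_def[symmetric] algebra_simps)
  then show "act (minv m) (act m p) = p" by (simp add: i p)
qed

lemma is_moebius_minv: "is_moebius m \<Longrightarrow> is_moebius (minv m)"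
proof -
  assume "is_moebius m"
  obtain a b c d where m: "m = (a, b, c, d)" by (cases m)
  define i where "i = inverse (a * d - b * c)"
  have i: "(a * d - b * c) * i = 1" using \<open>is_moebius m\<close> by (simp add: m i_def)
  have "mdet (minv m) = (a * d - b * c) * i * i"
    by (simp add: m divide_inverse i_def[symmetric] algebra_simps)
  then show ?thesis using i by (auto simp: is_moebius_mdet)
qed

lemma act_nonzero: "is_moebius m \<Longrightarrow> p \<noteq> (0, 0) \<Longrightarrow> act m p \<noteq> (0, 0)"
proof
  assume m: "is_moebius m" and p: "p \<noteq> (0, 0)" and "act m p = (0, 0)"
  then have "act (minv m) (0, 0) = p" using act_minv'[OF m, of p] by simp
  moreover have "act (minv m) (0, 0) = (0, 0)" by (cases "minv m") simp
  ultimately show False using p by simp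
qed

definition geqv_by :: "(vertex \<Rightarrow> vertex) \<Rightarrow> (vertex \<Rightarrow> moebius) \<Rightarrow> complex \<Rightarrow> form \<Rightarrow> form \<Rightarrow> bool" where
  "geqv_by \<tau> M c T T' \<longleftrightarrow> bij \<tau> \<and> (\<forall>v. is_moebius (M v)) \<and> c \<noteq> 0 \<and>
     (\<forall>y. T' y = c * T (\<lambda>v. act (M v) (y (\<tau> v))))"

text \<open>Unlike \<open>eqv\<close>, this admits every bijection of the vertices: a lattice
  equivalence is analysed on one cell only, where just the bijectivity of the induced permutation is
  recorded.\<close>

definition geqv :: "form \<Rightarrow> form \<Rightarrow> bool" where
  "geqv T T' \<longleftrightarrow> (\<exists>\<tau> M c. geqv_by \<tau> M c T T')"

definition eqv :: "form \<Rightarrow> form \<Rightarrow> bool" where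
  "eqv T T' \<longleftrightarrow> (\<exists>\<tau> M c. square_relabelling \<tau> \<and> geqv_by \<tau> M c T T')"

lemma geqv_by_sym:
  assumes "geqv_by \<tau> M c T T'"
  shows "geqv_by (inv \<tau>) (\<lambda>v. minv (M (inv \<tau> v))) (1 / c) T' T"
proof -
  have b: "bij \<tau>" and m: "\<And>v. is_moebius (M v)" and c: "c \<noteq> 0"
    and e: "\<And>y. T' y = c * T (\<lambda>v. act (M v) (y (\<tau> v)))"
    using assms by (auto simp: geqv_by_def)
  have "inv \<tau> (\<tau> v) = v" for v using b by (simp add: bij_is_inj)
  then show ?thesis
    unfolding geqv_by_def by (simp add: bij_imp_bij_inv b c is_moebius_minv m e act_minv)
qed

lemma geqv_by_trans:
  assumes "geqv_by \<tau> M c T T'" "geqv_by \<tau>' M' c' T' T''"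
  shows "geqv_by (\<tau>' \<circ> \<tau>) (\<lambda>v. mmul (M v) (M' (\<tau> v))) (c' * c) T T''"
proof -
  have "bij \<tau>" "\<And>v. is_moebius (M v)" "c \<noteq> 0" "\<And>y. T' y = c * T (\<lambda>v. act (M v) (y (\<tau> v)))"
    "bij \<tau>'" "\<And>v. is_moebius (M' v)" "c' \<noteq> 0" "\<And>y. T'' y = c' * T' (\<lambda>v. act (M' v) (y (\<tau>' v)))"
    using assms by (auto simp: geqv_by_def)
  then show ?thesis
    by (simp add: geqv_by_def is_moebius_mdet mdet_mmul act_mmul bij_comp)
qed

lemma diagonal_Compl: "- {X, X12} = {X1, X2}" "- {X1, X2} = {X, X12}"
proof -
  show "- {X, X12} = {X1, X2}"
  proof (rule set_eqI)
    fix v show "v \<in> - {X, X12} \<longleftrightarrow> v \<in> {X1, X2}" by (cases v) simp_all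
  qed
  show "- {X1, X2} = {X, X12}"
  proof (rule set_eqI)
    fix v show "v \<in> - {X1, X2} \<longleftrightarrow> v \<in> {X, X12}" by (cases v) simp_all
  qed
qed

lemma square_relabelling_diagonal:
  "square_relabelling \<tau> \<longleftrightarrow> bij \<tau> \<and> (\<tau> ` {X, X12} = {X, X12} \<or> \<tau> ` {X, X12} = - {X, X12})"
  unfolding square_relabelling_def diagonal_Compl by blast

lemma square_relabelling_comp:
  assumes "square_relabelling \<tau>" "square_relabelling \<tau>'"
  shows "square_relabelling (\<tau>' \<circ> \<tau>)"
proof -
  define D where "D = {X, X12}"
  have b: "bij \<tau>" "bij \<tau>'" and t: "\<tau> ` D = D \<or> \<tau> ` D = - D" "\<tau>' ` D = D \<or> \<tau>' ` D = - D"
    using assms unfolding square_relabelling_diagonal D_def by blast+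
  have "\<tau>' ` (- D) = - (\<tau>' ` D)" using b(2) by (rule bij_image_Compl_eq)
  then have "\<tau>' ` (\<tau> ` D) = D \<or> \<tau>' ` (\<tau> ` D) = - D" using t by (elim disjE) simp_all
  then show ?thesis
    unfolding square_relabelling_diagonal D_def[symmetric] image_comp[symmetric]
    using b by (simp add: bij_comp)
qed

lemma eqv_trans [trans]:
  assumes "eqv T T'" "eqv T' T''" shows "eqv T T''"
  using assms geqv_by_trans square_relabelling_comp unfolding eqv_def by meson

lemma finite_vertex: "finite (UNIV :: vertex set)"
  by (simp add: UNIV_vertex)

lemma bij_pack:
  assumes "distinct [a, b, c, d :: vertex]" shows "bij (pack a b c d)"
proof -
  have "surj (pack a b c d)"
  proof -
    have "v \<in> {a, b, c, d}" for v using assms UNIV_distinct by blast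
    then have "v \<in> range (pack a b c d)" for v
      using rangeI[of "pack a b c d" X] rangeI[of "pack a b c d" X1] rangeI[of "pack a b c d" X2]
        rangeI[of "pack a b c d" X12] by fastforce
    then show ?thesis by blast
  qed
  then show ?thesis using finite_vertex finite_UNIV_surj_inj by (simp add: bij_def)
qed

lemma square_relabelling_pack:
  assumes "distinct [a, b, c, d]" "{a, d} \<in> {{X, X12}, {X1, X2}}"
  shows "square_relabelling (pack a b c d)"
  using assms bij_pack by (simp add: square_relabelling_def)

lemma eqvI:
  assumes "distinct [a, b, c, d]" "{a, d} \<in> {{X, X12}, {X1, X2}}"
    "is_moebius m0" "is_moebius m1" "is_moebius m2" "is_moebius m12" "k \<noteq> 0"
    "\<And>y. T' y = k * T (pack (act m0 (y a)) (act m1 (y b)) (act m2 (y c)) (act m12 (y d)))"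
  shows "eqv T T'"
proof -
  have "(\<lambda>v. act (pack m0 m1 m2 m12 v) (y (pack a b c d v))) =
      pack (act m0 (y a)) (act m1 (y b)) (act m2 (y c)) (act m12 (y d))" for y
  proof
    fix v show "act (pack m0 m1 m2 m12 v) (y (pack a b c d v)) =
      pack (act m0 (y a)) (act m1 (y b)) (act m2 (y c)) (act m12 (y d)) v" by (cases v) simp_all
  qed
  moreover have "is_moebius (pack m0 m1 m2 m12 v)" for v using assms by (cases v) simp_all
  ultimately have "geqv_by (pack a b c d) (pack m0 m1 m2 m12) k T T'"
    using assms bij_pack by (simp add: geqv_by_def)
  then show ?thesis using square_relabelling_pack[OF assms(1,2)] unfolding eqv_def by blast
qed

lemma eqv_moebiusI:
  assumes "is_moebius m0" "is_moebius m1" "is_moebius m2" "is_moebius m12" "k \<noteq> 0"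
    "\<And>y. T' y = k * T (pack (act m0 (y X)) (act m1 (y X1)) (act m2 (y X2)) (act m12 (y X12)))"
  shows "eqv T T'"
  by (rule eqvI[of X X1 X2 X12 m0 m1 m2 m12 k]) (use assms in simp_all)

lemma act_id: "act (1, 0, 0, 1) p = p"
  by simp

lemma eqv_relabelI:
  assumes "distinct [a, b, c, d]" "{a, d} \<in> {{X, X12}, {X1, X2}}"
    "\<And>y. T' y = T (pack (y a) (y b) (y c) (y d))"
  shows "eqv T T'"
  by (rule eqvI[OF assms(1,2), of "(1, 0, 0, 1)" "(1, 0, 0, 1)" "(1, 0, 0, 1)" "(1, 0, 0, 1)" 1])
    (simp_all add: act_id assms(3) del: act.simps)

lemma eqv_refl: "eqv T T"
  by (rule eqv_relabelI[of X X1 X2 X12]) simp_all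

lemma upd_comp_bij:
  assumes "bij \<tau>"
  shows "(\<lambda>v. act (M v) ((y(\<tau> m := p)) (\<tau> v))) = (\<lambda>v. act (M v) (y (\<tau> v)))(m := act (M m) p)"
  using bij_is_inj[OF assms] by (auto simp: fun_eq_iff inj_eq)

lemma multilin_geqv_by:
  assumes T: "multilin T" and g: "geqv_by \<tau> M c T T'"
  shows "multilin T'"
  unfolding multilin_def
proof (intro allI)
  fix v y s t
  have b: "bij \<tau>" and e: "\<And>y. T' y = c * T (\<lambda>v. act (M v) (y (\<tau> v)))"
    using g by (auto simp: geqv_by_def)
  obtain w where w: "v = \<tau> w" using bij_is_surj[OF b] by (rule surjE)
  obtain a1 a2 a3 a4 where M: "M w = (a1, a2, a3, a4)" by (cases "M w")
  define z where "z = (\<lambda>v. act (M v) (y (\<tau> v)))"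
  have "T (z(w := act (M w) (s, t))) = s * T (z(w := act (M w) (1, 0))) + t * T (z(w := act (M w) (0, 1)))"
    using multilin_comb[OF T, of z w s "(a1, a3)" t "(a2, a4)"] by (simp add: M mult.commute)
  then show "T' (y(v := (s, t))) = s * T' (y(v := (1, 0))) + t * T' (y(v := (0, 1)))"
    unfolding e w upd_comp_bij[OF b] z_def[symmetric] by (simp add: algebra_simps)
qed

text \<open>Changing the basis in the variables of \<open>m\<close> and \<open>n\<close> multiplies
  a 2 x 2 matrix from both sides, hence its determinant by the determinants of both Moebius
  matrices.\<close>

lemma tdet_geqv_by:
  assumes T: "multilin T" and g: "geqv_by \<tau> M c T T'" and mn: "m \<noteq> n"
  shows "tdet (\<tau> m) (\<tau> n) T' y = c\<^sup>2 * mdet (M m) * mdet (M n) * tdet m n T (\<lambda>v. act (M v) (y (\<tau> v)))"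
proof -
  have b: "bij \<tau>" and e: "\<And>y. T' y = c * T (\<lambda>v. act (M v) (y (\<tau> v)))"
    using g by (auto simp: geqv_by_def)
  obtain a1 a2 a3 a4 where M: "M m = (a1, a2, a3, a4)" by (cases "M m")
  obtain b1 b2 b3 b4 where N: "M n = (b1, b2, b3, b4)" by (cases "M n")
  define z where "z = (\<lambda>v. act (M v) (y (\<tau> v)))"
  have u: "z(m := p, n := q) = z(n := q, m := p)" for p q using mn by (auto simp: fun_eq_iff)
  have 1: "T (z(m := (s, t), n := q)) = s * T (z(m := (1, 0), n := q)) + t * T (z(m := (0, 1), n := q))" for s t q
    unfolding u by (rule multilinD[OF T])
  have 2: "T (z(m := p, n := (s, t))) = s * T (z(m := p, n := (1, 0))) + t * T (z(m := p, n := (0, 1)))" for s t p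
    by (rule multilinD[OF T])
  have 3: "T (z(m := (s, t), n := (s', t'))) = s * s' * T (z(m := (1, 0), n := (1, 0))) + s * t' * T (z(m := (1, 0), n := (0, 1)))
     + t * s' * T (z(m := (0, 1), n := (1, 0))) + t * t' * T (z(m := (0, 1), n := (0, 1)))" for s t s' t'
    unfolding 1[of s t] 2[of _ s' t'] by (simp add: algebra_simps)
  define p q r s where pqrs: "p = T (z(m := (1, 0), n := (1, 0)))" "q = T (z(m := (1, 0), n := (0, 1)))"
    "r = T (z(m := (0, 1), n := (1, 0)))" "s = T (z(m := (0, 1), n := (0, 1)))"
  have a: "act (M m) (1, 0) = (a1, a3)" "act (M m) (0, 1) = (a2, a4)" "act (M n) (1, 0) = (b1, b3)"
    "act (M n) (0, 1) = (b2, b4)" by (simp_all add: M N)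
  have d: "mdet (M m) = a1 * a4 - a2 * a3" "mdet (M n) = b1 * b4 - b2 * b3" by (simp_all add: M N)
  show ?thesis
    unfolding tdet_def e upd_comp_bij[OF b] z_def[symmetric] a d
    unfolding 3[of a1 a3] 3[of a2 a4] pqrs[symmetric] by (simp add: algebra_simps power2_eq_square)
qed

lemma hdeg_geqv_by:
  assumes T: "multilin T" and g: "geqv_by \<tau> M c T T'" and h: "hdeg i j T" and ij: "i \<noteq> j"
  shows "hdeg (\<tau> i) (\<tau> j) T'"
proof -
  have b: "bij \<tau>" and mo: "\<And>v. is_moebius (M v)" using g by (auto simp: geqv_by_def)
  obtain m n where d: "distinct [i, j, m, n]" using complement_pair[OF ij] by blast
  have d': "distinct [\<tau> i, \<tau> j, \<tau> m, \<tau> n]" using d bij_is_inj[OF b] by (auto simp: inj_eq)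
  obtain k p where k: "k \<in> {i, j}" "p \<noteq> (0, 0)" "\<And>y. y k = p \<Longrightarrow> tdet m n T y = 0"
    using h unfolding hdeg_iff[OF d] by blast
  have "tdet (\<tau> m) (\<tau> n) T' y = 0" if "y (\<tau> k) = act (minv (M k)) p" for y
  proof -
    have "act (M k) (y (\<tau> k)) = p" using that act_minv[OF mo] by simp
    then show ?thesis using tdet_geqv_by[OF T g, of m n y] d k(3) by simp
  qed
  moreover have "act (minv (M k)) p \<noteq> (0, 0)" using act_nonzero is_moebius_minv mo k(2) by blast
  moreover have "\<tau> k \<in> {\<tau> i, \<tau> j}" using k(1) by auto
  ultimately show ?thesis unfolding hdeg_iff[OF d'] by blast
qed

text \<open>Equivalent to \<open>quad_equation\<close> by \<open>quad_equation_pol_iff\<close>, but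
  stated in terms that visibly survive changes of basis.\<close>

definition nondeg :: "form \<Rightarrow> bool" where
  "nondeg T \<longleftrightarrow> (\<forall>m n. m \<noteq> n \<longrightarrow> (\<exists>y. tdet m n T y \<noteq> 0))"

lemma nondeg_eqv:
  assumes T: "multilin T" and nd: "nondeg T" and g: "eqv T T'"
  shows "nondeg T'"
  unfolding nondeg_def
proof (intro allI impI)
  fix m n :: vertex assume mn: "m \<noteq> n"
  obtain \<tau> M c where g: "geqv_by \<tau> M c T T'" using g by (auto simp: eqv_def)
  then have b: "bij \<tau>" and mo: "\<And>v. is_moebius (M v)" and c: "c \<noteq> 0" by (auto simp: geqv_by_def)
  obtain m' where m1: "m = \<tau> m'" using bij_is_surj[OF b] by (rule surjE)
  obtain n' where n1: "n = \<tau> n'" using bij_is_surj[OF b] by (rule surjE)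
  have m': "m = \<tau> m'" "n = \<tau> n'" "m' \<noteq> n'" using m1 n1 mn by auto
  obtain y where y: "tdet m' n' T y \<noteq> 0" using nd m'(3) unfolding nondeg_def by blast
  define z where "z = (\<lambda>v. act (minv (M (inv \<tau> v))) (y (inv \<tau> v)))"
  have "(\<lambda>v. act (M v) (z (\<tau> v))) = y"
    using b mo by (simp add: z_def act_minv bij_is_inj)
  then have "tdet m n T' z \<noteq> 0"
    using tdet_geqv_by[OF T g m'(3), of z] y c mo unfolding m'(1,2) is_moebius_mdet by simp
  then show "\<exists>y. tdet m n T' y \<noteq> 0" by blast
qed

text \<open>A binary quadratic form that vanishes at \<open>(0, 1)\<close>, \<open>(1, 1)\<close>
  and \<open>(-1, 1)\<close> is zero, so a nonzero determinant stays nonzero for a suitable finite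
  value at each vertex in turn.\<close>

lemma tdet_aff_nonzero:
  assumes T: "multilin T" and mn: "m \<noteq> n" and y: "tdet m n T y \<noteq> 0"
  shows "\<exists>z. tdet m n T (aff z) \<noteq> 0"
proof -
  have step: "\<exists>s. tdet m n T (y(v := (s, 1))) \<noteq> 0" if "tdet m n T y \<noteq> 0" for y v
  proof (rule ccontr)
    assume "\<not> ?thesis"
    then have z: "tdet m n T (y(v := (s, 1))) = 0" for s by blast
    show False
    proof (cases "v = m \<or> v = n")
      case True
      then have "y(v := (0, 1), m := p, n := q) = y(m := p, n := q)" for p q by (auto simp: fun_eq_iff)
      then have "tdet m n T (y(v := (0, 1))) = tdet m n T y" by (simp add: tdet_def)
      then show False using z that by simp
    next
      case False
      note Q = tdet_quadratic[OF T, of v m n y]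
      have "tdet m n T (y(v := (0, 1))) = 0" "tdet m n T (y(v := (1, 1))) = 0"  "tdet m n T (y(v := (- 1, 1))) = 0"
        by (rule z)+
      moreover from this have "tdet m n T (y(v := (1, 0))) = 0" using Q[of "-1" 1] False by simp
      ultimately have "tdet m n T (y(v := (s, t))) = 0" for s t using Q[of s t] False by simp
      from this[of "fst (y v)" "snd (y v)"] show False using that by simp
    qed
  qed
  obtain a where "tdet m n T (y(X := (a, 1))) \<noteq> 0" using step[OF y] by blast
  from step[OF this] obtain b where "tdet m n T (y(X := (a, 1), X1 := (b, 1))) \<noteq> 0" by blast
  from step[OF this] obtain c where "tdet m n T (y(X := (a, 1), X1 := (b, 1), X2 := (c, 1))) \<noteq> 0" by blast
  from step[OF this] obtain d where d: "tdet m n T (y(X := (a, 1), X1 := (b, 1), X2 := (c, 1), X12 := (d, 1))) \<noteq> 0" by blast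
  have "y(X := (a, 1), X1 := (b, 1), X2 := (c, 1), X12 := (d, 1)) = aff (pack a b c d)"
  proof
    fix v show "(y(X := (a, 1), X1 := (b, 1), X2 := (c, 1), X12 := (d, 1))) v = aff (pack a b c d) v"
      by (cases v) simp_all
  qed
  then show ?thesis using d by metis
qed

lemma quad_equation_pol_iff:
  assumes f: "multiaffine f"
  shows "quad_equation (pol f) \<longleftrightarrow> nondeg (hom f)"
proof
  assume q: "quad_equation (pol f)"
  have "evv (pol f) = f" using evv_pol[OF f] by auto
  then show "nondeg (hom f)"
    unfolding nondeg_def using quad_equation_fdet[OF q] fdet_tdet[OF f] by metis
next
  assume nd: "nondeg (hom f)"
  show "quad_equation (pol f)"
  proof (rule quad_equation_polI[OF f, of X])
    fix w assume "w \<noteq> X"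
    then show "\<exists>z. fdet X w f z \<noteq> 0"
      using nd tdet_aff_nonzero[OF multilin_hom, of X w] fdet_tdet[OF f] unfolding nondeg_def by metis
  qed
qed

section \<open>Lattice equations\<close>

text \<open>The corner of the cell whose parity class is \<open>v\<close>, which is in general not
  the corner in position \<open>v\<close>. With corners named in this way, the reflected copies of
  \<open>Q\<close> in \<open>lift\<close> all become \<open>Q\<close> itself
  (\<open>at_field_lift\<close>).\<close>

fun corner :: "site \<Rightarrow> vertex \<Rightarrow> site" where
  "corner (n, m) v = (if even n = (v = X \<or> v = X2) then n else n + 1, if even m = (v = X \<or> v = X1) then m else m + 1)"

definition par :: "site \<Rightarrow> vertex" where
  "par = by_parity X X1 X2 X12"

lemma par_corner [simp]: "par (corner s v) = v"
  by (cases s; cases v) (auto simp: par_def)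

lemma cell_corner: "cell s = range (corner s)"
proof (cases s)
  case (Pair n m)
  have "range (corner s) = corner s ` {X, X1, X2, X12}" by (simp only: UNIV_vertex)
  then show ?thesis using Pair by (cases "even n"; cases "even m") auto
qed

lemma corner_par: "p \<in> cell s \<Longrightarrow> corner s (par p) = p"
  unfolding cell_corner by auto

lemma bij_corner: "bij_betw (corner s) UNIV (cell s)"
  unfolding cell_corner by (metis bij_betw_def inj_on_inverseI par_corner)

lemma by_parity_par: "by_parity a b c d p = pack a b c d (par p)"
  by (cases p) (simp add: par_def)

lemma Fplus_even [simp]: "even n \<Longrightarrow> Fplus n = 1" "odd n \<Longrightarrow> Fplus n = 0"
  by (simp_all add: Fplus_def power_int_minus_left)

lemma Fminus_even [simp]: "even n \<Longrightarrow> Fminus n = 0" "odd n \<Longrightarrow> Fminus n = 1"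
  by (simp_all add: Fminus_def power_int_minus_left)

lemma at_field_lift: "at_field (lift Q) u s = evv Q (\<lambda>v. u (corner s v))"
  by (cases s; cases "even (fst s)"; cases "even (snd s)") (simp_all add: lift_def evv_def)

lemma multilin_scale_all:
  assumes T: "multilin T"
  shows "T (\<lambda>v. (r v * fst (y v), r v * snd (y v))) = (\<Prod>v\<in>UNIV. r v) * T y"
proof -
  define sc where "sc v = (r v * fst (y v), r v * snd (y v))" for v
  have s: "T (z(v := sc v)) = r v * T (z(v := y v))" for z v
    unfolding sc_def by (rule multilin_scale[OF T])
  have e: "(\<lambda>v. (r v * fst (y v), r v * snd (y v))) = y(X := sc X, X1 := sc X1, X2 := sc X2, X12 := sc X12)"
  proof
    fix v show "(r v * fst (y v), r v * snd (y v)) = (y(X := sc X, X1 := sc X1, X2 := sc X2, X12 := sc X12)) v"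
      by (cases v) (simp_all add: sc_def)
  qed
  have t: "y(X := sc X, X1 := sc X1, X2 := sc X2, X12 := y X12) = y(X := sc X, X1 := sc X1, X2 := sc X2)"
    "y(X := sc X, X1 := sc X1, X2 := y X2) = y(X := sc X, X1 := sc X1)"
    "y(X := sc X, X1 := y X1) = y(X := sc X)" by (auto simp: fun_eq_iff)
  show ?thesis unfolding e by (simp add: s t UNIV_vertex mult.assoc mult.left_commute)
qed

text \<open>Index maps act on parity classes: the unit translations in \<open>n\<close> and
  \<open>m\<close> give the two reflections that swap opposite edges, and the rotation exchanges
  \<open>X1\<close> and \<open>X2\<close>. Their compositions are all eight symmetries of the
  square.\<close>

lemma realize_relabelling:
  assumes "square_relabelling \<tau>"
  shows "\<exists>\<phi>\<in>index_maps. \<forall>p. par (\<phi> p) = \<tau> (par p)"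
proof -
  have comp: "\<exists>\<phi>\<in>index_maps. \<forall>p. par (\<phi> p) = (\<tau>1 \<circ> \<tau>2) (par p)"
    if "\<exists>\<phi>\<in>index_maps. \<forall>p. par (\<phi> p) = \<tau>1 (par p)" "\<exists>\<phi>\<in>index_maps. \<forall>p. par (\<phi> p) = \<tau>2 (par p)" for \<tau>1 \<tau>2
    using that index_maps.intros(9) by (metis comp_apply)
  have i: "\<exists>\<phi>\<in>index_maps. \<forall>p. par (\<phi> p) = pack X X1 X2 X12 (par p)"
    by (rule bexI[OF _ index_maps.intros(1)]) (simp add: pack_eta[of id, simplified])
  have a: "\<exists>\<phi>\<in>index_maps. \<forall>p. par (\<phi> p) = pack X1 X X12 X2 (par p)"
    by (rule bexI[OF _ index_maps.intros(2)]) (auto simp: par_def)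
  have b: "\<exists>\<phi>\<in>index_maps. \<forall>p. par (\<phi> p) = pack X2 X12 X X1 (par p)"
    by (rule bexI[OF _ index_maps.intros(4)]) (auto simp: par_def)
  have r: "\<exists>\<phi>\<in>index_maps. \<forall>p. par (\<phi> p) = pack X X2 X1 X12 (par p)"
    by (rule bexI[OF _ index_maps.intros(6)]) (auto simp: par_def)
  have pc: "\<tau>1 \<circ> pack a b c d = pack (\<tau>1 a) (\<tau>1 b) (\<tau>1 c) (\<tau>1 d)" for \<tau>1 :: "vertex \<Rightarrow> vertex" and a b c d
    by (auto simp: fun_eq_iff pack_def split: vertex.splits)
  note ab = comp[OF a b, unfolded pc pack_simps] and ar = comp[OF a r, unfolded pc pack_simps]
    and br = comp[OF b r, unfolded pc pack_simps]
  note abr = comp[OF ab r, unfolded pc pack_simps]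
  have inj: "inj \<tau>" and im: "\<tau> ` {X, X12} \<in> {{X, X12}, {X1, X2}}"
    using assms by (auto simp: square_relabelling_def bij_is_inj)
  have ne: "\<tau> X \<noteq> \<tau> X1" "\<tau> X \<noteq> \<tau> X2" "\<tau> X \<noteq> \<tau> X12" "\<tau> X1 \<noteq> \<tau> X2" "\<tau> X1 \<noteq> \<tau> X12" "\<tau> X2 \<noteq> \<tau> X12"
    using inj by (simp_all add: inj_eq)
  have d: "\<tau> X = X \<and> \<tau> X12 = X12 \<or> \<tau> X = X12 \<and> \<tau> X12 = X \<or> \<tau> X = X1 \<and> \<tau> X12 = X2 \<or> \<tau> X = X2 \<and> \<tau> X12 = X1"
    using im ne(3) by (auto simp: doubleton_eq_iff)
  have "\<tau> = pack (\<tau> X) (\<tau> X1) (\<tau> X2) (\<tau> X12)" by simp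
  then have "\<tau> \<in> {pack X X1 X2 X12, pack X1 X X12 X2, pack X2 X12 X X1, pack X X2 X1 X12,
      pack X12 X2 X1 X, pack X1 X12 X X2, pack X2 X X12 X1, pack X12 X1 X2 X}"
    using d ne by (cases "\<tau> X1"; cases "\<tau> X2") auto
  then show ?thesis using i a b r ab ar br abr by (elim insertE emptyE) simp_all
qed

lemma index_maps_cell:
  assumes "\<phi> \<in> index_maps"
  shows "inj \<phi> \<and> (\<forall>s. \<exists>s'. \<phi> ` cell s = cell s')"
  using assms
proof (induction rule: index_maps.induct)
  case 1
  then show ?case by auto
next
  case 2
  have "(\<lambda>(n, m). (n + 1, m)) ` cell (n, m) = cell (n + 1, m)" for n m :: int by auto
  then show ?case by (auto simp: inj_def simp del: cell.simps)
next
  case 3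
  have "(\<lambda>(n, m). (n - 1, m)) ` cell (n, m) = cell (n - 1, m)" for n m :: int by auto
  then show ?case by (auto simp: inj_def simp del: cell.simps)
next
  case 4
  have "(\<lambda>(n, m). (n, m + 1)) ` cell (n, m) = cell (n, m + 1)" for n m :: int by auto
  then show ?case by (auto simp: inj_def simp del: cell.simps)
next
  case 5
  have "(\<lambda>(n, m). (n, m - 1)) ` cell (n, m) = cell (n, m - 1)" for n m :: int by auto
  then show ?case by (auto simp: inj_def simp del: cell.simps)
next
  case 6
  have "(\<lambda>(n, m). (- m, n)) ` cell (n, m) = cell (- m - 1, n)" for n m :: int by auto
  then show ?case by (auto simp: inj_def simp del: cell.simps)
next
  case 7
  have "(\<lambda>(n, m). (- n, m)) ` cell (n, m) = cell (- n - 1, m)" for n m :: int by auto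
  then show ?case by (auto simp: inj_def simp del: cell.simps)
next
  case 8
  have "(\<lambda>(n, m). (n, - m)) ` cell (n, m) = cell (n, - m - 1)" for n m :: int by auto
  then show ?case by (auto simp: inj_def simp del: cell.simps)
next
  case (9 \<phi> \<psi>)
  then have "inj (\<phi> \<circ> \<psi>)" by (auto intro: inj_compose)
  moreover have "\<exists>s'. (\<phi> \<circ> \<psi>) ` cell s = cell s'" for s
    using 9 unfolding image_comp[symmetric] by metis
  ultimately show ?case by blast
qed

lemma act_aff:
  assumes "moebius_den m z \<noteq> 0"
  shows "act m (z, 1) = (moebius_den m z * moebius m z, moebius_den m z * 1)"
  using assms by (cases m) simp

text \<open>In parity coordinates every cell carries the same form, so one equivalence of forms
  serves all cells. The Moebius denominators come out as factors because the form is linear in each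
  homogeneous argument.\<close>

theorem lattice_equivalent_lift:
  assumes f: "multiaffine f" and g: "multiaffine g" and e: "eqv (hom f) (hom g)"
  shows "lattice_equivalent (lift (pol f)) (lift (pol g))"
proof -
  obtain \<tau> M c where sq: "square_relabelling \<tau>" and b: "bij \<tau>" and mo: "\<And>v. is_moebius (M v)"
    and c: "c \<noteq> 0" and T: "\<And>y. hom g y = c * hom f (\<lambda>v. act (M v) (y (\<tau> v)))"
    using e by (auto simp: eqv_def geqv_by_def)
  \<comment> \<open>\<open>geqv_by\<close> reads the value at \<open>\<tau> v\<close> into the slot
    \<open>v\<close>, so the index map has to send the parity class \<open>\<tau> v\<close> to
    \<open>v\<close>.\<close>
  define \<rho> where "\<rho> = inv \<tau>"
  have rt: "\<rho> (\<tau> v) = v" "\<tau> (\<rho> v) = v" for v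
    using b by (simp_all add: \<rho>_def bij_is_inj bij_is_surj surj_f_inv_f)
  have "square_relabelling \<rho>"
  proof -
    have i: "\<rho> ` A = \<tau> -` A" for A unfolding \<rho>_def using b by (rule bij_vimage_eq_inv_image[symmetric])
    have v: "\<tau> -` (\<tau> ` A) = A" for A using b by (simp add: bij_is_inj inj_vimage_image_eq)
    define D where "D = {X, X12}"
    have "\<tau> ` D = D \<or> \<tau> ` D = - D" using sq unfolding square_relabelling_diagonal D_def by blast
    then have "\<tau> -` D = D \<or> \<tau> -` D = - D" using v[of D] by (elim disjE) (simp_all add: vimage_Compl, auto)
    then show ?thesis
      unfolding square_relabelling_diagonal D_def[symmetric] i using bij_imp_bij_inv[OF b] by (simp add: \<rho>_def)
  qed
  then obtain \<phi> where \<phi>: "\<phi> \<in> index_maps" "\<And>p. par (\<phi> p) = \<rho> (par p)"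
    using realize_relabelling by blast
  define M' where "M' v = M (\<rho> v)" for v
  have mp: "by_parity (M' X) (M' X1) (M' X2) (M' X12) p = M' (par p)" for p
    by (simp add: by_parity_par)
  show ?thesis
    unfolding lattice_equivalent_def Let_def
  proof (rule bexI[OF _ \<phi>(1)], rule exI[of _ "M' X"], rule exI[of _ "M' X1"], rule exI[of _ "M' X2"],
      rule exI[of _ "M' X12"], intro conjI allI impI)
    fix s s' assume ss: "\<phi> ` cell s = cell s'"
    have "at_field (lift (pol g)) v s =
        c * (\<Prod>p\<in>cell s. moebius_den (M' (par p)) (v p)) * at_field (lift (pol f)) u s'"
      if uv: "\<And>p. p \<in> cell s \<Longrightarrow> moebius_den (M' (par p)) (v p) \<noteq> 0 \<and> u (\<phi> p) = moebius (M' (par p)) (v p)" for u v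
    proof -
      define p where "p w = corner s (\<tau> w)" for w
      have pc: "p w \<in> cell s" and pp: "par (p w) = \<tau> w" for w by (auto simp: p_def cell_corner)
      have cp: "corner s' w = \<phi> (p w)" for w
      proof -
        have "\<phi> (p w) \<in> cell s'" using pc ss by blast
        then have "corner s' (par (\<phi> (p w))) = \<phi> (p w)" by (rule corner_par)
        then show ?thesis by (simp add: \<phi>(2) pp rt)
      qed
      have den: "moebius_den (M w) (v (p w)) \<noteq> 0" and uu: "u (corner s' w) = moebius (M w) (v (p w))" for w
        using uv[OF pc[of w]] by (simp_all add: pp cp M'_def rt)
      have "at_field (lift (pol g)) v s = hom g (aff (\<lambda>w. v (corner s w)))"
        by (simp add: at_field_lift evv_pol[OF g] hom_aff[OF g])
      also have "\<dots> = c * hom f (\<lambda>w. act (M w) (v (p w), 1))"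
        unfolding T by (simp add: aff_def p_def)
      also have "(\<lambda>w. act (M w) (v (p w), 1)) = (\<lambda>w. (moebius_den (M w) (v (p w)) * fst (aff (\<lambda>w. u (corner s' w)) w),
          moebius_den (M w) (v (p w)) * snd (aff (\<lambda>w. u (corner s' w)) w)))"
        using act_aff[OF den] by (simp add: aff_def uu)
      also have "hom f \<dots> = (\<Prod>w\<in>UNIV. moebius_den (M w) (v (p w))) * hom f (aff (\<lambda>w. u (corner s' w)))"
        by (rule multilin_scale_all[OF multilin_hom])
      also have "hom f (aff (\<lambda>w. u (corner s' w))) = at_field (lift (pol f)) u s'"
        by (simp add: at_field_lift evv_pol[OF f] hom_aff[OF f])
      also have "(\<Prod>w\<in>UNIV. moebius_den (M w) (v (p w))) = (\<Prod>w\<in>UNIV. moebius_den (M' (par (p w))) (v (p w)))"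
        by (simp add: M'_def pp rt)
      also have "\<dots> = (\<Prod>q\<in>cell s. moebius_den (M' (par q)) (v q))"
      proof (rule prod.reindex_bij_betw)
        show "bij_betw p UNIV (cell s)"
          using bij_betw_trans[OF b bij_corner[of s]] by (simp add: p_def[abs_def] comp_def)
      qed
      finally show ?thesis by (simp add: mult.assoc)
    qed
    then show "\<exists>c. c \<noteq> 0 \<and> (\<forall>u v. (\<forall>p\<in>cell s. moebius_den (by_parity (M' X) (M' X1) (M' X2) (M' X12) p) (v p) \<noteq> 0 \<and>
        u (\<phi> p) = moebius (by_parity (M' X) (M' X1) (M' X2) (M' X12) p) (v p)) \<longrightarrow>
        at_field (lift (pol g)) v s = c * (\<Prod>p\<in>cell s. moebius_den (by_parity (M' X) (M' X1) (M' X2) (M' X12) p) (v p)) *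
          at_field (lift (pol f)) u s')"
      unfolding mp using c by (intro exI[of _ c]) blast
  qed (simp_all add: M'_def mo)
qed

text \<open>The cell at the origin already determines the form. The equality is known only where no
  denominator vanishes; two such points at each vertex suffice by
  \<open>multilin_eqI\<close>.\<close>

theorem lattice_equivalent_geqv:
  assumes f: "multiaffine f" and g: "multiaffine g" and e: "lattice_equivalent (lift (pol f)) (lift (pol g))"
  shows "geqv (hom f) (hom g)"
proof -
  obtain \<phi> m0 m1 m2 m12 where \<phi>: "\<phi> \<in> index_maps"
    and m: "is_moebius m0" "is_moebius m1" "is_moebius m2" "is_moebius m12"
    and all: "\<forall>s s'. \<phi> ` cell s = cell s' \<longrightarrow> (\<exists>c. c \<noteq> 0 \<and>
        (\<forall>u v. (\<forall>p\<in>cell s. moebius_den (by_parity m0 m1 m2 m12 p) (v p) \<noteq> 0 \<and> u (\<phi> p) = moebius (by_parity m0 m1 m2 m12 p) (v p)) \<longrightarrow>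
           at_field (lift (pol g)) v s = c * (\<Prod>p\<in>cell s. moebius_den (by_parity m0 m1 m2 m12 p) (v p)) * at_field (lift (pol f)) u s'))"
    using e unfolding lattice_equivalent_def Let_def by blast
  define s :: site where "s = (0, 0)"
  define M where "M = pack m0 m1 m2 m12"
  have mo: "is_moebius (M v)" for v using m by (cases v) (simp_all add: M_def)
  have inj: "inj \<phi>" using index_maps_cell[OF \<phi>] by blast
  obtain s' where s': "\<phi> ` cell s = cell s'" using index_maps_cell[OF \<phi>] by blast
  from all[rule_format, OF s'] obtain c where c: "c \<noteq> 0" and c_all: "\<forall>u v. (\<forall>p\<in>cell s.
      moebius_den (M (par p)) (v p) \<noteq> 0 \<and> u (\<phi> p) = moebius (M (par p)) (v p)) \<longrightarrow>
      at_field (lift (pol g)) v s = c * (\<Prod>p\<in>cell s. moebius_den (M (par p)) (v p)) * at_field (lift (pol f)) u s'"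
    unfolding by_parity_par M_def[symmetric] by (elim exE conjE)
  have eq: "at_field (lift (pol g)) v s = c * (\<Prod>p\<in>cell s. moebius_den (M (par p)) (v p)) * at_field (lift (pol f)) u s'"
    if "\<And>p. p \<in> cell s \<Longrightarrow> moebius_den (M (par p)) (v p) \<noteq> 0 \<and> u (\<phi> p) = moebius (M (par p)) (v p)" for u v
    by (rule c_all[rule_format]) (rule that)
  \<comment> \<open>The permutation of parity classes that \<open>\<phi>\<close> induces on this
    cell.\<close>
  define \<rho> where "\<rho> v = par (\<phi> (corner s v))" for v
  have cr: "corner s' (\<rho> v) = \<phi> (corner s v)" for v
    unfolding \<rho>_def by (rule corner_par) (use s' cell_corner in blast)
  have "inj \<rho>"
  proof (rule injI)
    fix v w assume "\<rho> v = \<rho> w"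
    then have "\<phi> (corner s v) = \<phi> (corner s w)" using cr by metis
    then show "v = w" using inj par_corner by (metis injD)
  qed
  then have b: "bij \<rho>" using finite_vertex finite_UNIV_inj_surj by (simp add: bij_def)
  define \<tau> where "\<tau> = inv \<rho>"
  have rt: "\<rho> (\<tau> v) = v" "\<tau> (\<rho> v) = v" for v
    using b by (simp_all add: \<tau>_def bij_is_inj bij_is_surj surj_f_inv_f)
  define S where "S y = c * hom f (\<lambda>v. act (M (\<tau> v)) (y (\<tau> v)))" for y
  have gb: "geqv_by \<tau> (\<lambda>v. M (\<tau> v)) c (hom f) S"
    unfolding geqv_by_def S_def using b mo c bij_imp_bij_inv by (simp add: \<tau>_def)
  have "hom g (aff z) = S (aff z)" if den: "\<And>v. moebius_den (M v) (z v) \<noteq> 0" for z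
  proof -
    define v where "v p = z (par p)" for p
    define u where "u q = moebius (M (par (inv \<phi> q))) (v (inv \<phi> q))" for q
    have u: "u (\<phi> p) = moebius (M (par p)) (v p)" for p by (simp add: u_def inj)
    have "at_field (lift (pol g)) v s = c * (\<Prod>p\<in>cell s. moebius_den (M (par p)) (v p)) * at_field (lift (pol f)) u s'"
      by (rule eq) (simp add: u den v_def)
    moreover have "at_field (lift (pol g)) v s = hom g (aff z)"
      by (simp add: at_field_lift evv_pol[OF g] hom_aff[OF g] v_def)
    moreover have "u (corner s' w) = moebius (M (\<tau> w)) (z (\<tau> w))" for w
      using cr[of "\<tau> w"] u[of "corner s (\<tau> w)"] by (simp add: rt v_def)
    then have "at_field (lift (pol f)) u s' = hom f (aff (\<lambda>w. moebius (M (\<tau> w)) (z (\<tau> w))))"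
      by (simp add: at_field_lift evv_pol[OF f] hom_aff[OF f])
    moreover have "(\<Prod>p\<in>cell s. moebius_den (M (par p)) (v p)) = (\<Prod>w\<in>UNIV. moebius_den (M (\<tau> w)) (z (\<tau> w)))"
    proof -
      have "bij_betw (\<lambda>w. corner s (\<tau> w)) UNIV (cell s)"
        using bij_betw_trans[OF bij_imp_bij_inv[OF b] bij_corner[of s]] by (simp add: \<tau>_def comp_def)
      from prod.reindex_bij_betw[OF this, of "\<lambda>p. moebius_den (M (par p)) (v p)"] show ?thesis by (simp add: v_def)
    qed
    moreover have "S (aff z) = c * ((\<Prod>w\<in>UNIV. moebius_den (M (\<tau> w)) (z (\<tau> w))) * hom f (aff (\<lambda>w. moebius (M (\<tau> w)) (z (\<tau> w)))))"
    proof -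
      have "(\<lambda>v. act (M (\<tau> v)) (aff z (\<tau> v))) = (\<lambda>w. (moebius_den (M (\<tau> w)) (z (\<tau> w)) * fst (aff (\<lambda>w. moebius (M (\<tau> w)) (z (\<tau> w))) w),
          moebius_den (M (\<tau> w)) (z (\<tau> w)) * snd (aff (\<lambda>w. moebius (M (\<tau> w)) (z (\<tau> w))) w)))"
        using act_aff[OF den] by (simp add: aff_def)
      then show ?thesis unfolding S_def by (simp only: multilin_scale_all[OF multilin_hom])
    qed
    ultimately show ?thesis by (simp add: mult.assoc)
  qed
  note main = this
  \<comment> \<open>The denominator of a Moebius transformation has at most one zero.\<close>
  have "\<exists>a b. a \<noteq> b \<and> moebius_den (M v) a \<noteq> 0 \<and> moebius_den (M v) b \<noteq> 0" for v
  proof -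
    obtain p q r t where M: "M v = (p, q, r, t)" by (cases "M v")
    have "r \<noteq> 0 \<or> t \<noteq> 0" using mo[of v] by (auto simp: M)
    then show ?thesis
    proof (cases "r = 0")
      case True
      then show ?thesis using \<open>r \<noteq> 0 \<or> t \<noteq> 0\<close> by (intro exI[of _ 0] exI[of _ 1]) (simp add: M)
    next
      case False
      then show ?thesis by (intro exI[of _ "(1 - t) / r"] exI[of _ "(2 - t) / r"]) (simp add: M field_simps)
    qed
  qed
  then obtain a b where ab: "\<And>v. a v \<noteq> b v" "\<And>v. moebius_den (M v) (a v) \<noteq> 0" "\<And>v. moebius_den (M v) (b v) \<noteq> 0"
    by metis
  have "hom g = S"
  proof (rule multilin_eqI[where a = a and b = b])
    fix z assume "\<And>v. z v \<in> {a v, b v}"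
    then have "moebius_den (M v) (z v) \<noteq> 0" for v using ab(2,3) by (metis empty_iff insert_iff)
    then show "hom g (aff z) = S (aff z)" by (rule main)
  qed (use ab(1) multilin_hom multilin_geqv_by[OF _ gb] in auto)
  then show ?thesis using gb unfolding geqv_def by blast
qed

section \<open>The cell polynomials of the representatives\<close>

definition cellf :: "lattice_equation \<Rightarrow> (vertex \<Rightarrow> complex) \<Rightarrow> complex" where
  "cellf E z = E (0, 0) (z X) (z X1) (z X2) (z X12)"

lemma cellf_pack: "cellf E (pack a b c d) = E (0, 0) a b c d"
  by (simp add: cellf_def)

lemma F_0 [simp]: "Fplus 0 = 1" "Fminus 0 = 0"
  by (simp_all add: Fplus_def Fminus_def)

lemma multiaffine_cellI:
  assumes "\<And>x x1 x2 x12. E (0, 0) x x1 x2 x12 = E (0, 0) 0 x1 x2 x12 + x * (E (0, 0) 1 x1 x2 x12 - E (0, 0) 0 x1 x2 x12)"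
    "\<And>x x1 x2 x12. E (0, 0) x x1 x2 x12 = E (0, 0) x 0 x2 x12 + x1 * (E (0, 0) x 1 x2 x12 - E (0, 0) x 0 x2 x12)"
    "\<And>x x1 x2 x12. E (0, 0) x x1 x2 x12 = E (0, 0) x x1 0 x12 + x2 * (E (0, 0) x x1 1 x12 - E (0, 0) x x1 0 x12)"
    "\<And>x x1 x2 x12. E (0, 0) x x1 x2 x12 = E (0, 0) x x1 x2 0 + x12 * (E (0, 0) x x1 x2 1 - E (0, 0) x x1 x2 0)"
  shows "multiaffine (cellf E)"
  by (rule multiaffine_pack[where g = "E (0, 0)"]) (rule cellf_pack, (rule assms)+)

lemmas rep_defs = tH1_def tH2_def tH3_def D1_def D2_1_def D2_2_def D2_3_def D3_def D4_1_def D4_2_def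

lemma multiaffine_cellf:
  "multiaffine (cellf (tH1 \<alpha>2 \<epsilon>))" "multiaffine (cellf (tH2 \<alpha>2 \<alpha>3 \<epsilon>))"
  "multiaffine (cellf (tH3 \<alpha>2 \<alpha>3 \<delta> \<epsilon>))" "multiaffine (cellf D1)" "multiaffine (cellf (D2_1 \<delta>1 \<delta>2))"
  "multiaffine (cellf (D2_2 \<delta>1 \<delta>2 lam))" "multiaffine (cellf (D2_3 \<delta>1 \<delta>2 lam))" "multiaffine (cellf D3)"
  "multiaffine (cellf (D4_1 \<delta>1 \<delta>2 \<delta>3))" "multiaffine (cellf (D4_2 \<delta>1 \<delta>2 \<delta>3))"
  by (rule multiaffine_cellI; simp add: rep_defs field_simps; fail)+

lemma lift_pol: "multiaffine f \<Longrightarrow> lift (pol f) = (\<lambda>(n, m) u u1 u2 u12.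
       Fplus n * Fplus m * f (pack u u1 u2 u12)
     + Fminus n * Fplus m * f (pack u1 u u12 u2)
     + Fplus n * Fminus m * f (pack u2 u12 u u1)
     + Fminus n * Fminus m * f (pack u12 u2 u1 u))"
  unfolding lift_def ev_eq_evv evv_pol ..

lemma lift_eqI:
  assumes f: "multiaffine f"
    and "\<And>n m u u1 u2 u12. even n \<Longrightarrow> even m \<Longrightarrow> E (n, m) u u1 u2 u12 = f (pack u u1 u2 u12)"
    "\<And>n m u u1 u2 u12. odd n \<Longrightarrow> even m \<Longrightarrow> E (n, m) u u1 u2 u12 = f (pack u1 u u12 u2)"
    "\<And>n m u u1 u2 u12. even n \<Longrightarrow> odd m \<Longrightarrow> E (n, m) u u1 u2 u12 = f (pack u2 u12 u u1)"
    "\<And>n m u u1 u2 u12. odd n \<Longrightarrow> odd m \<Longrightarrow> E (n, m) u u1 u2 u12 = f (pack u12 u2 u1 u)"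
  shows "E = lift (pol f)"
proof (intro ext)
  fix s :: site and u u1 u2 u12
  obtain n m where "s = (n, m)" by (cases s)
  then show "E s u u1 u2 u12 = lift (pol f) s u u1 u2 u12"
    unfolding lift_pol[OF f] using assms(2-) by (cases "even n"; cases "even m") simp_all
qed

lemma lift_cellf:
  "tH1 \<alpha>2 \<epsilon> = lift (pol (cellf (tH1 \<alpha>2 \<epsilon>)))" "tH2 \<alpha>2 \<alpha>3 \<epsilon> = lift (pol (cellf (tH2 \<alpha>2 \<alpha>3 \<epsilon>)))"
  "tH3 \<alpha>2 \<alpha>3 \<delta> \<epsilon> = lift (pol (cellf (tH3 \<alpha>2 \<alpha>3 \<delta> \<epsilon>)))" "D1 = lift (pol (cellf D1))"
  "D2_1 \<delta>1 \<delta>2 = lift (pol (cellf (D2_1 \<delta>1 \<delta>2)))"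
  "D2_2 \<delta>1 \<delta>2 lam = lift (pol (cellf (D2_2 \<delta>1 \<delta>2 lam)))"
  "D2_3 \<delta>1 \<delta>2 lam = lift (pol (cellf (D2_3 \<delta>1 \<delta>2 lam)))" "D3 = lift (pol (cellf D3))"
  "D4_1 \<delta>1 \<delta>2 \<delta>3 = lift (pol (cellf (D4_1 \<delta>1 \<delta>2 \<delta>3)))"
  "D4_2 \<delta>1 \<delta>2 \<delta>3 = lift (pol (cellf (D4_2 \<delta>1 \<delta>2 \<delta>3)))"
  by (rule lift_eqI, rule multiaffine_cellf; simp add: cellf_pack rep_defs algebra_simps; fail)+

lemma cell_irreducible_pol:
  assumes "multiaffine (cellf E)" "nondeg (hom (cellf E))"
  shows "cell_irreducible E"
proof -
  have "irreducible (pol (cellf E))"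
    using assms quad_equation_pol_iff quad_equation_def by blast
  then show ?thesis
    unfolding cell_irreducible_def ev_eq_evv using evv_pol[OF assms(1)] cellf_pack by metis
qed

lemma equivalent_to_rep:
  assumes f: "multiaffine f" and q: "quad_equation (pol f)"
    and g: "multiaffine (cellf E)" "E = lift (pol (cellf E))" and e: "eqv (hom f) (hom (cellf E))"
  shows "cell_irreducible E" "lattice_equivalent (lift (pol f)) E"
proof -
  have "nondeg (hom (cellf E))"
    using nondeg_eqv[OF multilin_hom _ e] q quad_equation_pol_iff[OF f] by blast
  then show "cell_irreducible E" using cell_irreducible_pol[OF g(1)] by blast
  show "lattice_equivalent (lift (pol f)) E"
    using lattice_equivalent_lift[OF f g(1) e] g(2) by simp
qed

lemma hom_eqI: "multilin T \<Longrightarrow> multiaffine f \<Longrightarrow> (\<And>a b c d. T (pack (a, 1) (b, 1) (c, 1) (d, 1)) = f (pack a b c d)) \<Longrightarrow> hom f = T"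
  by (rule multilin_eqI') (simp_all add: multilin_hom hom_aff, metis aff_pack pack_eta)

section \<open>Normal forms in the trapezoidal case\<close>

type_synonym bilinear = "complex \<times> complex \<times> complex \<times> complex"

fun bl :: "bilinear \<Rightarrow> hpoint \<Rightarrow> hpoint \<Rightarrow> complex" where
  "bl (a, b, c, d) q r = a * fst q * fst r + b * fst q * snd r + c * snd q * fst r + d * snd q * snd r"

text \<open>The general form \<open>x d + x1 b + c\<close> that vanishes when both \<open>x\<close>
  and \<open>x1\<close> are infinite. Each tuple lists the coefficients of \<open>x2 x12\<close>,
  \<open>x2\<close>, \<open>x12\<close> and 1.\<close>

definition NF :: "bilinear \<Rightarrow> bilinear \<Rightarrow> bilinear \<Rightarrow> form" where
  "NF d b c y = fst (y X) * snd (y X1) * bl d (y X2) (y X12) + snd (y X) * fst (y X1) * bl b (y X2) (y X12)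
     + snd (y X) * snd (y X1) * bl c (y X2) (y X12)"

lemma multilinI_pack:
  assumes "\<And>s t b c d. T (pack (s, t) b c d) = s * T (pack (1, 0) b c d) + t * T (pack (0, 1) b c d)"
    "\<And>a s t c d. T (pack a (s, t) c d) = s * T (pack a (1, 0) c d) + t * T (pack a (0, 1) c d)"
    "\<And>a b s t d. T (pack a b (s, t) d) = s * T (pack a b (1, 0) d) + t * T (pack a b (0, 1) d)"
    "\<And>a b c s t. T (pack a b c (s, t)) = s * T (pack a b c (1, 0)) + t * T (pack a b c (0, 1))"
  shows "multilin T"
proof -
  have "T ((pack a b c d)(v := (s, t))) = s * T ((pack a b c d)(v := (1, 0))) + t * T ((pack a b c d)(v := (0, 1)))"
    for v s t a b c d
    by (cases v; simp only: pack_upd; rule assms)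
  note main = this
  show ?thesis
    unfolding multilin_def
  proof (intro allI)
    fix v y s t
    show "T (y(v := (s, t))) = s * T (y(v := (1, 0))) + t * T (y(v := (0, 1)))"
      using main[of "y X" "y X1" "y X2" "y X12" v s t] by simp
  qed
qed

lemma multilin_NF: "multilin (NF d b c)"
  by (cases d; cases b; cases c; rule multilinI_pack) (simp_all add: NF_def algebra_simps)

text \<open>
  The substitution \<open>x \<mapsto> \<nu> x + \<sigma>\<close>, \<open>x1 \<mapsto> \<xi> x1 + \<rho>\<close>, \<open>x2 \<mapsto> s x2 + a\<close>, \<open>x12 \<mapsto> t x12 + a'\<close>.
\<close>

lemma NF_affine:
  assumes "k \<noteq> 0" "\<nu> \<noteq> 0" "\<xi> \<noteq> 0" "s \<noteq> 0" "t \<noteq> 0"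
    and "d' = (k * \<nu> * (d3 * s * t), k * \<nu> * (d3 * s * a' + d1 * s), k * \<nu> * (d3 * a * t + d2 * t), k * \<nu> * (d3 * a * a' + d1 * a + d2 * a' + d0))"
    and "b' = (k * \<xi> * (b3 * s * t), k * \<xi> * (b3 * s * a' + b1 * s), k * \<xi> * (b3 * a * t + b2 * t), k * \<xi> * (b3 * a * a' + b1 * a + b2 * a' + b0))"
    and "c' = (k * ((c3 + \<sigma> * d3 + \<rho> * b3) * s * t),
       k * ((c3 + \<sigma> * d3 + \<rho> * b3) * s * a' + (c1 + \<sigma> * d1 + \<rho> * b1) * s),
       k * ((c3 + \<sigma> * d3 + \<rho> * b3) * a * t + (c2 + \<sigma> * d2 + \<rho> * b2) * t),
       k * ((c3 + \<sigma> * d3 + \<rho> * b3) * a * a' + (c1 + \<sigma> * d1 + \<rho> * b1) * a + (c2 + \<sigma> * d2 + \<rho> * b2) * a' + (c0 + \<sigma> * d0 + \<rho> * b0)))"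
  shows "eqv (NF (d3, d1, d2, d0) (b3, b1, b2, b0) (c3, c1, c2, c0)) (NF d' b' c')"
  by (rule eqv_moebiusI[of "(\<nu>, \<sigma>, 0, 1)" "(\<xi>, \<rho>, 0, 1)" "(s, a, 0, 1)" "(t, a', 0, 1)" k])
    (use assms in \<open>simp_all add: NF_def algebra_simps\<close>)

text \<open>The substitution \<open>z \<mapsto> (1 + z) / (1 - z)\<close> in \<open>x2\<close> and \<open>x12\<close>.\<close>

lemma NF_cayley:
  "eqv (NF (0, 1, -1, 0) (0, -1, 1, 0) (0, k, k, 0)) (NF (0, 1, -1, 0) (0, -1, 1, 0) (- k, 0, 0, k))"
  by (rule eqv_moebiusI[of "(1, 0, 0, 1)" "(1, 0, 0, 1)" "(1, 1, -1, 1)" "(1, 1, -1, 1)" "1 / 2"])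
    (simp_all add: NF_def field_simps)

text \<open>Inverting \<open>x2\<close> and \<open>x12\<close> exchanges the coefficients of
  \<open>x2 x12\<close> and 1 and reverses the sign of \<open>x2 - x12\<close>, which the signs of
  \<open>x\<close> and \<open>x1\<close> compensate.\<close>

lemma NF_invert:
  "eqv (NF (0, 1, -1, 0) (0, -1, 1, 0) (k, 0, 0, 0)) (NF (0, 1, -1, 0) (0, -1, 1, 0) (0, 0, 0, k))"
  by (rule eqv_moebiusI[of "(-1, 0, 0, 1)" "(-1, 0, 0, 1)" "(0, 1, 1, 0)" "(0, 1, 1, 0)" "1"])
    (simp_all add: NF_def algebra_simps)

text \<open>The equation \<open>(x - x1) (x2 - x12) + \<alpha> (x + x1) = 0\<close> has null pairs
  at infinity on both opposite edges; exchanging these edges turns a Jordan block into a scalar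
  pencil.\<close>

lemma NF_swap:
  "eqv (NF (0, 1, -1, \<alpha>) (0, -1, 1, \<alpha>) (0, 0, 0, 0)) (NF (0, 1, -1, 0) (0, -1, 1, 0) (0, \<alpha>, \<alpha>, 0))"
  by (rule eqv_relabelI[of X2 X12 X X1]) (simp_all add: NF_def insert_commute algebra_simps)

lemma hom_tH1: "hom (cellf (tH1 \<alpha> \<epsilon>)) = NF (0, 1, -1, 0) (0, -1, 1, 0) (- \<alpha> * \<epsilon>\<^sup>2, 0, 0, - \<alpha>)"
  by (rule hom_eqI[OF multilin_NF multiaffine_cellf(1)]) (simp add: NF_def cellf_pack tH1_def algebra_simps)

lemma hom_tH2: "hom (cellf (tH2 \<alpha> \<beta> \<epsilon>)) = NF (0, 1, -1, \<alpha>) (0, -1, 1, \<alpha>)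
    (2 * \<epsilon> * \<alpha>, \<alpha> + \<epsilon> * \<alpha> * (2 * \<beta> + \<alpha>), \<alpha> + \<epsilon> * \<alpha> * (2 * \<beta> + \<alpha>),
     \<epsilon> * \<alpha> * (2 * \<beta> + \<alpha>)\<^sup>2 + (\<beta> + \<alpha>)\<^sup>2 - \<beta>\<^sup>2 - 2 * \<epsilon> * \<alpha> * \<beta> * (\<beta> + \<alpha>))"
  by (rule hom_eqI[OF multilin_NF multiaffine_cellf(2)])
    (simp add: NF_def cellf_pack tH2_def, simp add: field_simps power2_eq_square)

text \<open>For this value of the second parameter \<open>2 \<beta> + \<alpha>\<close> vanishes,
  which leaves only \<open>\<epsilon>\<close> to be matched with the coefficient of
  \<open>x2 x12\<close>.\<close>

lemma hom_tH2_half: "hom (cellf (tH2 \<alpha> (- \<alpha> / 2) \<epsilon>)) = NF (0, 1, -1, \<alpha>) (0, -1, 1, \<alpha>)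
    (2 * \<epsilon> * \<alpha>, \<alpha>, \<alpha>, \<epsilon> * \<alpha> ^ 3 / 2)"
proof -
  have "2 * (- \<alpha> / 2) + \<alpha> = 0" by simp
  moreover have "- \<alpha> / 2 + \<alpha> = \<alpha> / 2" by (simp add: field_simps)
  ultimately show ?thesis unfolding hom_tH2 by (simp add: power2_eq_square power3_eq_cube mult.assoc)
qed

lemma hom_tH3: "hom (cellf (tH3 \<alpha> \<beta> \<delta> \<epsilon>)) = NF (0, -1, \<alpha>, 0) (0, \<alpha>, -1, 0)
    (- \<epsilon>\<^sup>2 * (\<alpha>\<^sup>2 - 1) / (\<beta> * \<alpha>), 0, 0, - \<beta> * (\<alpha>\<^sup>2 - 1) * \<delta>\<^sup>2)"
  by (rule hom_eqI[OF multilin_NF multiaffine_cellf(3)])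
    (simp add: NF_def cellf_pack tH3_def divide_inverse algebra_simps)

text \<open>Here \<open>d = - b\<close>, so the equation reads
  \<open>(x - x1) (x2 - x12) + c = 0\<close>. A shift of \<open>x\<close> makes \<open>c\<close>
  symmetric; a common shift of \<open>x2\<close> and \<open>x12\<close> then removes its linear part
  if \<open>c3\<close> is nonzero, and its constant if \<open>c3 = 0\<close> and the linear part is
  not zero. The exceptional shapes reach \<open>tH1\<close> by \<open>NF_invert\<close> or
  \<open>NF_cayley\<close>, and \<open>c = 0\<close> contradicts nondegeneracy.\<close>

lemma NF_scalar:
  assumes nd: "nondeg (NF (0, 1, -1, 0) (0, -1, 1, 0) (c3, c1, c2, c0))"
  shows "\<exists>\<alpha> \<epsilon>. eqv (NF (0, 1, -1, 0) (0, -1, 1, 0) (c3, c1, c2, c0)) (hom (cellf (tH1 \<alpha> \<epsilon>)))"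
proof -
  let ?N = "NF (0, 1, -1, 0) (0, -1, 1, 0)"
  define e where "e = (c1 + c2) / 2"
  have 1: "eqv (?N (c3, c1, c2, c0)) (?N (c3, e, e, c0))"
    by (rule NF_affine[where k = "1" and \<nu> = "1" and \<xi> = "1" and s = "1" and t = "1" and a = "0" and a' = "0" and \<sigma> = "(c2 - c1) / 2" and \<rho> = "0"]) (simp_all add: e_def field_simps)
  have K: "\<exists>\<alpha> \<epsilon>. eqv (?N (k3, 0, 0, k0)) (hom (cellf (tH1 \<alpha> \<epsilon>)))" if "k0 \<noteq> 0" for k3 k0
  proof -
    \<comment> \<open>Comparison with \<open>hom_tH1\<close> requires \<open>\<alpha> = - k0\<close>
      and \<open>\<alpha> \<epsilon>^2 = - k3\<close>.\<close>
    have "?N (k3, 0, 0, k0) = hom (cellf (tH1 (- k0) (csqrt (k3 / k0))))"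
      using that by (simp add: hom_tH1)
    then show ?thesis using eqv_refl by metis
  qed
  show ?thesis
  proof (cases "c3 = 0")
    case False
    have 2: "eqv (?N (c3, e, e, c0)) (?N (c3, 0, 0, c0 - e\<^sup>2 / c3))"
      by (rule NF_affine[where k = "1" and \<nu> = "1" and \<xi> = "1" and s = "1" and t = "1" and a = "- e / c3" and a' = "- e / c3" and \<sigma> = "0" and \<rho> = "0"])
        (use False in \<open>simp_all add: field_simps power2_eq_square\<close>)
    show ?thesis
    proof (cases "c0 - e\<^sup>2 / c3 = 0")
      case True
      obtain \<alpha> \<epsilon> where "eqv (?N (0, 0, 0, c3)) (hom (cellf (tH1 \<alpha> \<epsilon>)))"
        using K[OF False] by blast
      from eqv_trans[OF NF_invert this] have "eqv (?N (c3, 0, 0, c0 - e\<^sup>2 / c3)) (hom (cellf (tH1 \<alpha> \<epsilon>)))"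
        unfolding True .
      from eqv_trans[OF 1 eqv_trans[OF 2 this]] show ?thesis by blast
    next
      case False
      obtain \<alpha> \<epsilon> where "eqv (?N (c3, 0, 0, c0 - e\<^sup>2 / c3)) (hom (cellf (tH1 \<alpha> \<epsilon>)))"
        using K[OF False] by blast
      from eqv_trans[OF 1 eqv_trans[OF 2 this]] show ?thesis by blast
    qed
  next
    case c3: True
    show ?thesis
    proof (cases "e = 0")
      case True
      have "c0 \<noteq> 0"
      proof
        assume "c0 = 0"
        then have "nondeg (?N (0, 0, 0, 0))"
          using nondeg_eqv[OF multilin_NF nd 1] c3 True by simp
        moreover have "tdet X X2 (?N (0, 0, 0, 0)) y = 0" for y
          by (simp add: tdet_def NF_def algebra_simps)
        ultimately show False unfolding nondeg_def using vertex.distinct(3) by blast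
      qed
      then obtain \<alpha> \<epsilon> where "eqv (?N (0, 0, 0, c0)) (hom (cellf (tH1 \<alpha> \<epsilon>)))"
        using K by blast
      from eqv_trans[OF 1[unfolded True c3] this] show ?thesis unfolding c3 by blast
    next
      case False
      have 2: "eqv (?N (0, e, e, c0)) (?N (0, e, e, 0))"
        by (rule NF_affine[where k = "1" and \<nu> = "1" and \<xi> = "1" and s = "1" and t = "1" and a = "- c0 / (2 * e)" and a' = "- c0 / (2 * e)" and \<sigma> = "0" and \<rho> = "0"])
          (use False in \<open>simp_all add: field_simps\<close>)
      obtain \<alpha> \<epsilon> where "eqv (?N (- e, 0, 0, e)) (hom (cellf (tH1 \<alpha> \<epsilon>)))"
        using K[OF False] by blast
      from eqv_trans[OF 1[unfolded c3] eqv_trans[OF 2 eqv_trans[OF NF_cayley this]]]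
      show ?thesis unfolding c3 by blast
    qed
  qed
qed

text \<open>Here \<open>d + b\<close> has rank one, a Jordan block. What remains free is a common
  shift \<open>a\<close> of \<open>x2\<close>, \<open>x12\<close> and shifts
  \<open>\<sigma>\<close>, \<open>\<rho>\<close> of \<open>x\<close>, \<open>x1\<close>: the
  difference \<open>\<sigma> - \<rho>\<close> moves the antisymmetric part of \<open>c\<close>, the
  sum \<open>\<sigma> + \<rho>\<close> its constant. So only \<open>c3\<close> and the symmetric
  linear part count; if both vanish, \<open>NF_swap\<close> shows that the equation is a
  \<open>tH1\<close>.\<close>

lemma NF_jordan:
  assumes a: "\<alpha> \<noteq> 0"
  shows "(\<exists>\<alpha>1 \<epsilon>. eqv (NF (0, 1, -1, \<alpha>) (0, -1, 1, \<alpha>) (c3, c1, c2, c0)) (hom (cellf (tH1 \<alpha>1 \<epsilon>)))) \<or>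
    (\<exists>\<alpha>2 \<beta> \<epsilon>. eqv (NF (0, 1, -1, \<alpha>) (0, -1, 1, \<alpha>) (c3, c1, c2, c0)) (hom (cellf (tH2 \<alpha>2 \<beta> \<epsilon>))))"
proof -
  let ?N = "NF (0, 1, -1, \<alpha>) (0, -1, 1, \<alpha>)"
  have sh: "eqv (?N (c3, c1, c2, c0)) (?N (c3 / k, (c1 + c3 * a + \<sigma> - \<rho>) / k, (c2 + c3 * a - \<sigma> + \<rho>) / k,
      (c0 + a * (c1 + c2) + c3 * a * a + \<alpha> * (\<sigma> + \<rho>)) / k))" if "k \<noteq> 0" for k a \<sigma> \<rho>
    by (rule NF_affine[where k = "1 / k" and \<nu> = "k" and \<xi> = "k" and s = "1" and t = "1" and a = "a" and a' = "a" and \<sigma> = "\<sigma>" and \<rho> = "\<rho>"])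
      (use that in \<open>simp_all add: field_simps\<close>)
  have sr: "\<exists>\<sigma> \<rho>. \<sigma> - \<rho> = u \<and> \<sigma> + \<rho> = v" for u v :: complex
    by (intro exI[of _ "(u + v) / 2"] exI[of _ "(v - u) / 2"]) (simp add: field_simps)
  show ?thesis
  proof (cases "c3 = 0")
    case False
    \<comment> \<open>Read off from \<open>hom_tH2_half\<close>:
      \<open>c3 = 2 \<epsilon> \<alpha>\<close>, and the shift \<open>s\<close> brings the mean of
      \<open>c1\<close> and \<open>c2\<close> to \<open>\<alpha>\<close>.\<close>
    define \<epsilon> where "\<epsilon> = c3 / (2 * \<alpha>)"
    define s where "s = (\<alpha> - (c1 + c2) / 2) / c3"
    obtain \<sigma> \<rho> where sr: "\<sigma> - \<rho> = (c2 - c1) / 2" "\<sigma> + \<rho> = (\<epsilon> * \<alpha> ^ 3 / 2 - (c0 + s * (c1 + c2) + c3 * s * s)) / \<alpha>"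
      using sr by blast
    have "?N (c3 / 1, (c1 + c3 * s + \<sigma> - \<rho>) / 1, (c2 + c3 * s - \<sigma> + \<rho>) / 1,
      (c0 + s * (c1 + c2) + c3 * s * s + \<alpha> * (\<sigma> + \<rho>)) / 1) = hom (cellf (tH2 \<alpha> (- \<alpha> / 2) \<epsilon>))"
    proof -
      have e3: "c3 = 2 * \<epsilon> * \<alpha>" using a by (simp add: \<epsilon>_def)
      have e12: "c1 + c3 * s + \<sigma> - \<rho> = \<alpha>" "c2 + c3 * s - \<sigma> + \<rho> = \<alpha>"
      proof -
        define m n where "m = (c1 + c2) / 2" and "n = (c2 - c1) / 2"
        have c12: "c1 = m - n" "c2 = m + n"
          unfolding m_def n_def by (simp_all flip: add_divide_distrib diff_divide_distrib)
        have cs: "c3 * s = \<alpha> - m" using False by (simp add: s_def m_def)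
        have sg: "\<sigma> = n + \<rho>" using sr(1) unfolding n_def by (simp only: diff_eq_eq)
        show "c1 + c3 * s + \<sigma> - \<rho> = \<alpha>" "c2 + c3 * s - \<sigma> + \<rho> = \<alpha>"
          unfolding cs sg c12 by simp_all
      qed
      have e0: "c0 + s * (c1 + c2) + c3 * s * s + \<alpha> * (\<sigma> + \<rho>) = \<epsilon> * \<alpha> ^ 3 / 2"
        unfolding sr(2) using a by simp
      show ?thesis unfolding div_by_1 e12 e0 hom_tH2_half by (simp only: e3)
    qed
    then have "eqv (?N (c3, c1, c2, c0)) (hom (cellf (tH2 \<alpha> (- \<alpha> / 2) \<epsilon>)))"
      using sh[OF one_neq_zero, of s \<sigma> \<rho>] by (simp only:)
    then show ?thesis by blast
  next
    case c3: True
    show ?thesis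
    proof (cases "c1 + c2 = 0")
      case False
      \<comment> \<open>With \<open>c3 = 0\<close> no shift changes the mean of \<open>c1\<close>
        and \<open>c2\<close>; it is scaled to \<open>\<alpha>\<close> instead.\<close>
      define k where "k = (c1 + c2) / (2 * \<alpha>)"
      have k: "k \<noteq> 0" using False a by (simp add: k_def)
      obtain \<sigma> \<rho> where sr: "\<sigma> - \<rho> = (c2 - c1) / 2" "\<sigma> + \<rho> = - c0 / \<alpha>" using sr by blast
      have "?N (c3 / k, (c1 + c3 * 0 + \<sigma> - \<rho>) / k, (c2 + c3 * 0 - \<sigma> + \<rho>) / k,
        (c0 + 0 * (c1 + c2) + c3 * 0 * 0 + \<alpha> * (\<sigma> + \<rho>)) / k) = hom (cellf (tH2 \<alpha> (- \<alpha> / 2) 0))"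
      proof -
        define m n where "m = (c1 + c2) / 2" and "n = (c2 - c1) / 2"
        have c12: "c1 = m - n" "c2 = m + n"
          unfolding m_def n_def by (simp_all flip: add_divide_distrib diff_divide_distrib)
        have sg: "\<sigma> = n + \<rho>" using sr(1) unfolding n_def by (simp only: diff_eq_eq)
        have "m = \<alpha> * k" using a by (simp add: k_def m_def)
        then have "c1 + \<sigma> - \<rho> = \<alpha> * k" "c2 - \<sigma> + \<rho> = \<alpha> * k" unfolding sg c12 by simp_all
        moreover have "c0 + \<alpha> * (\<sigma> + \<rho>) = 0" unfolding sr(2) using a by simp
        ultimately show ?thesis unfolding hom_tH2_half using k c3 by simp
      qed
      then have "eqv (?N (c3, c1, c2, c0)) (hom (cellf (tH2 \<alpha> (- \<alpha> / 2) 0)))"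
        using sh[OF k, of 0 \<sigma> \<rho>] by (simp only:)
      then show ?thesis by blast
    next
      case True
      obtain \<sigma> \<rho> where sr: "\<sigma> - \<rho> = (c2 - c1) / 2" "\<sigma> + \<rho> = - c0 / \<alpha>" using sr by blast
      have "c1 + \<sigma> - \<rho> = 0" "c2 - \<sigma> + \<rho> = 0" "c0 + \<alpha> * (\<sigma> + \<rho>) = 0"
      proof -
        have c2: "c2 = - c1" using True by (simp add: add_eq_0_iff)
        have "(c2 - c1) / 2 = - c1" by (simp add: c2)
        then have sg: "\<sigma> = - c1 + \<rho>" using sr(1) by (simp only: diff_eq_eq)
        show "c1 + \<sigma> - \<rho> = 0" "c2 - \<sigma> + \<rho> = 0" unfolding sg c2 by simp_all
        show "c0 + \<alpha> * (\<sigma> + \<rho>) = 0" unfolding sr(2) using a by simp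
      qed
      then have "eqv (?N (c3, c1, c2, c0)) (?N (0, 0, 0, 0))" using sh[of 1 0 \<sigma> \<rho>] c3 by simp
      also have "eqv \<dots> (NF (0, 1, -1, 0) (0, -1, 1, 0) (0, \<alpha>, \<alpha>, 0))" by (rule NF_swap)
      also have "eqv \<dots> (NF (0, 1, -1, 0) (0, -1, 1, 0) (- \<alpha>, 0, 0, \<alpha>))" by (rule NF_cayley)
      also have "NF (0, 1, -1, 0) (0, -1, 1, 0) (- \<alpha>, 0, 0, \<alpha>) = hom (cellf (tH1 (- \<alpha>) \<i>))"
        by (simp add: hom_tH1)
      finally show ?thesis by (intro disjI1 exI)
    qed
  qed
qed

text \<open>Scalings of the four variables preserve \<open>d2 b1 / (d1 b2)\<close>, which is
  \<open>\<alpha>^2\<close> for \<open>tH3\<close> and \<open>- d2 / d1\<close> here; this dictates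
  \<open>\<alpha>\<close>. As \<open>d1 + d2\<close> is nonzero, shifts of \<open>x\<close> and
  \<open>x1\<close> remove the linear part of \<open>c\<close>, and the two remaining coefficients
  are absorbed in \<open>\<delta>\<close> and \<open>\<epsilon>\<close>.\<close>

lemma NF_diagonal:
  assumes d: "d1 \<noteq> 0" "d2 \<noteq> 0" "d1 + d2 \<noteq> 0"
  shows "\<exists>\<alpha> \<delta> \<epsilon>. \<alpha> \<noteq> 0 \<and> eqv (NF (0, d1, d2, 0) (0, 1, -1, 0) (c3, c1, c2, c0)) (hom (cellf (tH3 \<alpha> 1 \<delta> \<epsilon>)))"
proof -
  define \<alpha> where "\<alpha> = csqrt (- d2 / d1)"
  have a2: "\<alpha>\<^sup>2 = - d2 / d1" by (simp add: \<alpha>_def)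
  have a: "\<alpha> \<noteq> 0" using d by (simp add: \<alpha>_def)
  have a1: "\<alpha>\<^sup>2 - 1 \<noteq> 0"
  proof
    assume "\<alpha>\<^sup>2 - 1 = 0"
    then have "- d2 = d1" using a2 d(1) by (simp add: field_simps)
    then show False using d(3) by auto
  qed
  define \<sigma> \<rho> where "\<sigma> = - (c1 + c2) / (d1 + d2)" and "\<rho> = - c1 - \<sigma> * d1"
  have sr: "c1 + \<sigma> * d1 + \<rho> = 0" "c2 + \<sigma> * d2 - \<rho> = 0"
  proof -
    have "\<sigma> * (d1 + d2) = - (c1 + c2)" using d(3) by (simp add: \<sigma>_def)
    then show "c1 + \<sigma> * d1 + \<rho> = 0" "c2 + \<sigma> * d2 - \<rho> = 0" by (simp_all add: \<rho>_def algebra_simps)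
  qed
  have da: "d2 / (d1 * \<alpha>) = - \<alpha>"
  proof -
    have "\<alpha> * \<alpha> * d1 = - d2" using a2 d(1) by (simp add: power2_eq_square field_simps)
    then show ?thesis using a d(1) by (simp add: field_simps)
  qed
  have "eqv (NF (0, d1, d2, 0) (0, 1, -1, 0) (c3, c1, c2, c0)) (NF (0, -1, \<alpha>, 0) (0, \<alpha>, -1, 0) (c3 / \<alpha>, 0, 0, c0))"
    by (rule NF_affine[where k = "1" and \<nu> = "- 1 / d1" and \<xi> = "\<alpha>" and s = "1" and t = "1 / \<alpha>" and a = "0" and a' = "0" and \<sigma> = "\<sigma>" and \<rho> = "\<rho>"])
      (use a d da sr in \<open>simp_all add: field_simps\<close>)
  also have "\<dots> = hom (cellf (tH3 \<alpha> 1 (csqrt (- c0 / (\<alpha>\<^sup>2 - 1))) (csqrt (- c3 / (\<alpha>\<^sup>2 - 1)))))"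
  proof -
    define w where "w = \<alpha>\<^sup>2 - 1"
    show ?thesis
      using a a1 unfolding hom_tH3 power2_csqrt w_def[symmetric] by simp
  qed
  finally show ?thesis using a by blast
qed

text \<open>A Moebius transformation of \<open>x12\<close> alone turns \<open>b\<close> into the
  skew form \<open>x2 - x12\<close>, which is preserved by every unimodular substitution performed
  in \<open>x2\<close> and \<open>x12\<close> simultaneously. Relative to it \<open>d\<close>
  behaves like an endomorphism; triangularising it leads to the pencils of
  \<open>NF_diagonal\<close>, \<open>NF_jordan\<close> and \<open>NF_scalar\<close>.\<close>

theorem trapezoidal_normal_form:
  assumes d: "d3 * d0 - d1 * d2 \<noteq> 0" and b: "b3 * b0 - b1 * b2 \<noteq> 0"
    and nd: "nondeg (NF (d3, d1, d2, d0) (b3, b1, b2, b0) (c3, c1, c2, c0))"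
  shows "\<exists>E\<in>{tH1 \<alpha> \<epsilon> |\<alpha> \<epsilon>. True} \<union> {tH2 \<alpha> \<beta> \<epsilon> |\<alpha> \<beta> \<epsilon>. True} \<union> {tH3 \<alpha> \<beta> \<delta> \<epsilon> |\<alpha> \<beta> \<delta> \<epsilon>. \<alpha> \<noteq> 0 \<and> \<beta> \<noteq> 0}.
    eqv (NF (d3, d1, d2, d0) (b3, b1, b2, b0) (c3, c1, c2, c0)) (hom (cellf E))"
proof -
  let ?T = "NF (d3, d1, d2, d0) (b3, b1, b2, b0) (c3, c1, c2, c0)"
  define \<Delta> where "\<Delta> = b3 * b0 - b1 * b2"
  have D: "\<Delta> \<noteq> 0" using b by (simp add: \<Delta>_def)
  have "\<exists>d3' d1' d2' d0' c'. d3' * d0' - d1' * d2' \<noteq> 0 \<and> eqv ?T (NF (d3', d1', d2', d0') (0, 1, -1, 0) c')"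
  proof -
    define d3' d1' d2' d0' where "d3' = d3 * b1 - d1 * b3" and "d1' = d3 * b0 - d1 * b2"
      and "d2' = d2 * b1 - d0 * b3" and "d0' = d2 * b0 - d0 * b2"
    have "eqv ?T (NF (d3', d1', d2', d0') (0, 1, -1, 0)
       (c3 * b1 - c1 * b3, c3 * b0 - c1 * b2, c2 * b1 - c0 * b3, c2 * b0 - c0 * b2))"
    proof (rule eqv_moebiusI[of "(1, 0, 0, 1)" "(1 / \<Delta>, 0, 0, 1)" "(1, 0, 0, 1)" "(b1, b0, - b3, - b2)" 1])
      fix y :: "vertex \<Rightarrow> hpoint"
      have "fst (y X1) = \<Delta> * (1 / \<Delta> * fst (y X1))" using D by simp
      then obtain u where u: "1 / \<Delta> * fst (y X1) = u" "fst (y X1) = (b3 * b0 - b1 * b2) * u"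
        unfolding \<Delta>_def by blast
      show "NF (d3', d1', d2', d0') (0, 1, -1, 0)
          (c3 * b1 - c1 * b3, c3 * b0 - c1 * b2, c2 * b1 - c0 * b3, c2 * b0 - c0 * b2) y =
        1 * ?T (pack (act (1, 0, 0, 1) (y X)) (act (1 / \<Delta>, 0, 0, 1) (y X1)) (act (1, 0, 0, 1) (y X2)) (act (b1, b0, - b3, - b2) (y X12)))"
        unfolding NF_def pack_simps act.simps u(1) unfolding u(2)
        by (simp add: d3'_def d1'_def d2'_def d0'_def algebra_simps)
    qed (use D in \<open>simp_all add: \<Delta>_def algebra_simps\<close>)
    moreover have "d3' * d0' - d1' * d2' = (d3 * d0 - d1 * d2) * \<Delta>"
      by (simp add: d3'_def d1'_def d2'_def d0'_def \<Delta>_def algebra_simps)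
    then have "d3' * d0' - d1' * d2' \<noteq> 0" using d D by simp
    ultimately show ?thesis by blast
  qed
  then obtain e3 e1 e2 e0 c' where e: "e3 * e0 - e1 * e2 \<noteq> 0" "eqv ?T (NF (e3, e1, e2, e0) (0, 1, -1, 0) c')"
    by blast
  have "\<exists>f1 f2 f0 c''. f1 * f2 \<noteq> 0 \<and> eqv ?T (NF (0, f1, f2, f0) (0, 1, -1, 0) c'')"
  proof -
    \<comment> \<open>An isotropic vector of the quadratic form \<open>d(q, q)\<close>; taken as
      first basis vector it kills the coefficient of \<open>x2 x12\<close>.\<close>
    have "\<exists>z w. (z, w) \<noteq> (0, 0) \<and> e3 * z * z + (e1 + e2) * z * w + e0 * w * w = 0"
    proof (cases "e3 = 0")
      case True
      then show ?thesis by (intro exI[of _ 1] exI[of _ 0]) simp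
    next
      case False
      define r where "r = csqrt ((e1 + e2)\<^sup>2 - 4 * e3 * e0)"
      have "r\<^sup>2 = (e1 + e2)\<^sup>2 - 4 * e3 * e0" by (simp add: r_def)
      moreover have "e3 * (r - (e1 + e2)) * (r - (e1 + e2)) + (e1 + e2) * (r - (e1 + e2)) * (2 * e3) + e0 * (2 * e3) * (2 * e3)
          = e3 * (r\<^sup>2 - (e1 + e2)\<^sup>2 + 4 * e3 * e0)" by (simp add: algebra_simps power2_eq_square)
      ultimately show ?thesis using False by (intro exI[of _ "r - (e1 + e2)"] exI[of _ "2 * e3"]) simp
    qed
    then obtain z w where zw: "(z, w) \<noteq> (0, 0)" "e3 * z * z + (e1 + e2) * z * w + e0 * w * w = 0" by blast
    \<comment> \<open>Completes \<open>(z, w)\<close> to a matrix of determinant 1, so that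
      \<open>b\<close> is preserved.\<close>
    obtain p q where pq: "z * q - p * w = 1"
    proof (cases "w = 0")
      case True
      then have "z * (1 / z) - 0 * w = 1" using zw(1) by simp
      then show thesis using that by blast
    next
      case False
      then have "z * 0 - (- 1 / w) * w = 1" by simp
      then show thesis using that by blast
    qed
    obtain k3 k1 k2 k0 where c': "c' = (k3, k1, k2, k0)" by (cases c')
    define f1 f2 f0 where "f1 = e3 * z * p + e1 * z * q + e2 * w * p + e0 * w * q"
      and "f2 = e3 * p * z + e1 * p * w + e2 * q * z + e0 * q * w" and "f0 = e3 * p * p + e1 * p * q + e2 * q * p + e0 * q * q"
    have "eqv (NF (e3, e1, e2, e0) (0, 1, -1, 0) c') (NF (0, f1, f2, f0) (0, 1, -1, 0)
      (k3 * z * z + k1 * z * w + k2 * w * z + k0 * w * w, k3 * z * p + k1 * z * q + k2 * w * p + k0 * w * q,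
       k3 * p * z + k1 * p * w + k2 * q * z + k0 * q * w, k3 * p * p + k1 * p * q + k2 * q * p + k0 * q * q))"
    proof (rule eqv_moebiusI[of "(1, 0, 0, 1)" "(1, 0, 0, 1)" "(z, p, w, q)" "(z, p, w, q)" 1])
      fix y :: "vertex \<Rightarrow> hpoint"
      obtain a b c d where y: "y X2 = (a, b)" "y X12 = (c, d)" by (metis prod.exhaust)
      have 1: "bl (0, 1, -1, 0) (z * a + p * b, w * a + q * b) (z * c + p * d, w * c + q * d) = (z * q - p * w) * (a * d - b * c)"
        by (simp add: algebra_simps)
      have 2: "bl (e3, e1, e2, e0) (z * a + p * b, w * a + q * b) (z * c + p * d, w * c + q * d) =
         (e3 * z * z + (e1 + e2) * z * w + e0 * w * w) * a * c + bl (0, f1, f2, f0) (a, b) (c, d)"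
        by (simp add: f1_def f2_def f0_def algebra_simps)
      show "NF (0, f1, f2, f0) (0, 1, -1, 0)
        (k3 * z * z + k1 * z * w + k2 * w * z + k0 * w * w, k3 * z * p + k1 * z * q + k2 * w * p + k0 * w * q,
         k3 * p * z + k1 * p * w + k2 * q * z + k0 * q * w, k3 * p * p + k1 * p * q + k2 * q * p + k0 * q * q) y =
        1 * NF (e3, e1, e2, e0) (0, 1, -1, 0) c' (pack (act (1, 0, 0, 1) (y X)) (act (1, 0, 0, 1) (y X1)) (act (z, p, w, q) (y X2)) (act (z, p, w, q) (y X12)))"
        unfolding NF_def c' by (simp add: y 1 2 pq zw(2) del: bl.simps) (simp add: algebra_simps)
    qed (simp_all add: pq)
    moreover have "f1 * f2 \<noteq> 0"
    proof -
      have "f1 * f2 = f0 * (e3 * z * z + (e1 + e2) * z * w + e0 * w * w) - (e3 * e0 - e1 * e2) * (z * q - p * w)\<^sup>2"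
        by (simp add: f1_def f2_def f0_def algebra_simps power2_eq_square)
      then show ?thesis using e(1) unfolding pq zw(2) by simp
    qed
    ultimately show ?thesis using e(2) eqv_trans by blast
  qed
  then obtain f1 f2 f0 c'' where f: "f1 \<noteq> 0" "f2 \<noteq> 0" "eqv ?T (NF (0, f1, f2, f0) (0, 1, -1, 0) c'')"
    by auto
  obtain k3 k1 k2 k0 where c'': "c'' = (k3, k1, k2, k0)" by (cases c'')
  show ?thesis
  \<comment> \<open>\<open>f1\<close> and \<open>- f2\<close> are the eigenvalues of
    \<open>d\<close> relative to \<open>b\<close>.\<close>
  proof (cases "f1 + f2 = 0")
    case False
    have "\<exists>k. eqv (NF (0, f1, f2, f0) (0, 1, -1, 0) (k3, k1, k2, k0)) (NF (0, f1, f2, 0) (0, 1, -1, 0) k)"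
    proof -
      define s where "s = - f0 / (f1 + f2)"
      have "(f1 + f2) * s = - f0" using False by (simp add: s_def)
      then have "f1 * s + f2 * s + f0 = 0" by (simp add: distrib_right)
      then have "eqv (NF (0, f1, f2, f0) (0, 1, -1, 0) (k3, k1, k2, k0)) (NF (0, f1, f2, 0) (0, 1, -1, 0)
         (k3, k3 * s + k1, k3 * s + k2, k3 * s * s + k1 * s + k2 * s + k0))"
        by (intro NF_affine[where k = "1" and \<nu> = "1" and \<xi> = "1" and s = "1" and t = "1" and a = "s" and a' = "s" and \<sigma> = "0" and \<rho> = "0"])
          (simp_all add: algebra_simps)
      then show ?thesis by blast
    qed
    then obtain k where k: "eqv (NF (0, f1, f2, f0) (0, 1, -1, 0) (k3, k1, k2, k0)) (NF (0, f1, f2, 0) (0, 1, -1, 0) k)" by blast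
    obtain l3 l1 l2 l0 where l: "k = (l3, l1, l2, l0)" by (cases k)
    obtain \<alpha> \<delta> \<epsilon> where \<alpha>: "\<alpha> \<noteq> 0"
      and h: "eqv (NF (0, f1, f2, 0) (0, 1, -1, 0) (l3, l1, l2, l0)) (hom (cellf (tH3 \<alpha> 1 \<delta> \<epsilon>)))"
      using NF_diagonal[OF f(1,2) False] by blast
    have "eqv ?T (hom (cellf (tH3 \<alpha> 1 \<delta> \<epsilon>)))"
      by (rule eqv_trans[OF f(3)[unfolded c''] eqv_trans[OF k[unfolded l] h]])
    moreover have "tH3 \<alpha> 1 \<delta> \<epsilon> \<in> {tH3 \<alpha> \<beta> \<delta> \<epsilon> |\<alpha> \<beta> \<delta> \<epsilon>. \<alpha> \<noteq> 0 \<and> \<beta> \<noteq> 0}" using \<alpha> by force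
    ultimately show ?thesis by blast
  next
    case True
    then have f2: "f2 = - f1" by (simp add: add_eq_0_iff)
    define e where "e = f0 / f1"
    \<comment> \<open>Shifting \<open>x2\<close> by \<open>- e / 2\<close> splits the nilpotent part
      evenly between \<open>d\<close> and \<open>b\<close>.\<close>
    have s1: "eqv (NF (0, f1, f2, f0) (0, 1, -1, 0) (k3, k1, k2, k0)) (NF (0, 1, -1, e / 2) (0, -1, 1, e / 2)
       (k3, k1, k2 - k3 * e / 2, k0 - k1 * e / 2))"
      by (rule NF_affine[where k = "1" and \<nu> = "1 / f1" and \<xi> = "- 1" and s = "1" and t = "1" and a = "- e / 2" and a' = "0" and \<sigma> = "0" and \<rho> = "0"])
        (use f in \<open>simp_all add: f2 e_def field_simps\<close>)
    show ?thesis
    proof (cases "e = 0")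
      case True
      then have T: "eqv ?T (NF (0, 1, -1, 0) (0, -1, 1, 0) (k3, k1, k2, k0))"
        using eqv_trans[OF f(3)[unfolded c''] s1] by simp
      obtain \<alpha> \<epsilon> where "eqv (NF (0, 1, -1, 0) (0, -1, 1, 0) (k3, k1, k2, k0)) (hom (cellf (tH1 \<alpha> \<epsilon>)))"
        using NF_scalar[OF nondeg_eqv[OF multilin_NF nd T]] by blast
      from eqv_trans[OF T this] show ?thesis by blast
    next
      case False
      then have "e / 2 \<noteq> 0" by simp
      have "eqv ?T (NF (0, 1, -1, e / 2) (0, -1, 1, e / 2) (k3, k1, k2 - k3 * e / 2, k0 - k1 * e / 2))"
        by (rule eqv_trans[OF f(3)[unfolded c''] s1])
      note T = this
      from NF_jordan[OF \<open>e / 2 \<noteq> 0\<close>, where ?c3.0 = k3 and ?c1.0 = k1 and ?c2.0 = "k2 - k3 * e / 2" and ?c0.0 = "k0 - k1 * e / 2"] show ?thesis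
      proof (elim disjE exE)
        fix \<alpha> \<epsilon>
        assume "eqv (NF (0, 1, -1, e / 2) (0, -1, 1, e / 2) (k3, k1, k2 - k3 * e / 2, k0 - k1 * e / 2)) (hom (cellf (tH1 \<alpha> \<epsilon>)))"
        with T have "eqv ?T (hom (cellf (tH1 \<alpha> \<epsilon>)))" by (rule eqv_trans)
        then show ?thesis by blast
      next
        fix \<alpha> \<beta> \<epsilon>
        assume "eqv (NF (0, 1, -1, e / 2) (0, -1, 1, e / 2) (k3, k1, k2 - k3 * e / 2, k0 - k1 * e / 2)) (hom (cellf (tH2 \<alpha> \<beta> \<epsilon>)))"
        with T have "eqv ?T (hom (cellf (tH2 \<alpha> \<beta> \<epsilon>)))" by (rule eqv_trans)
        then show ?thesis by blast
      qed
    qed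
  qed
qed

section \<open>Normal forms of type H6\<close>

text \<open>The form of \<open>x + P(x1, x2, x12)\<close>. In the names of the coefficients
  \<open>c\<close> stands for \<open>x12\<close>, and \<open>p7\<close> belongs to
  \<open>x1 x2 x12\<close>.\<close>

definition PF :: "complex \<Rightarrow> complex \<Rightarrow> complex \<Rightarrow> complex \<Rightarrow> complex \<Rightarrow> complex \<Rightarrow> complex \<Rightarrow> complex \<Rightarrow> form" where
  "PF p7 p12 p1c p2c p1 p2 pc p0 y = fst (y X) * snd (y X1) * snd (y X2) * snd (y X12) + snd (y X) *
    (p7 * fst (y X1) * fst (y X2) * fst (y X12) + p12 * fst (y X1) * fst (y X2) * snd (y X12)
     + p1c * fst (y X1) * snd (y X2) * fst (y X12) + p2c * snd (y X1) * fst (y X2) * fst (y X12)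
     + p1 * fst (y X1) * snd (y X2) * snd (y X12) + p2 * snd (y X1) * fst (y X2) * snd (y X12)
     + pc * snd (y X1) * snd (y X2) * fst (y X12) + p0 * snd (y X1) * snd (y X2) * snd (y X12))"

lemma multilin_PF: "multilin (PF p7 p12 p1c p2c p1 p2 pc p0)"
  by (rule multilinI_pack) (simp_all add: PF_def algebra_simps)

text \<open>The shift of \<open>x\<close> absorbs the constant term, including what the translations
  add to it, and the scaling of \<open>x\<close> compensates \<open>k\<close>.\<close>

lemma PF_affine:
  assumes "k \<noteq> 0" "t1 \<noteq> 0" "t2 \<noteq> 0" "t3 \<noteq> 0"
    and "q7 = k * t1 * t2 * t3 * p7" "q12 = k * t1 * t2 * (p7 * a3 + p12)" "q1c = k * t1 * t3 * (p7 * a2 + p1c)"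
    "q2c = k * t2 * t3 * (p7 * a1 + p2c)" "q1 = k * t1 * (p7 * a2 * a3 + p12 * a2 + p1c * a3 + p1)"
    "q2 = k * t2 * (p7 * a1 * a3 + p12 * a1 + p2c * a3 + p2)"
    "qc = k * t3 * (p7 * a1 * a2 + p1c * a1 + p2c * a2 + pc)"
  shows "eqv (PF p7 p12 p1c p2c p1 p2 pc p0) (PF q7 q12 q1c q2c q1 q2 qc 0)"
proof -
  define i where "i = 1 / k"
  have i: "k * i = 1" "i \<noteq> 0" using assms(1) by (simp_all add: i_def)
  show ?thesis
  proof (rule eqv_moebiusI[of "(i, - (p7 * a1 * a2 * a3 + p12 * a1 * a2 + p1c * a1 * a3 + p2c * a2 * a3
      + p1 * a1 + p2 * a2 + pc * a3 + p0), 0, 1)" "(t1, a1, 0, 1)" "(t2, a2, 0, 1)" "(t3, a3, 0, 1)" k])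
    fix y :: "vertex \<Rightarrow> hpoint"
    obtain x x' x1 x1' x2 x2' x12 x12' where y: "y X = (x, x')" "y X1 = (x1, x1')" "y X2 = (x2, x2')" "y X12 = (x12, x12')"
      by (metis prod.exhaust)
    have ik: "i * (k * z) = z" "k * (i * z) = z" for z using i(1) by (simp_all flip: mult.assoc add: mult.commute)
    show "PF q7 q12 q1c q2c q1 q2 qc 0 y = k * PF p7 p12 p1c p2c p1 p2 pc p0
      (pack (act (i, - (p7 * a1 * a2 * a3 + p12 * a1 * a2 + p1c * a1 * a3 + p2c * a2 * a3
      + p1 * a1 + p2 * a2 + pc * a3 + p0), 0, 1) (y X)) (act (t1, a1, 0, 1) (y X1)) (act (t2, a2, 0, 1) (y X2))
        (act (t3, a3, 0, 1) (y X12)))"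
      unfolding PF_def y pack_simps act.simps fst_conv snd_conv assms(5-)
      by (simp add: algebra_simps ik)
  qed (use assms i in simp_all)
qed

lemma PF_swap: "eqv (PF p7 p12 p1c p2c p1 p2 pc p0) (PF p7 p12 p2c p1c p2 p1 pc p0)"
  by (rule eqv_relabelI[of X X2 X1 X12]) (simp_all add: PF_def algebra_simps)

text \<open>Inverting \<open>x12\<close> and clearing the denominator turns
  \<open>x + x1 x2 x12 + \<delta>1 x1 + \<delta>2 x2 + \<delta>3 x12\<close> into \<open>x x12 + x1
  x2 + \<delta>1 x1 x12 + \<delta>2 x2 x12 + \<delta>3\<close>.\<close>

lemma PF_D4: "eqv (PF 1 0 0 0 \<delta>1 \<delta>2 \<delta>3 0) (hom (cellf (D4_1 \<delta>1 \<delta>2 \<delta>3)))"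
proof -
  define T where "T y = PF 1 0 0 0 \<delta>1 \<delta>2 \<delta>3 0 (pack (y X) (y X1) (y X2) (act (0, 1, 1, 0) (y X12)))" for y
  have "multilin T" by (rule multilinI_pack) (simp_all add: T_def PF_def algebra_simps)
  then have "hom (cellf (D4_1 \<delta>1 \<delta>2 \<delta>3)) = T"
    by (rule hom_eqI[OF _ multiaffine_cellf(9)]) (simp add: T_def PF_def cellf_pack D4_1_def algebra_simps)
  moreover have "eqv (PF 1 0 0 0 \<delta>1 \<delta>2 \<delta>3 0) T"
    by (rule eqv_moebiusI[of "(1, 0, 0, 1)" "(1, 0, 0, 1)" "(1, 0, 0, 1)" "(0, 1, 1, 0)" 1])
      (simp_all add: T_def)
  ultimately show ?thesis by simp
qed

lemma hom_D3: "hom (cellf D3) = PF 0 1 1 1 0 0 0 0"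
  by (rule hom_eqI[OF multilin_PF multiaffine_cellf(8)]) (simp add: PF_def cellf_pack D3_def)

lemma hom_D1: "hom (cellf D1) = PF 0 0 0 0 1 1 1 0"
  by (rule hom_eqI[OF multilin_PF multiaffine_cellf(4)]) (simp add: PF_def cellf_pack D1_def)

lemma PF_relabel:
  assumes "distinct [a, b, c, d]" "{a, d} \<in> {{X, X12}, {X1, X2}}" "multiaffine f"
    "\<And>z. f z = PF p7 p12 p1c p2c p1 p2 pc p0 (pack (aff z a) (aff z b) (aff z c) (aff z d))"
  shows "eqv (PF p7 p12 p1c p2c p1 p2 pc p0) (hom f)"
proof -
  define T where "T y = PF p7 p12 p1c p2c p1 p2 pc p0 (pack (y a) (y b) (y c) (y d))" for y
  have e: "eqv (PF p7 p12 p1c p2c p1 p2 pc p0) T"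
    by (rule eqv_relabelI[OF assms(1,2)]) (simp add: T_def)
  then have "multilin T" using multilin_geqv_by[OF multilin_PF] unfolding eqv_def by blast
  then have "hom f = T"
    by (rule multilin_eqI'[OF multilin_hom]) (simp add: hom_aff assms(3,4) T_def)
  then show ?thesis using e by simp
qed

lemma PF_D2_3: "eqv (PF 0 0 1 1 \<delta> 0 0 0) (hom (cellf (D2_3 1 \<delta> 0)))"
  by (rule PF_relabel[of X2 X X12 X1, OF _ _ multiaffine_cellf(7)])
    (simp_all add: PF_def cellf_def D2_3_def aff_def algebra_simps insert_commute)

lemma PF_D2_1: "eqv (PF 0 1 1 0 0 \<delta> 0 0) (hom (cellf (D2_1 1 \<delta>)))"
  by (rule PF_relabel[of X1 X12 X X2, OF _ _ multiaffine_cellf(5)])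
    (simp_all add: PF_def cellf_def D2_1_def aff_def algebra_simps insert_commute)

lemma PF_D2_1_0: "eqv (PF 0 1 0 0 0 0 1 0) (hom (cellf (D2_1 0 0)))"
  by (rule PF_relabel[of X1 X X12 X2, OF _ _ multiaffine_cellf(5)])
    (simp_all add: PF_def cellf_def D2_1_def aff_def algebra_simps insert_commute)

lemma PF_D2_2: "eqv (PF 0 0 1 0 0 1 0 0) (hom (cellf (D2_2 0 0 0)))"
  by (rule PF_relabel[of X2 X X12 X1, OF _ _ multiaffine_cellf(6)])
    (simp_all add: PF_def cellf_def D2_2_def aff_def algebra_simps insert_commute)

definition H6_reps :: "lattice_equation set" where
  "H6_reps = {D1, D3} \<union> {D2_1 \<delta>1 \<delta>2 |\<delta>1 \<delta>2. True} \<union> {D2_2 \<delta>1 \<delta>2 lam |\<delta>1 \<delta>2 lam. True} \<union>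
     {D2_3 \<delta>1 \<delta>2 lam |\<delta>1 \<delta>2 lam. True} \<union> {D4_1 \<delta>1 \<delta>2 \<delta>3 |\<delta>1 \<delta>2 \<delta>3. True}"

text \<open>Shifting \<open>x1\<close> removes the term linear in \<open>x12\<close>, shifting
  \<open>x2\<close> the term linear in \<open>x1\<close>; one linear coefficient survives as the
  parameter of \<open>D2_1\<close>.\<close>

lemma PF_quadratic:
  assumes "p12 \<noteq> 0" "p1c \<noteq> 0"
  shows "\<exists>E\<in>H6_reps. eqv (PF 0 p12 p1c 0 p1 p2 pc p0) (hom (cellf E))"
proof -
  have "eqv (PF 0 p12 p1c 0 p1 p2 pc p0) (PF 0 1 1 0 0 ((p2 - p12 * pc / p1c) / p12) 0 0)"
    by (rule PF_affine[where k = 1 and ?t1.0 = 1 and ?t2.0 = "1 / p12" and ?t3.0 = "1 / p1c" and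
          ?a1.0 = "- pc / p1c" and ?a2.0 = "- p1 / p12" and ?a3.0 = 0])
      (use assms in \<open>simp_all add: field_simps\<close>)
  from eqv_trans[OF this PF_D2_1] show ?thesis unfolding H6_reps_def by blast
qed

lemma PF_single:
  assumes "p1c \<noteq> 0" "p2 \<noteq> 0"
  shows "\<exists>E\<in>H6_reps. eqv (PF 0 0 p1c 0 p1 p2 pc p0) (hom (cellf E))"
proof -
  have "eqv (PF 0 0 p1c 0 p1 p2 pc p0) (PF 0 0 1 0 0 1 0 0)"
    by (rule PF_affine[where k = 1 and ?t1.0 = "1 / p1c" and ?t2.0 = "1 / p2" and ?t3.0 = 1 and
          ?a1.0 = "- pc / p1c" and ?a2.0 = 0 and ?a3.0 = "- p1 / p1c"])
      (use assms in \<open>simp_all add: field_simps\<close>)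
  from eqv_trans[OF this PF_D2_2] show ?thesis unfolding H6_reps_def by blast
qed

text \<open>Translations leave the coefficients of top degree alone and serve to remove the next
  lower ones: all quadratic terms if there is a cubic one, all linear terms if there are three
  quadratic ones. A variable without a term of higher degree has a nonzero linear coefficient by
  nondegeneracy, which can be scaled to 1.\<close>

theorem H6_normal_form:
  assumes nd: "nondeg (PF p7 p12 p1c p2c p1 p2 pc p0)"
  shows "\<exists>E\<in>H6_reps. eqv (PF p7 p12 p1c p2c p1 p2 pc p0) (hom (cellf E))"
proof -
  let ?P = "PF p7 p12 p1c p2c p1 p2 pc p0"
  have dep1: "p1 \<noteq> 0" if "p7 = 0" "p12 = 0" "p1c = 0"
  proof
    assume "p1 = 0"
    then have "tdet X X1 ?P y = 0" for y using that by (simp add: tdet_def PF_def)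
    then show False using nd unfolding nondeg_def using vertex.distinct(1) by blast
  qed
  have dep2: "p2 \<noteq> 0" if "p7 = 0" "p12 = 0" "p2c = 0"
  proof
    assume "p2 = 0"
    then have "tdet X X2 ?P y = 0" for y using that by (simp add: tdet_def PF_def)
    then show False using nd unfolding nondeg_def using vertex.distinct(3) by blast
  qed
  have depc: "pc \<noteq> 0" if "p7 = 0" "p1c = 0" "p2c = 0"
  proof
    assume "pc = 0"
    then have "tdet X X12 ?P y = 0" for y using that by (simp add: tdet_def PF_def)
    then show False using nd unfolding nondeg_def using vertex.distinct(5) by blast
  qed
  consider (cubic) "p7 \<noteq> 0" | (three) "p7 = 0" "p12 \<noteq> 0" "p1c \<noteq> 0" "p2c \<noteq> 0"
    | (opp) "p7 = 0" "p12 = 0" "p1c \<noteq> 0" "p2c \<noteq> 0" | (adj) "p7 = 0" "p12 \<noteq> 0" "p1c \<noteq> 0" "p2c = 0"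
    | (adj') "p7 = 0" "p12 \<noteq> 0" "p1c = 0" "p2c \<noteq> 0" | (one) "p7 = 0" "p12 \<noteq> 0" "p1c = 0" "p2c = 0"
    | (one1) "p7 = 0" "p12 = 0" "p1c \<noteq> 0" "p2c = 0" | (one2) "p7 = 0" "p12 = 0" "p1c = 0" "p2c \<noteq> 0"
    | (zero) "p7 = 0" "p12 = 0" "p1c = 0" "p2c = 0" by blast
  then show ?thesis
  proof cases
    case cubic
    define a1 a2 a3 where "a1 = - p2c / p7" and "a2 = - p1c / p7" and "a3 = - p12 / p7"
    have "eqv ?P (PF 1 0 0 0 (1 / p7 * 1 * (p7 * a2 * a3 + p12 * a2 + p1c * a3 + p1))
      (1 / p7 * 1 * (p7 * a1 * a3 + p12 * a1 + p2c * a3 + p2)) (1 / p7 * 1 * (p7 * a1 * a2 + p1c * a1 + p2c * a2 + pc)) 0)"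
      by (rule PF_affine[where k = "1 / p7" and ?t1.0 = 1 and ?t2.0 = 1 and ?t3.0 = 1 and
          ?a1.0 = a1 and ?a2.0 = a2 and ?a3.0 = a3])
        (use cubic in \<open>simp_all add: a1_def a2_def a3_def\<close>)
    from eqv_trans[OF this PF_D4] show ?thesis unfolding H6_reps_def by blast
  next
    case three
    \<comment> \<open>Solves the linear system for the translations \<open>a1\<close>,
      \<open>a2\<close>, \<open>a3\<close> that kill \<open>p1\<close>, \<open>p2\<close>,
      \<open>pc\<close>; the unknowns are multiplied by products of coefficients so that each
      equation becomes a sum of two of them.\<close>
    define u v w where "u = (- p1c * p2 - p12 * pc + p2c * p1) / 2" and "v = (- p2c * p1 - p12 * pc + p1c * p2) / 2"
      and "w = (- p2c * p1 - p1c * p2 + p12 * pc) / 2"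
    have s: "v + w = - p2c * p1" "u + w = - p1c * p2" "u + v = - p12 * pc"
      unfolding u_def v_def w_def by (simp_all flip: add_divide_distrib)
    define a1 a2 a3 where "a1 = u / (p12 * p1c)" and "a2 = v / (p12 * p2c)" and "a3 = w / (p1c * p2c)"
    have a: "p12 * a2 + p1c * a3 = (v + w) / p2c" "p12 * a1 + p2c * a3 = (u + w) / p1c"
      "p1c * a1 + p2c * a2 = (u + v) / p12"
      using three by (simp_all add: a1_def a2_def a3_def add_divide_distrib)
    have "p12 * a2 + p1c * a3 = - p1" "p12 * a1 + p2c * a3 = - p2" "p1c * a1 + p2c * a2 = - pc"
      unfolding a s using three by simp_all
    then have "eqv ?P (PF 0 1 1 1 0 0 0 0)"
      by (intro PF_affine[where k = "1 / (p12 * p1c * p2c)" and ?t1.0 = p2c and ?t2.0 = p1c and ?t3.0 = p12 and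
          ?a1.0 = a1 and ?a2.0 = a2 and ?a3.0 = a3])
        (use three in simp_all)
    then show ?thesis unfolding H6_reps_def hom_D3[symmetric] by blast
  next
    case opp
    have "eqv ?P (PF 0 0 1 1 ((p1 - p1c * p2 / p2c) / p1c) 0 0 0)"
      by (rule PF_affine[where k = 1 and ?t1.0 = "1 / p1c" and ?t2.0 = "1 / p2c" and ?t3.0 = 1 and
          ?a1.0 = "- pc / p1c" and ?a2.0 = 0 and ?a3.0 = "- p2 / p2c"])
        (use opp in \<open>simp_all add: field_simps\<close>)
    from eqv_trans[OF this PF_D2_3] show ?thesis unfolding H6_reps_def by blast
  next
    case adj
    then show ?thesis using PF_quadratic[of p12 p1c p1 p2 pc p0] by simp
  next
    case adj'
    then obtain E where "E \<in> H6_reps" "eqv (PF 0 p12 p2c 0 p2 p1 pc p0) (hom (cellf E))"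
      using PF_quadratic[of p12 p2c p2 p1 pc p0] by auto
    then show ?thesis using eqv_trans[OF PF_swap[of p7 p12 p1c p2c p1 p2 pc p0]] adj' by auto
  next
    case one
    have "eqv ?P (PF 0 1 0 0 0 0 1 0)"
      by (rule PF_affine[where k = 1 and ?t1.0 = "1 / p12" and ?t2.0 = 1 and ?t3.0 = "1 / pc" and
          ?a1.0 = "- p2 / p12" and ?a2.0 = "- p1 / p12" and ?a3.0 = 0])
        (use one depc in \<open>simp_all add: field_simps\<close>)
    from eqv_trans[OF this PF_D2_1_0] show ?thesis unfolding H6_reps_def by blast
  next
    case one1
    then show ?thesis using PF_single[of p1c p2 p1 pc p0] dep2 by simp
  next
    case one2
    then obtain E where "E \<in> H6_reps" "eqv (PF 0 0 p2c 0 p2 p1 pc p0) (hom (cellf E))"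
      using PF_single[of p2c p1 p2 pc p0] dep1 by auto
    then show ?thesis using eqv_trans[OF PF_swap[of p7 p12 p1c p2c p1 p2 pc p0]] one2 by auto
  next
    case zero
    have "eqv ?P (PF 0 0 0 0 1 1 1 0)"
      by (rule PF_affine[where k = 1 and ?t1.0 = "1 / p1" and ?t2.0 = "1 / p2" and ?t3.0 = "1 / pc" and
          ?a1.0 = 0 and ?a2.0 = 0 and ?a3.0 = 0])
        (use zero dep1 dep2 depc in simp_all)
    then show ?thesis unfolding H6_reps_def hom_D1[symmetric] by blast
  qed
qed

section \<open>Reduction to the normal forms\<close>

lemma moebius_to:
  assumes "p \<noteq> (0, 0)"
  shows "\<exists>m. is_moebius m \<and> act m (1, 0) = p"
proof -
  obtain s t where p: "p = (s, t)" by (cases p)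
  show ?thesis
  proof (cases "s = 0")
    case True
    then show ?thesis using assms by (intro exI[of _ "(s, 1, t, 0)"]) (auto simp: p)
  next
    case False
    then show ?thesis by (intro exI[of _ "(s, 0, t, 1)"]) (auto simp: p)
  qed
qed

lemma multilin_pack:
  assumes T: "multilin T"
  shows "T (pack a b c d) = fst a * T (pack (1, 0) b c d) + snd a * T (pack (0, 1) b c d)"
    "T (pack a b c d) = fst b * T (pack a (1, 0) c d) + snd b * T (pack a (0, 1) c d)"
    "T (pack a b c d) = fst c * T (pack a b (1, 0) d) + snd c * T (pack a b (0, 1) d)"
    "T (pack a b c d) = fst d * T (pack a b c (1, 0)) + snd d * T (pack a b c (0, 1))"
  using multilin_expand[OF T, of "pack a b c d" X a] multilin_expand[OF T, of "pack a b c d" X1 b]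
    multilin_expand[OF T, of "pack a b c d" X2 c] multilin_expand[OF T, of "pack a b c d" X12 d]
  by simp_all

lemma edge_relabelling:
  assumes "{k, m} \<in> {{X, X1}, {X2, X12}, {X, X2}, {X1, X12}}" "k \<noteq> m"
  shows "\<exists>\<tau>. square_relabelling \<tau> \<and> \<tau> k = X \<and> \<tau> m = X1"
proof -
  have sq: "square_relabelling \<tau>" if "\<tau> \<in> {pack X X1 X2 X12, pack X1 X X12 X2, pack X2 X12 X X1, pack X X2 X1 X12,
      pack X12 X2 X1 X, pack X1 X12 X X2, pack X2 X X12 X1, pack X12 X1 X2 X}" for \<tau>
    using that by (elim insertE emptyE) (simp_all add: square_relabelling_pack insert_commute)
  have "k = X \<and> m = X1 \<or> k = X1 \<and> m = X \<or> k = X2 \<and> m = X12 \<or> k = X12 \<and> m = X2 \<or>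
    k = X \<and> m = X2 \<or> k = X2 \<and> m = X \<or> k = X1 \<and> m = X12 \<or> k = X12 \<and> m = X1"
    using assms by (auto simp: doubleton_eq_iff)
  then show ?thesis
    by (elim disjE conjE)
      (rule exI[of _ "pack X X1 X2 X12"], simp add: sq, rule exI[of _ "pack X1 X X12 X2"], simp add: sq,
       rule exI[of _ "pack X2 X12 X X1"], simp add: sq, rule exI[of _ "pack X12 X2 X1 X"], simp add: sq,
       rule exI[of _ "pack X X2 X1 X12"], simp add: sq, rule exI[of _ "pack X1 X12 X X2"], simp add: sq,
       rule exI[of _ "pack X2 X X12 X1"], simp add: sq, rule exI[of _ "pack X12 X1 X2 X"], simp add: sq)
qed

lemma bl_degenerate:
  assumes "a * d - b * c = 0"
  shows "\<exists>q. q \<noteq> (0, 0) \<and> (\<forall>r. bl (a, b, c, d) q r = 0)"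
proof -
  have *: "(q1 * a + q2 * c) = 0 \<and> q1 * b + q2 * d = 0 \<longrightarrow> (\<forall>r. bl (a, b, c, d) (q1, q2) r = 0)" for q1 q2
  proof (intro impI allI)
    fix r assume "q1 * a + q2 * c = 0 \<and> q1 * b + q2 * d = 0"
    moreover have "bl (a, b, c, d) (q1, q2) r = (q1 * a + q2 * c) * fst r + (q1 * b + q2 * d) * snd r"
      by (simp add: algebra_simps)
    ultimately show "bl (a, b, c, d) (q1, q2) r = 0" by simp
  qed
  consider "c \<noteq> 0 \<or> a \<noteq> 0" | "c = 0" "a = 0" "d \<noteq> 0 \<or> b \<noteq> 0" | "a = 0" "b = 0" "c = 0" "d = 0" by blast
  then show ?thesis
  proof cases
    case 1
    then show ?thesis using *[of c "- a"] assms by (intro exI[of _ "(c, - a)"]) (auto simp: algebra_simps)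
  next
    case 2
    then show ?thesis using *[of d "- b"] by (intro exI[of _ "(d, - b)"]) (auto simp: algebra_simps)
  next
    case 3
    then show ?thesis by (intro exI[of _ "(1, 0)"]) simp
  qed
qed

text \<open>With the null pair moved to infinity, the determinant in \<open>X\<close>,
  \<open>X1\<close> is the product of the bilinear forms \<open>d\<close> and \<open>b\<close>. If
  one of these were degenerate, a kernel vector of it at \<open>X2\<close> would be a root of the
  product, against the nondegeneracy of \<open>{l, n}\<close>.\<close>

theorem trapezoidal_reduction:
  assumes T: "multilin T" and n: "null_pair T k p m a" and d: "distinct [k, l, m, n]"
    and e: "{k, m} \<in> {{X, X1}, {X2, X12}, {X, X2}, {X1, X12}}" and h: "\<not> hdeg l n T"
  shows "\<exists>d3 d1 d2 d0 b3 b1 b2 b0 c. d3 * d0 - d1 * d2 \<noteq> 0 \<and> b3 * b0 - b1 * b2 \<noteq> 0 \<and>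
    eqv T (NF (d3, d1, d2, d0) (b3, b1, b2, b0) c)"
proof -
  have km: "k \<noteq> m" using d by auto
  obtain \<tau> where \<tau>: "square_relabelling \<tau>" "\<tau> k = X" "\<tau> m = X1" using edge_relabelling[OF e km] by blast
  then have b: "bij \<tau>" by (simp add: square_relabelling_def)
  obtain mk mm where mo: "is_moebius mk" "act mk (1, 0) = p" "is_moebius mm" "act mm (1, 0) = a"
    using moebius_to n unfolding null_pair_def by metis
  define M where "M = (\<lambda>_. (1, 0, 0, 1) :: moebius)(k := mk, m := mm)"
  define S where "S y = T (\<lambda>v. act (M v) (y (\<tau> v)))" for y
  have gb: "geqv_by \<tau> M 1 T S" unfolding geqv_by_def S_def using b mo by (simp add: M_def)
  have S: "multilin S" by (rule multilin_geqv_by[OF T gb])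
  have z: "S (pack (1, 0) (1, 0) q r) = 0" for q r
    unfolding S_def using n km \<tau> mo by (simp add: null_pair_def M_def)
  define dd bb cc where "dd i j = S (pack (1, 0) (0, 1) i j)" and "bb i j = S (pack (0, 1) (1, 0) i j)"
    and "cc i j = S (pack (0, 1) (0, 1) i j)" for i j
  define o1 o0 :: hpoint where "o1 = (1, 0)" and "o0 = (0, 1)"
  have bl: "S (pack u v i j) = bl (S (pack u v o1 o1), S (pack u v o1 o0), S (pack u v o0 o1), S (pack u v o0 o0)) i j" for u v i j
    unfolding multilin_pack(3)[OF S, of u v i j]
    unfolding multilin_pack(4)[OF S, of u v _ j] o1_def o0_def
    by (simp add: algebra_simps)
  have NF: "S = NF (dd o1 o1, dd o1 o0, dd o0 o1, dd o0 o0) (bb o1 o1, bb o1 o0, bb o0 o1, bb o0 o0)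
      (cc o1 o1, cc o1 o0, cc o0 o1, cc o0 o0)"
  proof
    fix y
    have "S y = S (pack (y X) (y X1) (y X2) (y X12))" by simp
    also have "\<dots> = fst (y X) * (snd (y X1) * dd (y X2) (y X12)) + snd (y X) * (fst (y X1) * bb (y X2) (y X12) + snd (y X1) * cc (y X2) (y X12))"
      unfolding multilin_pack(1)[OF S, of "y X"]
      unfolding multilin_pack(2)[OF S, of _ "y X1"] z dd_def bb_def cc_def by simp
    also have "dd (y X2) (y X12) = bl (dd o1 o1, dd o1 o0, dd o0 o1, dd o0 o0) (y X2) (y X12)"
      unfolding dd_def by (rule bl)
    also have "bb (y X2) (y X12) = bl (bb o1 o1, bb o1 o0, bb o0 o1, bb o0 o0) (y X2) (y X12)"
      unfolding bb_def by (rule bl)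
    also have "cc (y X2) (y X12) = bl (cc o1 o1, cc o1 o0, cc o0 o1, cc o0 o0) (y X2) (y X12)"
      unfolding cc_def by (rule bl)
    finally show "S y = NF (dd o1 o1, dd o1 o0, dd o0 o1, dd o0 o0) (bb o1 o1, bb o1 o0, bb o0 o1, bb o0 o0)
      (cc o1 o1, cc o1 o0, cc o0 o1, cc o0 o0) y"
      unfolding NF_def by (simp only: ring_distribs mult.assoc add.assoc)
  qed
  have ln: "\<tau> l \<noteq> \<tau> n" "{\<tau> l, \<tau> n} = {X2, X12}"
  proof -
    have i: "\<tau> l \<noteq> X" "\<tau> l \<noteq> X1" "\<tau> n \<noteq> X" "\<tau> n \<noteq> X1" "\<tau> l \<noteq> \<tau> n"
      using d \<tau> bij_is_inj[OF b] by (metis distinct_length_2_or_more injD)+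
    then show "\<tau> l \<noteq> \<tau> n" "{\<tau> l, \<tau> n} = {X2, X12}" by (cases "\<tau> l"; cases "\<tau> n"; auto)+
  qed
  have h': "\<not> hdeg X2 X12 S"
  proof
    assume "hdeg X2 X12 S"
    then have "hdeg (\<tau> l) (\<tau> n) S" using ln hdeg_commute by (auto simp: doubleton_eq_iff)
    then have "hdeg (inv \<tau> (\<tau> l)) (inv \<tau> (\<tau> n)) T"
      using hdeg_geqv_by[OF S geqv_by_sym[OF gb]] ln(1) by blast
    then show False using h b by (simp add: bij_is_inj)
  qed
  have td: "tdet X X1 S y = dd (y X2) (y X12) * bb (y X2) (y X12)" for y
  proof -
    have "tdet X X1 S (pack (y X) (y X1) (y X2) (y X12)) = dd (y X2) (y X12) * bb (y X2) (y X12)"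
      by (simp add: tdet_def z dd_def bb_def del: pack_eta)
    then show ?thesis by simp
  qed
  have nz: "c1 * c4 - c2 * c3 \<noteq> 0"
    if "\<And>q r. bl (c1, c2, c3, c4) q r = 0 \<Longrightarrow> dd q r * bb q r = 0" for c1 c2 c3 c4
  proof
    assume "c1 * c4 - c2 * c3 = 0"
    then obtain q where "q \<noteq> (0, 0)" "\<forall>r. bl (c1, c2, c3, c4) q r = 0" using bl_degenerate by blast
    then have "\<forall>y. y X2 = q \<longrightarrow> tdet X X1 S y = 0" unfolding td using that by blast
    moreover have "distinct [X2, X12, X, X1]" by simp
    ultimately show False using h' \<open>q \<noteq> (0, 0)\<close> hdeg_iff by blast
  qed
  have "dd o1 o1 * dd o0 o0 - dd o1 o0 * dd o0 o1 \<noteq> 0"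
    by (rule nz) (simp only: dd_def bl[symmetric], simp)
  moreover have "bb o1 o1 * bb o0 o0 - bb o1 o0 * bb o0 o1 \<noteq> 0"
    by (rule nz) (simp only: bb_def bl[symmetric], simp)
  moreover have "eqv T S" unfolding eqv_def using gb \<tau>(1) by blast
  ultimately show ?thesis using NF by metis
qed

lemma linear_product_zero:
  assumes "\<And>s t. (s * a + t * b) * (s * c + t * d) = (0::complex)"
  shows "(a = 0 \<and> b = 0) \<or> (c = 0 \<and> d = 0)"
  using assms[of 1 0] assms[of 0 1] assms[of 1 1] assms[of 1 "-1"] by auto

text \<open>A root \<open>q\<close> at \<open>j\<close> of the degenerate biquadratic on
  \<open>{l, n}\<close> makes a product of two linear forms in the last variable vanish, so one of
  \<open>k\<close>, \<open>m\<close>, called \<open>\<kappa>\<close>, forms a null pair with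
  \<open>j\<close> as well. The trilinear form left at \<open>\<kappa>\<close> then vanishes for
  special values at two vertices and must be a product of three linear forms; the third one supplies
  the value at \<open>w\<close>.\<close>

lemma rank_one_point:
  assumes T: "multilin T" and n: "null_pair T k (1, 0) m (1, 0)" and d: "distinct [k, l, m, n]"
    and h: "hdeg l n T"
  shows "\<exists>\<kappa> u. \<forall>w. w \<noteq> \<kappa> \<longrightarrow> null_pair T \<kappa> (1, 0) w (u w)"
proof -
  define o1 o0 :: hpoint where "o1 = (1, 0)" and "o0 = (0, 1)"
  have d': "distinct [l, n, k, m]" using d by auto
  obtain j q where j: "j \<in> {l, n}" "q \<noteq> (0, 0)" "\<And>y. y j = q \<Longrightarrow> tdet k m T y = 0"
    using h unfolding hdeg_iff[OF d'] by blast
  define w where "w = (if j = l then n else l)"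
  have dj: "distinct [k, m, j, w]" using d j(1) by (auto simp: w_def)
  have z: "T y = 0" if "y k = o1" "y m = o1" for y using n that by (simp add: null_pair_def o1_def)
  have ex: "T y = fst (y v) * T (y(v := o1)) + snd (y v) * T (y(v := o0))" for y v
    using multilin_expand[OF T, of y v "y v"] by (simp add: o1_def o0_def)
  define B where "B = (\<lambda>_. o0)(j := q)"
  have cong: "y = y'" if "y k = y' k" "y m = y' m" "y j = y' j" "y w = y' w" for y y' :: "vertex \<Rightarrow> hpoint"
  proof
    fix v have "v \<in> {k, m, j, w}" using dj UNIV_distinct by blast
    then show "y v = y' v" using that by auto
  qed
  define f where "f r = T (B(k := o1, m := o0, w := r))" for r
  define g where "g r = T (B(k := o0, m := o1, w := r))" for r
  have lin: "f (s, t) = s * f o1 + t * f o0" "g (s, t) = s * g o1 + t * g o0" for s t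
    unfolding f_def g_def o1_def o0_def by (rule multilinD[OF T])+
  \<comment> \<open>The entry with both \<open>k\<close> and \<open>m\<close> at infinity is zero,
    so the determinant reduces to this product.\<close>
  have "f r * g r = 0" for r
  proof -
    have "tdet k m T (B(w := r)) = 0" by (rule j(3)) (use dj in \<open>simp add: B_def\<close>)
    moreover have "B(w := r, k := s, m := t) = B(k := s, m := t, w := r)" for s t
      using dj by (auto simp: fun_eq_iff)
    moreover have "T (B(k := o1, m := o1, w := r)) = 0" by (rule z) (use dj in auto)
    ultimately show ?thesis by (simp add: tdet_def f_def g_def o1_def[symmetric] o0_def[symmetric])
  qed
  then have "(f o1 = 0 \<and> f o0 = 0) \<or> (g o1 = 0 \<and> g o0 = 0)"
    by (intro linear_product_zero) (simp flip: lin)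
  then have fg: "(\<forall>r. f r = 0) \<or> (\<forall>r. g r = 0)" using lin by (metis add_0 mult_zero_right prod.exhaust)
  have "\<exists>\<kappa> \<mu>. {\<kappa>, \<mu>} = {k, m} \<and> distinct [\<kappa>, \<mu>, j, w] \<and> (\<forall>y. y \<kappa> = o1 \<longrightarrow> y j = q \<longrightarrow> T y = 0)"
    using fg
  proof
    assume f: "\<forall>r. f r = 0"
    have "T y = 0" if y: "y k = o1" "y j = q" for y
    proof -
      have "T (y(m := o1)) = 0" by (rule z) (use y dj in auto)
      moreover have "y(m := o0) = B(k := o1, m := o0, w := y w)" by (rule cong) (use y dj in \<open>auto simp: B_def\<close>)
      then have "T (y(m := o0)) = 0" using spec[OF f, of "y w"] by (simp add: f_def)
      ultimately show ?thesis using ex[of y m] by simp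
    qed
    then show ?thesis using dj by (intro exI[of _ k] exI[of _ m]) auto
  next
    assume g: "\<forall>r. g r = 0"
    have "T y = 0" if y: "y m = o1" "y j = q" for y
    proof -
      have "T (y(k := o1)) = 0" by (rule z) (use y dj in auto)
      moreover have "y(k := o0) = B(k := o0, m := o1, w := y w)" by (rule cong) (use y dj in \<open>auto simp: B_def\<close>)
      then have "T (y(k := o0)) = 0" using spec[OF g, of "y w"] by (simp add: g_def)
      ultimately show ?thesis using ex[of y k] by simp
    qed
    then show ?thesis using dj by (intro exI[of _ m] exI[of _ k]) auto
  qed
  then obtain \<kappa> \<mu> where km: "{\<kappa>, \<mu>} = {k, m}" "distinct [\<kappa>, \<mu>, j, w]" and zj: "\<And>y. y \<kappa> = o1 \<Longrightarrow> y j = q \<Longrightarrow> T y = 0"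
    by blast
  have zm: "T y = 0" if "y \<kappa> = o1" "y \<mu> = o1" for y using z[of y] that km(1) by (auto simp: doubleton_eq_iff)
  obtain q' where q': "fst q * snd q' - snd q * fst q' \<noteq> 0"
  proof (cases "fst q = 0")
    case True
    then have "snd q \<noteq> 0" using j(2) by (metis prod.collapse)
    then show thesis using that[of "(1, 0)"] by simp
  next
    case False
    then show thesis using that[of "(0, 1)"] by simp
  qed
  \<comment> \<open>With \<open>\<kappa>\<close> at infinity the form is divisible by a linear form
    in the value at \<open>\<mu>\<close> and one in the value at \<open>j\<close>; \<open>H\<close>
    is the remaining linear form in the value at \<open>w\<close>.\<close>
  define H where "H r = T ((\<lambda>_. o0)(\<kappa> := o1, \<mu> := o0, j := q', w := r))" for r
  have linH: "H (s, t) = s * H o1 + t * H o0" for s t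
    unfolding H_def o1_def o0_def by (rule multilinD[OF T])
  obtain r where r: "r \<noteq> (0, 0)" "H r = 0"
  proof (cases "H o1 = 0")
    case True
    then show thesis using that[of o1] by (simp add: o1_def)
  next
    case False
    then show thesis using that[of "(H o0, - H o1)"] by (simp add: linH)
  qed
  have zw: "T y = 0" if y: "y \<kappa> = o1" "y w = r" for y
  proof -
    have 1: "T (y(\<mu> := o1)) = 0" by (rule zm) (use y km(2) in auto)
    define \<Delta> where "\<Delta> = fst q * snd q' - snd q * fst q'"
    define c1 c2 where "c1 = (fst (y j) * snd q' - snd (y j) * fst q') / \<Delta>" and "c2 = (fst q * snd (y j) - snd q * fst (y j)) / \<Delta>"
    have "y j = (c1 * fst q + c2 * fst q', c1 * snd q + c2 * snd q')"
    proof -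
      have D: "\<Delta> \<noteq> 0" using q' by (simp add: \<Delta>_def)
      have "c1 * fst q + c2 * fst q' = ((fst (y j) * snd q' - snd (y j) * fst q') * fst q + (fst q * snd (y j) - snd q * fst (y j)) * fst q') / \<Delta>"
        "c1 * snd q + c2 * snd q' = ((fst (y j) * snd q' - snd (y j) * fst q') * snd q + (fst q * snd (y j) - snd q * fst (y j)) * snd q') / \<Delta>"
        unfolding c1_def c2_def by (simp_all only: add_divide_distrib times_divide_eq_left)
      moreover have "(fst (y j) * snd q' - snd (y j) * fst q') * fst q + (fst q * snd (y j) - snd q * fst (y j)) * fst q' = \<Delta> * fst (y j)"
        "(fst (y j) * snd q' - snd (y j) * fst q') * snd q + (fst q * snd (y j) - snd q * fst (y j)) * snd q' = \<Delta> * snd (y j)"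
        by (simp_all add: \<Delta>_def algebra_simps)
      ultimately have "c1 * fst q + c2 * fst q' = \<Delta> * fst (y j) / \<Delta>" "c1 * snd q + c2 * snd q' = \<Delta> * snd (y j) / \<Delta>"
        by simp_all
      then show ?thesis using D by (simp add: prod_eq_iff)
    qed
    then have e: "y(\<mu> := o0) = (y(\<mu> := o0))(j := (c1 * fst q + c2 * fst q', c1 * snd q + c2 * snd q'))"
      using km(2) by auto
    have "T (y(\<mu> := o0)) = c1 * T (y(\<mu> := o0, j := q)) + c2 * T (y(\<mu> := o0, j := q'))"
      using multilin_comb[OF T, of "y(\<mu> := o0)" j c1 q c2 q'] e by simp
    moreover have "T (y(\<mu> := o0, j := q)) = 0" by (rule zj) (use y km(2) in auto)
    moreover have "T (y(\<mu> := o0, j := q')) = 0"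
    proof -
      have "y(\<mu> := o0, j := q') = (\<lambda>_. o0)(\<kappa> := o1, \<mu> := o0, j := q', w := r)"
      proof
        fix v have "v \<in> {\<kappa>, \<mu>, j, w}" using km(2) UNIV_distinct by blast
        then show "(y(\<mu> := o0, j := q')) v = ((\<lambda>_. o0)(\<kappa> := o1, \<mu> := o0, j := q', w := r)) v"
          using y km(2) by auto
      qed
      then show ?thesis using r(2) by (simp add: H_def)
    qed
    ultimately show ?thesis using 1 ex[of y \<mu>] by simp
  qed
  define u where "u v = (if v = \<mu> then o1 else if v = j then q else r)" for v
  have "null_pair T \<kappa> (1, 0) v (u v)" if vk: "v \<noteq> \<kappa>" for v
  proof -
    have "v \<in> {\<kappa>, \<mu>, j, w}" using km(2) UNIV_distinct by blast
    then consider "v = \<mu>" | "v = j" "v \<noteq> \<mu>" | "v = w" "v \<noteq> \<mu>" "v \<noteq> j" using vk km(2) by auto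
    then show ?thesis
      using vk zm zj zw j(2) r(1) km(2) by cases (auto simp: null_pair_def u_def o1_def)
  qed
  then show ?thesis by blast
qed

text \<open>With the special values of \<open>rank_one_point\<close> moved to infinity, the part of
  the form that multiplies \<open>x\<close> vanishes whenever another vertex is at infinity, so it
  is a constant \<open>\<alpha>\<close> in affine coordinates. Nondegeneracy makes it nonzero, and
  division by it gives \<open>x + P\<close>.\<close>

theorem H6_reduction:
  assumes T: "multilin T" and nd: "nondeg T" and n: "null_pair T k p m a" and d: "distinct [k, l, m, n]"
    and h: "hdeg l n T"
  shows "\<exists>p7 p12 p1c p2c p1 p2 pc p0. eqv T (PF p7 p12 p1c p2c p1 p2 pc p0)"
proof -
  have km: "k \<noteq> m" using d by auto
  obtain mk mm where mo: "is_moebius mk" "act mk (1, 0) = p" "is_moebius mm" "act mm (1, 0) = a"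
    using moebius_to n unfolding null_pair_def by metis
  define M where "M = (\<lambda>_. (1, 0, 0, 1) :: moebius)(k := mk, m := mm)"
  define S where "S y = T (\<lambda>v. act (M v) (y v))" for y
  have gS: "geqv_by id M 1 T S" unfolding geqv_by_def S_def using mo by (simp add: M_def)
  have S: "multilin S" by (rule multilin_geqv_by[OF T gS])
  have sq_id: "square_relabelling id" by (simp add: square_relabelling_def)
  have eS: "eqv T S" unfolding eqv_def using gS sq_id by blast
  have "S y = 0" if "y k = (1, 0)" "y m = (1, 0)" for y
    unfolding S_def using n km mo that by (simp add: null_pair_def M_def)
  then have nS: "null_pair S k (1, 0) m (1, 0)" using km by (simp add: null_pair_def)
  have "hdeg l n S" using hdeg_geqv_by[OF T gS h] d by simp
  then obtain \<kappa> u where u: "\<And>w. w \<noteq> \<kappa> \<Longrightarrow> null_pair S \<kappa> (1, 0) w (u w)"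
    using rank_one_point[OF S nS d] by blast
  have "\<exists>\<tau>. square_relabelling \<tau> \<and> \<tau> \<kappa> = X"
  proof (cases \<kappa>)
    case X then show ?thesis using sq_id by (intro exI[of _ id]) simp
  next
    case X1 then show ?thesis by (intro exI[of _ "pack X1 X X12 X2"]) (simp add: square_relabelling_pack insert_commute)
  next
    case X2 then show ?thesis by (intro exI[of _ "pack X2 X12 X X1"]) (simp add: square_relabelling_pack insert_commute)
  next
    case X12 then show ?thesis by (intro exI[of _ "pack X12 X2 X1 X"]) (simp add: square_relabelling_pack insert_commute)
  qed
  then obtain \<tau> where \<tau>: "square_relabelling \<tau>" "\<tau> \<kappa> = X" by blast
  then have b: "bij \<tau>" by (simp add: square_relabelling_def)
  have "\<exists>m. is_moebius m \<and> (w \<noteq> \<kappa> \<longrightarrow> act m (1, 0) = u w) \<and> (w = \<kappa> \<longrightarrow> act m (1, 0) = (1, 0))" for w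
  proof (cases "w = \<kappa>")
    case True then show ?thesis by (intro exI[of _ "(1, 0, 0, 1)"]) simp
  next
    case False
    then have "u w \<noteq> (0, 0)" using u by (simp add: null_pair_def)
    from moebius_to[OF this] show ?thesis using False by blast
  qed
  then obtain N where N: "\<And>w. is_moebius (N w)" "\<And>w. w \<noteq> \<kappa> \<Longrightarrow> act (N w) (1, 0) = u w" "act (N \<kappa>) (1, 0) = (1, 0)"
    by metis
  define R where "R y = S (\<lambda>v. act (N v) (y (\<tau> v)))" for y
  have gR: "geqv_by \<tau> N 1 S R" unfolding geqv_by_def R_def using b N by simp
  have R: "multilin R" by (rule multilin_geqv_by[OF S gR])
  have eR: "eqv T R" by (rule eqv_trans[OF eS]) (use gR \<tau>(1) in \<open>auto simp: eqv_def\<close>)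
  have ndR: "nondeg R" by (rule nondeg_eqv[OF T nd eR])
  have z: "R y = 0" if "y X = (1, 0)" "y v = (1, 0)" "v \<noteq> X" for y v
  proof -
    obtain w where w: "v = \<tau> w" using bij_is_surj[OF b] by (rule surjE)
    have "w \<noteq> \<kappa>" using w that(3) \<tau>(2) by auto
    then show ?thesis unfolding R_def using u[OF \<open>w \<noteq> \<kappa>\<close>] N(2,3) that w \<tau>(2) by (auto simp: null_pair_def)
  qed
  have z': "R (pack (1, 0) (1, 0) c d) = 0" "R (pack (1, 0) c (1, 0) d) = 0" "R (pack (1, 0) c d (1, 0)) = 0" for c d
    using z[of "pack (1, 0) (1, 0) c d" X1] z[of "pack (1, 0) c (1, 0) d" X2] z[of "pack (1, 0) c d (1, 0)" X12] by simp_all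
  define \<alpha> where "\<alpha> = R (pack (1, 0) (0, 1) (0, 1) (0, 1))"
  define q where "q b c d = R (pack (0, 1) b c d)" for b c d
  have x: "R (pack (1, 0) b c d) = snd b * snd c * snd d * \<alpha>" for b c d
    unfolding multilin_pack(2)[OF R, of _ b] z'
    unfolding multilin_pack(3)[OF R, of _ _ c] z'
    unfolding multilin_pack(4)[OF R, of _ _ _ d] z' \<alpha>_def
    by simp
  have "\<alpha> \<noteq> 0"
  proof
    assume "\<alpha> = 0"
    then have "R (pack (1, 0) b c d) = 0" for b c d by (simp add: x)
    then have "tdet X X1 R (pack a b c d) = 0" for a b c d by (simp add: tdet_def)
    then have "tdet X X1 R y = 0" for y by (metis pack_eta)
    then show False using ndR unfolding nondeg_def using vertex.distinct(1) by blast
  qed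
  define o1 o0 :: hpoint where "o1 = (1, 0)" and "o0 = (0, 1)"
  have qq: "q b c d = fst b * fst c * fst d * q o1 o1 o1 + fst b * fst c * snd d * q o1 o1 o0 + fst b * snd c * fst d * q o1 o0 o1
    + snd b * fst c * fst d * q o0 o1 o1 + fst b * snd c * snd d * q o1 o0 o0 + snd b * fst c * snd d * q o0 o1 o0
    + snd b * snd c * fst d * q o0 o0 o1 + snd b * snd c * snd d * q o0 o0 o0" for b c d
    unfolding q_def multilin_pack(2)[OF R, of _ b]
    unfolding multilin_pack(3)[OF R, of _ _ c]
    unfolding multilin_pack(4)[OF R, of _ _ _ d] o1_def o0_def
    by (simp add: algebra_simps)
  have "eqv R (PF (q o1 o1 o1 / \<alpha>) (q o1 o1 o0 / \<alpha>) (q o1 o0 o1 / \<alpha>) (q o0 o1 o1 / \<alpha>) (q o1 o0 o0 / \<alpha>) (q o0 o1 o0 / \<alpha>) (q o0 o0 o1 / \<alpha>) (q o0 o0 o0 / \<alpha>))"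
  proof (rule eqv_moebiusI[of "(1, 0, 0, 1)" "(1, 0, 0, 1)" "(1, 0, 0, 1)" "(1, 0, 0, 1)" "1 / \<alpha>"])
    fix y :: "vertex \<Rightarrow> hpoint"
    have e1: "R (pack (y X) (y X1) (y X2) (y X12)) = fst (y X) * (snd (y X1) * snd (y X2) * snd (y X12) * \<alpha>) + snd (y X) * q (y X1) (y X2) (y X12)"
      unfolding multilin_pack(1)[OF R, of "y X"] x q_def ..
    have e2: "PF (q o1 o1 o1 / \<alpha>) (q o1 o1 o0 / \<alpha>) (q o1 o0 o1 / \<alpha>) (q o0 o1 o1 / \<alpha>) (q o1 o0 o0 / \<alpha>) (q o0 o1 o0 / \<alpha>) (q o0 o0 o1 / \<alpha>) (q o0 o0 o0 / \<alpha>) y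
      = fst (y X) * (snd (y X1) * snd (y X2) * snd (y X12)) + snd (y X) * (q (y X1) (y X2) (y X12) / \<alpha>)"
      unfolding PF_def qq[of "y X1" "y X2" "y X12"] by (simp add: divide_inverse algebra_simps)
    show "PF (q o1 o1 o1 / \<alpha>) (q o1 o1 o0 / \<alpha>) (q o1 o0 o1 / \<alpha>) (q o0 o1 o1 / \<alpha>) (q o1 o0 o0 / \<alpha>) (q o0 o1 o0 / \<alpha>) (q o0 o0 o1 / \<alpha>) (q o0 o0 o0 / \<alpha>) y
      = 1 / \<alpha> * R (pack (act (1, 0, 0, 1) (y X)) (act (1, 0, 0, 1) (y X1)) (act (1, 0, 0, 1) (y X2)) (act (1, 0, 0, 1) (y X12)))"
      unfolding act_id e1 e2 using \<open>\<alpha> \<noteq> 0\<close> by (simp add: distrib_left)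
  qed (use \<open>\<alpha> \<noteq> 0\<close> in simp_all)
  from eqv_trans[OF eR this] show ?thesis by blast
qed

section \<open>Assembling the classification\<close>

lemma tH_rep_cell:
  assumes "E \<in> {tH1 \<alpha> \<epsilon> |\<alpha> \<epsilon>. True} \<union> {tH2 \<alpha> \<beta> \<epsilon> |\<alpha> \<beta> \<epsilon>. True} \<union> {tH3 \<alpha> \<beta> \<delta> \<epsilon> |\<alpha> \<beta> \<delta> \<epsilon>. \<alpha> \<noteq> 0 \<and> \<beta> \<noteq> 0}"
  shows "multiaffine (cellf E)" "E = lift (pol (cellf E))" "cell_irreducible E \<Longrightarrow> E \<in> trapezoidal_list"
proof -
  consider \<alpha> \<epsilon> where "E = tH1 \<alpha> \<epsilon>" | \<alpha> \<beta> \<epsilon> where "E = tH2 \<alpha> \<beta> \<epsilon>"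
    | \<alpha> \<beta> \<delta> \<epsilon> where "E = tH3 \<alpha> \<beta> \<delta> \<epsilon>" "\<alpha> \<noteq> 0" "\<beta> \<noteq> 0"
    using assms by auto
  note E = this
  show "multiaffine (cellf E)" using E by cases (simp_all only: multiaffine_cellf)
  show "E = lift (pol (cellf E))" using E by cases (simp_all only: lift_cellf[symmetric])
  assume i: "cell_irreducible E"
  show "E \<in> trapezoidal_list"
    unfolding trapezoidal_list_def tH1_family_def tH2_family_def tH3_family_def
    using E i by cases blast+
qed

lemma H6_rep_cell:
  assumes "E \<in> H6_reps"
  shows "multiaffine (cellf E)" "E = lift (pol (cellf E))" "cell_irreducible E \<Longrightarrow> E \<in> H6_list \<union> {D1}"
proof -
  consider "E = D1" | "E = D3" | \<delta>1 \<delta>2 where "E = D2_1 \<delta>1 \<delta>2" | \<delta>1 \<delta>2 lam where "E = D2_2 \<delta>1 \<delta>2 lam"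
    | \<delta>1 \<delta>2 lam where "E = D2_3 \<delta>1 \<delta>2 lam" | \<delta>1 \<delta>2 \<delta>3 where "E = D4_1 \<delta>1 \<delta>2 \<delta>3"
    using assms unfolding H6_reps_def by auto
  note E = this
  show "multiaffine (cellf E)" using E by cases (simp_all only: multiaffine_cellf)
  show "E = lift (pol (cellf E))" using E by cases (simp_all only: lift_cellf[symmetric])
  assume i: "cell_irreducible E"
  show "E \<in> H6_list \<union> {D1}"
    unfolding H6_list_def D2_1_family_def D2_2_family_def D2_3_family_def D4_1_family_def
    using E i by cases blast+
qed

theorem classification:
  assumes q: "quad_equation Q" and nq: "\<not> type_Q Q" and nr: "\<not> rhombic_H4 Q"
  shows "trapezoidal_H4 Q \<and> (\<exists>E\<in>trapezoidal_list. lattice_equivalent (lift Q) E) \<or>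
      type_H6 Q \<and> (\<exists>E\<in>H6_list \<union> {D1}. lattice_equivalent (lift Q) E)"
proof -
  define f where "f = evv Q"
  have deg: "\<And>v. degree_le v 1 Q" using q by (simp add: quad_equation_def)
  have f: "multiaffine f" unfolding f_def by (rule multiaffine_evv[OF deg])
  have Q: "Q = pol f" unfolding f_def by (rule pol_evv[OF deg, symmetric])
  have nd: "nondeg (hom f)" using q quad_equation_pol_iff[OF f] unfolding Q by blast
  from f nq[unfolded Q] nr[unfolded Q] show ?thesis
  proof (cases rule: degenerate_type_cases)
    case (H4 k p m a l n)
    then obtain d3 d1 d2 d0 b3 b1 b2 b0 c where *: "d3 * d0 - d1 * d2 \<noteq> 0" "b3 * b0 - b1 * b2 \<noteq> 0"
      "eqv (hom f) (NF (d3, d1, d2, d0) (b3, b1, b2, b0) c)"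
      using trapezoidal_reduction[OF multilin_hom H4(2,3,4,6)] by blast
    obtain c3 c1 c2 c0 where c: "c = (c3, c1, c2, c0)" by (cases c)
    have ndN: "nondeg (NF (d3, d1, d2, d0) (b3, b1, b2, b0) (c3, c1, c2, c0))"
      using nondeg_eqv[OF multilin_hom nd *(3)] c by simp
    from trapezoidal_normal_form[OF *(1,2) ndN] obtain E
      where E: "E \<in> {tH1 \<alpha> \<epsilon> |\<alpha> \<epsilon>. True} \<union> {tH2 \<alpha> \<beta> \<epsilon> |\<alpha> \<beta> \<epsilon>. True} \<union> {tH3 \<alpha> \<beta> \<delta> \<epsilon> |\<alpha> \<beta> \<delta> \<epsilon>. \<alpha> \<noteq> 0 \<and> \<beta> \<noteq> 0}"
      and e: "eqv (NF (d3, d1, d2, d0) (b3, b1, b2, b0) (c3, c1, c2, c0)) (hom (cellf E))"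
      by (rule bexE)
    note r = equivalent_to_rep[OF f q[unfolded Q] tH_rep_cell(1,2)[OF E] eqv_trans[OF *(3)[unfolded c] e]]
    have "\<exists>E\<in>trapezoidal_list. lattice_equivalent (lift Q) E"
      unfolding Q using r(2) tH_rep_cell(3)[OF E r(1)] by blast
    then show ?thesis using H4(1) unfolding Q by blast
  next
    case (H6 k p m a l n)
    then obtain p7 p12 p1c p2c p1 p2 pc p0 where *: "eqv (hom f) (PF p7 p12 p1c p2c p1 p2 pc p0)"
      using H6_reduction[OF multilin_hom nd H6(2,3,4)] by blast
    from H6_normal_form[OF nondeg_eqv[OF multilin_hom nd *]] obtain E
      where E: "E \<in> H6_reps" and e: "eqv (PF p7 p12 p1c p2c p1 p2 pc p0) (hom (cellf E))"
      by (rule bexE)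
    note r = equivalent_to_rep[OF f q[unfolded Q] H6_rep_cell(1,2)[OF E] eqv_trans[OF * e]]
    have "\<exists>E\<in>H6_list \<union> {D1}. lattice_equivalent (lift Q) E"
      unfolding Q using r(2) H6_rep_cell(3)[OF E r(1)] by blast
    then show ?thesis using H6(1) unfolding Q by blast
  qed
qed

section \<open>Consistent six-tuples\<close>

type_synonym face = "complex \<Rightarrow> complex \<Rightarrow> complex \<Rightarrow> complex \<Rightarrow> complex"

definition four :: "face \<Rightarrow> (vertex \<Rightarrow> complex) \<Rightarrow> complex" where
  "four a z = a (z X) (z X1) (z X2) (z X12)"

lemma four_pack [simp]: "four a (pack x y z w) = a x y z w"
  by (simp add: four_def)

definition good_face :: "face \<Rightarrow> bool" where
  "good_face a \<longleftrightarrow> multiaffine (four a) \<and> quad_equation (pol (four a))"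

text \<open>The last three inequalities exhibit one point each where \<open>fdet X w\<close> is
  nonzero, as \<open>quad_equation_polI\<close> demands; the free coordinates of these points are
  chosen face by face.\<close>

lemma good_faceI:
  assumes "\<And>x x1 x2 x12. a x x1 x2 x12 = a 0 x1 x2 x12 + x * (a 1 x1 x2 x12 - a 0 x1 x2 x12)"
    "\<And>x x1 x2 x12. a x x1 x2 x12 = a x 0 x2 x12 + x1 * (a x 1 x2 x12 - a x 0 x2 x12)"
    "\<And>x x1 x2 x12. a x x1 x2 x12 = a x x1 0 x12 + x2 * (a x x1 1 x12 - a x x1 0 x12)"
    "\<And>x x1 x2 x12. a x x1 x2 x12 = a x x1 x2 0 + x12 * (a x x1 x2 1 - a x x1 x2 0)"
    and "a 1 0 p q * a 0 1 p q - a 1 1 p q * a 0 0 p q \<noteq> 0"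
    "a 1 p' 0 q' * a 0 p' 1 q' - a 1 p' 1 q' * a 0 p' 0 q' \<noteq> 0"
    "a 1 p'' q'' 0 * a 0 p'' q'' 1 - a 1 p'' q'' 1 * a 0 p'' q'' 0 \<noteq> 0"
  shows "good_face a"
proof -
  have m: "multiaffine (four a)"
    by (rule multiaffine_pack[where g = a]) (simp, (rule assms)+)
  moreover have "quad_equation (pol (four a))"
  proof (rule quad_equation_polI[OF m, of X])
    fix w assume "w \<noteq> X"
    moreover have "fdet X X1 (four a) (pack 0 0 p q) \<noteq> 0" "fdet X X2 (four a) (pack 0 p' 0 q') \<noteq> 0"
      "fdet X X12 (four a) (pack 0 p'' q'' 0) \<noteq> 0"
      using assms(5-7) by (simp_all add: fdet_def)
    ultimately show "\<exists>z. fdet X w (four a) z \<noteq> 0" by (cases w) blast+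
  qed
  ultimately show ?thesis by (simp add: good_face_def)
qed

lemma ev_face: "good_face a \<Longrightarrow> ev (pol (four a)) x y z w = a x y z w"
  by (simp add: ev_eq_evv evv_pol good_face_def)

text \<open>The inequality says that the leading coefficient in the last variable is nonzero, so
  that \<open>w\<close> is the only root (\<open>solves_iff\<close>).\<close>

definition solves :: "face \<Rightarrow> complex \<Rightarrow> complex \<Rightarrow> complex \<Rightarrow> complex \<Rightarrow> bool" where
  "solves a x y z w \<longleftrightarrow> a x y z w = 0 \<and> a x y z 1 \<noteq> a x y z 0"

lemma solves_iff:
  assumes "good_face a" "solves a x y z w"
  shows "(\<forall>t. ev (pol (four a)) x y z t = 0 \<longleftrightarrow> t = w)"
proof
  fix t
  have m: "multiaffine (four a)" using assms(1) by (simp add: good_face_def)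
  have lin: "a x y z t = a x y z 0 + t * (a x y z 1 - a x y z 0)" for t
    using multiaffineD[OF m, of "pack x y z 0" X12 t] by simp
  have "a x y z t = 0 \<longleftrightarrow> t = w"
  proof
    assume "a x y z t = 0"
    then have "(t - w) * (a x y z 1 - a x y z 0) = 0"
      using lin[of t] lin[of w] assms(2) unfolding solves_def by (simp add: algebra_simps)
    then show "t = w" using assms(2) by (simp add: solves_def)
  qed (use assms(2) in \<open>simp add: solves_def\<close>)
  then show "ev (pol (four a)) x y z t = 0 \<longleftrightarrow> t = w" by (simp add: ev_face[OF assms(1)])
qed

lemmas polyfun_intros = polyfun_const polyfun_var polyfun_add polyfun_diff polyfun_mult polyfun_minus polyfun_power

lemma generic_point:
  assumes "\<And>g. g \<in> set gs \<Longrightarrow> polyfun g \<and> (\<exists>z. g z \<noteq> 0)"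
  shows "\<exists>P. P \<noteq> 0 \<and> (\<forall>z. evv P z \<noteq> 0 \<longrightarrow> (\<forall>g\<in>set gs. g z \<noteq> 0))"
  using assms
proof (induction gs)
  case Nil
  then show ?case by (intro exI[of _ 1]) simp
next
  case (Cons g gs)
  obtain P where P: "P \<noteq> 0" "\<forall>z. evv P z \<noteq> 0 \<longrightarrow> (\<forall>g\<in>set gs. g z \<noteq> 0)"
    using Cons by auto
  obtain G where G: "\<And>z. evv G z = g z" using Cons.prems[of g] by (auto simp: polyfun_def)
  obtain z where "g z \<noteq> 0" using Cons.prems[of g] by auto
  then have "G \<noteq> 0" using G[of z] by auto
  then show ?case using P by (intro exI[of _ "G * P"]) (simp add: G)
qed

text \<open>\<open>h\<close> does not see \<open>x\<close>, so the tetrahedron property comes for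
  free: off the zero set of \<open>P\<close> the value \<open>x123\<close> is unique and equals
  \<open>h x1 x2 x3\<close>. The functions in \<open>gs\<close> are evaluated at
  \<open>pack x x1 x2 x3\<close>, that is, the slot \<open>X12\<close> holds \<open>x3\<close>; in
  the applications they keep the denominators and the leading coefficients of the six faces from
  vanishing.\<close>

theorem consistentI:
  assumes faces: "good_face a" "good_face a'" "good_face b" "good_face b'" "good_face c" "good_face c'"
    and gs: "list_all (\<lambda>g. polyfun g \<and> (\<exists>z. g z \<noteq> 0)) gs"
    and cube: "\<And>x x1 x2 x3. list_all (\<lambda>g. g (pack x x1 x2 x3) \<noteq> 0) gs \<Longrightarrow> \<exists>x12 x13 x23.
      solves a x x1 x2 x12 \<and> solves b x x2 x3 x23 \<and> solves c x x1 x3 x13 \<and> solves a' x3 x13 x23 (h x1 x2 x3) \<and>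
      solves b' x1 x12 x13 (h x1 x2 x3) \<and> solves c' x2 x12 x23 (h x1 x2 x3)"
    and f: "multiaffine f" and \<sigma>: "square_relabelling \<sigma>" and r: "r \<in> {a, a', b, b', c, c'}"
    and rel: "\<And>y. four r y = f (\<lambda>v. y (\<sigma> v))"
  shows "consistent (pol f)"
proof -
  let ?P = "\<lambda>a. pol (four a)"
  obtain P where P: "P \<noteq> 0" "\<And>z. evv P z \<noteq> 0 \<Longrightarrow> \<forall>g\<in>set gs. g z \<noteq> 0"
    using generic_point[of gs] gs unfolding list_all_iff by blast
  have ex: "\<exists>x12 x13 x23. cube_values (?P a) (?P a') (?P b) (?P b') (?P c) (?P c') x x1 x2 x3 x12 x13 x23 (h x1 x2 x3)"
    if "ev P x x1 x2 x3 \<noteq> 0" for x x1 x2 x3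
  proof -
    have "\<forall>g\<in>set gs. g (pack x x1 x2 x3) \<noteq> 0" by (rule P(2)) (use that in \<open>simp add: ev_eq_evv\<close>)
    then obtain x12 x13 x23 where s: "solves a x x1 x2 x12" "solves b x x2 x3 x23" "solves c x x1 x3 x13"
      "solves a' x3 x13 x23 (h x1 x2 x3)" "solves b' x1 x12 x13 (h x1 x2 x3)" "solves c' x2 x12 x23 (h x1 x2 x3)"
      using cube[of x x1 x2 x3] unfolding list_all_iff by blast
    have "cube_values (?P a) (?P a') (?P b) (?P b') (?P c) (?P c') x x1 x2 x3 x12 x13 x23 (h x1 x2 x3)"
      unfolding cube_values_def
      by (intro conjI solves_iff[OF faces(1) s(1)] solves_iff[OF faces(3) s(2)] solves_iff[OF faces(5) s(3)]
          solves_iff[OF faces(2) s(4)] solves_iff[OF faces(4) s(5)] solves_iff[OF faces(6) s(6)])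
    then show ?thesis by blast
  qed
  have c3: "consistent_3D (?P a) (?P a') (?P b) (?P b') (?P c) (?P c')"
    unfolding consistent_3D_def using P(1) ex by meson
  have val: "x123 = h x1 x2 x3"
    if v: "ev P x x1 x2 x3 \<noteq> 0" "cube_values (?P a) (?P a') (?P b) (?P b') (?P c) (?P c') x x1 x2 x3 x12 x13 x23 x123"
    for x x1 x2 x3 x12 x13 x23 x123
  proof -
    obtain y12 y13 y23 where y: "cube_values (?P a) (?P a') (?P b) (?P b') (?P c) (?P c') x x1 x2 x3 y12 y13 y23 (h x1 x2 x3)"
      using ex[OF v(1)] by blast
    have "x13 = y13" "x23 = y23" using y v(2) unfolding cube_values_def by blast+
    then show ?thesis using y v(2) unfolding cube_values_def by blast
  qed
  have t: "tetrahedron_property (?P a) (?P a') (?P b) (?P b') (?P c) (?P c')"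
    unfolding tetrahedron_property_def
  proof (intro exI[of _ P] conjI allI impI, rule P(1), elim conjE)
    fix x y x1 x2 x3 x12 x13 x23 x123 y12 y13 y23 y123
    assume a: "ev P x x1 x2 x3 \<noteq> 0" "ev P y x1 x2 x3 \<noteq> 0"
      and b: "cube_values (?P a) (?P a') (?P b) (?P b') (?P c) (?P c') x x1 x2 x3 x12 x13 x23 x123"
        "cube_values (?P a) (?P a') (?P b) (?P b') (?P c) (?P c') y x1 x2 x3 y12 y13 y23 y123"
    show "x123 = y123" using val[OF a(1) b(1)] val[OF a(2) b(2)] by simp
  qed
  have gr: "good_face r" using r faces by auto
  have "relabelled \<sigma> (pol f) (?P r)"
    unfolding relabelled_def
  proof
    fix y :: "vertex \<Rightarrow> complex"
    show "ev (?P r) (y X) (y X1) (y X2) (y X12) = ev (pol f) (y (\<sigma> X)) (y (\<sigma> X1)) (y (\<sigma> X2)) (y (\<sigma> X12))"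
      unfolding ev_face[OF gr] using rel[of y] pack_eta[of "\<lambda>v. y (\<sigma> v)"]
      by (simp add: four_def ev_eq_evv evv_pol[OF f])
  qed
  moreover have "?P r \<in> {?P a, ?P a', ?P b, ?P b', ?P c, ?P c'}" using r by auto
  moreover have "\<forall>G\<in>{?P a, ?P a', ?P b, ?P b', ?P c, ?P c'}. quad_equation G"
    using faces by (simp add: good_face_def)
  ultimately show ?thesis unfolding consistent_def using \<sigma> c3 t by blast
qed

lemma solvesI: "a x y z w = 0 \<Longrightarrow> a x y z 1 - a x y z 0 \<noteq> 0 \<Longrightarrow> solves a x y z w"
  by (simp add: solves_def)

text \<open>Supplies test points for faces whose determinant is
  \<open>t (\<delta> t + \<mu>)\<close>, where no single \<open>t\<close> works for all
  parameters.\<close>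

lemma nonzero_at_1_or_2: "(\<exists>t \<in> {1, 2}. t * (\<delta> * t + \<mu>) \<noteq> 0)" if "\<mu> \<noteq> 0" for \<mu> \<delta> :: complex
proof (rule ccontr)
  assume "\<not> ?thesis"
  then have "\<delta> + \<mu> = 0" "2 * \<delta> + \<mu> = 0" by (auto simp: mult.commute)
  then show False using that by algebra
qed

section \<open>The six-tuple of the first trapezoidal equation\<close>

definition face_t1 :: "complex \<Rightarrow> complex \<Rightarrow> face" where
  "face_t1 \<alpha> e x x1 x2 x12 = (x - x1) * (x2 - x12) - \<alpha> * (1 + e * x2 * x12)"

definition face_t1' :: "complex \<Rightarrow> complex \<Rightarrow> face" where
  "face_t1' \<alpha> e x x1 x2 x12 = (x2 - x12) * (x - x1) - \<alpha> * (1 + e * x * x1)"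

text \<open>Solved for \<open>x12\<close> this is \<open>x\<close> plus the sum of \<open>x1\<close>
  and \<open>x2\<close> under the addition law of the tangent,
  \<open>(a + b) / (1 - e a b)\<close>.\<close>

definition face_t1b :: "complex \<Rightarrow> face" where
  "face_t1b e x x1 x2 x12 = (x12 - x) * (1 - e * x1 * x2) - x1 - x2"

lemma good_face_t1: "good_face (face_t1 \<alpha> e)" if "\<alpha> \<noteq> 0"
  by (rule good_faceI[where p = 0 and q = 1 and p' = 0 and q' = 0 and p'' = 0 and q'' = 0])
    (simp_all add: face_t1_def that algebra_simps)

lemma good_face_t1': "good_face (face_t1' \<alpha> e)" if "\<alpha> \<noteq> 0"
  by (rule good_faceI[where p = "if e = 0 then 1 else 0" and q = 0 and p' = 0 and q' = 0 and p'' = 0 and q'' = 0])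
    (simp_all add: face_t1'_def that algebra_simps)

lemma good_face_t1b: "good_face (face_t1b e)"
  by (rule good_faceI[where p = 0 and q = 0 and p' = 0 and q' = 0 and p'' = 0 and q'' = 0])
    (simp_all add: face_t1b_def algebra_simps)

text \<open>In the addition law of \<open>face_t1b\<close>, face \<open>a\<close> reads
  \<open>x12 = x2 \<ominus> \<alpha> / (x - x1)\<close> and face \<open>c\<close> reads
  \<open>x13 = x3 \<oplus> \<alpha> / (x - x1)\<close>. The sum of \<open>x12\<close> and
  \<open>x13\<close> is therefore that of \<open>x2\<close> and \<open>x3\<close>, whence
  \<open>x123 - x1 = x23 - x\<close>, which is free of \<open>x\<close>.\<close>

lemma consistent_tH1:
  assumes \<alpha>: "\<alpha> \<noteq> 0"
  shows "consistent (pol (cellf (tH1 \<alpha> \<epsilon>)))"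
proof -
  define e where "e = \<epsilon>\<^sup>2"
  show ?thesis
  proof (rule consistentI[where a = "face_t1 \<alpha> e" and a' = "face_t1' (- \<alpha>) e" and b = "face_t1b e" and b' = "face_t1b e"
        and c = "face_t1 (- \<alpha>) e" and c' = "face_t1' \<alpha> e" and h = "\<lambda>x1 x2 x3. x1 + (x2 + x3) / (1 - e * x2 * x3)"
        and \<sigma> = id and r = "face_t1 \<alpha> e" and f = "cellf (tH1 \<alpha> \<epsilon>)"
        and gs = "[\<lambda>z. z X - z X1 + \<alpha> * e * z X2, \<lambda>z. z X - z X1 - \<alpha> * e * z X12, \<lambda>z. 1 - e * z X2 * z X12,
          \<lambda>z. (z X - z X1)\<^sup>2 + e * \<alpha>\<^sup>2, \<lambda>z. 1 + e * (z X2)\<^sup>2, \<lambda>z. 1 + e * (z X12)\<^sup>2]"])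
    have "(if e = 0 then 1 else 0 :: complex)\<^sup>2 + e * \<alpha>\<^sup>2 \<noteq> 0" using \<alpha> by simp
    then have w: "\<exists>z. z X - z X1 + \<alpha> * e * z X2 \<noteq> 0" "\<exists>z. z X - z X1 - \<alpha> * e * z X12 \<noteq> 0"
      "\<exists>z. 1 - e * z X2 * z X12 \<noteq> 0" "\<exists>z. (z X - z X1)\<^sup>2 + e * \<alpha>\<^sup>2 \<noteq> 0" "\<exists>z. 1 + e * (z X2)\<^sup>2 \<noteq> 0"
      "\<exists>z. 1 + e * (z X12)\<^sup>2 \<noteq> 0"
      by - ((rule exI[of _ "pack 1 0 0 0"], simp; fail) | (rule exI[of _ "pack (if e = 0 then 1 else 0) 0 0 0"], simp))+
    show "list_all (\<lambda>g. polyfun g \<and> (\<exists>z. g z \<noteq> 0)) [\<lambda>z. z X - z X1 + \<alpha> * e * z X2, \<lambda>z. z X - z X1 - \<alpha> * e * z X12,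
        \<lambda>z. 1 - e * z X2 * z X12, \<lambda>z. (z X - z X1)\<^sup>2 + e * \<alpha>\<^sup>2, \<lambda>z. 1 + e * (z X2)\<^sup>2, \<lambda>z. 1 + e * (z X12)\<^sup>2]"
      unfolding list.pred_inject by (intro conjI list.pred_inject(1) w polyfun_intros)
  next
    fix x x1 x2 x3
    assume "list_all (\<lambda>g. g (pack x x1 x2 x3) \<noteq> 0) [\<lambda>z. z X - z X1 + \<alpha> * e * z X2, \<lambda>z. z X - z X1 - \<alpha> * e * z X12,
        \<lambda>z. 1 - e * z X2 * z X12, \<lambda>z. (z X - z X1)\<^sup>2 + e * \<alpha>\<^sup>2, \<lambda>z. 1 + e * (z X2)\<^sup>2, \<lambda>z. 1 + e * (z X12)\<^sup>2]"
    then have g: "x - x1 + \<alpha> * e * x2 \<noteq> 0" "x - x1 - \<alpha> * e * x3 \<noteq> 0" "1 - e * x2 * x3 \<noteq> 0" "(x - x1)\<^sup>2 + e * \<alpha>\<^sup>2 \<noteq> 0"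
      "1 + e * x2\<^sup>2 \<noteq> 0" "1 + e * x3\<^sup>2 \<noteq> 0" unfolding list.pred_inject pack_simps by blast+
    define d where "d = x - x1"
    define D2 D3 U where "D2 = d + \<alpha> * e * x2" and "D3 = d - \<alpha> * e * x3" and "U = 1 - e * x2 * x3"
    have nz: "D2 \<noteq> 0" "D3 \<noteq> 0" "U \<noteq> 0" using g by (simp_all add: D2_def D3_def U_def d_def)
    obtain x12 where x12: "D2 * x12 = d * x2 - \<alpha>" using nz(1) by (metis nonzero_mult_div_cancel_left times_divide_eq_right)
    obtain x13 where x13: "D3 * x13 = d * x3 + \<alpha>" using nz(2) by (metis nonzero_mult_div_cancel_left times_divide_eq_right)
    define w where "w = (x2 + x3) / U"
    have w: "U * w = x2 + x3" using nz(3) by (simp add: w_def)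
    have h: "x1 + (x2 + x3) / (1 - e * x2 * x3) = x1 + w" by (simp add: w_def U_def)
    have a: "d * (x2 - x12) = \<alpha> * (1 + e * x2 * x12)" using x12 by (simp add: D2_def algebra_simps)
    have c: "d * (x3 - x13) = - \<alpha> * (1 + e * x3 * x13)" using x13 by (simp add: D3_def algebra_simps)
    have s2: "D2 * (x2 - x12) = \<alpha> * (1 + e * x2\<^sup>2)"
      using x12 by (simp add: right_diff_distrib) (simp add: D2_def algebra_simps power2_eq_square)
    have s3: "D3 * (x3 - x13) = - \<alpha> * (1 + e * x3\<^sup>2)"
      using x13 by (simp add: right_diff_distrib) (simp add: D3_def algebra_simps power2_eq_square)
    have ne: "x2 - x12 \<noteq> 0" "x3 - x13 \<noteq> 0" using s2 s3 g(5,6) \<alpha> by auto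
    \<comment> \<open>The leading coefficient on face \<open>b'\<close>: multiplied by the
      denominators it factors into polynomials in the initial data.\<close>
    have l: "D2 * D3 * (1 - e * x12 * x13) = U * (d\<^sup>2 + e * \<alpha>\<^sup>2)"
    proof -
      have "D2 * D3 * (1 - e * x12 * x13) = D2 * D3 - e * (D2 * x12) * (D3 * x13)" by (simp add: algebra_simps)
      then show ?thesis unfolding x12 x13 by (simp add: D2_def D3_def U_def algebra_simps power2_eq_square)
    qed
    then have lb: "1 - e * x12 * x13 \<noteq> 0" using nz g(4) by (auto simp: d_def)
    have "U * (D2 * D3) * (w * (1 - e * x12 * x13) - x12 - x13) = 0"
    proof -
      have "U * (D2 * D3) * (w * (1 - e * x12 * x13) - x12 - x13) =
        (U * w) * (D2 * D3 * (1 - e * x12 * x13)) - U * (D3 * (D2 * x12) + D2 * (D3 * x13))" by (simp add: algebra_simps)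
      then show ?thesis unfolding w l x12 x13 by (simp add: D2_def D3_def algebra_simps power2_eq_square)
    qed
    then have "w * (1 - e * x12 * x13) - x12 - x13 = 0" using nz by (simp only: mult_eq_0_iff simp_thms)
    then have b: "w * (1 - e * x12 * x13) = x12 + x13" by (simp only: diff_diff_eq right_minus_eq)
    show "\<exists>x12 x13 x23. solves (face_t1 \<alpha> e) x x1 x2 x12 \<and> solves (face_t1b e) x x2 x3 x23 \<and>
      solves (face_t1 (- \<alpha>) e) x x1 x3 x13 \<and> solves (face_t1' (- \<alpha>) e) x3 x13 x23 (x1 + (x2 + x3) / (1 - e * x2 * x3)) \<and>
      solves (face_t1b e) x1 x12 x13 (x1 + (x2 + x3) / (1 - e * x2 * x3)) \<and>
      solves (face_t1' \<alpha> e) x2 x12 x23 (x1 + (x2 + x3) / (1 - e * x2 * x3))"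
      unfolding h
    proof (rule exI[of _ x12], rule exI[of _ x13], rule exI[of _ "x + w"], intro conjI solvesI)
      show "face_t1 \<alpha> e x x1 x2 x12 = 0" using a by (simp add: face_t1_def d_def)
      show "face_t1 \<alpha> e x x1 x2 1 - face_t1 \<alpha> e x x1 x2 0 \<noteq> 0"
        using nz(1) by (simp add: face_t1_def D2_def d_def algebra_simps)
      show "face_t1b e x x2 x3 (x + w) = 0" using w by (simp add: face_t1b_def U_def mult.commute)
      show "face_t1b e x x2 x3 1 - face_t1b e x x2 x3 0 \<noteq> 0" using nz(3) by (simp add: face_t1b_def U_def algebra_simps)
      show "face_t1 (- \<alpha>) e x x1 x3 x13 = 0" using c by (simp add: face_t1_def d_def)
      show "face_t1 (- \<alpha>) e x x1 x3 1 - face_t1 (- \<alpha>) e x x1 x3 0 \<noteq> 0"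
        using nz(2) by (simp add: face_t1_def D3_def d_def algebra_simps)
      show "face_t1' (- \<alpha>) e x3 x13 (x + w) (x1 + w) = 0" using c by (simp add: face_t1'_def d_def)
      show "face_t1' (- \<alpha>) e x3 x13 (x + w) 1 - face_t1' (- \<alpha>) e x3 x13 (x + w) 0 \<noteq> 0"
        using ne(2) by (simp add: face_t1'_def algebra_simps)
      show "face_t1b e x1 x12 x13 (x1 + w) = 0" using b by (simp add: face_t1b_def)
      show "face_t1b e x1 x12 x13 1 - face_t1b e x1 x12 x13 0 \<noteq> 0" using lb by (simp add: face_t1b_def algebra_simps)
      show "face_t1' \<alpha> e x2 x12 (x + w) (x1 + w) = 0" using a by (simp add: face_t1'_def d_def)
      show "face_t1' \<alpha> e x2 x12 (x + w) 1 - face_t1' \<alpha> e x2 x12 (x + w) 0 \<noteq> 0"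
        using ne(1) by (simp add: face_t1'_def algebra_simps)
    qed
  next
    show "four (face_t1 \<alpha> e) y = cellf (tH1 \<alpha> \<epsilon>) (\<lambda>v. y (id v))" for y
      by (simp add: four_def cellf_def face_t1_def tH1_def e_def algebra_simps)
  qed (use \<alpha> in \<open>simp_all add: good_face_t1 good_face_t1' good_face_t1b multiaffine_cellf square_relabelling_def\<close>)
qed

lemma solve_linear: "D \<noteq> 0 \<Longrightarrow> \<exists>x. D * x = (N :: complex)"
  by (rule exI[of _ "N / D"]) simp

section \<open>The six-tuple of the second trapezoidal equation\<close>

definition face_t2 :: "complex \<Rightarrow> complex \<Rightarrow> complex \<Rightarrow> face" where
  "face_t2 \<alpha> e t x x1 x2 x12 = (x - x1) * (x2 - x12) + \<alpha> * (x + x1 + x2 + x12 + 2 * t + \<alpha>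
     + e * (2 * (x2 + t) * (x12 + t) + \<alpha> * (x2 + x12 + 2 * t) + \<alpha>\<^sup>2))"

definition face_t2b :: "complex \<Rightarrow> complex \<Rightarrow> face" where
  "face_t2b e t x x1 x2 x12 = x12 * (1 + e * (x1 + t + x2)) + (x1 + t) * x2 + x * (x1 + t) + x * x2"

definition face_t2c :: "complex \<Rightarrow> complex \<Rightarrow> face" where
  "face_t2c \<alpha> t x x1 x2 x12 = (x2 - x12) * (x - x1) + \<alpha> * (x2 + x12)
     - \<alpha> * (2 * (x + t) * (x1 + t) + \<alpha> * (x + x1 + 2 * t) + \<alpha>\<^sup>2)"

lemma good_face_t2: "good_face (face_t2 \<alpha> e t)" if "\<alpha> \<noteq> 0"
  by (rule good_faceI[where p = 0 and q = 0 and p' = 1 and q' = "- t" and p'' = 1 and q'' = "- \<alpha> - t"])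
    (simp_all add: face_t2_def that algebra_simps power2_eq_square)

lemma good_face_t2b: "good_face (face_t2b e t)"
proof -
  obtain s where s: "s * (e * s + 1) \<noteq> 0" using nonzero_at_1_or_2[OF one_neq_zero, of e] by blast
  have *: "face_t2b e t 1 (- t) s 0 * face_t2b e t 0 (- t) s 1 - face_t2b e t 1 (- t) s 1 * face_t2b e t 0 (- t) s 0 = s * (e * s + 1)"
    by (simp add: face_t2b_def algebra_simps)
  show ?thesis
    by (rule good_faceI[where p = 0 and q = 1 and p' = "- t" and q' = 1 and p'' = "- t" and q'' = s], unfold *, rule_tac [7] s)
      (simp_all add: face_t2b_def algebra_simps)
qed

lemma good_face_t2c: "good_face (face_t2c \<alpha> t)" if "\<alpha> \<noteq> 0"
  by (rule good_faceI[where p = 0 and q = 0 and p' = "- t" and q' = 1 and p'' = "- \<alpha> - t" and q'' = 1])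
    (simp_all add: face_t2c_def that algebra_simps power2_eq_square)

text \<open>One six-tuple serves two representatives: face \<open>a\<close> is \<open>tH2\<close>,
  and face \<open>b\<close> with both parameters zero is \<open>D3\<close> up to
  relabelling.\<close>

lemma consistent_t2:
  assumes \<alpha>: "\<alpha> \<noteq> 0" and f: "multiaffine f" and \<sigma>: "square_relabelling \<sigma>"
    and r: "r \<in> {face_t2 \<alpha> e t, face_t2b e t}" and rel: "\<And>y. four r y = f (\<lambda>v. y (\<sigma> v))"
  shows "consistent (pol f)"
proof -
  \<comment> \<open>The solution of \<open>face_t2b e t\<close> at the arguments \<open>x1\<close>,
    \<open>x2 + \<alpha>\<close>, \<open>x3 - \<alpha>\<close>.\<close>
  define h where "h x1 x2 x3 = - ((x2 + t) * x3 + \<alpha> * (x3 - (x2 + t)) - \<alpha>\<^sup>2 + x1 * (x2 + t + x3)) / (1 + e * (x2 + t + x3))" for x1 x2 x3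
  let ?gs = "[\<lambda>z. z X - z X1 - \<alpha> - 2 * e * \<alpha> * (z X2 + t) - e * \<alpha>\<^sup>2, \<lambda>z. z X - z X1 + \<alpha> + 2 * e * \<alpha> * z X12 - e * \<alpha>\<^sup>2,
    \<lambda>z. 1 + e * (z X2 + t + z X12), \<lambda>z. (z X - z X1)\<^sup>2 + (e * \<alpha>\<^sup>2)\<^sup>2 + 2 * e * \<alpha>\<^sup>2 * (z X + z X1) - \<alpha>\<^sup>2,
    \<lambda>z. z X + z X12 + e * (z X12)\<^sup>2, \<lambda>z. z X + (z X2 + t) + e * (z X2 + t)\<^sup>2]"
  show ?thesis
  proof (rule consistentI[where a = "face_t2 \<alpha> e t" and a' = "face_t2c (- \<alpha>) 0" and b = "face_t2b e t" and b' = "face_t2b e t"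
        and c = "face_t2 (- \<alpha>) e 0" and c' = "face_t2c \<alpha> t" and h = h and gs = ?gs, OF _ _ _ _ _ _ _ _ f \<sigma> _ rel])
    have w1: "\<exists>z. z X - z X1 - \<alpha> - 2 * e * \<alpha> * (z X2 + t) - e * \<alpha>\<^sup>2 \<noteq> 0"
      by (rule exI[of _ "pack (1 + \<alpha> + 2 * e * \<alpha> * t + e * \<alpha>\<^sup>2) 0 0 0"]) (simp add: algebra_simps)
    have w2: "\<exists>z. z X - z X1 + \<alpha> + 2 * e * \<alpha> * z X12 - e * \<alpha>\<^sup>2 \<noteq> 0"
      by (rule exI[of _ "pack (1 - \<alpha> + e * \<alpha>\<^sup>2) 0 0 0"]) simp
    have w3: "\<exists>z. 1 + e * (z X2 + t + z X12) \<noteq> 0" by (rule exI[of _ "pack 0 0 (- t) 0"]) simp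
    have w4: "\<exists>z. (z X - z X1)\<^sup>2 + (e * \<alpha>\<^sup>2)\<^sup>2 + 2 * e * \<alpha>\<^sup>2 * (z X + z X1) - \<alpha>\<^sup>2 \<noteq> 0"
      using \<alpha> by (intro exI[of _ "pack (- e * \<alpha>\<^sup>2) 0 0 0"]) (simp add: power2_eq_square algebra_simps)
    have w5: "\<exists>z. z X + z X12 + e * (z X12)\<^sup>2 \<noteq> 0" by (rule exI[of _ "pack 1 0 0 0"]) simp
    have w6: "\<exists>z. z X + (z X2 + t) + e * (z X2 + t)\<^sup>2 \<noteq> 0" by (rule exI[of _ "pack 1 0 (- t) 0"]) simp
    show "list_all (\<lambda>g. polyfun g \<and> (\<exists>z. g z \<noteq> 0)) ?gs"
      unfolding list.pred_inject by (intro conjI list.pred_inject(1) w1 w2 w3 w4 w5 w6 polyfun_intros)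
  next
    fix x x1 x2 x3
    assume "list_all (\<lambda>g. g (pack x x1 x2 x3) \<noteq> 0) ?gs"
    then have g: "x - x1 - \<alpha> - 2 * e * \<alpha> * (x2 + t) - e * \<alpha>\<^sup>2 \<noteq> 0" "x - x1 + \<alpha> + 2 * e * \<alpha> * x3 - e * \<alpha>\<^sup>2 \<noteq> 0"
      "1 + e * (x2 + t + x3) \<noteq> 0" "(x - x1)\<^sup>2 + (e * \<alpha>\<^sup>2)\<^sup>2 + 2 * e * \<alpha>\<^sup>2 * (x + x1) - \<alpha>\<^sup>2 \<noteq> 0"
      "x + x3 + e * x3\<^sup>2 \<noteq> 0" "x + (x2 + t) + e * (x2 + t)\<^sup>2 \<noteq> 0"
      unfolding list.pred_inject pack_simps by blast+
    \<comment> \<open>Shifting \<open>x2\<close> and \<open>x12\<close> by \<open>t\<close>, to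
      \<open>y\<close> and \<open>u\<close>, makes \<open>t\<close> disappear from all six
      faces.\<close>
    define y where "y = x2 + t"
    define D2 N2 where "D2 = x - x1 - \<alpha> - 2 * e * \<alpha> * y - e * \<alpha>\<^sup>2"
      and "N2 = (x - x1) * y + \<alpha> * (x + x1 + y + \<alpha> + e * \<alpha> * y + e * \<alpha>\<^sup>2)"
    define D3 N3 where "D3 = x - x1 + \<alpha> + 2 * e * \<alpha> * x3 - e * \<alpha>\<^sup>2"
      and "N3 = (x - x1) * x3 - \<alpha> * (x + x1 + x3 - \<alpha> - e * \<alpha> * x3 + e * \<alpha>\<^sup>2)"
    define U where "U = 1 + e * (y + x3)"
    have nz: "D2 \<noteq> 0" "D3 \<noteq> 0" "U \<noteq> 0" using g(1-3) by (simp_all add: D2_def D3_def U_def y_def)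
    obtain u where u: "D2 * u = N2" using solve_linear[OF nz(1)] by blast
    obtain x13 where x13: "D3 * x13 = N3" using solve_linear[OF nz(2)] by blast
    obtain v where v: "U * v = - (y * x3 + x * y + x * x3)" using solve_linear[OF nz(3)] by blast
    define w where "w = h x1 x2 x3"
    have w: "U * w = - (y * x3 + \<alpha> * (x3 - y) - \<alpha>\<^sup>2 + x1 * (y + x3))"
      using nz(3) by (simp add: w_def h_def U_def y_def)
    have la: "D3 * (x3 - x13 + \<alpha>) = 2 * \<alpha> * (x + x3 + e * x3\<^sup>2)"
    proof -
      have "D3 * (x3 - x13 + \<alpha>) = D3 * (x3 + \<alpha>) - D3 * x13" by (simp add: algebra_simps)
      then show ?thesis unfolding x13 by (simp add: D3_def N3_def algebra_simps power2_eq_square)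
    qed
    have lc: "D2 * (y - u - \<alpha>) = - 2 * \<alpha> * (x + y + e * y\<^sup>2)"
    proof -
      have "D2 * (y - u - \<alpha>) = D2 * (y - \<alpha>) - D2 * u" by (simp add: algebra_simps)
      then show ?thesis unfolding u by (simp add: D2_def N2_def algebra_simps power2_eq_square)
    qed
    have lb: "D2 * D3 * (1 + e * (u + x13)) = U * ((x - x1)\<^sup>2 + (e * \<alpha>\<^sup>2)\<^sup>2 + 2 * e * \<alpha>\<^sup>2 * (x + x1) - \<alpha>\<^sup>2)"
    proof -
      have "D2 * D3 * (1 + e * (u + x13)) = D2 * D3 + e * (D3 * (D2 * u) + D2 * (D3 * x13))" by (simp add: algebra_simps)
      then show ?thesis unfolding u x13 by (simp add: D2_def N2_def D3_def N3_def U_def algebra_simps power2_eq_square)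
    qed
    have "D3 * (x3 - x13 + \<alpha>) \<noteq> 0" "D2 * (y - u - \<alpha>) \<noteq> 0" "D2 * D3 * (1 + e * (u + x13)) \<noteq> 0"
      unfolding la lb lc using nz(3) g(4-6) \<alpha> by (simp_all add: y_def)
    then have ne: "x3 - x13 + \<alpha> \<noteq> 0" "y - u - \<alpha> \<noteq> 0" "1 + e * (u + x13) \<noteq> 0"
      by (simp_all only: mult_eq_0_iff de_Morgan_disj not_False_eq_True simp_thms)
    have "U * D3 * ((v - w) * (x3 - x13) - \<alpha> * (v + w) + \<alpha> * (2 * x3 * x13 - \<alpha> * (x3 + x13) + \<alpha>\<^sup>2)) =
      (U * v - U * w) * (D3 * x3 - D3 * x13) - \<alpha> * (U * v + U * w) * D3
      + \<alpha> * U * (2 * x3 * (D3 * x13) - \<alpha> * (D3 * x3 + D3 * x13) + \<alpha>\<^sup>2 * D3)" by (simp add: algebra_simps)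
    also have "\<dots> = 0"
      unfolding v w x13 by (simp add: D3_def N3_def U_def algebra_simps power2_eq_square)
    finally have ea: "(v - w) * (x3 - x13) - \<alpha> * (v + w) + \<alpha> * (2 * x3 * x13 - \<alpha> * (x3 + x13) + \<alpha>\<^sup>2) = 0" using nz by simp
    have "U * D2 * ((v - w) * (y - u) + \<alpha> * (v + w) - \<alpha> * (2 * y * u + \<alpha> * (y + u) + \<alpha>\<^sup>2)) =
      (U * v - U * w) * (D2 * y - D2 * u) + \<alpha> * (U * v + U * w) * D2
      - \<alpha> * U * (2 * y * (D2 * u) + \<alpha> * (D2 * y + D2 * u) + \<alpha>\<^sup>2 * D2)" by (simp add: algebra_simps)
    also have "\<dots> = 0"
      unfolding v w u by (simp add: D2_def N2_def U_def algebra_simps power2_eq_square)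
    finally have ec: "(v - w) * (y - u) + \<alpha> * (v + w) - \<alpha> * (2 * y * u + \<alpha> * (y + u) + \<alpha>\<^sup>2) = 0" using nz by simp
    have "U * (D2 * D3) * (w * (1 + e * (u + x13)) + u * x13 + x1 * u + x1 * x13) =
      (U * w) * (D2 * D3 * (1 + e * (u + x13))) + U * ((D2 * u) * (D3 * x13) + x1 * (D3 * (D2 * u) + D2 * (D3 * x13)))"
      by (simp add: algebra_simps)
    also have "\<dots> = U * ((U * w) * ((x - x1)\<^sup>2 + (e * \<alpha>\<^sup>2)\<^sup>2 + 2 * e * \<alpha>\<^sup>2 * (x + x1) - \<alpha>\<^sup>2) + (N2 * N3 + x1 * (D3 * N2 + D2 * N3)))"
      unfolding lb u x13 by (simp add: algebra_simps)
    also have "(U * w) * ((x - x1)\<^sup>2 + (e * \<alpha>\<^sup>2)\<^sup>2 + 2 * e * \<alpha>\<^sup>2 * (x + x1) - \<alpha>\<^sup>2) + (N2 * N3 + x1 * (D3 * N2 + D2 * N3)) = 0"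
      unfolding w by (simp add: D2_def N2_def D3_def N3_def algebra_simps power2_eq_square)
    finally have eb: "w * (1 + e * (u + x13)) + u * x13 + x1 * u + x1 * x13 = 0" using nz by simp
    show "\<exists>x12 x13 x23. solves (face_t2 \<alpha> e t) x x1 x2 x12 \<and> solves (face_t2b e t) x x2 x3 x23 \<and>
      solves (face_t2 (- \<alpha>) e 0) x x1 x3 x13 \<and> solves (face_t2c (- \<alpha>) 0) x3 x13 x23 (h x1 x2 x3) \<and>
      solves (face_t2b e t) x1 x12 x13 (h x1 x2 x3) \<and> solves (face_t2c \<alpha> t) x2 x12 x23 (h x1 x2 x3)"
      unfolding w_def[symmetric]
    proof (rule exI[of _ "u - t"], rule exI[of _ x13], rule exI[of _ v], intro conjI solvesI)
      have "face_t2 \<alpha> e t x x1 x2 (u - t) = N2 - D2 * u"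
        by (simp add: face_t2_def N2_def D2_def y_def algebra_simps power2_eq_square)
      then show "face_t2 \<alpha> e t x x1 x2 (u - t) = 0" using u by simp
      have "face_t2 \<alpha> e t x x1 x2 1 - face_t2 \<alpha> e t x x1 x2 0 = - D2"
        by (simp add: face_t2_def D2_def y_def algebra_simps power2_eq_square)
      then show "face_t2 \<alpha> e t x x1 x2 1 - face_t2 \<alpha> e t x x1 x2 0 \<noteq> 0" using nz(1) by simp
      have "face_t2b e t x x2 x3 v = U * v + (y * x3 + x * y + x * x3)" by (simp add: face_t2b_def U_def y_def algebra_simps)
      then show "face_t2b e t x x2 x3 v = 0" unfolding v by simp
      show "face_t2b e t x x2 x3 1 - face_t2b e t x x2 x3 0 \<noteq> 0" using nz(3) by (simp add: face_t2b_def U_def y_def)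
      have "face_t2 (- \<alpha>) e 0 x x1 x3 x13 = N3 - D3 * x13"
        by (simp add: face_t2_def N3_def D3_def algebra_simps power2_eq_square)
      then show "face_t2 (- \<alpha>) e 0 x x1 x3 x13 = 0" using x13 by simp
      have "face_t2 (- \<alpha>) e 0 x x1 x3 1 - face_t2 (- \<alpha>) e 0 x x1 x3 0 = - D3"
        by (simp add: face_t2_def D3_def algebra_simps power2_eq_square)
      then show "face_t2 (- \<alpha>) e 0 x x1 x3 1 - face_t2 (- \<alpha>) e 0 x x1 x3 0 \<noteq> 0" using nz(2) by simp
      show "face_t2c (- \<alpha>) 0 x3 x13 v w = 0" using ea by (simp add: face_t2c_def algebra_simps)
      have "face_t2c (- \<alpha>) 0 x3 x13 v 1 - face_t2c (- \<alpha>) 0 x3 x13 v 0 = - (x3 - x13 + \<alpha>)" by (simp add: face_t2c_def algebra_simps)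
      then show "face_t2c (- \<alpha>) 0 x3 x13 v 1 - face_t2c (- \<alpha>) 0 x3 x13 v 0 \<noteq> 0" using ne(1) by (simp only: neg_equal_0_iff_equal not_False_eq_True)
      show "face_t2b e t x1 (u - t) x13 w = 0" using eb by (simp add: face_t2b_def)
      show "face_t2b e t x1 (u - t) x13 1 - face_t2b e t x1 (u - t) x13 0 \<noteq> 0" using ne(3) by (simp add: face_t2b_def)
      have "face_t2c \<alpha> t x2 (u - t) v w = (v - w) * (y - u) + \<alpha> * (v + w) - \<alpha> * (2 * y * u + \<alpha> * (y + u) + \<alpha>\<^sup>2)"
        by (simp add: face_t2c_def y_def algebra_simps)
      then show "face_t2c \<alpha> t x2 (u - t) v w = 0" using ec by simp
      have "face_t2c \<alpha> t x2 (u - t) v 1 - face_t2c \<alpha> t x2 (u - t) v 0 = - (y - u - \<alpha>)" by (simp add: face_t2c_def y_def algebra_simps)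
      then show "face_t2c \<alpha> t x2 (u - t) v 1 - face_t2c \<alpha> t x2 (u - t) v 0 \<noteq> 0" using ne(2) by (simp only: neg_equal_0_iff_equal not_False_eq_True)
    qed
  qed (use \<alpha> r in \<open>auto simp: good_face_t2 good_face_t2b good_face_t2c\<close>)
qed

lemma consistent_tH2:
  assumes "\<alpha> \<noteq> 0"
  shows "consistent (pol (cellf (tH2 \<alpha> \<beta> \<epsilon>)))"
proof (rule consistent_t2[OF assms multiaffine_cellf(2), of id "face_t2 \<alpha> \<epsilon> \<beta>" \<epsilon> \<beta>])
  show "four (face_t2 \<alpha> \<epsilon> \<beta>) y = cellf (tH2 \<alpha> \<beta> \<epsilon>) (\<lambda>v. y (id v))" for y
    by (simp add: four_def cellf_def face_t2_def tH2_def field_simps power2_eq_square)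
qed (simp_all add: square_relabelling_def)

lemma consistent_D3: "consistent (pol (cellf D3))"
proof (rule consistent_t2[OF one_neq_zero multiaffine_cellf(8), of "pack X12 X2 X1 X" "face_t2b 0 0" 0 0])
  show "four (face_t2b 0 0) y = cellf D3 (\<lambda>v. y (pack X12 X2 X1 X v))" for y
    by (simp add: four_def cellf_def face_t2b_def D3_def algebra_simps)
qed (simp_all add: square_relabelling_pack insert_commute)

section \<open>The six-tuples of the equations with quadratic terms\<close>

text \<open>The shape of \<open>tH3\<close>; \<open>p\<close> and \<open>q\<close> sit on opposite
  edges, and at most one of them is nonzero in each use.\<close>

definition face_S :: "complex \<Rightarrow> complex \<Rightarrow> complex \<Rightarrow> complex \<Rightarrow> complex \<Rightarrow> face" where
  "face_S A B p q k x x1 x2 x12 = A * (x * x2 + x1 * x12) + B * (x * x12 + x1 * x2) + p * x2 * x12 + q * x * x1 + k"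

text \<open>Along suitable lines each determinant is a polynomial in \<open>t\<close> of degree at
  most 2. The first one contains only \<open>t^2\<close>, so 1 or 2 is not a root; the other two
  have a nonzero linear coefficient, which the values at 1 and -1 detect.\<close>

lemma good_face_S:
  assumes "A \<noteq> 0" "B \<noteq> 0" "A\<^sup>2 \<noteq> B\<^sup>2" "p = 0 \<or> q = 0"
  shows "good_face (face_S A B p q k)"
proof -
  let ?a = "face_S A B p q k"
  have ne: "p * q + B\<^sup>2 - A\<^sup>2 \<noteq> 0" "p * q + A\<^sup>2 - B\<^sup>2 \<noteq> 0" using assms(3,4) by auto
  have 1: "?a 1 0 t 0 * ?a 0 1 t 0 - ?a 1 1 t 0 * ?a 0 0 t 0 = A * B * t\<^sup>2 - q * k" for t
    by (simp add: face_S_def algebra_simps power2_eq_square)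
  have 2: "?a 1 1 0 t * ?a 0 1 1 t - ?a 1 1 1 t * ?a 0 1 0 t = (p * q + B\<^sup>2 - A\<^sup>2) * t + q * B + p * B * t\<^sup>2 - A * k" for t
    by (simp add: face_S_def algebra_simps power2_eq_square)
  have 3: "?a 1 1 t 0 * ?a 0 1 t 1 - ?a 1 1 t 1 * ?a 0 1 t 0 = (p * q + A\<^sup>2 - B\<^sup>2) * t + q * A + p * A * t\<^sup>2 - B * k" for t
    by (simp add: face_S_def algebra_simps power2_eq_square)
  have "A * B * 1\<^sup>2 - q * k \<noteq> 0 \<or> A * B * 2\<^sup>2 - q * k \<noteq> 0" using assms(1,2) by auto
  then obtain t where t: "A * B * t\<^sup>2 - q * k \<noteq> 0" by blast
  have sep: "\<exists>t. c * t + d + e * t\<^sup>2 - f \<noteq> 0" if "c \<noteq> 0" for c d e f :: complex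
  proof (rule ccontr)
    assume "\<not> ?thesis"
    then have z: "c * t + d + e * t\<^sup>2 - f = 0" for t by blast
    show False using that z[of 1] z[of "- 1"] by simp algebra
  qed
  obtain u where u: "(p * q + B\<^sup>2 - A\<^sup>2) * u + q * B + p * B * u\<^sup>2 - A * k \<noteq> 0" using sep[OF ne(1)] by blast
  obtain v where v: "(p * q + A\<^sup>2 - B\<^sup>2) * v + q * A + p * A * v\<^sup>2 - B * k \<noteq> 0" using sep[OF ne(2)] by blast
  show ?thesis
    by (rule good_faceI[where p = t and q = 0 and p' = 1 and q' = u and p'' = 1 and q'' = v], unfold 1 2 3,
        rule_tac [7] v, rule_tac [6] u, rule_tac [5] t) (simp_all add: face_S_def algebra_simps)
qed

definition face_d :: "complex \<Rightarrow> complex \<Rightarrow> complex \<Rightarrow> complex \<Rightarrow> face" where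
  "face_d E l m \<kappa> x x1 x2 x12 = x12 * (x2 - \<kappa> * x1) - (E * x + l * x2) * x1 - m"

definition face_d' :: "complex \<Rightarrow> complex \<Rightarrow> complex \<Rightarrow> complex \<Rightarrow> face" where
  "face_d' E l m \<kappa> x x1 x2 x12 = x1 * x2 - \<kappa> - x12 * (E * x + l * x2 + m * x1)"

lemma good_face_d: "good_face (face_d E l m \<kappa>)" if "E \<noteq> 0"
  by (rule good_faceI[where p = 1 and q = "m + 1" and p' = 1 and q' = "l + 1" and p'' = 1 and q'' = "\<kappa> + 1"])
    (simp_all add: face_d_def that algebra_simps)

lemma good_face_d': "good_face (face_d' E l m \<kappa>)" if "E \<noteq> 0"
  by (rule good_faceI[where p = "m + 1" and q = 1 and p' = "l + 1" and q' = 1 and p'' = 1 and q'' = "\<kappa> + 1"])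
    (simp_all add: face_d'_def that algebra_simps)

text \<open>Face \<open>b\<close> has the shape of \<open>D4_2\<close>; \<open>x123\<close> is the
  solution of the same face at the arguments \<open>x1\<close>, \<open>\<alpha> x2\<close>,
  \<open>\<alpha> x3\<close>. The factor \<open>r\<close> only rescales \<open>x\<close> and
  \<open>x1\<close>.\<close>

lemma consistent_d:
  assumes \<alpha>: "\<alpha> \<noteq> 0" "\<alpha>\<^sup>2 \<noteq> 1" and r: "r \<noteq> 0" and f: "multiaffine f" and \<sigma>: "square_relabelling \<sigma>"
    and rel: "\<And>y. four (face_d ((\<alpha>\<^sup>2 - 1) * r) l (\<alpha> * k) \<kappa>) y = f (\<lambda>v. y (\<sigma> v))"
  shows "consistent (pol f)"
proof -
  define c where "c = \<alpha>\<^sup>2 - 1"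
  have c: "c \<noteq> 0" using \<alpha>(2) by (simp add: c_def)
  let ?a = "face_S (\<alpha> * r) (- r) (\<kappa> * l) 0 k" and ?b = "face_d (c * r) l (\<alpha> * k) \<kappa>"
    and ?c = "face_S (\<alpha> * r) (- r) l 0 (\<kappa> * k)" and ?c' = "face_S \<alpha> (- 1) 0 (- c * l) 0"
    and ?a' = "face_S \<alpha> (- 1) 0 0 (- c * k)"
  define h where "h x1 x2 x3 = (c * (r * x1) * x2 + \<alpha> * l * x2 * x3 + k) / (x3 - \<kappa> * x2)" for x1 x2 x3
  let ?gs = "[\<lambda>z. \<alpha> * (r * z X1) - r * z X + \<kappa> * l * z X2, \<lambda>z. \<alpha> * (r * z X1) - r * z X + l * z X12, \<lambda>z. z X12 - \<kappa> * z X2,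
    \<lambda>z. (\<alpha> * (r * z X) - r * z X1) * (\<alpha> * (r * z X1) - r * z X) - \<kappa> * k * l,
    \<lambda>z. c * (r * z X) * z X2 + \<kappa> * l * (z X2)\<^sup>2 + \<alpha> * k, \<lambda>z. c * (r * z X) * z X12 + l * (z X12)\<^sup>2 + \<alpha> * \<kappa> * k]"
  show ?thesis
  proof (rule consistentI[where a = ?a and a' = ?a' and b = ?b and b' = ?b and c = ?c and c' = ?c' and h = h and gs = ?gs
        and r = ?b, OF _ _ _ _ _ _ _ _ f \<sigma>])
    have w1: "\<exists>z. \<alpha> * (r * z X1) - r * z X + \<kappa> * l * z X2 \<noteq> 0" by (rule exI[of _ "pack 1 0 0 0"]) (simp add: r)
    have w2: "\<exists>z. \<alpha> * (r * z X1) - r * z X + l * z X12 \<noteq> 0" by (rule exI[of _ "pack 1 0 0 0"]) (simp add: r)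
    have w3: "\<exists>z. z X12 - \<kappa> * z X2 \<noteq> 0" by (rule exI[of _ "pack 0 0 0 1"]) simp
    have w4: "\<exists>z. (\<alpha> * (r * z X) - r * z X1) * (\<alpha> * (r * z X1) - r * z X) - \<kappa> * k * l \<noteq> 0"
      using \<alpha>(1) r by (intro exI[of _ "pack (if \<kappa> * k * l = 0 then 1 else 0) 0 0 0"]) auto
    have w5: "\<exists>z. c * (r * z X) * z X2 + \<kappa> * l * (z X2)\<^sup>2 + \<alpha> * k \<noteq> 0"
      using c r by (intro exI[of _ "pack ((1 - \<kappa> * l - \<alpha> * k) / (c * r)) 0 1 0"]) simp
    have w6: "\<exists>z. c * (r * z X) * z X12 + l * (z X12)\<^sup>2 + \<alpha> * \<kappa> * k \<noteq> 0"
      using c r by (intro exI[of _ "pack ((1 - l - \<alpha> * \<kappa> * k) / (c * r)) 0 0 1"]) simp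
    show "list_all (\<lambda>g. polyfun g \<and> (\<exists>z. g z \<noteq> 0)) ?gs"
      unfolding list.pred_inject by (intro conjI list.pred_inject(1) w1 w2 w3 w4 w5 w6 polyfun_intros)
  next
    fix x x1 x2 x3
    assume g0: "list_all (\<lambda>g. g (pack x x1 x2 x3) \<noteq> 0) ?gs"
    define V W where "V = r * x" and "W = r * x1"
    have g: "\<alpha> * W - V + \<kappa> * l * x2 \<noteq> 0" "\<alpha> * W - V + l * x3 \<noteq> 0" "x3 - \<kappa> * x2 \<noteq> 0"
      "(\<alpha> * V - W) * (\<alpha> * W - V) - \<kappa> * k * l \<noteq> 0" "c * V * x2 + \<kappa> * l * x2\<^sup>2 + \<alpha> * k \<noteq> 0"
      "c * V * x3 + l * x3\<^sup>2 + \<alpha> * \<kappa> * k \<noteq> 0"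
      using g0 unfolding list.pred_inject pack_simps V_def W_def by blast+
    define D2 N2 where "D2 = \<alpha> * W - V + \<kappa> * l * x2" and "N2 = W * x2 - \<alpha> * V * x2 - k"
    define D3 N3 where "D3 = \<alpha> * W - V + l * x3" and "N3 = W * x3 - \<alpha> * V * x3 - \<kappa> * k"
    define U where "U = x3 - \<kappa> * x2"
    have nz: "D2 \<noteq> 0" "D3 \<noteq> 0" "U \<noteq> 0" using g(1-3) by (simp_all add: D2_def D3_def U_def)
    obtain x12 where x12: "D2 * x12 = N2" using solve_linear[OF nz(1)] by blast
    obtain x13 where x13: "D3 * x13 = N3" using solve_linear[OF nz(2)] by blast
    obtain v where v: "U * v = c * V * x2 + l * x2 * x3 + \<alpha> * k" using solve_linear[OF nz(3)] by blast
    define w where "w = h x1 x2 x3"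
    have w: "U * w = c * W * x2 + \<alpha> * l * x2 * x3 + k" using nz(3) by (simp add: w_def h_def U_def W_def)
    have lb: "D2 * D3 * (x13 - \<kappa> * x12) = - U * ((\<alpha> * V - W) * (\<alpha> * W - V) - \<kappa> * k * l)"
    proof -
      have "D2 * D3 * (x13 - \<kappa> * x12) = D2 * (D3 * x13) - \<kappa> * D3 * (D2 * x12)" by (simp add: algebra_simps)
      then show ?thesis unfolding x12 x13 by (simp add: D2_def N2_def D3_def N3_def U_def algebra_simps power2_eq_square)
    qed
    have lc: "D2 * (\<alpha> * x12 - x2) = - (c * V * x2 + \<kappa> * l * x2\<^sup>2 + \<alpha> * k)"
    proof -
      have "D2 * (\<alpha> * x12 - x2) = \<alpha> * (D2 * x12) - D2 * x2" by (simp add: algebra_simps)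
      then show ?thesis unfolding x12 by (simp add: D2_def N2_def c_def algebra_simps power2_eq_square)
    qed
    have la: "D3 * (\<alpha> * x13 - x3) = - (c * V * x3 + l * x3\<^sup>2 + \<alpha> * \<kappa> * k)"
    proof -
      have "D3 * (\<alpha> * x13 - x3) = \<alpha> * (D3 * x13) - D3 * x3" by (simp add: algebra_simps)
      then show ?thesis unfolding x13 by (simp add: D3_def N3_def c_def algebra_simps power2_eq_square)
    qed
    have "D3 * (\<alpha> * x13 - x3) \<noteq> 0" "D2 * (\<alpha> * x12 - x2) \<noteq> 0" "D2 * D3 * (x13 - \<kappa> * x12) \<noteq> 0"
      unfolding la lb lc neg_equal_0_iff_equal mult_eq_0_iff using nz(3) g(4-6) by simp_all
    then have ne: "\<alpha> * x13 - x3 \<noteq> 0" "\<alpha> * x12 - x2 \<noteq> 0" "x13 - \<kappa> * x12 \<noteq> 0"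
      by (simp_all only: mult_eq_0_iff de_Morgan_disj not_False_eq_True simp_thms)
    have "U * D2 * (\<alpha> * (x2 * v + x12 * w) - (x2 * w + x12 * v) - c * l * x2 * x12) =
      \<alpha> * (x2 * (U * v) * D2 + (D2 * x12) * (U * w)) - (x2 * (U * w) * D2 + (D2 * x12) * (U * v)) - c * l * x2 * (D2 * x12) * U"
      by (simp add: algebra_simps)
    also have "\<dots> = 0"
      unfolding v w x12 by (simp add: D2_def N2_def U_def c_def algebra_simps power2_eq_square)
    finally have ec: "\<alpha> * (x2 * v + x12 * w) - (x2 * w + x12 * v) - c * l * x2 * x12 = 0"
      using nz by (simp only: mult_eq_0_iff simp_thms)
    have "U * D3 * (\<alpha> * (x3 * v + x13 * w) - (x3 * w + x13 * v) - c * k) =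
      \<alpha> * (x3 * (U * v) * D3 + (D3 * x13) * (U * w)) - (x3 * (U * w) * D3 + (D3 * x13) * (U * v)) - c * k * D3 * U"
      by (simp add: algebra_simps)
    also have "\<dots> = 0"
      unfolding v w x13 by (simp add: D3_def N3_def U_def c_def algebra_simps power2_eq_square)
    finally have ea: "\<alpha> * (x3 * v + x13 * w) - (x3 * w + x13 * v) - c * k = 0"
      using nz by (simp only: mult_eq_0_iff simp_thms)
    have "D2 * D3 * (w * (x13 - \<kappa> * x12) - (c * W + l * x13) * x12 - \<alpha> * k) =
      w * (D2 * D3 * (x13 - \<kappa> * x12)) - (c * W * D3 + l * (D3 * x13)) * (D2 * x12) - \<alpha> * k * D2 * D3"
      by (simp add: algebra_simps)
    also have "\<dots> = - (U * w) * ((\<alpha> * V - W) * (\<alpha> * W - V) - \<kappa> * k * l) - (c * W * D3 + l * N3) * N2 - \<alpha> * k * D2 * D3"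
      unfolding lb x12 x13 by (simp add: algebra_simps)
    also have "\<dots> = 0"
      unfolding w by (simp add: D2_def N2_def D3_def N3_def c_def algebra_simps power2_eq_square)
    finally have eb: "w * (x13 - \<kappa> * x12) - (c * W + l * x13) * x12 - \<alpha> * k = 0"
      using nz by (simp only: mult_eq_0_iff simp_thms)
    show "\<exists>x12 x13 x23. solves ?a x x1 x2 x12 \<and> solves ?b x x2 x3 x23 \<and> solves ?c x x1 x3 x13 \<and>
      solves ?a' x3 x13 x23 (h x1 x2 x3) \<and> solves ?b x1 x12 x13 (h x1 x2 x3) \<and> solves ?c' x2 x12 x23 (h x1 x2 x3)"
      unfolding w_def[symmetric]
    proof (rule exI[of _ x12], rule exI[of _ x13], rule exI[of _ v], intro conjI solvesI)
      have "?a x x1 x2 x12 = D2 * x12 - N2" by (simp add: face_S_def D2_def N2_def V_def W_def algebra_simps)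
      then show "?a x x1 x2 x12 = 0" using x12 by simp
      have "?a x x1 x2 1 - ?a x x1 x2 0 = D2" by (simp add: face_S_def D2_def V_def W_def algebra_simps)
      then show "?a x x1 x2 1 - ?a x x1 x2 0 \<noteq> 0" using nz(1) by simp
      have "?b x x2 x3 v = U * v - (c * V * x2 + l * x2 * x3 + \<alpha> * k)"
        by (simp add: face_d_def U_def V_def algebra_simps)
      then show "?b x x2 x3 v = 0" unfolding v by simp
      have "?b x x2 x3 1 - ?b x x2 x3 0 = U" by (simp add: face_d_def U_def)
      then show "?b x x2 x3 1 - ?b x x2 x3 0 \<noteq> 0" using nz(3) by simp
      have "?c x x1 x3 x13 = D3 * x13 - N3" by (simp add: face_S_def D3_def N3_def V_def W_def algebra_simps)
      then show "?c x x1 x3 x13 = 0" using x13 by simp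
      have "?c x x1 x3 1 - ?c x x1 x3 0 = D3" by (simp add: face_S_def D3_def V_def W_def algebra_simps)
      then show "?c x x1 x3 1 - ?c x x1 x3 0 \<noteq> 0" using nz(2) by simp
      show "?a' x3 x13 v w = 0" using ea by (simp add: face_S_def algebra_simps)
      have "?a' x3 x13 v 1 - ?a' x3 x13 v 0 = \<alpha> * x13 - x3" by (simp add: face_S_def algebra_simps)
      then show "?a' x3 x13 v 1 - ?a' x3 x13 v 0 \<noteq> 0" using ne(1) by (simp only: simp_thms not_False_eq_True)
      show "?b x1 x12 x13 w = 0" using eb by (simp add: face_d_def W_def mult.assoc)
      have "?b x1 x12 x13 1 - ?b x1 x12 x13 0 = x13 - \<kappa> * x12" by (simp add: face_d_def)
      then show "?b x1 x12 x13 1 - ?b x1 x12 x13 0 \<noteq> 0" using ne(3) by (simp only: simp_thms not_False_eq_True)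
      show "?c' x2 x12 v w = 0" using ec by (simp add: face_S_def algebra_simps)
      have "?c' x2 x12 v 1 - ?c' x2 x12 v 0 = \<alpha> * x12 - x2" by (simp add: face_S_def algebra_simps)
      then show "?c' x2 x12 v 1 - ?c' x2 x12 v 0 \<noteq> 0" using ne(2) by (simp only: simp_thms not_False_eq_True)
    qed
  next
    show "four ?b y = f (\<lambda>v. y (\<sigma> v))" for y unfolding c_def by (rule rel)
  qed (use \<alpha> r c in \<open>simp_all add: good_face_S good_face_d power_mult_distrib\<close>)
qed

text \<open>Two representatives share this six-tuple: \<open>tH3\<close> on face \<open>a\<close>
  and \<open>D4_1\<close> on face \<open>b\<close>. The value \<open>x123\<close> solves face
  \<open>b\<close> at the arguments \<open>x1\<close>, \<open>x2 / \<alpha>\<close>,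
  \<open>\<alpha> x3\<close>.\<close>

lemma consistent_d':
  assumes \<alpha>: "\<alpha> \<noteq> 0" "\<alpha>\<^sup>2 \<noteq> 1" and r: "r \<noteq> 0" and f: "multiaffine f" and \<sigma>: "square_relabelling \<sigma>"
    and R: "R \<in> {face_S (- r) (\<alpha> * r) k 0 (\<kappa> * l), face_d' ((\<alpha>\<^sup>2 - 1) * r) l (\<alpha> * k) \<kappa>}"
    and rel: "\<And>y. four R y = f (\<lambda>v. y (\<sigma> v))"
  shows "consistent (pol f)"
proof -
  define c where "c = \<alpha>\<^sup>2 - 1"
  have c: "c \<noteq> 0" using \<alpha>(2) by (simp add: c_def)
  let ?a = "face_S (- r) (\<alpha> * r) k 0 (\<kappa> * l)" and ?b = "face_d' (c * r) l (\<alpha> * k) \<kappa>"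
    and ?c = "face_S (\<alpha> * r) (- r) l 0 (\<kappa> * k)" and ?c' = "face_S \<alpha> (- 1) (- c * l) 0 0"
    and ?a' = "face_S (- 1) \<alpha> (- c * k) 0 0"
  define h where "h x1 x2 x3 = (x2 * x3 - \<kappa>) / (c * (r * x1) + \<alpha> * l * x3 + k * x2)" for x1 x2 x3
  let ?gs = "[\<lambda>z. \<alpha> * (r * z X) - r * z X1 + k * z X2, \<lambda>z. \<alpha> * (r * z X1) - r * z X + l * z X12,
    \<lambda>z. c * (r * z X) + l * z X12 + \<alpha> * k * z X2, \<lambda>z. c * (r * z X1) + \<alpha> * l * z X12 + k * z X2,
    \<lambda>z. (\<alpha> * (r * z X) - r * z X1) * (\<alpha> * (r * z X1) - r * z X) - \<kappa> * k * l,
    \<lambda>z. c * (r * z X) * z X2 + \<alpha> * k * (z X2)\<^sup>2 + \<kappa> * l, \<lambda>z. c * (r * z X) * z X12 + l * (z X12)\<^sup>2 + \<alpha> * \<kappa> * k]"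
  show ?thesis
  proof (rule consistentI[where a = ?a and a' = ?a' and b = ?b and b' = ?b and c = ?c and c' = ?c' and h = h and gs = ?gs,
        OF _ _ _ _ _ _ _ _ f \<sigma> _ rel])
    have w1: "\<exists>z. \<alpha> * (r * z X) - r * z X1 + k * z X2 \<noteq> 0" by (rule exI[of _ "pack 0 1 0 0"]) (simp add: r)
    have w2: "\<exists>z. \<alpha> * (r * z X1) - r * z X + l * z X12 \<noteq> 0" by (rule exI[of _ "pack 1 0 0 0"]) (simp add: r)
    have w3: "\<exists>z. c * (r * z X) + l * z X12 + \<alpha> * k * z X2 \<noteq> 0" by (rule exI[of _ "pack 1 0 0 0"]) (simp add: r c)
    have w3': "\<exists>z. c * (r * z X1) + \<alpha> * l * z X12 + k * z X2 \<noteq> 0" by (rule exI[of _ "pack 0 1 0 0"]) (simp add: r c)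
    have w4: "\<exists>z. (\<alpha> * (r * z X) - r * z X1) * (\<alpha> * (r * z X1) - r * z X) - \<kappa> * k * l \<noteq> 0"
      using \<alpha>(1) r by (intro exI[of _ "pack (if \<kappa> * k * l = 0 then 1 else 0) 0 0 0"]) auto
    have w5: "\<exists>z. c * (r * z X) * z X2 + \<alpha> * k * (z X2)\<^sup>2 + \<kappa> * l \<noteq> 0"
      using c r by (intro exI[of _ "pack ((1 - \<alpha> * k - \<kappa> * l) / (c * r)) 0 1 0"]) simp
    have w6: "\<exists>z. c * (r * z X) * z X12 + l * (z X12)\<^sup>2 + \<alpha> * \<kappa> * k \<noteq> 0"
      using c r by (intro exI[of _ "pack ((1 - l - \<alpha> * \<kappa> * k) / (c * r)) 0 0 1"]) simp
    show "list_all (\<lambda>g. polyfun g \<and> (\<exists>z. g z \<noteq> 0)) ?gs"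
      unfolding list.pred_inject by (intro conjI list.pred_inject(1) w1 w2 w3 w3' w4 w5 w6 polyfun_intros)
  next
    fix x x1 x2 x3
    assume g0: "list_all (\<lambda>g. g (pack x x1 x2 x3) \<noteq> 0) ?gs"
    define V W where "V = r * x" and "W = r * x1"
    have g: "\<alpha> * V - W + k * x2 \<noteq> 0" "\<alpha> * W - V + l * x3 \<noteq> 0" "c * V + l * x3 + \<alpha> * k * x2 \<noteq> 0"
      "c * W + \<alpha> * l * x3 + k * x2 \<noteq> 0" "(\<alpha> * V - W) * (\<alpha> * W - V) - \<kappa> * k * l \<noteq> 0"
      "c * V * x2 + \<alpha> * k * x2\<^sup>2 + \<kappa> * l \<noteq> 0" "c * V * x3 + l * x3\<^sup>2 + \<alpha> * \<kappa> * k \<noteq> 0"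
      using g0 unfolding list.pred_inject pack_simps V_def W_def by blast+
    define D2 N2 where "D2 = \<alpha> * V - W + k * x2" and "N2 = V * x2 - \<alpha> * W * x2 - \<kappa> * l"
    define D3 N3 where "D3 = \<alpha> * W - V + l * x3" and "N3 = W * x3 - \<alpha> * V * x3 - \<kappa> * k"
    define U U' N where "U = c * V + l * x3 + \<alpha> * k * x2" and "U' = c * W + \<alpha> * l * x3 + k * x2" and "N = x2 * x3 - \<kappa>"
    have nz: "D2 \<noteq> 0" "D3 \<noteq> 0" "U \<noteq> 0" "U' \<noteq> 0" using g(1-4) by (simp_all add: D2_def D3_def U_def U'_def)
    obtain x12 where x12: "D2 * x12 = N2" using solve_linear[OF nz(1)] by blast
    obtain x13 where x13: "D3 * x13 = N3" using solve_linear[OF nz(2)] by blast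
    obtain v where v: "U * v = N" using solve_linear[OF nz(3)] by blast
    define w where "w = h x1 x2 x3"
    have w: "U' * w = N" using nz(4) by (simp add: w_def h_def U'_def W_def N_def)
    have lb: "D2 * D3 * (c * W + l * x13 + \<alpha> * k * x12) = U' * ((\<alpha> * V - W) * (\<alpha> * W - V) - \<kappa> * k * l)"
    proof -
      have "D2 * D3 * (c * W + l * x13 + \<alpha> * k * x12) = D2 * D3 * c * W + l * D2 * (D3 * x13) + \<alpha> * k * D3 * (D2 * x12)"
        by (simp add: algebra_simps)
      then show ?thesis unfolding x12 x13
        by (simp add: D2_def N2_def D3_def N3_def U'_def c_def algebra_simps power2_eq_square)
    qed
    have lc: "D2 * U * (\<alpha> * x12 - x2 - c * l * v) = - U' * (c * V * x2 + \<alpha> * k * x2\<^sup>2 + \<kappa> * l)"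
    proof -
      have "D2 * U * (\<alpha> * x12 - x2 - c * l * v) = \<alpha> * U * (D2 * x12) - D2 * U * x2 - c * l * D2 * (U * v)"
        by (simp add: algebra_simps)
      then show ?thesis unfolding x12 v
        by (simp add: D2_def N2_def U_def U'_def N_def c_def algebra_simps power2_eq_square)
    qed
    have la: "D3 * U * (\<alpha> * x3 - x13 - c * k * v) = U' * (c * V * x3 + l * x3\<^sup>2 + \<alpha> * \<kappa> * k)"
    proof -
      have "D3 * U * (\<alpha> * x3 - x13 - c * k * v) = \<alpha> * D3 * U * x3 - U * (D3 * x13) - c * k * D3 * (U * v)"
        by (simp add: algebra_simps)
      then show ?thesis unfolding x13 v
        by (simp add: D3_def N3_def U_def U'_def N_def c_def algebra_simps power2_eq_square)
    qed
    have "D3 * U * (\<alpha> * x3 - x13 - c * k * v) \<noteq> 0" "D2 * U * (\<alpha> * x12 - x2 - c * l * v) \<noteq> 0"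
      "D2 * D3 * (c * W + l * x13 + \<alpha> * k * x12) \<noteq> 0"
      unfolding la lb lc neg_equal_0_iff_equal mult_eq_0_iff using nz(4) g(5-7) by simp_all
    then have ne: "\<alpha> * x3 - x13 - c * k * v \<noteq> 0" "\<alpha> * x12 - x2 - c * l * v \<noteq> 0" "c * W + l * x13 + \<alpha> * k * x12 \<noteq> 0"
      by (simp_all only: mult_eq_0_iff de_Morgan_disj not_False_eq_True simp_thms)
    have "U * U' * D2 * (\<alpha> * (x2 * v + x12 * w) - (x2 * w + x12 * v) - c * l * v * w) =
      \<alpha> * (x2 * (U * v) * U' * D2 + (D2 * x12) * (U' * w) * U) - (x2 * (U' * w) * U * D2 + (D2 * x12) * (U * v) * U')
      - c * l * (U * v) * (U' * w) * D2"
      by (simp add: algebra_simps)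
    also have "\<dots> = N * (\<alpha> * (x2 * U' * D2 + N2 * U) - (x2 * U * D2 + N2 * U') - c * l * N * D2)"
      unfolding v w x12 by (simp add: algebra_simps)
    also have "\<alpha> * (x2 * U' * D2 + N2 * U) - (x2 * U * D2 + N2 * U') - c * l * N * D2 = 0"
      by (simp add: D2_def N2_def U_def U'_def N_def c_def algebra_simps power2_eq_square)
    finally have ec: "\<alpha> * (x2 * v + x12 * w) - (x2 * w + x12 * v) - c * l * v * w = 0"
      using nz by (simp only: mult_eq_0_iff mult_zero_right simp_thms)
    have "U * U' * D3 * (\<alpha> * (x3 * w + x13 * v) - (x3 * v + x13 * w) - c * k * v * w) =
      \<alpha> * (x3 * (U' * w) * U * D3 + (D3 * x13) * (U * v) * U') - (x3 * (U * v) * U' * D3 + (D3 * x13) * (U' * w) * U)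
      - c * k * (U * v) * (U' * w) * D3"
      by (simp add: algebra_simps)
    also have "\<dots> = N * (\<alpha> * (x3 * U * D3 + N3 * U') - (x3 * U' * D3 + N3 * U) - c * k * N * D3)"
      unfolding v w x13 by (simp add: algebra_simps)
    also have "\<alpha> * (x3 * U * D3 + N3 * U') - (x3 * U' * D3 + N3 * U) - c * k * N * D3 = 0"
      by (simp add: D3_def N3_def U_def U'_def N_def c_def algebra_simps power2_eq_square)
    finally have ea: "\<alpha> * (x3 * w + x13 * v) - (x3 * v + x13 * w) - c * k * v * w = 0"
      using nz by (simp only: mult_eq_0_iff mult_zero_right simp_thms)
    have "D2 * D3 * (x12 * x13 - \<kappa> - w * (c * W + l * x13 + \<alpha> * k * x12)) =
      (D2 * x12) * (D3 * x13) - \<kappa> * D2 * D3 - w * (D2 * D3 * (c * W + l * x13 + \<alpha> * k * x12))"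
      by (simp add: algebra_simps)
    also have "\<dots> = N2 * N3 - \<kappa> * D2 * D3 - (U' * w) * ((\<alpha> * V - W) * (\<alpha> * W - V) - \<kappa> * k * l)"
      unfolding lb x12 x13 by (simp add: algebra_simps)
    also have "\<dots> = 0"
      unfolding w by (simp add: D2_def N2_def D3_def N3_def N_def algebra_simps power2_eq_square)
    finally have eb: "x12 * x13 - \<kappa> - w * (c * W + l * x13 + \<alpha> * k * x12) = 0"
      using nz by (simp only: mult_eq_0_iff simp_thms)
    show "\<exists>x12 x13 x23. solves ?a x x1 x2 x12 \<and> solves ?b x x2 x3 x23 \<and> solves ?c x x1 x3 x13 \<and>
      solves ?a' x3 x13 x23 (h x1 x2 x3) \<and> solves ?b x1 x12 x13 (h x1 x2 x3) \<and> solves ?c' x2 x12 x23 (h x1 x2 x3)"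
      unfolding w_def[symmetric]
    proof (rule exI[of _ x12], rule exI[of _ x13], rule exI[of _ v], intro conjI solvesI)
      have "?a x x1 x2 x12 = D2 * x12 - N2" by (simp add: face_S_def D2_def N2_def V_def W_def algebra_simps)
      then show "?a x x1 x2 x12 = 0" using x12 by simp
      have "?a x x1 x2 1 - ?a x x1 x2 0 = D2" by (simp add: face_S_def D2_def V_def W_def algebra_simps)
      then show "?a x x1 x2 1 - ?a x x1 x2 0 \<noteq> 0" using nz(1) by simp
      have "?b x x2 x3 v = N - U * v"
        by (simp add: face_d'_def U_def N_def V_def algebra_simps)
      then show "?b x x2 x3 v = 0" unfolding v by simp
      have "?b x x2 x3 1 - ?b x x2 x3 0 = - U" by (simp add: face_d'_def U_def V_def algebra_simps)
      then show "?b x x2 x3 1 - ?b x x2 x3 0 \<noteq> 0" using nz(3) by simp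
      have "?c x x1 x3 x13 = D3 * x13 - N3" by (simp add: face_S_def D3_def N3_def V_def W_def algebra_simps)
      then show "?c x x1 x3 x13 = 0" using x13 by simp
      have "?c x x1 x3 1 - ?c x x1 x3 0 = D3" by (simp add: face_S_def D3_def V_def W_def algebra_simps)
      then show "?c x x1 x3 1 - ?c x x1 x3 0 \<noteq> 0" using nz(2) by simp
      show "?a' x3 x13 v w = 0" using ea by (simp add: face_S_def algebra_simps)
      have "?a' x3 x13 v 1 - ?a' x3 x13 v 0 = \<alpha> * x3 - x13 - c * k * v" by (simp add: face_S_def algebra_simps)
      then show "?a' x3 x13 v 1 - ?a' x3 x13 v 0 \<noteq> 0" using ne(1) by (simp only: simp_thms not_False_eq_True)
      show "?b x1 x12 x13 w = 0" using eb by (simp add: face_d'_def W_def mult.assoc)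
      have "?b x1 x12 x13 1 - ?b x1 x12 x13 0 = - (c * W + l * x13 + \<alpha> * k * x12)" by (simp add: face_d'_def W_def mult.assoc)
      then show "?b x1 x12 x13 1 - ?b x1 x12 x13 0 \<noteq> 0"
        using ne(3) by (simp only: neg_equal_0_iff_equal simp_thms not_False_eq_True)
      show "?c' x2 x12 v w = 0" using ec by (simp add: face_S_def algebra_simps)
      have "?c' x2 x12 v 1 - ?c' x2 x12 v 0 = \<alpha> * x12 - x2 - c * l * v" by (simp add: face_S_def algebra_simps)
      then show "?c' x2 x12 v 1 - ?c' x2 x12 v 0 \<noteq> 0" using ne(2) by (simp only: simp_thms not_False_eq_True)
    qed
  next
    show "R \<in> {?a, ?a', ?b, ?b, ?c, ?c'}" using R unfolding c_def by blast
  qed (use \<alpha> r c in \<open>simp_all add: good_face_S good_face_d' power_mult_distrib\<close>)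
qed

lemma consistent_tH3:
  assumes "\<alpha> \<noteq> 0" "\<alpha>\<^sup>2 \<noteq> 1"
  shows "consistent (pol (cellf (tH3 \<alpha> \<beta> \<delta> \<epsilon>)))"
proof -
  define k where "k = - (\<epsilon>\<^sup>2 * (\<alpha>\<^sup>2 - 1) / (\<beta> * \<alpha>))"
  define \<kappa> where "\<kappa> = - (\<beta> * (\<alpha>\<^sup>2 - 1) * \<delta>\<^sup>2)"
  show ?thesis
  proof (rule consistent_d'[OF assms one_neq_zero multiaffine_cellf(3), of id "face_S (- 1) (\<alpha> * 1) k 0 (\<kappa> * 1)" k \<kappa> 1])
    show "four (face_S (- 1) (\<alpha> * 1) k 0 (\<kappa> * 1)) y = cellf (tH3 \<alpha> \<beta> \<delta> \<epsilon>) (\<lambda>v. y (id v))" for y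
      unfolding cellf_def tH3_def id_apply
      by (simp add: four_def face_S_def k_def[symmetric] \<kappa>_def) (simp add: k_def)
  qed (simp_all add: square_relabelling_def)
qed

lemma consistent_D4_1: "consistent (pol (cellf (D4_1 \<delta>1 \<delta>2 \<delta>3)))"
\<comment> \<open>Any \<open>\<alpha>\<close> with \<open>\<alpha>^2\<close> different from 0 and 1
  would serve; for \<open>\<alpha> = 2\<close> the choice \<open>r = - 1 / 3\<close> makes
  \<open>(\<alpha>^2 - 1) r\<close> equal to -1, which normalises the coefficient of
  \<open>x x12\<close>.\<close>
proof (rule consistent_d'[of 2 "- 1 / 3", OF _ _ _ multiaffine_cellf(9),
      of id "face_d' ((2\<^sup>2 - 1) * (- 1 / 3)) (- \<delta>2) (2 * (- \<delta>1 / 2)) (- \<delta>3)" "- \<delta>1 / 2" "- \<delta>3" "- \<delta>2"])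
  show "four (face_d' ((2\<^sup>2 - 1) * (- 1 / 3)) (- \<delta>2) (2 * (- \<delta>1 / 2)) (- \<delta>3)) y = cellf (D4_1 \<delta>1 \<delta>2 \<delta>3) (\<lambda>v. y (id v))" for y
    by (simp add: four_def cellf_def face_d'_def D4_1_def algebra_simps)
qed (simp_all add: square_relabelling_def)

lemma consistent_D4_2: "consistent (pol (cellf (D4_2 \<delta>1 \<delta>2 \<delta>3)))"
proof (rule consistent_d[of 2 "- 1 / 3", OF _ _ _ multiaffine_cellf(10), of id "- \<delta>2" "- \<delta>3 / 2" "- \<delta>1"])
  show "four (face_d ((2\<^sup>2 - 1) * (- 1 / 3)) (- \<delta>2) (2 * (- \<delta>3 / 2)) (- \<delta>1)) y = cellf (D4_2 \<delta>1 \<delta>2 \<delta>3) (\<lambda>v. y (id v))" for y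
    by (simp add: four_def cellf_def face_d_def D4_2_def algebra_simps)
qed (simp_all add: square_relabelling_def)

section \<open>The six-tuples of the equations linear in one variable\<close>

definition face_g :: "complex \<Rightarrow> complex \<Rightarrow> complex \<Rightarrow> complex \<Rightarrow> complex \<Rightarrow> complex \<Rightarrow> complex \<Rightarrow> face" where
  "face_g e s \<rho> e' \<beta> \<delta> k x x1 x2 x12 = (x2 + e) * (s * x12 + e' + \<rho> * x1) + \<beta> * x + \<delta> * x1 + k"

definition face_ga :: "complex \<Rightarrow> complex \<Rightarrow> complex \<Rightarrow> face" where
  "face_ga e \<mu> \<delta> x x1 x2 x12 = (x12 + e) * (x + \<delta> * x2) + x1 + \<mu> * x2"

definition face_ga' :: "complex \<Rightarrow> complex \<Rightarrow> complex \<Rightarrow> complex \<Rightarrow> face" where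
  "face_ga' \<mu> k \<rho> d x x1 x2 x12 = x1 + \<mu> * x2 + k + (\<rho> * x + d) * x12"

definition face_gc' :: "complex \<Rightarrow> complex \<Rightarrow> complex \<Rightarrow> complex \<Rightarrow> face" where
  "face_gc' e s e' \<rho> x x1 x2 x12 = (x1 + e) * (s * x2 + e' + \<rho> * x) - x12"

definition face_gb' :: "complex \<Rightarrow> complex \<Rightarrow> complex \<Rightarrow> complex \<Rightarrow> face" where
  "face_gb' e \<rho> \<mu> \<delta> x x1 x2 x12 = (x1 + e) * (x2 + \<rho> * x) + x12 * (\<mu> + \<delta> * (x1 + e))"

definition face_k :: "complex \<Rightarrow> complex \<Rightarrow> complex \<Rightarrow> complex \<Rightarrow> face" where
  "face_k e f \<mu> \<delta> x x1 x2 x12 = x + \<delta> * x2 + (x12 + e) * (x1 - f + \<mu> * x2)"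

definition face_kb' :: "complex \<Rightarrow> complex \<Rightarrow> complex \<Rightarrow> complex \<Rightarrow> complex \<Rightarrow> face" where
  "face_kb' e f \<rho> \<mu> \<delta> x x1 x2 x12 = x2 + \<rho> * (x - f) - x12 * (\<mu> * (x1 + e) + \<delta>)"

definition face_kc' :: "complex \<Rightarrow> complex \<Rightarrow> complex \<Rightarrow> face" where
  "face_kc' e s \<rho> x x1 x2 x12 = s * x2 + \<rho> * x + (x1 + e) * x12"

lemma good_face_g: "good_face (face_g e s \<rho> e' \<beta> \<delta> k)" if "\<beta> \<noteq> 0" "s \<noteq> 0" "\<rho> \<noteq> 0"
  by (rule good_faceI[where p = "(1 - \<delta>) / \<rho> - e" and q = 0 and p' = "(1 - e') / \<rho>" and q' = 0 and p'' = 0 and q'' = "1 - e"])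
    (simp_all add: face_g_def that field_simps)

lemma good_face_ga:
  assumes "\<mu> \<noteq> 0" shows "good_face (face_ga e \<mu> \<delta>)"
proof -
  obtain t where t: "t * (\<delta> * t + \<mu>) \<noteq> 0" using nonzero_at_1_or_2[OF assms, of \<delta>] by blast
  have *: "face_ga e \<mu> \<delta> 1 0 0 (t - e) * face_ga e \<mu> \<delta> 0 0 1 (t - e)
      - face_ga e \<mu> \<delta> 1 0 1 (t - e) * face_ga e \<mu> \<delta> 0 0 0 (t - e) = t * (\<delta> * t + \<mu>)"
    by (simp add: face_ga_def algebra_simps)
  show ?thesis
    by (rule good_faceI[where p = 0 and q = "1 - e" and p' = 0 and q' = "t - e" and p'' = 1 and q'' = 0], unfold *,
        rule_tac [6] t) (simp_all add: face_ga_def algebra_simps)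
qed

lemma good_face_ga': "good_face (face_ga' \<mu> k \<rho> d)" if "\<mu> \<noteq> 0" "\<rho> \<noteq> 0"
  by (rule good_faceI[where p = 0 and q = 1 and p' = 0 and q' = 1 and p'' = "1 - k" and q'' = 0])
    (simp_all add: face_ga'_def that algebra_simps)

lemma good_face_gc': "good_face (face_gc' e s e' \<rho>)" if "s \<noteq> 0" "\<rho> \<noteq> 0"
  by (rule good_faceI[where p = 0 and q = 1 and p' = "1 - e" and q' = 0 and p'' = "1 - e" and q'' = 0])
    (simp_all add: face_gc'_def that algebra_simps)

lemma good_face_gb':
  assumes "\<mu> \<noteq> 0" "\<rho> \<noteq> 0" shows "good_face (face_gb' e \<rho> \<mu> \<delta>)"
proof -
  obtain t where t: "t * (\<delta> * t + \<mu>) \<noteq> 0" using nonzero_at_1_or_2[OF assms(1), of \<delta>] by blast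
  have *: "face_gb' e \<rho> \<mu> \<delta> 1 (t - e) 0 0 * face_gb' e \<rho> \<mu> \<delta> 0 (t - e) 0 1
      - face_gb' e \<rho> \<mu> \<delta> 1 (t - e) 0 1 * face_gb' e \<rho> \<mu> \<delta> 0 (t - e) 0 0 = \<rho> * (t * (\<delta> * t + \<mu>))"
    by (simp add: face_gb'_def algebra_simps)
  have "\<rho> * (t * (\<delta> * t + \<mu>)) \<noteq> 0" using t assms(2) by (metis mult_eq_0_iff)
  note ne = this
  show ?thesis
    by (rule good_faceI[where p = 0 and q = 1 and p' = "1 - e" and q' = 0 and p'' = "t - e" and q'' = 0], unfold *,
        rule_tac [7] ne) (simp_all add: face_gb'_def assms algebra_simps)
qed

lemma good_face_k: "good_face (face_k e f \<mu> \<delta>)" if "\<mu> \<noteq> 0"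
  by (rule good_faceI[where p = 0 and q = "1 - e" and p' = f and q' = "(1 - \<delta>) / \<mu> - e" and p'' = "f + 1" and q'' = 0])
    (simp_all add: face_k_def that field_simps)

lemma good_face_kb': "good_face (face_kb' e f \<rho> \<mu> \<delta>)" if "\<mu> \<noteq> 0" "\<rho> \<noteq> 0"
  by (rule good_faceI[where p = 0 and q = 1 and p' = 0 and q' = 0 and p'' = "(1 - \<delta>) / \<mu> - e" and q'' = 0])
    (simp_all add: face_kb'_def that field_simps)

lemma good_face_kc': "good_face (face_kc' e s \<rho>)" if "s \<noteq> 0" "\<rho> \<noteq> 0"
  by (rule good_faceI[where p = 0 and q = 1 and p' = 0 and q' = 0 and p'' = "1 - e" and q'' = 0])
    (simp_all add: face_kc'_def that algebra_simps)

text \<open>In the quantities \<open>W = x12 + e\<close>, \<open>q = s x23 + e23 + \<rho> x2\<close>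
  and \<open>t = x13 + \<rho> x1\<close> the lower faces become
  \<open>W (x + \<delta> x2) = - (x1 + \<mu> x2)\<close>,
  \<open>(x3 + e3) q = - (x + \<delta> x2)\<close> and
  \<open>(x3 + e3) t = \<mu> x - \<delta> x1\<close>. In the product \<open>W q\<close>, which is
  \<open>x123\<close>, the factor with \<open>x\<close> cancels.\<close>

lemma consistent_g:
  assumes nz: "\<mu> \<noteq> 0" "\<rho> \<noteq> 0" "s \<noteq> 0" and f: "multiaffine f" and \<sigma>: "square_relabelling \<sigma>"
    and R: "R \<in> {face_ga e \<mu> \<delta>, face_g e3 s \<rho> e23 1 \<delta> 0}" and rel: "\<And>y. four R y = f (\<lambda>v. y (\<sigma> v))"
  shows "consistent (pol f)"
proof -
  let ?a = "face_ga e \<mu> \<delta>" and ?b = "face_g e3 s \<rho> e23 1 \<delta> 0" and ?c = "face_g e3 1 \<rho> 0 (- \<mu>) \<delta> 0"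
    and ?a' = "face_ga' (\<mu> * s) (\<mu> * e23) \<rho> (\<rho> * e3 + \<delta>)" and ?b' = "face_gb' e \<rho> \<mu> \<delta>" and ?c' = "face_gc' e s e23 \<rho>"
  let ?gs = "[\<lambda>z. z X + \<delta> * z X2, \<lambda>z. z X12 + e3, \<lambda>z. \<rho> * (z X12 + e3) + \<delta>, \<lambda>z. \<mu> * z X - \<delta> * z X1]"
  show ?thesis
  proof (rule consistentI[where a = ?a and a' = ?a' and b = ?b and b' = ?b' and c = ?c and c' = ?c' and gs = ?gs
        and h = "\<lambda>x1 x2 x3. (x1 + \<mu> * x2) / (x3 + e3)", OF _ _ _ _ _ _ _ _ f \<sigma> _ rel])
    have w1: "\<exists>z. z X + \<delta> * z X2 \<noteq> 0" by (rule exI[of _ "pack 1 0 0 0"]) simp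
    have w2: "\<exists>z. z X12 + e3 \<noteq> 0" by (rule exI[of _ "pack 0 0 0 (1 - e3)"]) simp
    have w3: "\<exists>z. \<rho> * (z X12 + e3) + \<delta> \<noteq> 0" by (rule exI[of _ "pack 0 0 0 ((1 - \<delta>) / \<rho> - e3)"]) (simp add: nz)
    have w4: "\<exists>z. \<mu> * z X - \<delta> * z X1 \<noteq> 0" by (rule exI[of _ "pack 1 0 0 0"]) (simp add: nz)
    show "list_all (\<lambda>g. polyfun g \<and> (\<exists>z. g z \<noteq> 0)) ?gs"
      unfolding list.pred_inject by (intro conjI list.pred_inject(1) w1 w2 w3 w4 polyfun_intros)
  next
    fix x x1 x2 x3
    assume "list_all (\<lambda>g. g (pack x x1 x2 x3) \<noteq> 0) ?gs"
    then have g: "x + \<delta> * x2 \<noteq> 0" "x3 + e3 \<noteq> 0" "\<rho> * (x3 + e3) + \<delta> \<noteq> 0" "\<mu> * x - \<delta> * x1 \<noteq> 0"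
      unfolding list.pred_inject pack_simps by blast+
    obtain W where W: "(x + \<delta> * x2) * W = - (x1 + \<mu> * x2)" using solve_linear[OF g(1)] by blast
    obtain t where t: "(x3 + e3) * t = \<mu> * x - \<delta> * x1" using solve_linear[OF g(2)] by blast
    obtain q where q: "(x3 + e3) * q = - (x + \<delta> * x2)" using solve_linear[OF g(2)] by blast
    define w where "w = (x1 + \<mu> * x2) / (x3 + e3)"
    have w: "(x3 + e3) * w = x1 + \<mu> * x2" using g(2) by (simp add: w_def)
    have "(x3 + e3) * (W * q - w) = 0" using W q w by algebra
    then have ec: "W * q - w = 0" using g(2) by (simp only: mult_eq_0_iff simp_thms)
    have "(x3 + e3) * (W * t + w * (\<mu> + \<delta> * W)) = 0" using W t w by algebra
    then have eb: "W * t + w * (\<mu> + \<delta> * W) = 0" using g(2) by (simp only: mult_eq_0_iff simp_thms)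
    have "(x3 + e3) * (t + \<mu> * q + \<delta> * w) = 0" using t q w by algebra
    then have ea: "t + \<mu> * q + \<delta> * w = 0" using g(2) by (simp only: mult_eq_0_iff simp_thms)
    have "(x + \<delta> * x2) * (\<mu> + \<delta> * W) = \<mu> * x - \<delta> * x1" using W by algebra
    then have lb: "\<mu> + \<delta> * W \<noteq> 0" using g(4) by auto
    define v where "v = (q - e23 - \<rho> * x2) / s"
    have v: "s * v + e23 + \<rho> * x2 = q" using nz(3) by (simp add: v_def)
    show "\<exists>x12 x13 x23. solves ?a x x1 x2 x12 \<and> solves ?b x x2 x3 x23 \<and> solves ?c x x1 x3 x13 \<and>
      solves ?a' x3 x13 x23 ((x1 + \<mu> * x2) / (x3 + e3)) \<and> solves ?b' x1 x12 x13 ((x1 + \<mu> * x2) / (x3 + e3)) \<and>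
      solves ?c' x2 x12 x23 ((x1 + \<mu> * x2) / (x3 + e3))"
      unfolding w_def[symmetric]
    proof (rule exI[of _ "W - e"], rule exI[of _ "t - \<rho> * x1"], rule exI[of _ v], intro conjI solvesI)
      show "?a x x1 x2 (W - e) = 0" using W by (simp add: face_ga_def algebra_simps)
      have "?a x x1 x2 1 - ?a x x1 x2 0 = x + \<delta> * x2" by (simp add: face_ga_def algebra_simps)
      then show "?a x x1 x2 1 - ?a x x1 x2 0 \<noteq> 0" using g(1) by simp
      show "?b x x2 x3 v = 0" unfolding face_g_def v using q by (simp add: algebra_simps)
      have "?b x x2 x3 1 - ?b x x2 x3 0 = (x3 + e3) * s" by (simp add: face_g_def algebra_simps)
      then show "?b x x2 x3 1 - ?b x x2 x3 0 \<noteq> 0" using g(2) nz(3) by simp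
      show "?c x x1 x3 (t - \<rho> * x1) = 0" using t by (simp add: face_g_def)
      have "?c x x1 x3 1 - ?c x x1 x3 0 = x3 + e3" by (simp add: face_g_def algebra_simps)
      then show "?c x x1 x3 1 - ?c x x1 x3 0 \<noteq> 0" using g(2) by simp
      have "?a' x3 (t - \<rho> * x1) v w = t - \<rho> * x1 + \<mu> * (s * v + e23) + (\<rho> * (x3 + e3) + \<delta>) * w"
        by (simp add: face_ga'_def algebra_simps)
      also have "\<dots> = 0" using ea v w by algebra
      finally show "?a' x3 (t - \<rho> * x1) v w = 0" .
      have "?a' x3 (t - \<rho> * x1) v 1 - ?a' x3 (t - \<rho> * x1) v 0 = \<rho> * (x3 + e3) + \<delta>" by (simp add: face_ga'_def algebra_simps)
      then show "?a' x3 (t - \<rho> * x1) v 1 - ?a' x3 (t - \<rho> * x1) v 0 \<noteq> 0" using g(3) by simp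
      show "?b' x1 (W - e) (t - \<rho> * x1) w = 0" using eb by (simp add: face_gb'_def)
      show "?b' x1 (W - e) (t - \<rho> * x1) 1 - ?b' x1 (W - e) (t - \<rho> * x1) 0 \<noteq> 0" using lb by (simp add: face_gb'_def)
      show "?c' x2 (W - e) v w = 0" unfolding face_gc'_def v using ec by simp
      show "?c' x2 (W - e) v 1 - ?c' x2 (W - e) v 0 \<noteq> 0" by (simp add: face_gc'_def)
    qed
  next
    show "R \<in> {?a, ?a', ?b, ?b', ?c, ?c'}" using R by blast
  qed (use nz in \<open>simp_all add: good_face_ga good_face_g good_face_ga' good_face_gb' good_face_gc'\<close>)
qed

text \<open>The variant of \<open>consistent_g\<close> with \<open>x12 + e\<close> replaced by its
  inverse: now \<open>W (x1 - k + \<mu> x2) = - (x + \<delta> x2)\<close>, and the factor with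
  \<open>x\<close> cancels in \<open>x123 = - q / W\<close>.\<close>

lemma consistent_k:
  assumes nz: "\<mu> \<noteq> 0" "\<rho> \<noteq> 0" "s \<noteq> 0" and f: "multiaffine f" and \<sigma>: "square_relabelling \<sigma>"
    and R: "R \<in> {face_k e k \<mu> \<delta>, face_kc' e s \<rho>}" and rel: "\<And>y. four R y = f (\<lambda>v. y (\<sigma> v))"
  shows "consistent (pol f)"
proof -
  let ?a = "face_k e k \<mu> \<delta>" and ?b = "face_g 0 s \<rho> 0 1 \<delta> 0" and ?c = "face_g 0 1 \<rho> (- \<rho> * k) (- \<mu>) \<delta> (- \<delta> * k)"
    and ?a' = "face_ga' (\<mu> * s) 0 (- \<rho>) (- \<delta>)" and ?b' = "face_kb' e k \<rho> \<mu> \<delta>" and ?c' = "face_kc' e s \<rho>"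
  let ?gs = "[\<lambda>z. z X1 - k + \<mu> * z X2, \<lambda>z. z X12, \<lambda>z. \<rho> * z X12 + \<delta>, \<lambda>z. \<delta> * (z X1 - k) - \<mu> * z X, \<lambda>z. z X + \<delta> * z X2]"
  show ?thesis
  proof (rule consistentI[where a = ?a and a' = ?a' and b = ?b and b' = ?b' and c = ?c and c' = ?c' and gs = ?gs
        and h = "\<lambda>x1 x2 x3. - (x1 - k + \<mu> * x2) / x3", OF _ _ _ _ _ _ _ _ f \<sigma> _ rel])
    have w1: "\<exists>z. z X1 - k + \<mu> * z X2 \<noteq> 0" by (rule exI[of _ "pack 0 (1 + k) 0 0"]) simp
    have w2: "\<exists>z :: vertex \<Rightarrow> complex. z X12 \<noteq> 0" by (rule exI[of _ "pack 0 0 0 1"]) simp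
    have w3: "\<exists>z. \<rho> * z X12 + \<delta> \<noteq> 0" by (rule exI[of _ "pack 0 0 0 ((1 - \<delta>) / \<rho>)"]) (simp add: nz)
    have w4: "\<exists>z. \<delta> * (z X1 - k) - \<mu> * z X \<noteq> 0" by (rule exI[of _ "pack 1 k 0 0"]) (simp add: nz)
    have w5: "\<exists>z. z X + \<delta> * z X2 \<noteq> 0" by (rule exI[of _ "pack 1 0 0 0"]) simp
    show "list_all (\<lambda>g. polyfun g \<and> (\<exists>z. g z \<noteq> 0)) ?gs"
      unfolding list.pred_inject by (intro conjI list.pred_inject(1) w1 w2 w3 w4 w5 polyfun_intros)
  next
    fix x x1 x2 x3
    assume "list_all (\<lambda>g. g (pack x x1 x2 x3) \<noteq> 0) ?gs"
    then have g: "x1 - k + \<mu> * x2 \<noteq> 0" "x3 \<noteq> 0" "\<rho> * x3 + \<delta> \<noteq> 0" "\<delta> * (x1 - k) - \<mu> * x \<noteq> 0" "x + \<delta> * x2 \<noteq> 0"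
      unfolding list.pred_inject pack_simps by blast+
    obtain W where W: "(x1 - k + \<mu> * x2) * W = - (x + \<delta> * x2)" using solve_linear[OF g(1)] by blast
    obtain t where t: "x3 * t = \<mu> * x - \<delta> * (x1 - k)" using solve_linear[OF g(2)] by blast
    obtain q where q: "x3 * q = - (x + \<delta> * x2)" using solve_linear[OF g(2)] by blast
    define w where "w = - (x1 - k + \<mu> * x2) / x3"
    have w: "x3 * w = - (x1 - k + \<mu> * x2)" using g(2) by (simp add: w_def)
    have "x3 * (q + W * w) = 0" using W q w by algebra
    then have ec: "q + W * w = 0" using g(2) by (simp only: mult_eq_0_iff simp_thms)
    have "x3 * (t - w * (\<mu> * W + \<delta>)) = 0" using W t w by algebra
    then have eb: "t - w * (\<mu> * W + \<delta>) = 0" using g(2) by (simp only: mult_eq_0_iff simp_thms)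
    have "x3 * (t + \<mu> * q - \<delta> * w) = 0" using t q w by algebra
    then have ea: "t + \<mu> * q - \<delta> * w = 0" using g(2) by (simp only: mult_eq_0_iff simp_thms)
    have "(x1 - k + \<mu> * x2) * (\<mu> * W + \<delta>) = \<delta> * (x1 - k) - \<mu> * x" using W by algebra
    then have lb: "\<mu> * W + \<delta> \<noteq> 0" using g(4) by auto
    have lc: "W \<noteq> 0" using W g(5) by (metis mult_zero_right neg_equal_0_iff_equal)
    define v where "v = (q - \<rho> * x2) / s"
    have v: "s * v + \<rho> * x2 = q" using nz(3) by (simp add: v_def)
    show "\<exists>x12 x13 x23. solves ?a x x1 x2 x12 \<and> solves ?b x x2 x3 x23 \<and> solves ?c x x1 x3 x13 \<and>
      solves ?a' x3 x13 x23 (- (x1 - k + \<mu> * x2) / x3) \<and> solves ?b' x1 x12 x13 (- (x1 - k + \<mu> * x2) / x3) \<and>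
      solves ?c' x2 x12 x23 (- (x1 - k + \<mu> * x2) / x3)"
      unfolding w_def[symmetric]
    proof (rule exI[of _ "W - e"], rule exI[of _ "t - \<rho> * (x1 - k)"], rule exI[of _ v], intro conjI solvesI)
      show "?a x x1 x2 (W - e) = 0" using W by (simp add: face_k_def mult.commute)
      have "?a x x1 x2 1 - ?a x x1 x2 0 = x1 - k + \<mu> * x2" by (simp add: face_k_def algebra_simps)
      then show "?a x x1 x2 1 - ?a x x1 x2 0 \<noteq> 0" using g(1) by simp
      have "?b x x2 x3 v = x3 * (s * v + \<rho> * x2) + x + \<delta> * x2" by (simp add: face_g_def)
      then show "?b x x2 x3 v = 0" unfolding v q by simp
      have "?b x x2 x3 1 - ?b x x2 x3 0 = x3 * s" by (simp add: face_g_def algebra_simps)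
      then show "?b x x2 x3 1 - ?b x x2 x3 0 \<noteq> 0" using g(2) nz(3) by simp
      have "?c x x1 x3 (t - \<rho> * (x1 - k)) = x3 * t - (\<mu> * x - \<delta> * (x1 - k))" by (simp add: face_g_def algebra_simps)
      then show "?c x x1 x3 (t - \<rho> * (x1 - k)) = 0" unfolding t by simp
      have "?c x x1 x3 1 - ?c x x1 x3 0 = x3" by (simp add: face_g_def algebra_simps)
      then show "?c x x1 x3 1 - ?c x x1 x3 0 \<noteq> 0" using g(2) by simp
      have "?a' x3 (t - \<rho> * (x1 - k)) v w = t - \<rho> * (x1 - k) + \<mu> * (s * v) - (\<rho> * x3 + \<delta>) * w"
        by (simp add: face_ga'_def algebra_simps)
      also have "\<dots> = 0" using ea v w by algebra
      finally show "?a' x3 (t - \<rho> * (x1 - k)) v w = 0" .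
      have "?a' x3 (t - \<rho> * (x1 - k)) v 1 - ?a' x3 (t - \<rho> * (x1 - k)) v 0 = - (\<rho> * x3 + \<delta>)"
        by (simp add: face_ga'_def algebra_simps)
      then show "?a' x3 (t - \<rho> * (x1 - k)) v 1 - ?a' x3 (t - \<rho> * (x1 - k)) v 0 \<noteq> 0"
        using g(3) by (simp only: neg_equal_0_iff_equal simp_thms not_False_eq_True)
      show "?b' x1 (W - e) (t - \<rho> * (x1 - k)) w = 0" using eb by (simp add: face_kb'_def)
      have "?b' x1 (W - e) (t - \<rho> * (x1 - k)) 1 - ?b' x1 (W - e) (t - \<rho> * (x1 - k)) 0 = - (\<mu> * W + \<delta>)"
        by (simp add: face_kb'_def)
      then show "?b' x1 (W - e) (t - \<rho> * (x1 - k)) 1 - ?b' x1 (W - e) (t - \<rho> * (x1 - k)) 0 \<noteq> 0"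
        using lb by (simp only: neg_equal_0_iff_equal simp_thms not_False_eq_True)
      show "?c' x2 (W - e) v w = 0" unfolding face_kc'_def v using ec by simp
      show "?c' x2 (W - e) v 1 - ?c' x2 (W - e) v 0 \<noteq> 0" using lc by (simp add: face_kc'_def)
    qed
  next
    show "R \<in> {?a, ?a', ?b, ?b', ?c, ?c'}" using R by blast
  qed (use nz in \<open>simp_all add: good_face_k good_face_g good_face_ga' good_face_kb' good_face_kc'\<close>)
qed

text \<open>The equation is a face \<open>a\<close> of \<open>consistent_g\<close> with
  \<open>\<mu> = 1 - \<delta>1 - \<delta>1 \<delta>2\<close>, provided this is nonzero. If it
  vanishes, then \<open>\<delta>1\<close> is nonzero and, relabelled, the polynomial becomes
  \<open>x + (x2 + \<delta>2) (x1 + \<delta>1 x12)\<close>, a face \<open>b\<close>.\<close>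

lemma consistent_D2_1: "consistent (pol (cellf (D2_1 \<delta>1 \<delta>2)))"
proof (cases "1 - \<delta>1 - \<delta>1 * \<delta>2 = 0")
  case False
  show ?thesis
  proof (rule consistent_g[OF False one_neq_zero one_neq_zero multiaffine_cellf(5), of id "face_ga \<delta>2 (1 - \<delta>1 - \<delta>1 * \<delta>2) \<delta>1"])
    show "four (face_ga \<delta>2 (1 - \<delta>1 - \<delta>1 * \<delta>2) \<delta>1) y = cellf (D2_1 \<delta>1 \<delta>2) (\<lambda>v. y (id v))" for y
      by (simp add: four_def cellf_def face_ga_def D2_1_def algebra_simps)
    show "face_ga \<delta>2 (1 - \<delta>1 - \<delta>1 * \<delta>2) \<delta>1 \<in> {face_ga \<delta>2 (1 - \<delta>1 - \<delta>1 * \<delta>2) \<delta>1, face_g 0 1 1 0 1 \<delta>1 0}" by simp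
  qed (simp add: square_relabelling_def)
next
  case True
  then have d: "\<delta>1 \<noteq> 0" "1 - \<delta>1 = \<delta>1 * \<delta>2" by (auto simp: algebra_simps)
  let ?r = "face_g \<delta>2 \<delta>1 1 0 1 0 0"
  show ?thesis
  proof (rule consistent_g[OF one_neq_zero one_neq_zero d(1) multiaffine_cellf(5), of "pack X1 X X12 X2" ?r])
    show "four ?r y = cellf (D2_1 \<delta>1 \<delta>2) (\<lambda>v. y (pack X1 X X12 X2 v))" for y
    proof -
      have "four ?r y = cellf (D2_1 \<delta>1 \<delta>2) (\<lambda>v. y (pack X1 X X12 X2 v)) - (1 - \<delta>1 - \<delta>1 * \<delta>2) * y X12"
        by (simp add: four_def cellf_def face_g_def D2_1_def algebra_simps)
      then show ?thesis unfolding True by simp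
    qed
    show "?r \<in> {face_ga 0 1 0, ?r}" by simp
  qed (simp add: square_relabelling_pack insert_commute)
qed

lemma consistent_D2_2_0: "consistent (pol (cellf (D2_2 0 \<delta>2 lam)))"
proof (rule consistent_k[OF one_neq_zero one_neq_zero one_neq_zero multiaffine_cellf(6), of "pack X12 X1 X2 X" "face_kc' \<delta>2 1 1"])
  show "four (face_kc' \<delta>2 1 1) y = cellf (D2_2 0 \<delta>2 lam) (\<lambda>v. y (pack X12 X1 X2 X v))" for y
    by (simp add: four_def cellf_def face_kc'_def D2_2_def algebra_simps)
  show "face_kc' \<delta>2 1 1 \<in> {face_k \<delta>2 0 1 0, face_kc' \<delta>2 1 1}" by simp
qed (simp add: square_relabelling_pack insert_commute)

lemma consistent_D2_2: "consistent (pol (cellf (D2_2 \<delta>1 \<delta>2 lam)))"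
proof (cases "\<delta>1 = 0")
  case True
  then show ?thesis using consistent_D2_2_0 by simp
next
  case False
  let ?r = "face_g \<delta>2 1 \<delta>1 (- \<delta>1 * lam) 1 (1 - \<delta>1 - \<delta>1 * \<delta>2) 0"
  show ?thesis
  proof (rule consistent_g[OF one_neq_zero False one_neq_zero multiaffine_cellf(6), of "pack X12 X2 X1 X" ?r])
    show "four ?r y = cellf (D2_2 \<delta>1 \<delta>2 lam) (\<lambda>v. y (pack X12 X2 X1 X v))" for y
      by (simp add: four_def cellf_def face_g_def D2_2_def algebra_simps)
    show "?r \<in> {face_ga 0 1 (1 - \<delta>1 - \<delta>1 * \<delta>2), ?r}" by simp
  qed (simp add: square_relabelling_pack insert_commute)
qed

lemma consistent_D2_3: "consistent (pol (cellf (D2_3 \<delta>1 \<delta>2 lam)))"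
proof (cases "\<delta>1 = 0")
  case True
  have "D2_3 0 \<delta>2 lam = D2_2 0 \<delta>2 lam" by (simp add: D2_2_def D2_3_def fun_eq_iff)
  then show ?thesis using consistent_D2_2_0 True by simp
next
  case False
  let ?r = "face_k \<delta>2 (\<delta>1 * lam) \<delta>1 (1 - \<delta>1 - \<delta>1 * \<delta>2)"
  show ?thesis
  proof (rule consistent_k[OF False one_neq_zero one_neq_zero multiaffine_cellf(7), of "pack X1 X12 X X2" ?r])
    show "four ?r y = cellf (D2_3 \<delta>1 \<delta>2 lam) (\<lambda>v. y (pack X1 X12 X X2 v))" for y
      by (simp add: four_def cellf_def face_k_def D2_3_def algebra_simps)
    show "?r \<in> {?r, face_kc' \<delta>2 1 1}" by simp
  qed (simp add: square_relabelling_pack insert_commute)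
qed

section \<open>The six-tuple of the linear equation\<close>

definition face_l :: "complex \<Rightarrow> complex \<Rightarrow> complex \<Rightarrow> face" where
  "face_l a b c x x1 x2 x12 = x12 + a * x + b * x1 + c * x2"

lemma good_face_l: "good_face (face_l a b c)" if "a \<noteq> 0" "b \<noteq> 0" "c \<noteq> 0"
  by (rule good_faceI[where p = 0 and q = 0 and p' = 0 and q' = 0 and p'' = 0 and q'' = 0])
    (simp_all add: face_l_def that algebra_simps)

text \<open>Six copies of the equation itself would give \<open>x123 = 2 x + x1 + x2 + x3\<close>;
  the signs on the other five faces are chosen so that \<open>x\<close> cancels.\<close>

lemma consistent_D1: "consistent (pol (cellf D1))"
proof (rule consistentI[where a = "face_l 1 1 1" and a' = "face_l (- 1) 1 (- 1)" and b = "face_l (- 1) 1 (- 1)"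
      and b' = "face_l 1 (- 1) (- 1)" and c = "face_l (- 1) (- 1) (- 1)" and c' = "face_l (- 1) (- 1) (- 1)"
      and gs = "[]" and h = "\<lambda>x1 x2 x3. x3 - x1 - x2" and \<sigma> = id and r = "face_l 1 1 1", OF _ _ _ _ _ _ _ _ multiaffine_cellf(4)])
  fix x x1 x2 x3 :: complex
  show "\<exists>x12 x13 x23. solves (face_l 1 1 1) x x1 x2 x12 \<and> solves (face_l (- 1) 1 (- 1)) x x2 x3 x23 \<and>
    solves (face_l (- 1) (- 1) (- 1)) x x1 x3 x13 \<and> solves (face_l (- 1) 1 (- 1)) x3 x13 x23 (x3 - x1 - x2) \<and>
    solves (face_l 1 (- 1) (- 1)) x1 x12 x13 (x3 - x1 - x2) \<and> solves (face_l (- 1) (- 1) (- 1)) x2 x12 x23 (x3 - x1 - x2)"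
    by (rule exI[of _ "- x - x1 - x2"], rule exI[of _ "x + x1 + x3"], rule exI[of _ "x - x2 + x3"])
      (simp add: solves_def face_l_def)
  show "four (face_l 1 1 1) y = cellf D1 (\<lambda>v. y (id v))" for y by (simp add: four_def cellf_def face_l_def D1_def)
qed (simp_all add: good_face_l square_relabelling_def)

text \<open>The face \<open>R\<close> that witnesses consistency is a relabelled copy of the
  polynomial; nondegeneracy of its form is carried back along the relabelling.\<close>

lemma consistent_quad_equation:
  assumes f: "multiaffine f" and c: "consistent (pol f)"
  shows "quad_equation (pol f)"
proof -
  obtain \<sigma> R where \<sigma>: "square_relabelling \<sigma>" and r: "relabelled \<sigma> (pol f) R" and q: "quad_equation R"
    using c unfolding consistent_def by blast
  have b: "bij \<sigma>" using \<sigma> by (simp add: square_relabelling_def)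
  have d: "degree_le v 1 R" for v using q by (simp add: quad_equation_def)
  let ?g = "evv R"
  have g: "multiaffine ?g" by (rule multiaffine_evv[OF d])
  have e: "?g y = f (\<lambda>v. y (\<sigma> v))" for y
    using r[unfolded relabelled_def, THEN spec[of _ y]] pack_eta[of "\<lambda>v. y (\<sigma> v)"]
    by (simp add: ev_eq_evv evv_pol[OF f])
  have "hom ?g = (\<lambda>y. hom f (\<lambda>v. y (\<sigma> v)))"
  proof (rule multilin_eqI')
    have "geqv_by \<sigma> (\<lambda>_. (1, 0, 0, 1)) 1 (hom f) (\<lambda>y. hom f (\<lambda>v. y (\<sigma> v)))"
      unfolding geqv_by_def using b by (simp add: act_id del: act.simps)
    then show "multilin (\<lambda>y. hom f (\<lambda>v. y (\<sigma> v)))" by (rule multilin_geqv_by[OF multilin_hom])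
    show "hom ?g (aff z) = hom f (\<lambda>v. aff z (\<sigma> v))" for z
    proof -
      have "(\<lambda>v. aff z (\<sigma> v)) = aff (\<lambda>v. z (\<sigma> v))" by (simp add: aff_def fun_eq_iff)
      then show ?thesis by (simp only: hom_aff[OF g] hom_aff[OF f] e)
    qed
  qed (rule multilin_hom)
  then have ge: "geqv_by \<sigma> (\<lambda>_. (1, 0, 0, 1)) 1 (hom f) (hom ?g)"
    unfolding geqv_by_def using b by (simp add: act_id del: act.simps)
  have nd: "nondeg (hom ?g)" using quad_equation_pol_iff[OF g] q unfolding pol_evv[OF d] by blast
  have "nondeg (hom f)"
    unfolding nondeg_def
  proof (intro allI impI)
    fix m n :: vertex assume mn: "m \<noteq> n"
    then have "\<sigma> m \<noteq> \<sigma> n" using b by (simp add: bij_def inj_eq)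
    then obtain y where "tdet (\<sigma> m) (\<sigma> n) (hom ?g) y \<noteq> 0" using nd unfolding nondeg_def by blast
    then show "\<exists>y. tdet m n (hom f) y \<noteq> 0"
      unfolding tdet_geqv_by[OF multilin_hom ge mn] by (metis mult_zero_right)
  qed
  then show ?thesis using quad_equation_pol_iff[OF f] by blast
qed

text \<open>Both factors vanish at the origin, so neither is a unit.\<close>

lemma reducible_product:
  assumes "irreducible Q" and ev: "\<And>x x1 x2 x12. ev Q x x1 x2 x12 = (x + a * x1) * (c * (x2 + b * x12))"
  shows False
proof -
  have "polyfun (\<lambda>z. z X + a * z X1)" "polyfun (\<lambda>z. c * (z X2 + b * z X12))" by (intro polyfun_intros)+
  then obtain A B where AB: "\<And>z. evv A z = z X + a * z X1" "\<And>z. evv B z = c * (z X2 + b * z X12)"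
    unfolding polyfun_def by metis
  have "evv Q z = evv (A * B) z" for z by (simp add: AB) (simp add: evv_def ev)
  then have "Q = A * B" by (rule evv_inject)
  moreover have "\<not> P dvd 1" if P: "evv P (\<lambda>_. 0) = 0" for P
  proof
    assume "P dvd 1"
    then obtain R where "1 = P * R" by (rule dvdE)
    then have "evv (P * R) (\<lambda>_. 0) = 1" by (metis evv_simps(2))
    then show False by (simp add: P)
  qed
  ultimately show False using irreducibleD[OF assms(1), of A B] AB by simp
qed

section \<open>Types of the representatives\<close>

lemma tdet_NF:
  "tdet X X1 (NF d b c) y = bl d (y X2) (y X12) * bl b (y X2) (y X12)"
  "tdet X2 X12 (NF (d3, d1, d2, d0) (b3, b1, b2, b0) (c3, c1, c2, c0)) (pack (x, s) (x1, t) q r) =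
    (x * t * d1 + s * x1 * b1 + s * t * c1) * (x * t * d2 + s * x1 * b2 + s * t * c2)
    - (x * t * d3 + s * x1 * b3 + s * t * c3) * (x * t * d0 + s * x1 * b0 + s * t * c0)"
  by (simp_all add: tdet_def NF_def algebra_simps)

lemma nonzero_linear_forms:
  fixes a b c d :: complex
  assumes "a \<noteq> 0 \<or> b \<noteq> 0" "c \<noteq> 0 \<or> d \<noteq> 0"
  shows "\<exists>s t. (a * s + b * t) * (c * s + d * t) \<noteq> 0"
proof (rule ccontr)
  assume "\<not> ?thesis"
  then have z: "(a * s + b * t) * (c * s + d * t) = 0" for s t by blast
  show False using assms z[of 1 0] z[of 0 1] z[of 1 1] z[of 1 "-1"] by (auto simp: mult_eq_0_iff)
qed

text \<open>A root at \<open>X\<close> must be infinite, since with \<open>x1\<close> at infinity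
  the determinant in \<open>X2\<close>, \<open>X12\<close> is \<open>s^2\<close> times that of
  \<open>b\<close>; at the infinite point the determinant of \<open>d\<close> appears. A root at
  \<open>X1\<close> is excluded symmetrically. The determinant in \<open>X\<close>,
  \<open>X1\<close> is the product of the bilinear forms \<open>d\<close> and \<open>b\<close>, and
  a root at \<open>X2\<close> or \<open>X12\<close> would be a kernel vector of one of them.\<close>

lemma NF_not_hdeg:
  fixes c0 c1 c2 c3 :: complex
  assumes d: "d1 * d2 - d3 * d0 \<noteq> 0" and b: "b1 * b2 - b3 * b0 \<noteq> 0"
  defines "N \<equiv> NF (d3, d1, d2, d0) (b3, b1, b2, b0) (c3, c1, c2, c0)"
  shows "\<not> hdeg X X1 N" "\<not> hdeg X2 X12 N"
proof -
  have h: "distinct [X, X1, X2, X12]" "distinct [X2, X12, X, X1]" by simp_all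
  have e: "tdet X2 X12 N (pack (x, s) (x1, t) q r) =
    (x * t * d1 + s * x1 * b1 + s * t * c1) * (x * t * d2 + s * x1 * b2 + s * t * c2)
    - (x * t * d3 + s * x1 * b3 + s * t * c3) * (x * t * d0 + s * x1 * b0 + s * t * c0)" for x s x1 t q r
    unfolding N_def by (rule tdet_NF)
  show "\<not> hdeg X X1 N"
  proof
    assume "hdeg X X1 N"
    then obtain k x s where k: "k \<in> {X, X1}" "(x, s) \<noteq> (0, 0)" and z: "\<And>y. y k = (x, s) \<Longrightarrow> tdet X2 X12 N y = 0"
      unfolding hdeg_iff[OF h(1)] by auto
    let ?i = "(0, 1) :: hpoint"
    show False
    proof (cases "k = X")
      case True
      have "tdet X2 X12 N (pack (x, s) (1, 0) ?i ?i) = 0" "tdet X2 X12 N (pack (x, s) (0, 1) ?i ?i) = 0"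
        by (rule z, simp add: True)+
      moreover have "tdet X2 X12 N (pack (x, s) (1, 0) ?i ?i) = s\<^sup>2 * (b1 * b2 - b3 * b0)"
        unfolding e by (simp add: algebra_simps power2_eq_square)
      ultimately have "s = 0" "tdet X2 X12 N (pack (x, s) (0, 1) ?i ?i) = 0" using b by simp_all
      then have "x\<^sup>2 * (d1 * d2 - d3 * d0) = 0" unfolding e by (simp add: algebra_simps power2_eq_square)
      then show False using d k(2) \<open>s = 0\<close> by simp
    next
      case False
      then have k1: "k = X1" using k(1) by simp
      have "tdet X2 X12 N (pack (1, 0) (x, s) ?i ?i) = 0" "tdet X2 X12 N (pack (0, 1) (x, s) ?i ?i) = 0"
        by (rule z, simp add: k1)+
      moreover have "tdet X2 X12 N (pack (1, 0) (x, s) ?i ?i) = s\<^sup>2 * (d1 * d2 - d3 * d0)"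
        unfolding e by (simp add: algebra_simps power2_eq_square)
      ultimately have "s = 0" "tdet X2 X12 N (pack (0, 1) (x, s) ?i ?i) = 0" using d by simp_all
      then have "x\<^sup>2 * (b1 * b2 - b3 * b0) = 0" unfolding e by (simp add: algebra_simps power2_eq_square)
      then show False using b k(2) \<open>s = 0\<close> by simp
    qed
  qed
  have inv: "a1 * q1 + a2 * q2 \<noteq> 0 \<or> a3 * q1 + a4 * q2 \<noteq> 0"
    if "a1 * a4 \<noteq> a2 * a3" "(q1, q2) \<noteq> (0, 0)" for a1 a2 a3 a4 q1 q2 :: complex
  proof (rule ccontr)
    assume "\<not> ?thesis"
    then have "(a1 * a4 - a2 * a3) * q1 = 0" "(a1 * a4 - a2 * a3) * q2 = 0" by algebra+
    then show False using that by simp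
  qed
  show "\<not> hdeg X2 X12 N"
  proof
    assume "hdeg X2 X12 N"
    then obtain k q1 q2 where k: "k \<in> {X2, X12}" "(q1, q2) \<noteq> (0, 0)"
      and z: "\<And>y. y k = (q1, q2) \<Longrightarrow> tdet X X1 N y = 0"
      unfolding hdeg_iff[OF h(2)] by auto
    let ?i = "(0, 1) :: hpoint"
    show False
    proof (cases "k = X2")
      case True
      have "d3 * q1 + d2 * q2 \<noteq> 0 \<or> d1 * q1 + d0 * q2 \<noteq> 0" "b3 * q1 + b2 * q2 \<noteq> 0 \<or> b1 * q1 + b0 * q2 \<noteq> 0"
        by (rule inv[OF _ k(2)]; use d b in \<open>simp add: mult.commute\<close>)+
      from nonzero_linear_forms[OF this] obtain s t where
        st: "((d3 * q1 + d2 * q2) * s + (d1 * q1 + d0 * q2) * t) * ((b3 * q1 + b2 * q2) * s + (b1 * q1 + b0 * q2) * t) \<noteq> 0"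
        by blast
      have "tdet X X1 N (pack ?i ?i (q1, q2) (s, t)) = 0" by (rule z) (simp add: True)
      then show False using st unfolding N_def tdet_NF by (simp add: algebra_simps)
    next
      case False
      then have k1: "k = X12" using k(1) by simp
      have "d3 * q1 + d1 * q2 \<noteq> 0 \<or> d2 * q1 + d0 * q2 \<noteq> 0" "b3 * q1 + b1 * q2 \<noteq> 0 \<or> b2 * q1 + b0 * q2 \<noteq> 0"
        by (rule inv[OF _ k(2)]; use d b in \<open>simp add: mult.commute\<close>)+
      from nonzero_linear_forms[OF this] obtain s t where
        st: "((d3 * q1 + d1 * q2) * s + (d2 * q1 + d0 * q2) * t) * ((b3 * q1 + b1 * q2) * s + (b2 * q1 + b0 * q2) * t) \<noteq> 0"
        by blast
      have "tdet X X1 N (pack ?i ?i (s, t) (q1, q2)) = 0" by (rule z) (simp add: k1)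
      then show False using st unfolding N_def tdet_NF by (simp add: algebra_simps)
    qed
  qed
qed

lemma trapezoidal_NF:
  assumes f: "multiaffine f" "hom f = NF (d3, d1, d2, d0) (b3, b1, b2, b0) (c3, c1, c2, c0)"
    and d: "d1 * d2 - d3 * d0 \<noteq> 0" and b: "b1 * b2 - b3 * b0 \<noteq> 0"
  shows "trapezoidal_H4 (pol f)" "\<not> hdeg X X1 (hom f)"
proof -
  have n: "null_pair (hom f) X (1, 0) X1 (1, 0)" unfolding f(2) null_pair_def NF_def by simp
  have "type_H4 (pol f) \<and> nondegenerate_pairs (pol f) = {{X, X1}, {X2, X12}}"
    by (rule type_H4_pol[OF f(1) n]) (simp_all add: f(2) NF_not_hdeg[OF d b])
  then show "trapezoidal_H4 (pol f)" by (simp add: trapezoidal_H4_def)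
  show "\<not> hdeg X X1 (hom f)" unfolding f(2) by (rule NF_not_hdeg[OF d b])
qed

lemma trapezoidal_tH:
  "trapezoidal_H4 (pol (cellf (tH1 \<alpha> \<epsilon>)))" "\<not> hdeg X X1 (hom (cellf (tH1 \<alpha> \<epsilon>)))"
  "trapezoidal_H4 (pol (cellf (tH2 \<alpha> \<beta> \<epsilon>)))" "\<not> hdeg X X1 (hom (cellf (tH2 \<alpha> \<beta> \<epsilon>)))"
  "\<alpha> \<noteq> 0 \<Longrightarrow> trapezoidal_H4 (pol (cellf (tH3 \<alpha> \<beta> \<delta> \<epsilon>)))" "\<alpha> \<noteq> 0 \<Longrightarrow> \<not> hdeg X X1 (hom (cellf (tH3 \<alpha> \<beta> \<delta> \<epsilon>)))"
  by ((rule trapezoidal_NF[OF multiaffine_cellf(1) hom_tH1] trapezoidal_NF[OF multiaffine_cellf(2) hom_tH2]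
      trapezoidal_NF[OF multiaffine_cellf(3) hom_tH3]; simp); fail)+

text \<open>Every pair of distinct vertices joins an end of one of these null pairs to a vertex
  outside it, so \<open>null_pair_hdeg\<close> applies.\<close>

lemma all_hdegI:
  assumes T: "multilin T" and n: "\<And>w. w \<noteq> v \<Longrightarrow> null_pair T v p w (q w)" and ij: "i \<noteq> j"
  shows "hdeg i j T"
proof -
  have v: "hdeg v k T" if "k \<noteq> v" for k
  proof -
    obtain w where "w \<noteq> v" "w \<noteq> k" by (cases v; cases k) auto
    then show ?thesis using null_pair_hdeg(1)[OF T n, of w k] that by simp
  qed
  show ?thesis
  proof (cases "i = v \<or> j = v")
    case True
    then show ?thesis using v ij hdeg_commute by metis
  next
    case False
    then show ?thesis using null_pair_hdeg(2)[OF T n, of i j] ij by simp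
  qed
qed

text \<open>Each polynomial has a variable that occurs in a single term; with this variable at
  infinity the form is a product of linear forms, whose roots at the other vertices complete the
  null pairs. For \<open>D4_1\<close> that term is \<open>x x12\<close> and for \<open>D4_2\<close>
  it is \<open>x x1\<close>, whence the root \<open>(0, 1)\<close> at \<open>X12\<close> and at
  \<open>X1\<close>.\<close>

lemma all_hdeg_H6:
  assumes "i \<noteq> j"
  shows "hdeg i j (hom (cellf D1))" "hdeg i j (hom (cellf (D2_1 \<delta>1 \<delta>2)))" "hdeg i j (hom (cellf (D2_2 \<delta>1 \<delta>2 lam)))"
    "hdeg i j (hom (cellf (D2_3 \<delta>1 \<delta>2 lam)))" "hdeg i j (hom (cellf D3))" "hdeg i j (hom (cellf (D4_1 \<delta>1 \<delta>2 \<delta>3)))"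
    "hdeg i j (hom (cellf (D4_2 \<delta>1 \<delta>2 \<delta>3)))"
proof -
  note [simp] = null_pair_def hom_def hlin_def cellf_pack rep_defs
  show "hdeg i j (hom (cellf D1))"
    by (rule all_hdegI[OF multilin_hom _ assms, where v = X and p = "(1, 0)" and q = "\<lambda>_. (1, 0)"]) (rename_tac w, case_tac w; simp add: algebra_simps)
  show "hdeg i j (hom (cellf (D2_1 \<delta>1 \<delta>2)))"
    by (rule all_hdegI[OF multilin_hom _ assms, where v = X1 and p = "(1, 0)" and q = "\<lambda>_. (1, 0)"]) (rename_tac w, case_tac w; simp add: algebra_simps)
  show "hdeg i j (hom (cellf (D2_2 \<delta>1 \<delta>2 lam)))"
    by (rule all_hdegI[OF multilin_hom _ assms, where v = X12 and p = "(1, 0)" and q = "\<lambda>_. (1, 0)"]) (rename_tac w, case_tac w; simp add: algebra_simps)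
  show "hdeg i j (hom (cellf (D2_3 \<delta>1 \<delta>2 lam)))"
    by (rule all_hdegI[OF multilin_hom _ assms, where v = X2 and p = "(1, 0)" and q = "\<lambda>_. (1, 0)"]) (rename_tac w, case_tac w; simp add: algebra_simps)
  show "hdeg i j (hom (cellf D3))"
    by (rule all_hdegI[OF multilin_hom _ assms, where v = X and p = "(1, 0)" and q = "\<lambda>_. (1, 0)"]) (rename_tac w, case_tac w; simp add: algebra_simps)
  show "hdeg i j (hom (cellf (D4_1 \<delta>1 \<delta>2 \<delta>3)))"
    by (rule all_hdegI[OF multilin_hom _ assms, where v = X and p = "(1, 0)" and q = "\<lambda>w. if w = X12 then (0, 1) else (1, 0)"])
      (rename_tac w, case_tac w; simp add: algebra_simps)
  show "hdeg i j (hom (cellf (D4_2 \<delta>1 \<delta>2 \<delta>3)))"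
    by (rule all_hdegI[OF multilin_hom _ assms, where v = X and p = "(1, 0)" and q = "\<lambda>w. if w = X1 then (0, 1) else (1, 0)"])
      (rename_tac w, case_tac w; simp add: algebra_simps)
qed

lemma cell_irreducible_not_product:
  assumes "cell_irreducible E" shows "\<not> (\<forall>x x1 x2 x12. E (0, 0) x x1 x2 x12 = (x + a * x1) * (c * (x2 + b * x12)))"
  using assms reducible_product unfolding cell_irreducible_def by metis

text \<open>At the excluded values the cell polynomial splits into a factor in \<open>x\<close>,
  \<open>x1\<close> and one in \<open>x2\<close>, \<open>x12\<close>.\<close>

lemma trapezoidal_parameters:
  "cell_irreducible (tH1 \<alpha> \<epsilon>) \<Longrightarrow> \<alpha> \<noteq> 0" "cell_irreducible (tH2 \<alpha> \<beta> \<epsilon>) \<Longrightarrow> \<alpha> \<noteq> 0"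
  "cell_irreducible (tH3 \<alpha> \<beta> \<delta> \<epsilon>) \<Longrightarrow> \<alpha>\<^sup>2 \<noteq> 1"
proof -
  show "\<alpha> \<noteq> 0" if "cell_irreducible (tH1 \<alpha> \<epsilon>)"
    using cell_irreducible_not_product[OF that, of "-1" 1 "-1"] by (auto simp: tH1_def)
  show "\<alpha> \<noteq> 0" if "cell_irreducible (tH2 \<alpha> \<beta> \<epsilon>)"
    using cell_irreducible_not_product[OF that, of "-1" 1 "-1"] by (auto simp: tH2_def)
  show "\<alpha>\<^sup>2 \<noteq> 1" if "cell_irreducible (tH3 \<alpha> \<beta> \<delta> \<epsilon>)"
  proof
    assume "\<alpha>\<^sup>2 = 1"
    then consider "\<alpha> = 1" | "\<alpha> = - 1" by (auto simp: power2_eq_1_iff)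
    then show False
    proof cases
      case 1
      then show False using cell_irreducible_not_product[OF that, of "-1" "-1" "-1"] by (simp add: tH3_def algebra_simps)
    next
      case 2
      then show False using cell_irreducible_not_product[OF that, of 1 "-1" 1] by (simp add: tH3_def algebra_simps)
    qed
  qed
qed

section \<open>Consistency and type of the listed equations\<close>

lemma representative:
  assumes "multiaffine (cellf E)" "E = lift (pol (cellf E))" "consistent (pol (cellf E))"
  shows "quad_equation (pol (cellf E)) \<and> consistent (pol (cellf E)) \<and> same_equation (lift (pol (cellf E))) E"
proof -
  have "same_equation E E" unfolding same_equation_def by (intro allI exI[of _ 1]) simp
  then show ?thesis using consistent_quad_equation assms by simp
qed

theorem trapezoidal_list_consistent:
  assumes "E \<in> trapezoidal_list"
  shows "\<exists>Q. quad_equation Q \<and> consistent Q \<and> trapezoidal_H4 Q \<and> same_equation (lift Q) E"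
proof -
  from assms consider \<alpha> \<epsilon> where "E = tH1 \<alpha> \<epsilon>" "cell_irreducible E" | \<alpha> \<beta> \<epsilon> where "E = tH2 \<alpha> \<beta> \<epsilon>" "cell_irreducible E"
    | \<alpha> \<beta> \<delta> \<epsilon> where "E = tH3 \<alpha> \<beta> \<delta> \<epsilon>" "\<alpha> \<noteq> 0" "cell_irreducible E"
    unfolding trapezoidal_list_def tH1_family_def tH2_family_def tH3_family_def by blast
  then show ?thesis
  proof cases
    case 1
    then show ?thesis
      using representative[OF multiaffine_cellf(1) lift_cellf(1) consistent_tH1] trapezoidal_tH(1) trapezoidal_parameters(1)
      by metis
  next
    case 2
    then show ?thesis
      using representative[OF multiaffine_cellf(2) lift_cellf(2) consistent_tH2] trapezoidal_tH(3) trapezoidal_parameters(2)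
      by metis
  next
    case 3
    then show ?thesis
      using representative[OF multiaffine_cellf(3) lift_cellf(3) consistent_tH3] trapezoidal_tH(5) trapezoidal_parameters(3)
      by metis
  qed
qed

theorem H6_list_consistent:
  assumes "E \<in> H6_list \<union> {D1}"
  shows "\<exists>Q. quad_equation Q \<and> consistent Q \<and> type_H6 Q \<and> same_equation (lift Q) E"
proof -
  from assms consider "E = D1" | \<delta>1 \<delta>2 where "E = D2_1 \<delta>1 \<delta>2" | \<delta>1 \<delta>2 lam where "E = D2_2 \<delta>1 \<delta>2 lam"
    | \<delta>1 \<delta>2 lam where "E = D2_3 \<delta>1 \<delta>2 lam" | "E = D3" | \<delta>1 \<delta>2 \<delta>3 where "E = D4_1 \<delta>1 \<delta>2 \<delta>3"
    | \<delta>1 \<delta>2 \<delta>3 where "E = D4_2 \<delta>1 \<delta>2 \<delta>3"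
    unfolding H6_list_def D2_1_family_def D2_2_family_def D2_3_family_def D4_1_family_def D4_2_family_def by blast
  then show ?thesis
  proof cases
    case 1
    show ?thesis unfolding 1
      using representative[OF multiaffine_cellf(4) lift_cellf(4) consistent_D1] type_H6_pol[OF multiaffine_cellf(4) all_hdeg_H6(1)] by blast
  next
    case 2
    show ?thesis unfolding 2
      using representative[OF multiaffine_cellf(5) lift_cellf(5) consistent_D2_1] type_H6_pol[OF multiaffine_cellf(5) all_hdeg_H6(2)] by blast
  next
    case 3
    show ?thesis unfolding 3
      using representative[OF multiaffine_cellf(6) lift_cellf(6) consistent_D2_2] type_H6_pol[OF multiaffine_cellf(6) all_hdeg_H6(3)] by blast
  next
    case 4
    show ?thesis unfolding 4
      using representative[OF multiaffine_cellf(7) lift_cellf(7) consistent_D2_3] type_H6_pol[OF multiaffine_cellf(7) all_hdeg_H6(4)] by blast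
  next
    case 5
    show ?thesis unfolding 5
      using representative[OF multiaffine_cellf(8) lift_cellf(8) consistent_D3] type_H6_pol[OF multiaffine_cellf(8) all_hdeg_H6(5)] by blast
  next
    case 6
    show ?thesis unfolding 6
      using representative[OF multiaffine_cellf(9) lift_cellf(9) consistent_D4_1] type_H6_pol[OF multiaffine_cellf(9) all_hdeg_H6(6)] by blast
  next
    case 7
    show ?thesis unfolding 7
      using representative[OF multiaffine_cellf(10) lift_cellf(10) consistent_D4_2] type_H6_pol[OF multiaffine_cellf(10) all_hdeg_H6(7)] by blast
  qed
qed

section \<open>Inequivalence\<close>

text \<open>The discriminant of a binary quadratic form, whose mixed coefficient is recovered from
  the value at \<open>(1, 1)\<close>.\<close>

definition discr :: "(hpoint \<Rightarrow> complex) \<Rightarrow> complex" where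
  "discr g = (g (1, 1) - g (1, 0) - g (0, 1))\<^sup>2 - 4 * g (1, 0) * g (0, 1)"

text \<open>Cayley's hyperdeterminant of the trilinear form obtained by fixing the remaining variable.\<close>

definition hyperdet :: "form \<Rightarrow> vertex \<Rightarrow> vertex \<Rightarrow> vertex \<Rightarrow> form" where
  "hyperdet T w m n y = discr (\<lambda>q. tdet m n T (y(w := q)))"

lemma discr_quadratic:
  assumes q: "\<And>s t. g (s, t) = s\<^sup>2 * g (1, 0) + s * t * (g (1, 1) - g (1, 0) - g (0, 1)) + t\<^sup>2 * g (0, 1)"
  shows "discr (\<lambda>p. k * g (act m p)) = k\<^sup>2 * (mdet m)\<^sup>2 * discr g"
proof -
  obtain a b c d where m: "m = (a, b, c, d)" by (cases m)
  define A B C where "A = g (1, 0)" and "B = g (1, 1) - g (1, 0) - g (0, 1)" and "C = g (0, 1)"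
  have g: "g (s, t) = A * s\<^sup>2 + B * s * t + C * t\<^sup>2" for s t unfolding A_def B_def C_def by (subst q) (simp add: algebra_simps)
  show ?thesis unfolding m discr_def by (simp add: g power2_eq_square algebra_simps)
qed

text \<open>Written in the eight values of the trilinear form, the symmetry in the three vertices
  (\<open>hyperdet_swap\<close>) becomes a polynomial identity.\<close>

lemma hyperdet_expand:
  fixes y :: "vertex \<Rightarrow> hpoint"
  assumes T: "multilin T" and d: "distinct [w, m, n]"
  defines "a i j k \<equiv> T (y(w := i, m := j, n := k))"
  shows "hyperdet T w m n y =
    (let e = (1, 0); f = (0, 1) in
     (a e e f * a f f e + a f e f * a e f e - a e e e * a f f f - a f e e * a e f f)\<^sup>2
     - 4 * (a e e f * a e f e - a e e e * a e f f) * (a f e f * a f f e - a f e e * a f f f))"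
proof -
  have u: "y(w := i, m := j, n := k) = y(m := j, n := k, w := i)" for i j k
    using d by (auto simp: fun_eq_iff)
  have s: "a (1, 1) j k = a (1, 0) j k + a (0, 1) j k" for j k
    unfolding a_def u using multilinD[OF T, of "y(m := j, n := k)" w 1 1] by simp
  show ?thesis
    unfolding hyperdet_def discr_def tdet_def a_def[symmetric] s Let_def by (simp add: algebra_simps)
qed

lemma hyperdet_swap:
  assumes T: "multilin T" and d: "distinct [w, m, n]"
  shows "hyperdet T w m n y = hyperdet T m w n y" "hyperdet T w m n y = hyperdet T w n m y"
proof -
  have u: "y(m := j, w := i, n := k) = y(w := i, m := j, n := k)" for i j k
    using d by (auto simp: fun_eq_iff)
  have d': "distinct [m, w, n]" using d by auto
  show "hyperdet T w m n y = hyperdet T m w n y"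
    unfolding hyperdet_expand[OF T d] hyperdet_expand[OF T d'] u Let_def by algebra
  show "hyperdet T w m n y = hyperdet T w n m y"
    unfolding hyperdet_def using tdet_commute[of m n T] d by simp
qed

lemma hyperdet_perm:
  assumes T: "multilin T" and d: "distinct [v, w, m, n]" "distinct [v, w', m', n']"
  shows "hyperdet T w' m' n' y = hyperdet T w m n y"
proof -
  have "w' \<in> {v, w, m, n}" "m' \<in> {v, w, m, n}" "n' \<in> {v, w, m, n}" using d(1) UNIV_distinct by blast+
  then have "(w', m', n') \<in> {(w, m, n), (w, n, m), (m, w, n), (m, n, w), (n, w, m), (n, m, w)}"
    using d by auto
  moreover have "hyperdet T w n m y = hyperdet T w m n y" "hyperdet T m w n y = hyperdet T w m n y"
    "hyperdet T m n w y = hyperdet T w m n y" "hyperdet T n w m y = hyperdet T w m n y" "hyperdet T n m w y = hyperdet T w m n y"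
  proof -
    have 1: "hyperdet T w n m y = hyperdet T w m n y" by (rule hyperdet_swap(2)[OF T]) (use d in auto)
    have 2: "hyperdet T m w n y = hyperdet T w m n y" by (rule hyperdet_swap(1)[OF T]) (use d in auto)
    have 3: "hyperdet T m n w y = hyperdet T m w n y" by (rule hyperdet_swap(2)[OF T]) (use d in auto)
    have 4: "hyperdet T n w m y = hyperdet T w n m y" by (rule hyperdet_swap(1)[OF T]) (use d in auto)
    have 5: "hyperdet T n m w y = hyperdet T m n w y" by (rule hyperdet_swap(1)[OF T]) (use d in auto)
    show "hyperdet T w n m y = hyperdet T w m n y" "hyperdet T m w n y = hyperdet T w m n y"
      "hyperdet T m n w y = hyperdet T w m n y" "hyperdet T n w m y = hyperdet T w m n y"
      "hyperdet T n m w y = hyperdet T w m n y" using 1 2 3 4 5 by simp_all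
  qed
  ultimately show ?thesis by auto
qed

lemma hyperdet_cong:
  assumes d: "distinct [v, w, m, n]" and y: "y v = y' v"
  shows "hyperdet T w m n y = hyperdet T w m n y'"
  unfolding hyperdet_def
  by (intro arg_cong[where f = discr] ext tdet_cong[of v w m n]) (use d y in auto)

text \<open>A root \<open>p\<close> of the binary quartic obtained by leaving the argument at
  \<open>v\<close> free. By \<open>hyperdet_perm\<close> the quartic does not depend on the order of
  \<open>w\<close>, \<open>m\<close>, \<open>n\<close>.\<close>

definition singular_at :: "form \<Rightarrow> vertex \<Rightarrow> hpoint \<Rightarrow> bool" where
  "singular_at T v p \<longleftrightarrow> (\<forall>w m n y. distinct [v, w, m, n] \<longrightarrow> y v = p \<longrightarrow> hyperdet T w m n y = 0)"

definition totally_singular :: "form \<Rightarrow> vertex \<Rightarrow> bool" where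
  "totally_singular T v \<longleftrightarrow> (\<forall>p. p \<noteq> (0, 0) \<longrightarrow> singular_at T v p)"

text \<open>The quartic is nonzero and has two distinct roots; the inequality says that
  \<open>p\<close> and \<open>q\<close> are different points of the projective line.\<close>

definition doubly_singular :: "form \<Rightarrow> vertex \<Rightarrow> bool" where
  "doubly_singular T v \<longleftrightarrow> \<not> totally_singular T v \<and> (\<exists>p q. singular_at T v p \<and> singular_at T v q \<and> fst p * snd q \<noteq> snd p * fst q)"

lemma singular_at_iff:
  assumes T: "multilin T" and d: "distinct [v, w, m, n]"
  shows "singular_at T v p \<longleftrightarrow> hyperdet T w m n (y(v := p)) = 0"
proof
  assume "singular_at T v p"
  then show "hyperdet T w m n (y(v := p)) = 0" unfolding singular_at_def using d by simp
next
  assume z: "hyperdet T w m n (y(v := p)) = 0"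
  show "singular_at T v p"
    unfolding singular_at_def
  proof (intro allI impI)
    fix w' m' n' and y' :: "vertex \<Rightarrow> hpoint" assume d': "distinct [v, w', m', n']" and y': "y' v = p"
    have "hyperdet T w' m' n' y' = hyperdet T w m n y'" by (rule hyperdet_perm[OF T d d'])
    also have "\<dots> = hyperdet T w m n (y(v := p))" by (rule hyperdet_cong[OF d]) (simp add: y')
    finally show "hyperdet T w' m' n' y' = 0" using z by simp
  qed
qed

text \<open>Changes of basis multiply the hyperdeterminant by the squares of their determinants, so
  its zeros merely move along with the coordinates.\<close>

lemma singular_at_geqv_by:
  assumes T: "multilin T" and g: "geqv_by \<tau> M c T T'"
  shows "singular_at T' (\<tau> v) p \<longleftrightarrow> singular_at T v (act (M v) p)"
proof -
  have b: "bij \<tau>" and mo: "\<And>v. is_moebius (M v)" and c: "c \<noteq> 0" using g by (auto simp: geqv_by_def)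
  obtain w m n where d: "distinct [v, w, m, n]" using complement_pair by (cases v) (auto simp: ex_vertex)
  have d': "distinct [\<tau> v, \<tau> w, \<tau> m, \<tau> n]" using d bij_is_inj[OF b] by (auto simp: inj_eq)
  have mn: "m \<noteq> n" using d by simp
  let ?o = "\<lambda>_ :: vertex. (0, 0) :: hpoint"
  define y where "y = ?o(\<tau> v := p)"
  define z where "z = (\<lambda>u. act (M u) (y (\<tau> u)))"
  have zv: "z(v := act (M v) p) = z" unfolding z_def y_def by (auto simp: fun_eq_iff)
  define g where "g q = tdet m n T (z(w := q))" for q
  define K where "K = c\<^sup>2 * mdet (M m) * mdet (M n)"
  have K: "K \<noteq> 0" using c mo[of m] mo[of n] by (simp add: K_def is_moebius_mdet)
  have "tdet (\<tau> m) (\<tau> n) T' (y(\<tau> w := q)) = K * g (act (M w) q)" for q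
    unfolding tdet_geqv_by[OF T g mn] upd_comp_bij[OF b] z_def[symmetric] g_def K_def by simp
  then have "hyperdet T' (\<tau> w) (\<tau> m) (\<tau> n) y = discr (\<lambda>q. K * g (act (M w) q))" by (simp add: hyperdet_def)
  also have "\<dots> = K\<^sup>2 * (mdet (M w))\<^sup>2 * discr g"
    by (rule discr_quadratic) (unfold g_def, rule tdet_quadratic[OF T], use d in auto)
  also have "discr g = hyperdet T w m n z" by (simp add: hyperdet_def g_def[abs_def])
  finally have "hyperdet T' (\<tau> w) (\<tau> m) (\<tau> n) y = K\<^sup>2 * (mdet (M w))\<^sup>2 * hyperdet T w m n z" .
  moreover have "K\<^sup>2 * (mdet (M w))\<^sup>2 \<noteq> 0" using K mo[of w] by (simp add: is_moebius_mdet)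
  ultimately have "hyperdet T' (\<tau> w) (\<tau> m) (\<tau> n) y = 0 \<longleftrightarrow> hyperdet T w m n z = 0" by simp
  then show ?thesis
    using singular_at_iff[OF multilin_geqv_by[OF T g] d', of p ?o] singular_at_iff[OF T d, of "act (M v) p" z]
    unfolding zv y_def[symmetric] by simp
qed

lemma totally_singular_geqv_by:
  assumes T: "multilin T" and g: "geqv_by \<tau> M c T T'"
  shows "totally_singular T' (\<tau> v) \<longleftrightarrow> totally_singular T v"
proof -
  have mo: "is_moebius (M v)" using g by (auto simp: geqv_by_def)
  have m': "is_moebius (minv (M v))" using is_moebius_minv mo by blast
  show ?thesis
    unfolding totally_singular_def singular_at_geqv_by[OF T g] using act_nonzero[OF mo] act_nonzero[OF m'] act_minv[OF mo] by metis
qed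

lemma act_det: "fst (act m p) * snd (act m q) - snd (act m p) * fst (act m q) = mdet m * (fst p * snd q - snd p * fst q)"
  by (cases m; cases p; cases q) (simp add: algebra_simps)

lemma doubly_singular_geqv_by:
  assumes T: "multilin T" and g: "geqv_by \<tau> M c T T'"
  shows "doubly_singular T' (\<tau> v) \<longleftrightarrow> doubly_singular T v"
proof -
  have mo: "is_moebius (M v)" using g by (auto simp: geqv_by_def)
  have i: "fst (act (M v) p) * snd (act (M v) q) \<noteq> snd (act (M v) p) * fst (act (M v) q) \<longleftrightarrow> fst p * snd q \<noteq> snd p * fst q" for p q
    using act_det[of "M v" p q] mo unfolding is_moebius_mdet by (metis mult_eq_0_iff right_minus_eq)
  have "(\<exists>p q. singular_at T v (act (M v) p) \<and> singular_at T v (act (M v) q) \<and> fst p * snd q \<noteq> snd p * fst q) \<longleftrightarrow>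
      (\<exists>p q. singular_at T v p \<and> singular_at T v q \<and> fst p * snd q \<noteq> snd p * fst q)" (is "?L = ?R")
  proof
    assume ?L then show ?R using i by blast
  next
    assume ?R
    then obtain p q where pq: "singular_at T v p" "singular_at T v q" "fst p * snd q \<noteq> snd p * fst q" by blast
    define p' q' where "p' = act (minv (M v)) p" and "q' = act (minv (M v)) q"
    have "act (M v) p' = p" "act (M v) q' = q" using act_minv[OF mo] by (simp_all add: p'_def q'_def)
    then show ?L using pq i[of p' q'] by (intro exI[of _ p'] exI[of _ q']) simp
  qed
  then show ?thesis unfolding doubly_singular_def totally_singular_geqv_by[OF T g] singular_at_geqv_by[OF T g] by blast
qed

definition all_hdeg :: "form \<Rightarrow> bool" where
  "all_hdeg T \<longleftrightarrow> (\<forall>i j. i \<noteq> j \<longrightarrow> hdeg i j T)"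

text \<open>The values are the positions in \<open>equation_classes\<close>. Vertices occur only
  under quantifiers over all of them, since \<open>geqv\<close> may permute them
  arbitrarily.\<close>

definition kind :: "form \<Rightarrow> nat" where
  "kind T = (if all_hdeg T
     then if \<forall>v. totally_singular T v then 3 else if \<forall>v. \<not> doubly_singular T v then 4 else if \<forall>v. doubly_singular T v then 6 else 5
     else if \<exists>v. totally_singular T v then 0 else if \<forall>v. doubly_singular T v then 2 else 1)"

lemma all_hdeg_geqv_by:
  assumes T: "multilin T" and g: "geqv_by \<tau> M c T T'" and a: "all_hdeg T"
  shows "all_hdeg T'"
  unfolding all_hdeg_def
proof (intro allI impI)
  fix i j :: vertex assume ij: "i \<noteq> j"
  have "surj \<tau>" using g by (simp add: geqv_by_def bij_is_surj)
  then obtain i' j' where "i = \<tau> i'" "j = \<tau> j'" by (metis surjD)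
  then show "hdeg i j T'" using hdeg_geqv_by[OF T g, of i' j'] a ij unfolding all_hdeg_def by auto
qed

lemma kind_geqv:
  assumes T: "multilin T" and g: "geqv T T'"
  shows "kind T' = kind T"
proof -
  obtain \<tau> M c where g: "geqv_by \<tau> M c T T'" using g unfolding geqv_def by blast
  have b: "surj \<tau>" using g by (simp add: geqv_by_def bij_is_surj)
  have all: "(\<forall>v. P (\<tau> v)) \<longleftrightarrow> (\<forall>v. P v)" for P using b by (metis surjD)
  have ex: "(\<exists>v. P (\<tau> v)) \<longleftrightarrow> (\<exists>v. P v)" for P using b by (metis surjD)
  have 1: "all_hdeg T' \<longleftrightarrow> all_hdeg T"
    using all_hdeg_geqv_by[OF T g] all_hdeg_geqv_by[OF multilin_geqv_by[OF T g] geqv_by_sym[OF g]] by blast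
  have 2: "(\<forall>v. totally_singular T' v) \<longleftrightarrow> (\<forall>v. totally_singular T v)" "(\<exists>v. totally_singular T' v) \<longleftrightarrow> (\<exists>v. totally_singular T v)"
    using all[of "totally_singular T'"] ex[of "totally_singular T'"] unfolding totally_singular_geqv_by[OF T g] by blast+
  have 3: "(\<forall>v. doubly_singular T' v) \<longleftrightarrow> (\<forall>v. doubly_singular T v)" "(\<forall>v. \<not> doubly_singular T' v) \<longleftrightarrow> (\<forall>v. \<not> doubly_singular T v)"
    using all[of "doubly_singular T'"] all[of "\<lambda>v. \<not> doubly_singular T' v"] unfolding doubly_singular_geqv_by[OF T g] by blast+
  show ?thesis unfolding kind_def 1 2 3 ..
qed

section \<open>Computing the invariant of each class\<close>

lemma totally_singularI:
  assumes T: "multilin T" and d: "distinct [v, w, m, n]"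
    and h: "\<And>s t. hyperdet T w m n (y(v := (s, t))) = 0"
  shows "totally_singular T v"
  unfolding totally_singular_def using singular_at_iff[OF T d, of _ y] h by (metis prod.exhaust)

lemma not_totally_singularI:
  assumes T: "multilin T" and d: "distinct [v, w, m, n]"
    and h: "hyperdet T w m n (y(v := p)) \<noteq> 0" "p \<noteq> (0, 0)"
  shows "\<not> totally_singular T v"
  unfolding totally_singular_def using singular_at_iff[OF T d, of p y] h by blast

text \<open>\<open>K t^4\<close> is zero or has infinity as its only root.\<close>

lemma quartic_not_doubly_singular:
  assumes T: "multilin T" and d: "distinct [v, w, m, n]"
    and h: "\<And>s t. hyperdet T w m n (y(v := (s, t))) = K * t ^ 4"
  shows "\<not> doubly_singular T v" "K \<noteq> 0 \<Longrightarrow> \<not> totally_singular T v"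
proof -
  have s: "singular_at T v (a, t) \<longleftrightarrow> K = 0 \<or> t = 0" for a t unfolding singular_at_iff[OF T d, of _ y] h by simp
  show "K \<noteq> 0 \<Longrightarrow> \<not> totally_singular T v" by (rule not_totally_singularI[OF T d, of y "(0, 1)"]) (simp_all add: h)
  show "\<not> doubly_singular T v"
  proof (cases "K = 0")
    case True
    then have "totally_singular T v" by (intro totally_singularI[OF T d, of y]) (simp add: h)
    then show ?thesis by (simp add: doubly_singular_def)
  next
    case False
    then have "singular_at T v p \<Longrightarrow> snd p = 0" for p using s[of "fst p" "snd p"] by simp
    then show ?thesis unfolding doubly_singular_def by (metis mult_zero_left mult_zero_right)
  qed
qed

text \<open>The quartic is \<open>t^2 (k s^2 + e t^2)\<close>, with infinity and the finite point
  \<open>csqrt (- e / k)\<close> among its roots.\<close>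

lemma biquadratic_doubly_singular:
  assumes T: "multilin T" and d: "distinct [v, w, m, n]" and k: "k \<noteq> 0"
    and h: "\<And>s t. hyperdet T w m n (y(v := (s, t))) = k * s\<^sup>2 * t\<^sup>2 + e * t ^ 4"
  shows "doubly_singular T v"
proof -
  have s: "singular_at T v (a, t) \<longleftrightarrow> k * a\<^sup>2 * t\<^sup>2 + e * t ^ 4 = 0" for a t unfolding singular_at_iff[OF T d, of _ y] h ..
  have "\<not> totally_singular T v"
  proof
    assume z: "totally_singular T v"
    have "singular_at T v (0, 1)" "singular_at T v (1, 1)" using z unfolding totally_singular_def by simp_all
    then show False using k unfolding s by simp
  qed
  moreover have "singular_at T v (1, 0)" "singular_at T v (csqrt (- e / k), 1)" using k unfolding s by simp_all
  ultimately show ?thesis unfolding doubly_singular_def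
    by (intro conjI exI[of _ "(1, 0)"] exI[of _ "(csqrt (- e / k), 1)"]) simp_all
qed

text \<open>With the value at \<open>X2\<close> or \<open>X12\<close> fixed, the determinant in
  \<open>X\<close>, \<open>X1\<close> is a product of two linear forms, and the discriminant of such
  a product is the square of their resultant.\<close>

lemma hyperdet_NF:
  fixes b0 b1 b2 b3 c0 c1 c2 c3 d0 d1 d2 d3 :: complex
  defines "N \<equiv> NF (d3, d1, d2, d0) (b3, b1, b2, b0) (c3, c1, c2, c0)"
  shows "hyperdet N X12 X X1 (pack a b (s, t) e) =
      ((d3 * s + d2 * t) * (b1 * s + b0 * t) - (d1 * s + d0 * t) * (b3 * s + b2 * t))\<^sup>2"
    "hyperdet N X2 X X1 (pack a b e (s, t)) =
      ((d3 * s + d1 * t) * (b2 * s + b0 * t) - (d2 * s + d0 * t) * (b3 * s + b1 * t))\<^sup>2"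
    "hyperdet N X1 X2 X12 (pack (s, t) a b e) =
      (t * b1 * (s * d2 + t * c2) + t * b2 * (s * d1 + t * c1) - t * b3 * (s * d0 + t * c0) - t * b0 * (s * d3 + t * c3))\<^sup>2
      - 4 * t\<^sup>2 * (b1 * b2 - b3 * b0) * ((s * d1 + t * c1) * (s * d2 + t * c2) - (s * d3 + t * c3) * (s * d0 + t * c0))"
    "hyperdet N X X2 X12 (pack a (s, t) b e) =
      (t * d1 * (s * b2 + t * c2) + t * d2 * (s * b1 + t * c1) - t * d3 * (s * b0 + t * c0) - t * d0 * (s * b3 + t * c3))\<^sup>2
      - 4 * t\<^sup>2 * (d1 * d2 - d3 * d0) * ((s * b1 + t * c1) * (s * b2 + t * c2) - (s * b3 + t * c3) * (s * b0 + t * c0))"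
proof -
  show "hyperdet N X12 X X1 (pack a b (s, t) e) =
      ((d3 * s + d2 * t) * (b1 * s + b0 * t) - (d1 * s + d0 * t) * (b3 * s + b2 * t))\<^sup>2"
    unfolding hyperdet_def discr_def N_def pack_upd tdet_NF by (simp add: algebra_simps power2_eq_square)
  show "hyperdet N X2 X X1 (pack a b e (s, t)) =
      ((d3 * s + d1 * t) * (b2 * s + b0 * t) - (d2 * s + d0 * t) * (b3 * s + b1 * t))\<^sup>2"
    unfolding hyperdet_def discr_def N_def pack_upd tdet_NF by (simp add: algebra_simps power2_eq_square)
  show "hyperdet N X1 X2 X12 (pack (s, t) a b e) =
      (t * b1 * (s * d2 + t * c2) + t * b2 * (s * d1 + t * c1) - t * b3 * (s * d0 + t * c0) - t * b0 * (s * d3 + t * c3))\<^sup>2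
      - 4 * t\<^sup>2 * (b1 * b2 - b3 * b0) * ((s * d1 + t * c1) * (s * d2 + t * c2) - (s * d3 + t * c3) * (s * d0 + t * c0))"
    unfolding hyperdet_def discr_def N_def pack_upd tdet_NF by (simp add: algebra_simps power2_eq_square)
  show "hyperdet N X X2 X12 (pack a (s, t) b e) =
      (t * d1 * (s * b2 + t * c2) + t * d2 * (s * b1 + t * c1) - t * d3 * (s * b0 + t * c0) - t * d0 * (s * b3 + t * c3))\<^sup>2
      - 4 * t\<^sup>2 * (d1 * d2 - d3 * d0) * ((s * b1 + t * c1) * (s * b2 + t * c2) - (s * b3 + t * c3) * (s * b0 + t * c0))"
    unfolding hyperdet_def discr_def N_def pack_upd tdet_NF by (simp add: algebra_simps power2_eq_square)
qed

text \<open>The roots of the quartic at \<open>X2\<close> are the eigenvectors of the pencil of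
  \<open>d\<close> and \<open>b\<close>: it vanishes identically for the scalar pencil, is a
  multiple of \<open>t^4\<close> for the Jordan block and of \<open>s^2 t^2\<close> for the diagonal
  pencil.\<close>

lemma kind_trapezoidal:
  "kind (hom (cellf (tH1 \<alpha> \<epsilon>))) = 0"
  "\<alpha> \<noteq> 0 \<Longrightarrow> kind (hom (cellf (tH2 \<alpha> \<beta> \<epsilon>))) = 1"
  "\<alpha> \<noteq> 0 \<Longrightarrow> \<alpha>\<^sup>2 \<noteq> 1 \<Longrightarrow> kind (hom (cellf (tH3 \<alpha> \<beta> \<delta> \<epsilon>))) = 2"
proof -
  let ?o = "(0, 0) :: hpoint"
  have d: "distinct [X, X1, X2, X12]" "distinct [X1, X, X2, X12]" "distinct [X2, X12, X, X1]" "distinct [X12, X2, X, X1]"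
    by simp_all
  note m = multilin_hom
  show "kind (hom (cellf (tH1 \<alpha> \<epsilon>))) = 0"
  proof -
    have "totally_singular (hom (cellf (tH1 \<alpha> \<epsilon>))) X2"
      by (rule totally_singularI[OF m d(3), of _ "pack ?o ?o ?o ?o"]) (simp add: hom_tH1 hyperdet_NF algebra_simps)
    moreover have "\<not> all_hdeg (hom (cellf (tH1 \<alpha> \<epsilon>)))" using trapezoidal_tH(2) unfolding all_hdeg_def by blast
    ultimately show ?thesis unfolding kind_def by auto
  qed
  show "kind (hom (cellf (tH2 \<alpha> \<beta> \<epsilon>))) = 1" if \<alpha>: "\<alpha> \<noteq> 0"
  proof -
    let ?T = "hom (cellf (tH2 \<alpha> \<beta> \<epsilon>))"
    have h: "hyperdet ?T X12 X X1 ((pack ?o ?o ?o ?o)(X2 := (s, t))) = (4 * \<alpha>\<^sup>2) * t ^ 4"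
      "hyperdet ?T X2 X X1 ((pack ?o ?o ?o ?o)(X12 := (s, t))) = (4 * \<alpha>\<^sup>2) * t ^ 4" for s t
      unfolding pack_upd hom_tH2 hyperdet_NF by (simp_all add: algebra_simps power2_eq_square power4_eq_xxxx)
    have nz: "4 * \<alpha>\<^sup>2 \<noteq> 0" using \<alpha> by simp
    note 2 = quartic_not_doubly_singular[OF m d(3) h(1)] and 12 = quartic_not_doubly_singular[OF m d(4) h(2)]
    define c1 c0 where "c1 = \<alpha> + \<epsilon> * \<alpha> * (2 * \<beta> + \<alpha>)"
      and "c0 = \<epsilon> * \<alpha> * (2 * \<beta> + \<alpha>)\<^sup>2 + (\<beta> + \<alpha>)\<^sup>2 - \<beta>\<^sup>2 - 2 * \<epsilon> * \<alpha> * \<beta> * (\<beta> + \<alpha>)"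
    have T: "?T = NF (0, 1, -1, \<alpha>) (0, -1, 1, \<alpha>) (2 * \<epsilon> * \<alpha>, c1, c1, c0)" unfolding hom_tH2 c1_def c0_def ..
    have r: "hyperdet ?T X1 X2 X12 ((pack ?o ?o ?o ?o)(X := (s, 1))) =
        (4 * (\<epsilon> * \<alpha>\<^sup>2)\<^sup>2 + 4 * c1\<^sup>2 - 8 * \<epsilon> * \<alpha> * c0) - 16 * \<epsilon> * \<alpha>\<^sup>2 * s"
      "hyperdet ?T X X2 X12 ((pack ?o ?o ?o ?o)(X1 := (s, 1))) =
        (4 * (\<epsilon> * \<alpha>\<^sup>2)\<^sup>2 + 4 * c1\<^sup>2 - 8 * \<epsilon> * \<alpha> * c0) - 16 * \<epsilon> * \<alpha>\<^sup>2 * s" for s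
      unfolding pack_upd T hyperdet_NF by (simp_all add: algebra_simps power2_eq_square)
    \<comment> \<open>Linear in \<open>s\<close> unless \<open>\<epsilon> = 0\<close>, when it is
      the constant \<open>4 \<alpha>^2\<close>; the witness makes the value 1.\<close>
    have "\<exists>s. (4 * (\<epsilon> * \<alpha>\<^sup>2)\<^sup>2 + 4 * c1\<^sup>2 - 8 * \<epsilon> * \<alpha> * c0) - 16 * \<epsilon> * \<alpha>\<^sup>2 * s \<noteq> 0"
    proof (cases "\<epsilon> = 0")
      case True
      then show ?thesis using \<alpha> by (simp add: c1_def)
    next
      case False
      then show ?thesis using \<alpha>
        by (intro exI[of _ "((4 * (\<epsilon> * \<alpha>\<^sup>2)\<^sup>2 + 4 * c1\<^sup>2 - 8 * \<epsilon> * \<alpha> * c0) - 1) / (16 * \<epsilon> * \<alpha>\<^sup>2)"]) simp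
    qed
    then obtain s where s: "(4 * (\<epsilon> * \<alpha>\<^sup>2)\<^sup>2 + 4 * c1\<^sup>2 - 8 * \<epsilon> * \<alpha> * c0) - 16 * \<epsilon> * \<alpha>\<^sup>2 * s \<noteq> 0" by blast
    have n: "hyperdet ?T X1 X2 X12 ((pack ?o ?o ?o ?o)(X := (s, 1))) \<noteq> 0"
      "hyperdet ?T X X2 X12 ((pack ?o ?o ?o ?o)(X1 := (s, 1))) \<noteq> 0" unfolding r by (rule s)+
    have "\<not> totally_singular ?T X" "\<not> totally_singular ?T X1" using not_totally_singularI[OF m d(1) n(1)] not_totally_singularI[OF m d(2) n(2)] by simp_all
    then have "\<not> totally_singular ?T v" for v using 2(2)[OF nz] 12(2)[OF nz] by (cases v) simp_all
    moreover have "\<not> all_hdeg ?T" using trapezoidal_tH(4) unfolding all_hdeg_def by blast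
    ultimately show ?thesis using 2(1) unfolding kind_def by auto
  qed
  show "kind (hom (cellf (tH3 \<alpha> \<beta> \<delta> \<epsilon>))) = 2" if \<alpha>: "\<alpha> \<noteq> 0" "\<alpha>\<^sup>2 \<noteq> 1"
  proof -
    let ?T = "hom (cellf (tH3 \<alpha> \<beta> \<delta> \<epsilon>))"
    have k: "(\<alpha>\<^sup>2 - 1)\<^sup>2 \<noteq> 0" using \<alpha> by simp
    define c3 c0 where "c3 = - \<epsilon>\<^sup>2 * (\<alpha>\<^sup>2 - 1) / (\<beta> * \<alpha>)" and "c0 = - \<beta> * (\<alpha>\<^sup>2 - 1) * \<delta>\<^sup>2"
    have T: "?T = NF (0, -1, \<alpha>, 0) (0, \<alpha>, -1, 0) (c3, 0, 0, c0)" unfolding hom_tH3 c3_def c0_def ..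
    have h: "hyperdet ?T X12 X X1 ((pack ?o ?o ?o ?o)(X2 := (s, t))) = (\<alpha>\<^sup>2 - 1)\<^sup>2 * s\<^sup>2 * t\<^sup>2 + 0 * t ^ 4"
      "hyperdet ?T X2 X X1 ((pack ?o ?o ?o ?o)(X12 := (s, t))) = (\<alpha>\<^sup>2 - 1)\<^sup>2 * s\<^sup>2 * t\<^sup>2 + 0 * t ^ 4"
      "hyperdet ?T X1 X2 X12 ((pack ?o ?o ?o ?o)(X := (s, t))) = (\<alpha>\<^sup>2 - 1)\<^sup>2 * s\<^sup>2 * t\<^sup>2 + (- 4 * \<alpha> * c3 * c0) * t ^ 4"
      "hyperdet ?T X X2 X12 ((pack ?o ?o ?o ?o)(X1 := (s, t))) = (\<alpha>\<^sup>2 - 1)\<^sup>2 * s\<^sup>2 * t\<^sup>2 + (- 4 * \<alpha> * c3 * c0) * t ^ 4" for s t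
      unfolding pack_upd T hyperdet_NF by (simp_all add: algebra_simps power2_eq_square power4_eq_xxxx)
    have doubly_singular: "doubly_singular ?T v" for v
      using biquadratic_doubly_singular[OF m d(3) k h(1)] biquadratic_doubly_singular[OF m d(4) k h(2)] biquadratic_doubly_singular[OF m d(1) k h(3)]
        biquadratic_doubly_singular[OF m d(2) k h(4)] by (cases v) simp_all
    then have "\<not> totally_singular ?T v" for v by (simp add: doubly_singular_def)
    moreover have "\<not> all_hdeg ?T" using trapezoidal_tH(6)[OF \<alpha>(1)] unfolding all_hdeg_def by blast
    ultimately show ?thesis using doubly_singular unfolding kind_def by auto
  qed
qed

lemma kind_4:
  assumes T: "multilin T" "all_hdeg T" and K: "K \<noteq> 0 \<or> K1 \<noteq> 0 \<or> K2 \<noteq> 0 \<or> K12 \<noteq> 0"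
    and h: "\<And>s t. hyperdet T X1 X2 X12 (y(X := (s, t))) = K * t ^ 4" "\<And>s t. hyperdet T X X2 X12 (y(X1 := (s, t))) = K1 * t ^ 4"
      "\<And>s t. hyperdet T X12 X X1 (y(X2 := (s, t))) = K2 * t ^ 4" "\<And>s t. hyperdet T X2 X X1 (y(X12 := (s, t))) = K12 * t ^ 4"
  shows "kind T = 4"
proof -
  have d: "distinct [X, X1, X2, X12]" "distinct [X1, X, X2, X12]" "distinct [X2, X12, X, X1]" "distinct [X12, X2, X, X1]"
    by simp_all
  note q = quartic_not_doubly_singular[OF T(1) d(1) h(1)] quartic_not_doubly_singular[OF T(1) d(2) h(2)] quartic_not_doubly_singular[OF T(1) d(3) h(3)]
    quartic_not_doubly_singular[OF T(1) d(4) h(4)]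
  have "\<not> doubly_singular T v" for v using q by (cases v) simp_all
  moreover have "\<exists>v. \<not> totally_singular T v" using K q by blast
  ultimately show ?thesis using T(2) unfolding kind_def by auto
qed

lemma kind_6:
  assumes T: "multilin T" "all_hdeg T"
    and h: "\<And>s t. hyperdet T X1 X2 X12 (y(X := (s, t))) = 1 * s\<^sup>2 * t\<^sup>2 + K * t ^ 4"
      "\<And>s t. hyperdet T X X2 X12 (y(X1 := (s, t))) = 1 * s\<^sup>2 * t\<^sup>2 + 0 * t ^ 4"
      "\<And>s t. hyperdet T X12 X X1 (y(X2 := (s, t))) = 1 * s\<^sup>2 * t\<^sup>2 + 0 * t ^ 4"
      "\<And>s t. hyperdet T X2 X X1 (y(X12 := (s, t))) = 1 * s\<^sup>2 * t\<^sup>2 + 0 * t ^ 4"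
  shows "kind T = 6"
proof -
  have d: "distinct [X, X1, X2, X12]" "distinct [X1, X, X2, X12]" "distinct [X2, X12, X, X1]" "distinct [X12, X2, X, X1]"
    by simp_all
  have doubly_singular: "doubly_singular T v" for v
    using biquadratic_doubly_singular[OF T(1) d(1) one_neq_zero h(1)] biquadratic_doubly_singular[OF T(1) d(2) one_neq_zero h(2)]
      biquadratic_doubly_singular[OF T(1) d(3) one_neq_zero h(3)] biquadratic_doubly_singular[OF T(1) d(4) one_neq_zero h(4)] by (cases v) simp_all
  then have "\<not> totally_singular T v" for v by (simp add: doubly_singular_def)
  then show ?thesis using T(2) doubly_singular unfolding kind_def by auto
qed

lemma kind_H6:
  "kind (hom (cellf D1)) = 3" "kind (hom (cellf (D2_1 \<delta>1 \<delta>2))) = 4" "kind (hom (cellf (D2_2 \<delta>1 \<delta>2 lam))) = 4"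
  "kind (hom (cellf (D2_3 \<delta>1 \<delta>2 lam))) = 4" "kind (hom (cellf D3)) = 5" "kind (hom (cellf (D4_1 \<delta>1 \<delta>2 \<delta>3))) = 6"
  "kind (hom (cellf (D4_2 \<delta>1 \<delta>2 \<delta>3))) = 6"
proof -
  define y0 :: "vertex \<Rightarrow> hpoint" where "y0 = pack (0, 0) (0, 0) (0, 0) (0, 0)"
  have d: "distinct [X, X1, X2, X12]" "distinct [X1, X, X2, X12]" "distinct [X2, X12, X, X1]" "distinct [X12, X2, X, X1]"
    by simp_all
  note m = multilin_hom
  note ev = y0_def hyperdet_def discr_def tdet_def hom_def hlin_def cellf_pack rep_defs power2_eq_square power4_eq_xxxx
  have a: "all_hdeg (hom (cellf D1))" "all_hdeg (hom (cellf (D2_1 \<delta>1 \<delta>2)))" "all_hdeg (hom (cellf (D2_2 \<delta>1 \<delta>2 lam)))"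
    "all_hdeg (hom (cellf (D2_3 \<delta>1 \<delta>2 lam)))" "all_hdeg (hom (cellf D3))" "all_hdeg (hom (cellf (D4_1 \<delta>1 \<delta>2 \<delta>3)))"
    "all_hdeg (hom (cellf (D4_2 \<delta>1 \<delta>2 \<delta>3)))"
    by (simp_all add: all_hdeg_def all_hdeg_H6)
  show "kind (hom (cellf D1)) = 3"
  proof -
    let ?T = "hom (cellf D1)"
    have h: "hyperdet ?T X1 X2 X12 (y0(X := (s, t))) = 0" "hyperdet ?T X X2 X12 (y0(X1 := (s, t))) = 0"
      "hyperdet ?T X12 X X1 (y0(X2 := (s, t))) = 0" "hyperdet ?T X2 X X1 (y0(X12 := (s, t))) = 0" for s t
      by (simp_all add: ev algebra_simps)
    have "totally_singular ?T v" for v using totally_singularI[OF m d(1) h(1)] totally_singularI[OF m d(2) h(2)] totally_singularI[OF m d(3) h(3)] totally_singularI[OF m d(4) h(4)] by (cases v) simp_all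
    then show ?thesis using a unfolding kind_def by simp
  qed
  \<comment> \<open>For each \<open>D2\<close> equation one of the four quartics is exactly
    \<open>t^4\<close>, whatever the parameters.\<close>
  show "kind (hom (cellf (D2_1 \<delta>1 \<delta>2))) = 4"
    by (rule kind_4[OF m a(2), of "\<delta>1\<^sup>2" "(1 - \<delta>1 - \<delta>1 * \<delta>2)\<^sup>2" 1 0 y0]) (simp_all add: ev algebra_simps)
  show "kind (hom (cellf (D2_2 \<delta>1 \<delta>2 lam))) = 4"
    by (rule kind_4[OF m a(3), of "\<delta>1\<^sup>2" 0 1 "(1 - \<delta>1 - \<delta>1 * \<delta>2)\<^sup>2" y0]) (simp_all add: ev algebra_simps)
  show "kind (hom (cellf (D2_3 \<delta>1 \<delta>2 lam))) = 4"
    by (rule kind_4[OF m a(4), of "\<delta>1\<^sup>2" 0 "(1 - \<delta>1 - \<delta>1 * \<delta>2)\<^sup>2" 1 y0]) (simp_all add: ev algebra_simps)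
  show "kind (hom (cellf D3)) = 5"
  proof -
    let ?T = "hom (cellf D3)"
    \<comment> \<open>The quartic \<open>4 s t^3\<close> at \<open>X\<close> has the two roots 0 and
      infinity, the one at \<open>X1\<close> only infinity; this separates \<open>D3\<close> from
      the \<open>D2\<close> and the \<open>D4\<close> equations.\<close>
    have h: "hyperdet ?T X1 X2 X12 (y0(X := (s, t))) = 4 * s * t ^ 3" "hyperdet ?T X X2 X12 (y0(X1 := (s, t))) = 1 * t ^ 4" for s t
      by (simp_all add: ev power3_eq_cube algebra_simps)
    have s: "singular_at ?T X (s, t) \<longleftrightarrow> 4 * s * t ^ 3 = 0" for s t unfolding singular_at_iff[OF m d(1), where y = y0] h ..
    have "\<not> singular_at ?T X (1, 1)" unfolding s by simp
    then have "\<not> totally_singular ?T X" unfolding totally_singular_def by force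
    moreover have "singular_at ?T X (0, 1)" "singular_at ?T X (1, 0)" unfolding s by simp_all
    ultimately have "doubly_singular ?T X" unfolding doubly_singular_def by (intro conjI exI[of _ "(0, 1)"] exI[of _ "(1, 0)"]) simp_all
    moreover have "\<not> doubly_singular ?T X1" by (rule quartic_not_doubly_singular[OF m d(2) h(2)])
    ultimately show ?thesis using a \<open>\<not> totally_singular ?T X\<close> unfolding kind_def by auto
  qed
  show "kind (hom (cellf (D4_1 \<delta>1 \<delta>2 \<delta>3))) = 6"
    by (rule kind_6[OF m a(6), of y0 "4 * \<delta>1 * \<delta>2 * \<delta>3"]) (simp_all add: ev algebra_simps)
  show "kind (hom (cellf (D4_2 \<delta>1 \<delta>2 \<delta>3))) = 6"
    by (rule kind_6[OF m a(7), of y0 "4 * \<delta>1 * \<delta>2 * \<delta>3"]) (simp_all add: ev algebra_simps)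
qed

lemma equation_classes_kind:
  assumes "i < length equation_classes" "E \<in> equation_classes ! i"
  shows "multiaffine (cellf E) \<and> E = lift (pol (cellf E)) \<and> kind (hom (cellf E)) = i"
proof -
  have "i \<in> {0, 1, 2, 3, 4, 5, 6}" using assms(1) unfolding equation_classes_def by auto
  then consider "i = 0" | "i = 1" | "i = 2" | "i = 3" | "i = 4" | "i = 5" | "i = 6" by blast
  then show ?thesis
  proof cases
    case 1
    then obtain \<alpha> \<epsilon> where E: "E = tH1 \<alpha> \<epsilon>"
      using assms(2) unfolding equation_classes_def tH1_family_def by auto
    show ?thesis unfolding E 1 using multiaffine_cellf(1) lift_cellf(1) kind_trapezoidal(1) by blast
  next
    case 2
    then obtain \<alpha> \<beta> \<epsilon> where E: "E = tH2 \<alpha> \<beta> \<epsilon>" "cell_irreducible (tH2 \<alpha> \<beta> \<epsilon>)"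
      using assms(2) unfolding equation_classes_def tH2_family_def by auto
    show ?thesis unfolding E(1) 2
      using multiaffine_cellf(2) lift_cellf(2) kind_trapezoidal(2) trapezoidal_parameters(2)[OF E(2)] by blast
  next
    case 3
    then obtain \<alpha> \<beta> \<delta> \<epsilon> where E: "E = tH3 \<alpha> \<beta> \<delta> \<epsilon>" "cell_irreducible (tH3 \<alpha> \<beta> \<delta> \<epsilon>)" "\<alpha> \<noteq> 0"
      using assms(2) unfolding equation_classes_def tH3_family_def by auto
    show ?thesis unfolding E(1) 3
      using multiaffine_cellf(3) lift_cellf(3) kind_trapezoidal(3) trapezoidal_parameters(3)[OF E(2)] E(3) by blast
  next
    case 4
    then have E: "E = D1" using assms(2) unfolding equation_classes_def by simp
    show ?thesis unfolding E 4 using multiaffine_cellf(4) lift_cellf(4) kind_H6(1) by blast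
  next
    case 5
    then consider \<delta>1 \<delta>2 where "E = D2_1 \<delta>1 \<delta>2" | \<delta>1 \<delta>2 lam where "E = D2_2 \<delta>1 \<delta>2 lam" | \<delta>1 \<delta>2 lam where "E = D2_3 \<delta>1 \<delta>2 lam"
      using assms(2) unfolding equation_classes_def D2_1_family_def D2_2_family_def D2_3_family_def by auto
    then show ?thesis
      unfolding 5 by cases (simp_all add: multiaffine_cellf lift_cellf[symmetric] kind_H6)
  next
    case 6
    then have E: "E = D3" using assms(2) unfolding equation_classes_def by simp
    show ?thesis unfolding E 6 using multiaffine_cellf(8) lift_cellf(8) kind_H6(5) by blast
  next
    case 7
    then consider \<delta>1 \<delta>2 \<delta>3 where "E = D4_1 \<delta>1 \<delta>2 \<delta>3" | \<delta>1 \<delta>2 \<delta>3 where "E = D4_2 \<delta>1 \<delta>2 \<delta>3"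
      using assms(2) unfolding equation_classes_def D4_1_family_def D4_2_family_def by auto
    then show ?thesis
      unfolding 7 by cases (simp_all add: multiaffine_cellf lift_cellf[symmetric] kind_H6)
  qed
qed

theorem equation_classes_inequivalent:
  assumes "i < length equation_classes" "j < length equation_classes" "i \<noteq> j"
  shows "inequivalent (equation_classes ! i) (equation_classes ! j)"
  unfolding inequivalent_def
proof (intro ballI notI)
  fix E E' assume E: "E \<in> equation_classes ! i" "E' \<in> equation_classes ! j" and e: "lattice_equivalent E E'"
  note 1 = equation_classes_kind[OF assms(1) E(1)] and 2 = equation_classes_kind[OF assms(2) E(2)]
  have "lattice_equivalent (lift (pol (cellf E))) (lift (pol (cellf E')))" using e 1 2 by simp
  then have "geqv (hom (cellf E)) (hom (cellf E'))" using lattice_equivalent_geqv 1 2 by blast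
  then show False using kind_geqv[OF multilin_hom] 1 2 assms(3) by simp
qed

theorem theorem3:
  "(\<forall>Q. quad_equation Q \<and> consistent Q \<and> \<not> type_Q Q \<and> \<not> rhombic_H4 Q \<longrightarrow>
      trapezoidal_H4 Q \<and> (\<exists>E\<in>trapezoidal_list. lattice_equivalent (lift Q) E) \<or>
      type_H6 Q \<and> (\<exists>E\<in>H6_list \<union> {D1}. lattice_equivalent (lift Q) E))
   \<and> (\<forall>E\<in>trapezoidal_list. \<exists>Q. quad_equation Q \<and> consistent Q \<and> trapezoidal_H4 Q \<and>
        same_equation (lift Q) E)
   \<and> (\<forall>E\<in>H6_list \<union> {D1}. \<exists>Q. quad_equation Q \<and> consistent Q \<and> type_H6 Q \<and>
        same_equation (lift Q) E)
   \<and> (\<forall>i<length equation_classes. \<forall>j<length equation_classes. i \<noteq> j \<longrightarrow>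
        inequivalent (equation_classes ! i) (equation_classes ! j))"
proof (intro conjI)
  show "\<forall>Q. quad_equation Q \<and> consistent Q \<and> \<not> type_Q Q \<and> \<not> rhombic_H4 Q \<longrightarrow>
      trapezoidal_H4 Q \<and> (\<exists>E\<in>trapezoidal_list. lattice_equivalent (lift Q) E) \<or>
      type_H6 Q \<and> (\<exists>E\<in>H6_list \<union> {D1}. lattice_equivalent (lift Q) E)"
    by (intro allI impI, elim conjE) (rule classification)
  show "\<forall>E\<in>trapezoidal_list. \<exists>Q. quad_equation Q \<and> consistent Q \<and> trapezoidal_H4 Q \<and> same_equation (lift Q) E"
    by (intro ballI) (rule trapezoidal_list_consistent)
  show "\<forall>E\<in>H6_list \<union> {D1}. \<exists>Q. quad_equation Q \<and> consistent Q \<and> type_H6 Q \<and> same_equation (lift Q) E"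
    by (intro ballI) (rule H6_list_consistent)
  show "\<forall>i<length equation_classes. \<forall>j<length equation_classes. i \<noteq> j \<longrightarrow>
      inequivalent (equation_classes ! i) (equation_classes ! j)"
    by (intro allI impI) (rule equation_classes_inequivalent)
qed

end
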